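(* Let $V$, $f$, $u_0$, $u_1$ satisfy the assumptions (A0)–(A3) listed in the context. Then the initial value problem $$\begin{cases} V(x)u_{tt}(x,t)-u_{xx}(x,t)=0, & x\in[0,\infty),\ t\in[0,\infty),\\ u_x(0,t)=(f(u_t(0,t)))_t, & t\in[0,\infty),\\ u(x,0)=u_0(x),\quad u_t(x,0)=u_1(x), & x\in[0,\infty)\end{cases}$$ has exactly one global $C^1$-solution $u:[0,\infty)\times[0,\infty)\to\mathbb{R}$. Moreover, the problem is wellposed on every finite time interval $[0,T]$, $T>0$, in the following sense: if $u_0^{(n)}\in C^1([0,\infty))$, $u_1^{(n)}\in C([0,\infty))$ ($n\in\mathbb{N}$) are such that $u_0^{(n)}\to u_0$, $(u_0^{(n)})'\to u_0'$ and $u_1^{(n)}\to u_1$ uniformly on compact subsets of $[0,\infty)$, and $u^{(n)}$, $u$ denote the global $C^1$-solutions with initial data $(u_0^{(n)},u_1^{(n)})$ and $(u_0,u_1)$ respectively, then for every $T>0$ one has $u^{(n)}\to u$, $u^{(n)}_t\to u_t$ and $u^{(n)}_x\to u_x$ uniformly on compact subsets of $[0,\infty)\times[0,T]$.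
   Context: All functions are real-valued. For a closed interval $I\subseteq\mathbb{R}$, a function $\phi:I\to\mathbb{R}$ is piecewise $C^k$, written $\phi\in PC^k(I)$, if there is a discrete set $D\subseteq I$ with $\phi\in C^k(I\setminus D)$ such that the one-sided limits $\phi^{(j)}(x-)$, $\phi^{(j)}(x+)$ exist for all $x\in D$, $0\le j\le k$ (they need not coincide); if $I$ is bounded from below (above), also $\phi^{(j)}(\min I+)$ (resp. $\phi^{(j)}(\max I-)$) is required to exist for $0\le j\le k$. $D(\phi)$ denotes the set of discontinuities of $\phi$. Assumptions: (A0) $u_0\in C^1([0,\infty))$, $u_1\in C([0,\infty))$. (A1) $V\in PC^1([0,\infty))$, $V,V'\in L^\infty$, $\inf V>0$. (A2) $\inf\{|d_1-d_2| : d_1,d_2\in D(V)\cup\{0\},\ d_1\neq d_2\}>0$. (A3) $f:\mathbb{R}\to\mathbb{R}$ is an increasing homeomorphism. Put $c(x)=1/\sqrt{V(x)}$. A global $C^1$-solution with initial data $(u_0,u_1)$ is a function $u\in C^1([0,\infty)\times[0,\infty))$ such that: (i) for all $(x,t)\in[0,\infty)^2$ with $x\notin D(c)\cup D(c')$, the directional derivative $(\partial_t-c(x)\partial_x)(u_t+c(x)u_x)(x,t)$ exists and equals $-c(x)c'(x)u_x(x,t)$ (at boundary points of the domain the directional derivative is taken one-sidedly, along the part of the line lying in the domain); (ii) $t\mapsto f(u_t(0,t))$ is differentiable with $(f(u_t(0,t)))_t=u_x(0,t)$ for all $t\ge0$; (iii) $u(x,0)=u_0(x)$ and $u_t(x,0)=u_1(x)$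 for all $x\ge0$.
   Formalization: In (i), the directional derivative along ∂_t − c(x)∂_x is taken along the characteristic curve X' = −c(X) through (x,t), not along its straight tangent line; with the straight line, solutions can fail to exist for non-constant c. *)

theory Defs
  imports "HOL-Analysis.Analysis"
begin

text \<open>Derivatives are taken relative to a set \<open>S\<close>, hence one-sidedly at its boundary points.\<close>

definition deriv_on :: "real set \<Rightarrow> (real \<Rightarrow> real) \<Rightarrow> real \<Rightarrow> real" where
  "deriv_on S g x = vector_derivative g (at x within S)"

definition C_k :: "nat \<Rightarrow> real set \<Rightarrow> (real \<Rightarrow> real) \<Rightarrow> bool" where
  "C_k k S g \<longleftrightarrow>
     (\<forall>j\<le>k. continuous_on S ((deriv_on S ^^ j) g)) \<and>
     (\<forall>j<k. \<forall>x\<in>S. (deriv_on S ^^ j) g differentiable (at x within S))"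

text \<open>
  Limits are taken along \<open>I - D\<close>, where the derivatives are defined. If an end point of \<open>I\<close>
  belongs to \<open>D\<close>, the one-sided limit pointing out of \<open>I\<close> is along the trivial filter, so that
  nothing is required of it.
\<close>

definition PC :: "nat \<Rightarrow> real set \<Rightarrow> (real \<Rightarrow> real) \<Rightarrow> bool" where
  "PC k I g \<longleftrightarrow> (\<exists>D\<subseteq>I. discrete D \<and> C_k k (I - D) g \<and>
     (\<forall>j\<le>k.
        (\<forall>x\<in>D.
           (\<exists>l. ((deriv_on (I - D) ^^ j) g \<longlongrightarrow> l) (at x within (I - D) \<inter> {..<x})) \<and>
           (\<exists>l. ((deriv_on (I - D) ^^ j) g \<longlongrightarrow> l) (at x within (I - D) \<inter> {x<..}))) \<and>
        (bdd_below I \<longrightarrow>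
           (\<exists>l. ((deriv_on (I - D) ^^ j) g \<longlongrightarrow> l) (at (Inf I) within (I - D) \<inter> {Inf I<..}))) \<and>
        (bdd_above I \<longrightarrow>
           (\<exists>l. ((deriv_on (I - D) ^^ j) g \<longlongrightarrow> l) (at (Sup I) within (I - D) \<inter> {..<Sup I})))))"

definition disc :: "real set \<Rightarrow> (real \<Rightarrow> real) \<Rightarrow> real set" where
  "disc I g = {x\<in>I. \<not> continuous (at x within I) g}"

text \<open>
  The set of discontinuities of the derivative. The derivative is a function on the set of points
  of differentiability only; points where it does not exist (jumps and kinks) count as
  discontinuities.
\<close>

definition disc_deriv :: "real set \<Rightarrow> (real \<Rightarrow> real) \<Rightarrow> real set" where
  "disc_deriv I g = {x\<in>I. \<not> (g differentiable (at x within I) \<and>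
     continuous (at x within {y\<in>I. g differentiable (at y within I)}) (deriv_on I g))}"

definition L_inf :: "real set \<Rightarrow> (real \<Rightarrow> real) \<Rightarrow> bool" where
  "L_inf I g \<longleftrightarrow> g \<in> borel_measurable (lebesgue_on I) \<and>
     (\<exists>M. AE x in lebesgue_on I. \<bar>g x\<bar> \<le> M)"

text \<open>Infima are taken in the extended reals: \<open>disc {0..} V \<union> {0}\<close> may be just \<open>{0}\<close>, and then
  the infimum in the fourth condition is that of the empty set, \<open>\<infinity>\<close>.\<close>

definition admissible_potential :: "(real \<Rightarrow> real) \<Rightarrow> bool" where
  "admissible_potential V \<longleftrightarrow>
     PC 1 {0..} V \<and>
     L_inf {0..} V \<and> L_inf {0..} (deriv_on {0..} V) \<and>
     (INF x\<in>{0..}. ereal (V x)) > 0 \<and>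
     Inf {ereal \<bar>d1 - d2\<bar> | d1 d2. d1 \<in> disc {0..} V \<union> {0} \<and> d2 \<in> disc {0..} V \<union> {0} \<and> d1 \<noteq> d2} > 0"

definition increasing_homeomorphism :: "(real \<Rightarrow> real) \<Rightarrow> bool" where
  "increasing_homeomorphism f \<longleftrightarrow> strict_mono f \<and> (\<exists>g. homeomorphism UNIV UNIV f g)"

definition speed :: "(real \<Rightarrow> real) \<Rightarrow> real \<Rightarrow> real" where
  "speed V x = 1 / sqrt (V x)"

abbreviation quadrant :: "(real \<times> real) set" where
  "quadrant \<equiv> {0..} \<times> {0..}"

definition dx :: "(real \<times> real \<Rightarrow> real) \<Rightarrow> real \<times> real \<Rightarrow> real" where
  "dx u p = deriv_on {0..} (\<lambda>x. u (x, snd p)) (fst p)"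

definition dt :: "(real \<times> real \<Rightarrow> real) \<Rightarrow> real \<times> real \<Rightarrow> real" where
  "dt u p = deriv_on {0..} (\<lambda>t. u (fst p, t)) (snd p)"

definition C1_quadrant :: "(real \<times> real \<Rightarrow> real) \<Rightarrow> bool" where
  "C1_quadrant u \<longleftrightarrow>
     (\<forall>x\<ge>0. \<forall>t\<ge>0. (\<lambda>y. u (y, t)) differentiable (at x within {0..}) \<and>
                    (\<lambda>s. u (x, s)) differentiable (at t within {0..})) \<and>
     continuous_on quadrant u \<and> continuous_on quadrant (dx u) \<and> continuous_on quadrant (dt u)"

text \<open>
  \<open>has_char_derivative c w L (x, t)\<close>: at \<open>(x, t)\<close> the function \<open>w\<close> has derivative \<open>L\<close> in the
  direction of the vector field \<open>\<partial>\<^sub>t - c(x) \<partial>\<^sub>x\<close>, i.e. along its integral curve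
  \<open>s \<mapsto> (X s, t + s)\<close>, \<open>X' = - c(X)\<close>, \<open>X 0 = x\<close> (the characteristic line through \<open>(x, t)\<close>).
  The set \<open>J\<close> is a neighbourhood of \<open>0\<close> in the set of parameters for which the curve stays in the
  closed quadrant: the derivative is forward if \<open>t = 0\<close>, backward if \<open>x = 0\<close>, and there is no
  condition at the corner \<open>(0, 0)\<close>, where \<open>J = {0}\<close>.

  For differentiable \<open>w\<close> this is the derivative along the tangent line. For \<open>w\<close> that are merely
  continuous, such as \<open>w = u\<^sub>t + c u\<^sub>x\<close> with \<open>u\<close> of class \<open>C\<^sup>1\<close>, the derivative along the tangent
  line need not exist when the characteristic is curved: if \<open>w\<close> is a function \<open>F(t + k(x))\<close> of the
  characteristic alone, where \<open>k' = 1/c\<close>, the tangent line leaves the characteristic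
  quadratically, and \<open>F(z + a s\<^sup>2) - F(z)\<close> with \<open>a \<noteq> 0\<close> is not \<open>O(s)\<close> in general.
\<close>

definition has_char_derivative ::
    "(real \<Rightarrow> real) \<Rightarrow> (real \<times> real \<Rightarrow> real) \<Rightarrow> real \<Rightarrow> real \<times> real \<Rightarrow> bool" where
  "has_char_derivative c w L p \<longleftrightarrow> (case p of (x, t) \<Rightarrow>
     \<exists>X \<epsilon>. \<epsilon> > 0 \<and> X 0 = x \<and>
       (let J = {s. \<bar>s\<bar> < \<epsilon> \<and> 0 \<le> t + s \<and> (x = 0 \<longrightarrow> s \<le> 0)} in
          (\<forall>s\<in>J. 0 \<le> X s \<and> (X has_real_derivative - c (X s)) (at s within J)) \<and>
          ((\<lambda>s. w (X s, t + s)) has_real_derivative L) (at 0 within J)))"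

definition global_C1_solution ::
    "(real \<Rightarrow> real) \<Rightarrow> (real \<Rightarrow> real) \<Rightarrow> (real \<Rightarrow> real) \<Rightarrow> (real \<Rightarrow> real) \<Rightarrow>
     (real \<times> real \<Rightarrow> real) \<Rightarrow> bool" where
  "global_C1_solution V f u0 u1 u \<longleftrightarrow>
     C1_quadrant u \<and>
     (\<forall>x\<ge>0. \<forall>t\<ge>0. x \<notin> disc {0..} (speed V) \<union> disc_deriv {0..} (speed V) \<longrightarrow>
        has_char_derivative (speed V) (\<lambda>p. dt u p + speed V (fst p) * dx u p)
          (- speed V x * deriv_on {0..} (speed V) x * dx u (x, t)) (x, t)) \<and>
     (\<forall>t\<ge>0. ((\<lambda>s. f (dt u (0, s))) has_real_derivative dx u (0, t)) (at t within {0..})) \<and>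
     (\<forall>x\<ge>0. u (x, 0) = u0 x \<and> dt u (x, 0) = u1 x)"

definition loc_uniform_limit ::
    "'a::topological_space set \<Rightarrow> (nat \<Rightarrow> 'a \<Rightarrow> real) \<Rightarrow> ('a \<Rightarrow> real) \<Rightarrow> bool" where
  "loc_uniform_limit S F G \<longleftrightarrow>
     (\<forall>K. compact K \<and> K \<subseteq> S \<longrightarrow> uniform_limit K F G sequentially)"

end

theory Submission
  imports Defs
begin

text \<open>
  In the coordinate \<open>y\<close> given by the travel time \<open>\<integral>\<surd>V\<close> the characteristics are straight lines, and the speed \<open>c\<close> becomes
  a function whose increments are integrals of a bounded density \<open>J\<close> with respect to Lebesgue measure plus a
  unit mass at each jump. Integrating \<open>u\<^sub>t \<plusminus> c u\<^sub>x\<close> along the characteristics yields, for \<open>r = u\<^sub>x - u\<^sub>0'\<close>, a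
  linear equation with the memory kernels \<open>K1\<close> and \<open>K2\<close> and with the trace of \<open>u\<^sub>t\<close> on the boundary as a forcing term. A
  reflection at a jump acts without delay, but \<open>c > 0\<close> makes it strictly smaller than the term it is
  compared with, and the equation is a contraction for a norm with a weight that is reduced at the atoms. After
  integration in time the boundary condition reads \<open>E' = g (\<psi> - E / c 0)\<close> for \<open>E t = u (0, t) - u (0, 0)\<close>, with
  \<open>g\<close> the inverse of \<open>f\<close>; as \<open>g\<close> is increasing, \<open>E\<close> depends on \<open>\<psi>\<close> in a Lipschitz way although \<open>g\<close> need not be
  Lipschitz. Uniqueness is continuous dependence for a constant sequence of data.
\<close>

section \<open>Monotone ordinary differential equations\<close>

text \<open>Condition (i) controls only the invariant carried by the characteristics that run
  towards the boundary, and \<open>u\<close> is merely C^1. The invariant of the opposite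
  characteristics has to be recovered from the compatibility of \<open>u\<^sub>x\<close> and
  \<open>u\<^sub>t\<close>: in the coordinate \<open>y\<close>, the time integral of
  \<open>u\<^sub>t\<close> has the space derivative \<open>c * r\<close>. Conversely, this
  compatibility is what makes a pair of mild fields the gradient of one function. The trace of
  \<open>u\<^sub>t\<close> need not depend on \<open>r\<close> in a Lipschitz way, so the
  contraction is run for the time integral of \<open>r\<close>, whose equation contains the trace
  only through \<open>E\<close>; \<open>r\<close> is then regained from the linear equation in which
  the trace is known. Stability has the same two levels: a Lipschitz estimate for integrated
  quantities, then the boundary condition and uniform continuity of \<open>g\<close> on a bounded
  interval, then the linear estimate for \<open>r\<close> itself. Subtracting
  \<open>u\<^sub>0'\<close> makes the unknown vanish at time 0, so that it can be continued by 0 to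
  negative times and differentiated or integrated across \<open>t = 0\<close>.\<close>

lemma increment_bound_off_countable:
  fixes f :: "real \<Rightarrow> real"
  assumes "a \<le> b" and cont: "continuous_on {a..b} f" and S: "countable S"
    and der: "\<And>x. a < x \<Longrightarrow> x < b \<Longrightarrow> x \<notin> S \<Longrightarrow>
      \<exists>d. (f has_real_derivative d) (at x) \<and> d \<le> M"
  shows "f b - f a \<le> M * (b - a)"
proof (cases "a = b")
  case True then show ?thesis by simp
next
  case False
  then have ab: "a < b" using assms(1) by simp
  \<comment> \<open>Exceptional points are crossed with the help of an increasing jump function
    \<open>sg\<close>, which never exceeds 2 and jumps by at least \<open>(1/2) ^ n\<close> at the
    point with number \<open>n\<close>. The slack \<open>e * sg\<close> absorbs the countable set;
    the slack \<open>e * (x - a')\<close> turns the bound on the derivative into a strict one.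
    Starting at \<open>a' > a\<close> leaves only interior points, at which a derivative is at
    hand.\<close>
  have main: "f b - f a' \<le> M * (b - a') + e * (b - a' + 2)" if e: "e > 0" and a': "a < a'" "a' < b" for e a'
  proof -
    obtain en :: "real \<Rightarrow> nat" where en: "inj_on en S"
      using S by (auto simp: countable_def)
    define W where "W x = en ` {s\<in>S. s < x}" for x
    define sg where "sg x = (\<Sum>n. indicator (W x) n * (1/2::real) ^ n)" for x
    have geo: "summable (\<lambda>n. (1/2::real)^n)" by (simp add: summable_geometric)
    have summ: "summable (\<lambda>n. indicator (W x) n * (1/2::real) ^ n)" for x
      by (rule summable_comparison_test'[OF geo, of 0]) (auto simp: indicator_def)
    have sg_le2: "sg x \<le> 2" for x
    proof -
      have "sg x \<le> (\<Sum>n. (1/2::real) ^ n)" unfolding sg_def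
        by (intro suminf_le summ geo) (auto simp: indicator_def)
      also have "\<dots> = 2" by (simp add: suminf_geometric)
      finally show ?thesis .
    qed
    have sg0: "sg x \<ge> 0" for x unfolding sg_def by (intro suminf_nonneg summ) auto
    have sgmono: "sg x \<le> sg y" if "x \<le> y" for x y unfolding sg_def
      by (intro suminf_le summ) (use that in \<open>auto simp: indicator_def W_def\<close>)
    have sgjump: "sg x + (1/2)^en x \<le> sg y" if xy: "x < y" "x \<in> S" for x y
    proof -
      have "(\<lambda>n. if n = en x then (1/2::real)^n else 0) sums (1/2)^en x"
        using sums_single[of "en x" "\<lambda>n. (1/2::real)^n"] by simp
      from sums_add[OF summable_sums[OF summ[of x]] this]
      have *: "(\<lambda>n. indicator (W x) n * (1/2::real) ^ n + (if n = en x then (1/2::real)^n else 0)) sums (sg x + (1/2)^en x)"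
        unfolding sg_def .
      have "en x \<notin> W x" using en xy unfolding W_def inj_on_def by blast
      moreover have "en x \<in> W y" using xy unfolding W_def by blast
      moreover have "W x \<subseteq> W y" using xy unfolding W_def by fastforce
      ultimately have "(\<Sum>n. indicator (W x) n * (1/2::real) ^ n + (if n = en x then (1/2::real)^n else 0)) \<le> sg y"
        unfolding sg_def
        by (intro suminf_le summ sums_summable[OF *]) (auto simp: indicator_def)
      then show ?thesis using sums_unique[OF *] by simp
    qed
    define P where "P x \<longleftrightarrow> f x - f a' \<le> M * (x - a') + e * (x - a' + sg x)" for x
    define T where "T = {x \<in> {a'..b}. \<forall>y\<in>{a'..x}. P y}"
    define X where "X = Sup T"
    have aT: "a' \<in> T" unfolding T_def P_def using a' e sg0 by (auto simp: order.strict_implies_order)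
    have bdd: "bdd_above T" unfolding T_def by (auto intro: bdd_aboveI[of _ b])
    have X1: "a' \<le> X" unfolding X_def by (rule cSup_upper[OF aT bdd])
    have X2: "X \<le> b" unfolding X_def
    proof (rule cSup_least)
      show "T \<noteq> {}" using aT by blast
      show "x \<le> b" if "x \<in> T" for x using that unfolding T_def by simp
    qed
    note X = X1 X2
    have below: "P y" if y: "a' \<le> y" "y < X" for y
    proof -
      obtain x where "x \<in> T" "y < x" using y(2) less_cSup_iff[OF _ bdd, of y] aT unfolding X_def by blast
      then show ?thesis using y unfolding T_def by auto
    qed
    \<comment> \<open>Below \<open>X\<close> the value \<open>sg x\<close> is replaced by the
      constant \<open>sg X\<close>, so that passing to the limit needs nothing but the continuity of
      \<open>f\<close>.\<close>
    have PX: "P X"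
    proof (cases "X = a'")
      case True then show ?thesis using aT unfolding T_def by auto
    next
      case False
      then have "a' < X" using X by simp
      have "((\<lambda>x. f x - f a' - M * (x - a') - e * (x - a' + sg X)) \<longlongrightarrow> f X - f a' - M * (X - a') - e * (X - a' + sg X)) (at_left X)"
      proof -
        have "continuous_on {a'..X} f" using cont by (rule continuous_on_subset) (use X a' in auto)
        then have "(f \<longlongrightarrow> f X) (at X within {a'..X})" using X by (auto simp: continuous_on_def)
        then have "(f \<longlongrightarrow> f X) (at_left X)" by (simp add: at_within_Icc_at_left[OF \<open>a' < X\<close>])
        then show ?thesis by (intro tendsto_intros)
      qed
      moreover have "eventually (\<lambda>x. f x - f a' - M * (x - a') - e * (x - a' + sg X) \<le> 0) (at_left X)"
        using eventually_at_left_real[OF \<open>a' < X\<close>]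
      proof eventually_elim
        case (elim x)
        then have "P x" using below by auto
        moreover have "e * sg x \<le> e * sg X" using elim sgmono e by auto
        ultimately show ?case unfolding P_def by (simp add: algebra_simps)
      qed
      ultimately have "f X - f a' - M * (X - a') - e * (X - a' + sg X) \<le> 0"
        by (intro tendsto_upperbound) auto
      then show ?thesis unfolding P_def by simp
    qed
    have "X = b"
    proof (rule ccontr)
      assume "X \<noteq> b"
      then have Xb: "X < b" using X by simp
      have aX: "a < X" using X a' by simp
      \<comment> \<open>Just beyond \<open>X\<close>: at an exceptional point \<open>f\<close> is
        merely continuous, but \<open>sg\<close> has gained \<open>(1/2) ^ en X\<close>; at any
        other point the difference quotient stays below \<open>M + e\<close>.\<close>
      have "\<exists>d>0. \<forall>x. X < x \<and> x < X + d \<and> x < b \<longrightarrow> P x"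
      proof (cases "X \<in> S")
        case True
        have "isCont f X" using cont aX Xb by (intro continuous_on_interior) auto
        then have 1: "((\<lambda>x. f x - f X - M * (x - X)) \<longlongrightarrow> f X - f X - M * (X - X)) (at X)"
          by (intro tendsto_intros) (auto simp: isCont_def)
        moreover have "0 < e * (1/2)^en X" using e by simp
        ultimately have "eventually (\<lambda>x. f x - f X - M * (x - X) < e * (1/2)^en X) (at X)"
          using order_tendstoD(2)[OF 1, of "e * (1/2)^en X"] by simp
        then obtain d where d: "d > 0" "\<And>x. x \<noteq> X \<Longrightarrow> dist x X < d \<Longrightarrow> f x - f X - M * (x - X) < e * (1/2)^en X"
          unfolding eventually_at by auto
        have "P x" if "X < x" "x < X + d" for x
        proof -
          have "f x - f X - M * (x - X) < e * (1/2)^en X" using d(2)[of x] that by (simp add: dist_real_def)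
          moreover have "e * (sg X + (1/2)^en X) \<le> e * sg x" using sgjump[OF that(1) True] e by simp
          moreover have "0 \<le> e * (x - X)" using e that by simp
          ultimately show ?thesis using PX unfolding P_def by (simp add: algebra_simps)
        qed
        then show ?thesis using d(1) by blast
      next
        case False
        obtain D where D: "(f has_real_derivative D) (at X)" "D \<le> M" using der[OF aX Xb False] by auto
        have "((\<lambda>x. (f x - f X) / (x - X)) \<longlongrightarrow> D) (at X)"
          using D(1) has_field_derivative_iff by blast
        then have "eventually (\<lambda>x. (f x - f X) / (x - X) < M + e) (at X)"
          by (rule order_tendstoD(2)) (use D e in simp)
        then obtain d where d: "d > 0" "\<And>x. x \<noteq> X \<Longrightarrow> dist x X < d \<Longrightarrow> (f x - f X) / (x - X) < M + e"
          unfolding eventually_at by auto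
        have "P x" if "X < x" "x < X + d" for x
        proof -
          have "(f x - f X) / (x - X) < M + e" using d(2)[of x] that by (simp add: dist_real_def)
          then have "f x - f X < (M + e) * (x - X)" using that by (simp add: field_simps)
          moreover have "e * sg X \<le> e * sg x" using sgmono[of X x] that e by simp
          ultimately show ?thesis using PX unfolding P_def by (simp add: algebra_simps)
        qed
        then show ?thesis using d(1) by blast
      qed
      then obtain d where d: "d > 0" "\<And>x. X < x \<Longrightarrow> x < X + d \<Longrightarrow> x < b \<Longrightarrow> P x" by blast
      define x where "x = min (X + d/2) ((X+b)/2)"
      have x: "X < x" "x < X + d" "x < b" using d Xb by (auto simp: x_def min_def)
      have "x \<in> T" unfolding T_def
      proof (clarsimp, intro conjI ballI)
        show "a' \<le> x" "x \<le> b" using x X by auto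
        fix y assume "y \<in> {a'..x}"
        then show "P y" using below[of y] PX d(2)[of y] x by (cases y X rule: linorder_cases) auto
      qed
      then have "x \<le> X" unfolding X_def using bdd by (simp add: cSup_upper)
      then show False using x by simp
    qed
    then have "f b - f a' \<le> M * (b - a') + e * (b - a' + sg b)" using PX unfolding P_def by simp
    also have "e * (b - a' + sg b) \<le> e * (b - a' + 2)" using sg_le2 e by simp
    finally show ?thesis by simp
  qed
  have step: "f b - f a' \<le> M * (b - a')" if a': "a < a'" "a' < b" for a'
  proof (rule field_le_epsilon)
    fix e :: real assume "e > 0"
    moreover have p: "b - a' + 2 > 0" using a' by simp
    moreover have "e / (b - a' + 2) * (b - a' + 2) = e" using p by simp
    ultimately show "f b - f a' \<le> M * (b - a') + e"
      using main[of "e / (b - a' + 2)" a'] a' by simp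
  qed
  have "((\<lambda>x. f b - f x - M * (b - x)) \<longlongrightarrow> f b - f a - M * (b - a)) (at_right a)"
  proof -
    have "(f \<longlongrightarrow> f a) (at a within {a..b})" using cont ab by (auto simp: continuous_on_def)
    then have "(f \<longlongrightarrow> f a) (at_right a)" by (simp add: at_within_Icc_at_right[OF ab])
    then show ?thesis by (intro tendsto_intros)
  qed
  moreover have "eventually (\<lambda>x. f b - f x - M * (b - x) \<le> 0) (at_right a)"
    using eventually_at_right_real[OF ab] by eventually_elim (use step in fastforce)
  ultimately have "f b - f a - M * (b - a) \<le> 0" by (intro tendsto_upperbound) auto
  then show ?thesis by simp
qed

text \<open>Meant for functions along characteristics, which meet jumps and kinks of the speed in a
  countable set of points; continuity is all that is known there.\<close>

lemma constant_off_countable: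
  fixes f :: "real \<Rightarrow> real"
  assumes "a \<le> b" "continuous_on {a..b} f" "countable S"
    and "\<And>x. a < x \<Longrightarrow> x < b \<Longrightarrow> x \<notin> S \<Longrightarrow> (f has_real_derivative 0) (at x)"
  shows "f b = f a"
proof -
  have "f b - f a \<le> 0 * (b - a)"
    by (rule increment_bound_off_countable[OF assms(1-3)]) (meson assms(4) order_refl)
  moreover have "- f b - - f a \<le> 0 * (b - a)"
    by (rule increment_bound_off_countable[where f = "\<lambda>x. - f x", OF assms(1) continuous_on_minus[OF assms(2)] assms(3)])
       (metis DERIV_minus assms(4) minus_zero order_refl)
  ultimately show ?thesis by simp
qed

text \<open>Once the difference exceeds \<open>k * D\<close>, the argument of \<open>g\<close>
  belonging to \<open>E1\<close> lies below the one belonging to \<open>E2\<close>, and monotonicity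
  forbids a further increase. The bound therefore involves neither a modulus of continuity of
  \<open>g\<close> nor the length of the time interval.\<close>

lemma ode_comparison:
  fixes g \<phi>1 \<phi>2 E1 E2 :: "real \<Rightarrow> real"
  assumes g: "mono g" and k: "k > 0" and t: "t \<in> {0..T}"
    and E1: "\<And>t. t \<in> {0..T} \<Longrightarrow> (E1 has_real_derivative g (\<phi>1 t - E1 t / k)) (at t within {0..T})"
    and E2: "\<And>t. t \<in> {0..T} \<Longrightarrow> (E2 has_real_derivative g (\<phi>2 t - E2 t / k)) (at t within {0..T})"
    and init: "E1 0 = E2 0"
    and D: "\<And>t. t \<in> {0..T} \<Longrightarrow> \<phi>1 t - \<phi>2 t \<le> D" and D0: "D \<ge> 0"
  shows "E1 t - E2 t \<le> k * D"
proof (rule ccontr)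
  define e where "e t = E1 t - E2 t" for t
  assume "\<not> E1 t - E2 t \<le> k * D"
  then have et: "e t > k * D" by (simp add: e_def)
  have e': "(e has_real_derivative g (\<phi>1 s - E1 s / k) - g (\<phi>2 s - E2 s / k)) (at s within {0..T})"
    if "s \<in> {0..T}" for s
    using DERIV_diff[OF E1[OF that] E2[OF that]] unfolding e_def[abs_def] .
  have ce: "continuous_on {0..T} e" by (rule DERIV_continuous_on[OF e'])
  have e0: "e 0 = 0" using init by (simp add: e_def)
  define S where "S = {s \<in> {0..t}. e s \<le> k * D}"
  have "closed S" unfolding S_def
    by (rule continuous_on_closed_Collect_le[OF continuous_on_subset[OF ce] continuous_on_const])
       (use t in auto)
  define t0 where "t0 = Sup S"
  have S0: "0 \<in> S" unfolding S_def using e0 k D0 t by auto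
  have bdd: "bdd_above S" unfolding S_def by (auto intro: bdd_aboveI[of _ t])
  have t0S: "t0 \<in> S" unfolding t0_def using closed_contains_Sup[OF _ bdd \<open>closed S\<close>] S0 by auto
  then have t0: "0 \<le> t0" "t0 < t" "e t0 \<le> k * D" using et unfolding S_def by (auto simp: less_le)
  have above: "e s > k * D" if "t0 < s" "s \<le> t" for s
  proof (rule ccontr)
    assume "\<not> e s > k * D"
    then have "s \<in> S" unfolding S_def using that t0 by auto
    then have "s \<le> t0" unfolding t0_def by (rule cSup_upper[OF _ bdd])
    then show False using that by simp
  qed
  obtain \<xi> where \<xi>: "t0 < \<xi>" "\<xi> < t" "e t - e t0 = (t - t0) * (g (\<phi>1 \<xi> - E1 \<xi> / k) - g (\<phi>2 \<xi> - E2 \<xi> / k))"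
  proof -
    have "\<exists>l z. t0 < z \<and> z < t \<and> (e has_real_derivative l) (at z) \<and> e t - e t0 = (t - t0) * l"
    proof (rule MVT)
      show "continuous_on {t0..t} e" by (rule continuous_on_subset[OF ce]) (use t t0 in auto)
      show "e differentiable (at x)" if "t0 < x" "x < t" for x
        using e'[of x] at_within_Icc_at[of 0 x T] that t t0
        by (auto simp: real_differentiable_def)
    qed (rule t0)
    then obtain l z where z: "t0 < z" "z < t" "(e has_real_derivative l) (at z)" "e t - e t0 = (t - t0) * l" by blast
    have "(e has_real_derivative g (\<phi>1 z - E1 z / k) - g (\<phi>2 z - E2 z / k)) (at z)"
      using e'[of z] at_within_Icc_at[of 0 z T] z t t0 by auto
    then have "l = g (\<phi>1 z - E1 z / k) - g (\<phi>2 z - E2 z / k)" using z(3) DERIV_unique by blast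
    then show ?thesis using that z by blast
  qed
  have "\<phi>1 \<xi> - \<phi>2 \<xi> \<le> D" using D \<xi> t t0 by auto
  moreover have "k * D < e \<xi>" using above \<xi> by auto
  then have "D < e \<xi> / k" using k by (simp add: pos_less_divide_eq mult.commute)
  ultimately have "\<phi>1 \<xi> - E1 \<xi> / k \<le> \<phi>2 \<xi> - E2 \<xi> / k"
    unfolding e_def diff_divide_distrib by linarith
  then have "g (\<phi>1 \<xi> - E1 \<xi> / k) \<le> g (\<phi>2 \<xi> - E2 \<xi> / k)" using g by (auto dest: monoD)
  then have "e t - e t0 \<le> 0" unfolding \<xi>(3) using t0 by (intro mult_nonneg_nonpos) auto
  then show False using et t0 by simp
qed

lemma ode_stability:
  fixes g \<phi> \<psi> E F :: "real \<Rightarrow> real"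
  assumes g: "mono g" and k: "k > 0" and t: "t \<in> {0..T}"
    and E: "\<And>t. t \<in> {0..T} \<Longrightarrow> (E has_real_derivative g (\<phi> t - E t / k)) (at t within {0..T})"
    and F: "\<And>t. t \<in> {0..T} \<Longrightarrow> (F has_real_derivative g (\<psi> t - F t / k)) (at t within {0..T})"
    and init: "E 0 = F 0"
    and D: "\<And>t. t \<in> {0..T} \<Longrightarrow> \<bar>\<phi> t - \<psi> t\<bar> \<le> D"
  shows "\<bar>E t - F t\<bar> \<le> k * D"
proof -
  have "D \<ge> 0" using D[OF t] by simp
  have D': "\<phi> t - \<psi> t \<le> D" "\<psi> t - \<phi> t \<le> D" if "t \<in> {0..T}" for t
    using D[OF that] by linarith+
  have "E t - F t \<le> k * D"
    by (rule ode_comparison[OF g k t E F init D'(1) \<open>D \<ge> 0\<close>])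
  moreover have "F t - E t \<le> k * D"
    by (rule ode_comparison[OF g k t F E init[symmetric] D'(2) \<open>D \<ge> 0\<close>])
  ultimately show ?thesis by simp
qed

text \<open>With the feedback of \<open>E\<close> delayed by \<delta> the equation can be integrated
  interval by interval. The delay can be moved into the forcing, so the delayed solutions solve
  undelayed equations whose forcings are \<open>O(\<delta>)\<close> apart, and stability makes them
  a Cauchy sequence without a compactness argument. The bound \<open>M\<close> on \<open>g\<close>
  is a Lipschitz constant of the approximations and makes the effect of the delay small.\<close>

lemma ode_exists_bounded:
  fixes g \<phi> :: "real \<Rightarrow> real"
  assumes g: "mono g" and cg: "continuous_on UNIV g" and M: "\<And>x. \<bar>g x\<bar> \<le> M"
    and k: "k > 0" and c\<phi>: "continuous_on {0..} \<phi>" and T: "T > 0"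
  shows "\<exists>E. E 0 = 0 \<and> (\<forall>t\<in>{0..T}. (E has_real_derivative g (\<phi> t - E t / k)) (at t within {0..T}))"
proof -
  define \<psi> where "\<psi> s = \<phi> (max 0 s)" for s
  have c\<psi>: "continuous_on A \<psi>" for A unfolding \<psi>_def
    by (rule continuous_on_compose2[OF c\<phi>]) (auto intro!: continuous_intros)
  have M0: "M \<ge> 0" using M[of 0] by simp
  have approx: "\<exists>E \<phi>'. E 0 = 0 \<and> (\<forall>t\<in>{0..T}. (E has_real_derivative g (\<phi>' t - E t / k)) (at t within {0..T}))
      \<and> (\<forall>t\<in>{0..T}. \<bar>\<phi>' t - \<phi> t\<bar> \<le> M * \<delta> / k) \<and> (\<forall>a\<in>{0..T}. \<forall>b\<in>{0..T}. \<bar>E a - E b\<bar> \<le> M * \<bar>a - b\<bar>)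
      \<and> continuous_on {0..T} \<phi>'"
    if \<delta>: "\<delta> > 0" for \<delta>
  proof -
    \<comment> \<open>An iterate uses its predecessor at the times \<open>s - \<delta>\<close> only,
      hence \<open>e m\<close> and \<open>e (Suc m)\<close> agree up to time
      \<open>m * \<delta>\<close>. Integrating up to \<open>max 0 t\<close> continues the iterates
      by 0 to the negative times at which the delayed argument begins.\<close>
    define e where "e = rec_nat (\<lambda>t. 0) (\<lambda>_ u t. integral {0..max 0 t} (\<lambda>s. g (\<psi> s - u (s - \<delta>) / k)))"
    have e0: "e 0 = (\<lambda>t. 0)" and eS: "e (Suc m) = (\<lambda>t. integral {0..max 0 t} (\<lambda>s. g (\<psi> s - e m (s - \<delta>) / k)))" for m
      by (auto simp: e_def)
    define h where "h m s = g (\<psi> s - e m (s - \<delta>) / k)" for m s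
    have Lip': "\<bar>e (Suc m) a - e (Suc m) b\<bar> \<le> M * \<bar>a - b\<bar>" and ch': "continuous_on A (h m)"
      if ce: "continuous_on UNIV (e m)" for m a b A
    proof -
      have ch: "continuous_on A (h m)" for A unfolding h_def
      proof (rule continuous_on_compose2[OF cg])
        show "continuous_on A (\<lambda>s. \<psi> s - e m (s - \<delta>) / k)"
          by (intro continuous_intros c\<psi> continuous_on_compose2[OF ce]) (use k in auto)
      qed auto
      show "continuous_on A (h m)" by (rule ch)
      have *: "\<bar>e (Suc m) b - e (Suc m) a\<bar> \<le> M * (b - a)" if ab: "a \<le> b" for a b
      proof -
        have "integral {0..max 0 a} (h m) + integral {max 0 a..max 0 b} (h m) = integral {0..max 0 b} (h m)"
          by (rule Henstock_Kurzweil_Integration.integral_combine) (use ab in \<open>auto intro!: integrable_continuous_real ch\<close>)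
        then have "e (Suc m) b - e (Suc m) a = integral {max 0 a..max 0 b} (h m)" unfolding eS h_def by simp
        also have "\<bar>\<dots>\<bar> \<le> M * (max 0 b - max 0 a)"
          using integral_bound[of "max 0 a" "max 0 b" "h m" M] ab ch M by (auto simp: h_def)
        also have "\<dots> \<le> M * (b - a)" using M0 ab by (intro mult_left_mono) auto
        finally show ?thesis .
      qed
      show "\<bar>e (Suc m) a - e (Suc m) b\<bar> \<le> M * \<bar>a - b\<bar>"
        using *[of a b] *[of b a] by (cases "a \<le> b") (auto simp: abs_minus_commute)
    qed
    have ce: "continuous_on UNIV (e m)" for m
    proof (induction m)
      case 0 then show ?case by (simp add: e0)
    next
      case (Suc m)
      have "M-lipschitz_on UNIV (e (Suc m))"
        by (rule lipschitz_onI) (use Lip'[OF Suc] M0 in \<open>auto simp: dist_real_def\<close>)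
      then show ?case by (rule lipschitz_on_continuous_on)
    qed
    note Lip = Lip'[OF ce] and ch = ch'[OF ce]
    have neg: "e m t = 0" if "t \<le> 0" for m t using that by (cases m) (auto simp: e0 eS max_def)
    have agree: "t \<le> m * \<delta> \<Longrightarrow> e m t = e (Suc m) t" for m t
    proof (induction m arbitrary: t)
      case 0 then show ?case using neg by auto
    next
      case (Suc m)
      have "e m (s - \<delta>) = e (Suc m) (s - \<delta>)" if "s \<in> {0..max 0 t}" for s
      proof (cases "s - \<delta> \<le> 0")
        case True then show ?thesis using neg by simp
      next
        case False
        then have "s \<le> t" using that \<delta> by auto
        then have "s - \<delta> \<le> m * \<delta>" using Suc.prems by (simp add: algebra_simps)
        then show ?thesis by (rule Suc.IH)
      qed
      then show ?case unfolding eS[of m] eS[of "Suc m"] by (intro integral_cong) simp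
    qed
    obtain m :: nat where m: "T \<le> m * \<delta>"
      using ex_less_of_nat_mult[OF \<delta>, of T] by (auto intro: less_imp_le)
    define E where "E = e (Suc m)"
    \<comment> \<open>Chosen such that
      \<open>\<phi>' t - E t / k = \<psi> t - E (t - \<delta>) / k\<close>: the delayed equation for
      \<psi> is an undelayed one for \<open>\<phi>'\<close>.\<close>
    define \<phi>' where "\<phi>' t = \<psi> t + (E t - E (t - \<delta>)) / k" for t
    have der: "(E has_real_derivative h m t) (at t within {0..T})" if t: "t \<in> {0..T}" for t
    proof -
      have "((\<lambda>t. integral {0..t} (h m)) has_real_derivative h m t) (at t within {0..T})"
        by (rule integral_has_real_derivative[OF ch t])
      then show ?thesis
        by (rule has_field_derivative_transform_within[OF _ zero_less_one t]) (auto simp: E_def eS h_def[abs_def])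
    qed
    have hE: "h m t = g (\<phi>' t - E t / k)" if "t \<in> {0..T}" for t
    proof -
      have "e m (t - \<delta>) = E (t - \<delta>)" unfolding E_def by (rule agree) (use that m \<delta> in auto)
      then show ?thesis unfolding h_def \<phi>'_def by (simp add: diff_divide_distrib algebra_simps)
    qed
    have "E 0 = 0" unfolding E_def by (rule neg) simp
    moreover have "\<bar>\<phi>' t - \<phi> t\<bar> \<le> M * \<delta> / k" if "t \<in> {0..T}" for t
    proof -
      have "\<bar>E t - E (t - \<delta>)\<bar> \<le> M * \<delta>" unfolding E_def using Lip[of m t "t - \<delta>"] \<delta> by simp
      then show ?thesis using that k unfolding \<phi>'_def \<psi>_def by (auto simp: abs_divide divide_right_mono max_def)
    qed
    moreover have "continuous_on {0..T} \<phi>'" unfolding \<phi>'_def E_def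
      by (intro continuous_intros c\<psi> continuous_on_compose2[OF ce] continuous_on_subset[OF ce]) (use k in auto)
    moreover have "\<bar>E a - E b\<bar> \<le> M * \<bar>a - b\<bar>" for a b unfolding E_def by (rule Lip)
    ultimately show ?thesis using der hE by (intro exI[of _ E] exI[of _ \<phi>']) auto
  qed
  have "\<forall>n. \<exists>E \<phi>'. E 0 = 0 \<and> (\<forall>t\<in>{0..T}. (E has_real_derivative g (\<phi>' t - E t / k)) (at t within {0..T}))
      \<and> (\<forall>t\<in>{0..T}. \<bar>\<phi>' t - \<phi> t\<bar> \<le> M * inverse (real (Suc n)) / k)
      \<and> (\<forall>a\<in>{0..T}. \<forall>b\<in>{0..T}. \<bar>E a - E b\<bar> \<le> M * \<bar>a - b\<bar>) \<and> continuous_on {0..T} \<phi>'"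
    by (intro allI approx) simp
  then obtain E \<phi>' where E0: "\<And>n. E n 0 = 0"
    and E': "\<And>n t. t\<in>{0..T} \<Longrightarrow> (E n has_real_derivative g (\<phi>' n t - E n t / k)) (at t within {0..T})"
    and \<phi>': "\<And>n t. t\<in>{0..T} \<Longrightarrow> \<bar>\<phi>' n t - \<phi> t\<bar> \<le> M * inverse (real (Suc n)) / k"
    and Lip: "\<And>n a b. a\<in>{0..T} \<Longrightarrow> b\<in>{0..T} \<Longrightarrow> \<bar>E n a - E n b\<bar> \<le> M * \<bar>a - b\<bar>"
    and c\<phi>': "\<And>n. continuous_on {0..T} (\<phi>' n)" by metis
  have stab: "\<bar>E n t - E m t\<bar> \<le> M * inverse (real (Suc n)) + M * inverse (real (Suc m))" if t: "t \<in> {0..T}" for n m t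
  proof -
    have "\<bar>E n t - E m t\<bar> \<le> k * (M * inverse (real (Suc n)) / k + M * inverse (real (Suc m)) / k)"
    proof (rule ode_stability[OF g k t E' E'])
      show "\<bar>\<phi>' n s - \<phi>' m s\<bar> \<le> M * inverse (real (Suc n)) / k + M * inverse (real (Suc m)) / k" if "s \<in> {0..T}" for s
        using \<phi>'[OF that, of n] \<phi>'[OF that, of m] by linarith
    qed (auto simp: E0)
    also have "\<dots> = M * inverse (real (Suc n)) + M * inverse (real (Suc m))"
      using k by (simp add: distrib_left)
    finally show ?thesis .
  qed
  have lim0: "(\<lambda>n. M * inverse (real (Suc n))) \<longlonglongrightarrow> 0"
    using tendsto_mult_right_zero[OF LIMSEQ_inverse_real_of_nat] by blast
  have "convergent (\<lambda>n. E n t)" if t: "t \<in> {0..T}" for t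
  proof (rule Cauchy_convergent, rule metric_CauchyI)
    fix \<epsilon> :: real assume "\<epsilon> > 0"
    then have "eventually (\<lambda>n. M * inverse (real (Suc n)) < \<epsilon> / 2) sequentially"
      using order_tendstoD(2)[OF lim0, of "\<epsilon>/2"] by simp
    then obtain N where N: "\<And>n. n \<ge> N \<Longrightarrow> M * inverse (real (Suc n)) < \<epsilon> / 2"
      unfolding eventually_sequentially by auto
    show "\<exists>N. \<forall>m\<ge>N. \<forall>n\<ge>N. dist (E m t) (E n t) < \<epsilon>"
    proof (intro exI[of _ N] allI impI)
      fix m n assume "N \<le> m" "N \<le> n"
      then show "dist (E m t) (E n t) < \<epsilon>" using stab[OF t, of m n] N[of m] N[of n] by (simp add: dist_real_def)
    qed
  qed
  then obtain F where F: "\<And>t. t \<in> {0..T} \<Longrightarrow> (\<lambda>n. E n t) \<longlonglongrightarrow> F t"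
    unfolding convergent_def by metis
  have F0: "F 0 = 0" using LIMSEQ_unique[OF F[of 0]] T by (simp add: E0)
  have LipF: "\<bar>F a - F b\<bar> \<le> M * \<bar>a - b\<bar>" if "a\<in>{0..T}" "b\<in>{0..T}" for a b
    by (rule LIMSEQ_le_const2[OF tendsto_rabs[OF tendsto_diff[OF F[OF that(1)] F[OF that(2)]]]]) (use Lip that in auto)
  have cF: "continuous_on {0..T} F"
  proof -
    have "M-lipschitz_on {0..T} F"
      by (rule lipschitz_onI) (use LipF M0 in \<open>auto simp: dist_real_def\<close>)
    then show ?thesis by (rule lipschitz_on_continuous_on)
  qed
  define H where "H s = g (\<phi> s - F s / k)" for s
  have cH: "continuous_on {0..T} H" unfolding H_def
    by (rule continuous_on_compose2[OF cg]) (use k in \<open>auto intro!: continuous_intros cF continuous_on_subset[OF c\<phi>]\<close>)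
  have FI: "F t = integral {0..t} H" if t: "t \<in> {0..T}" for t
  proof -
    have Ei: "((\<lambda>s. g (\<phi>' n s - E n s / k)) has_integral E n t) {0..t}" for n
    proof -
      have "((\<lambda>s. g (\<phi>' n s - E n s / k)) has_integral (E n t - E n 0)) {0..t}"
      proof (rule fundamental_theorem_of_calculus)
        show "(E n has_vector_derivative g (\<phi>' n x - E n x / k)) (at x within {0..t})" if "x \<in> {0..t}" for x
          using has_vector_derivative_within_subset[OF E'[unfolded has_real_derivative_iff_has_vector_derivative], of x "{0..t}" n] that t by auto
      qed (use t in auto)
      then show ?thesis by (simp add: E0)
    qed
    have "(\<lambda>n. integral {0..t} (\<lambda>s. g (\<phi>' n s - E n s / k))) \<longlonglongrightarrow> integral {0..t} H"
    proof (rule dominated_convergence(2))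
      show "(\<lambda>s. g (\<phi>' n s - E n s / k)) integrable_on {0..t}" for n using Ei by blast
      show "(\<lambda>s. M) integrable_on {0..t}" by (rule integrable_const_ivl)
      show "norm (g (\<phi>' n s - E n s / k)) \<le> M" for n s using M by simp
      fix s assume s: "s \<in> {0..t}"
      have "(\<lambda>n. \<phi>' n s - \<phi> s) \<longlonglongrightarrow> 0"
      proof (rule Lim_null_comparison)
        show "\<forall>\<^sub>F n in sequentially. norm (\<phi>' n s - \<phi> s) \<le> M * inverse (real (Suc n)) / k" using \<phi>' s t by (intro always_eventually) auto
        show "(\<lambda>n. M * inverse (real (Suc n)) / k) \<longlonglongrightarrow> 0" using tendsto_divide_zero[OF lim0] .
      qed
      then have "(\<lambda>n. \<phi>' n s) \<longlonglongrightarrow> \<phi> s" using LIM_zero_iff by blast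
      then have "(\<lambda>n. \<phi>' n s - E n s / k) \<longlonglongrightarrow> \<phi> s - F s / k"
        by (intro tendsto_intros F) (use s t k in auto)
      then show "(\<lambda>n. g (\<phi>' n s - E n s / k)) \<longlonglongrightarrow> H s" unfolding H_def
        by (rule isCont_tendsto_compose[rotated]) (use cg in \<open>simp add: continuous_on_eq_continuous_at\<close>)
    qed
    moreover have "integral {0..t} (\<lambda>s. g (\<phi>' n s - E n s / k)) = E n t" for n using Ei by (rule integral_unique)
    ultimately show ?thesis using F[OF t] LIMSEQ_unique by auto
  qed
  have "(F has_real_derivative g (\<phi> t - F t / k)) (at t within {0..T})" if t: "t \<in> {0..T}" for t
  proof -
    have "(F has_real_derivative H t) (at t within {0..T})"
      using integral_has_real_derivative[OF cH t]
      by (rule has_field_derivative_transform_within[OF _ zero_less_one t]) (use FI in auto)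
    then show ?thesis unfolding H_def .
  qed
  then show ?thesis using F0 by blast
qed

text \<open>The constant 0 is the solution for the constant forcing \<open>r\<close>, because
  \<open>g r = 0\<close>. Comparison with it bounds \<open>E\<close> by \<open>k * B\<close>
  irrespective of the growth of the nonlinearity, so \<open>g\<close> may be truncated outside a
  bounded interval that the argument never leaves. Stability also shows that the solutions on
  different intervals agree.\<close>

lemma ode_exists:
  fixes g \<phi> :: "real \<Rightarrow> real"
  assumes g: "mono g" and cg: "continuous_on UNIV g" and r: "g r = 0"
    and k: "k > 0" and c\<phi>: "continuous_on {0..} \<phi>"
  shows "\<exists>E. E 0 = 0 \<and> (\<forall>t\<ge>0. (E has_real_derivative g (\<phi> t - E t / k)) (at t within {0..}))"
proof -
  have ex: "\<exists>E. E 0 = 0 \<and> (\<forall>t\<in>{0..T}. (E has_real_derivative g (\<phi> t - E t / k)) (at t within {0..T}))" if T: "T > 0" for T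
  proof -
    have "continuous_on {0..T} (\<lambda>t. \<phi> t - r)" by (intro continuous_intros continuous_on_subset[OF c\<phi>]) auto
    then have "bounded ((\<lambda>t. \<phi> t - r) ` {0..T})" using compact_continuous_image compact_imp_bounded compact_Icc by blast
    then have "\<exists>B. \<forall>t\<in>{0..T}. \<bar>\<phi> t - r\<bar> \<le> B" unfolding bounded_iff by auto
    then obtain B where B: "\<And>t. t \<in> {0..T} \<Longrightarrow> \<bar>\<phi> t - r\<bar> \<le> B" by blast
    have B0: "B \<ge> 0" using B[of 0] T by auto
    \<comment> \<open>The argument of \<open>g\<close> is at most \<open>\<bar>r\<bar> +
      \<bar>\<phi> t - r\<bar> + \<bar>E t / k\<bar>\<close> in absolute value, and each of the last
      two terms is at most \<open>B\<close>.\<close>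
    define m where "m = \<bar>r\<bar> + 2 * B"
    define h where "h x = g (max (-m) (min x m))" for x
    have m0: "m \<ge> 0" using B0 by (simp add: m_def)
    have hm: "mono h" unfolding h_def by (intro monoI monoD[OF g]) auto
    have ch: "continuous_on UNIV h" unfolding h_def by (rule continuous_on_compose2[OF cg]) (auto intro!: continuous_intros)
    have hb: "\<bar>h x\<bar> \<le> \<bar>g m\<bar> + \<bar>g (-m)\<bar>" for x
      using monoD[OF g, of "-m" "max (-m) (min x m)"] monoD[OF g, of "max (-m) (min x m)" m] m0 unfolding h_def by linarith
    obtain E where E: "E 0 = 0" "\<And>t. t\<in>{0..T} \<Longrightarrow> (E has_real_derivative h (\<phi> t - E t / k)) (at t within {0..T})"
      using ode_exists_bounded[OF hm ch hb k c\<phi> T] by blast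
    have "max (-m) (min r m) = r" using B0 unfolding m_def by linarith
    then have hr: "h r = 0" using r unfolding h_def by simp
    have "\<bar>E t - 0\<bar> \<le> k * B" if t: "t \<in> {0..T}" for t
    proof (rule ode_stability[OF hm k t E(2), where F = "\<lambda>_. 0" and \<psi> = "\<lambda>_. r"])
      show "((\<lambda>_. 0) has_real_derivative h (r - 0 / k)) (at s within {0..T})" for s using hr by simp
    qed (use E(1) B in auto)
    then have Eb: "\<bar>E t / k\<bar> \<le> B" if "t \<in> {0..T}" for t using that k by (simp add: field_simps)
    have "h (\<phi> t - E t / k) = g (\<phi> t - E t / k)" if t: "t \<in> {0..T}" for t
    proof -
      have "\<bar>\<phi> t - E t / k\<bar> \<le> m" using B[OF t] Eb[OF t] unfolding m_def by linarith
      then have "max (- m) (min (\<phi> t - E t / k) m) = \<phi> t - E t / k" by linarith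
      then show ?thesis unfolding h_def by simp
    qed
    then show ?thesis using E by (intro exI[of _ E]) auto
  qed
  then obtain Es where Es0: "\<And>T. T > 0 \<Longrightarrow> Es T 0 = 0"
    and Es: "\<And>T t. T > 0 \<Longrightarrow> t \<in> {0..T} \<Longrightarrow> (Es T has_real_derivative g (\<phi> t - Es T t / k)) (at t within {0..T})"
    by metis
  have uniq: "Es T1 t = Es T2 t" if "0 \<le> t" "t \<le> T1" "T1 \<le> T2" "T1 > 0" for t T1 T2
  proof -
    have "\<bar>Es T1 t - Es T2 t\<bar> \<le> k * 0"
    proof (rule ode_stability[OF g k _ Es, of t T1])
      show "(Es T2 has_real_derivative g (\<phi> s - Es T2 s / k)) (at s within {0..T1})" if "s \<in> {0..T1}" for s
        by (rule DERIV_subset[OF Es]) (use that \<open>T1 \<le> T2\<close> \<open>T1 > 0\<close> in auto)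
    qed (use that Es0 in auto)
    then show ?thesis by simp
  qed
  \<comment> \<open>The interval is chosen to end beyond \<open>t\<close>; in a neighbourhood of
    \<open>t\<close> all these solutions coincide with the one on \<open>{0..t + 2}\<close>, which
    is differentiable there.\<close>
  define E where "E t = Es (t + 1) t" for t
  have "(E has_real_derivative g (\<phi> t - E t / k)) (at t within {0..})" if t: "t \<ge> 0" for t
  proof -
    have "(Es (t + 2) has_real_derivative g (\<phi> t - Es (t + 2) t / k)) (at t within {0..t+2})"
      by (rule Es) (use t in auto)
    moreover have "at t within {0..t+2} = at t within {0..}"
      by (rule at_within_nhd[of _ "{t-1<..<t+1}"]) auto
    moreover have "Es (t + 2) t = E t" unfolding E_def using uniq[of t "t+1" "t+2"] t by simp
    ultimately have "(Es (t + 2) has_real_derivative g (\<phi> t - E t / k)) (at t within {0..})" by simp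
    then show ?thesis
    proof (rule has_field_derivative_transform_within[of _ _ _ _ 1])
      show "Es (t + 2) s = E s" if "s \<in> {0..}" "dist s t < 1" for s
        unfolding E_def using uniq[of s "s+1" "t+2"] that by (auto simp: dist_real_def)
    qed (use t in auto)
  qed
  moreover have "E 0 = 0" unfolding E_def using Es0 by simp
  ultimately show ?thesis by blast
qed

section \<open>Lebesgue measure with atoms\<close>

definition atomic_lborel :: "real set \<Rightarrow> real measure" where
  "atomic_lborel A = measure_of UNIV (sets borel)
     (\<lambda>X. emeasure lborel X + emeasure (count_space UNIV) (X \<inter> A))"

lemma sets_atomic_lborel[simp, measurable_cong]: "sets (atomic_lborel A) = sets borel"
  unfolding atomic_lborel_def using sets.sigma_sets_eq[of borel] by (subst sets_measure_of) auto

lemma space_atomic_lborel[simp]: "space (atomic_lborel A) = UNIV"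
  using sets_eq_imp_space_eq[OF sets_atomic_lborel] by simp

lemma emeasure_atomic_lborel:
  assumes "X \<in> sets borel"
  shows "emeasure (atomic_lborel A) X = emeasure lborel X + emeasure (count_space UNIV) (X \<inter> A)"
proof (rule emeasure_measure_of[OF atomic_lborel_def])
  show "countably_additive (sets (atomic_lborel A)) (\<lambda>X. emeasure lborel X + emeasure (count_space UNIV) (X \<inter> A))"
  proof (rule countably_additiveI)
    fix F :: "nat \<Rightarrow> real set"
    assume F: "range F \<subseteq> sets (atomic_lborel A)" "disjoint_family F" "\<Union> (range F) \<in> sets (atomic_lborel A)"
    have 1: "(\<Sum>i. emeasure lborel (F i)) = emeasure lborel (\<Union> (range F))"
      by (rule suminf_emeasure) (use F in auto)
    have 2: "(\<Sum>i. emeasure (count_space UNIV) (F i \<inter> A)) = emeasure (count_space UNIV) (\<Union>i. F i \<inter> A)"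
      by (rule suminf_emeasure) (use F in \<open>auto simp: disjoint_family_on_def\<close>)
    have "(\<Union>i. F i \<inter> A) = \<Union> (range F) \<inter> A" by auto
    then show "(\<Sum>i. emeasure lborel (F i) + emeasure (count_space UNIV) (F i \<inter> A)) =
       emeasure lborel (\<Union> (range F)) + emeasure (count_space UNIV) (\<Union> (range F) \<inter> A)"
      using 1 2 by (subst suminf_add[symmetric]) auto
  qed
qed (use assms in \<open>auto simp: positive_def\<close>)

lemma nn_integral_atomic_lborel:
  assumes A[measurable]: "A \<in> sets borel" and f: "f \<in> borel_measurable borel"
  shows "(\<integral>\<^sup>+x. f x \<partial>atomic_lborel A) =
    (\<integral>\<^sup>+x. f x \<partial>lborel) + (\<integral>\<^sup>+x. f x * indicator A x \<partial>count_space UNIV)"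
  using f
proof (induction rule: borel_measurable_induct)
  case (cong f g)
  then have "f = g" by auto
  then show ?case using cong by simp
next
  case (set B)
  have "(\<integral>\<^sup>+x. indicator B x * indicator A x \<partial>count_space UNIV) = (\<integral>\<^sup>+x. indicator (B \<inter> A) x \<partial>count_space (UNIV::real set))"
    by (intro nn_integral_cong) (auto simp: indicator_def)
  then show ?case using set by (simp add: emeasure_atomic_lborel)
next
  case (mult u c)
  have "(\<integral>\<^sup>+x. c * u x * indicator A x \<partial>count_space UNIV) = c * (\<integral>\<^sup>+x. u x * indicator A x \<partial>count_space UNIV)"
    by (subst nn_integral_cmult[symmetric]) (auto simp: mult.assoc)
  then show ?case using mult by (simp add: nn_integral_cmult distrib_left)
next
  case (add u v)
  have "(\<integral>\<^sup>+x. (v x + u x) * indicator A x \<partial>count_space UNIV) =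
     (\<integral>\<^sup>+x. v x * indicator A x \<partial>count_space UNIV) + (\<integral>\<^sup>+x. u x * indicator A x \<partial>count_space UNIV)"
    by (subst nn_integral_add[symmetric]) (auto simp: distrib_right)
  then show ?case using add by (simp add: nn_integral_add ac_simps)
next
  case (seq U)
  have inc: "incseq (\<lambda>i x. U i x * indicator A x)"
    using seq(3) by (auto simp: incseq_def le_fun_def intro!: mult_right_mono)
  have eqf: "Sup (range U) = (\<lambda>x. SUP i. U i x)" by (auto simp: SUP_apply fun_eq_iff image_comp)
  have eq: "(SUP i. U i x) * indicator A x = (SUP i. U i x * indicator A x)" for x
    by (simp add: SUP_mult_right_ennreal)
  have 1: "(\<integral>\<^sup>+x. (SUP i. U i x) \<partial>atomic_lborel A) = (SUP i. \<integral>\<^sup>+x. U i x \<partial>atomic_lborel A)"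
    by (rule nn_integral_monotone_convergence_SUP) (use seq in auto)
  have 2: "(\<integral>\<^sup>+x. (SUP i. U i x) \<partial>lborel) = (SUP i. \<integral>\<^sup>+x. U i x \<partial>lborel)"
    by (rule nn_integral_monotone_convergence_SUP) (use seq in auto)
  have 3: "(\<integral>\<^sup>+x. (SUP i. U i x) * indicator A x \<partial>count_space UNIV) = (SUP i. \<integral>\<^sup>+x. U i x * indicator A x \<partial>count_space UNIV)"
    unfolding eq by (rule nn_integral_monotone_convergence_SUP[OF inc]) auto
  have "(SUP i. (\<integral>\<^sup>+x. U i x \<partial>lborel) + (\<integral>\<^sup>+x. U i x * indicator A x \<partial>count_space UNIV)) =
      (SUP i. \<integral>\<^sup>+x. U i x \<partial>lborel) + (SUP i. \<integral>\<^sup>+x. U i x * indicator A x \<partial>count_space UNIV)"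
    by (rule ennreal_SUP_add)
       (use seq(3) inc in \<open>auto simp: incseq_def le_fun_def intro!: nn_integral_mono\<close>)
  then show ?case unfolding eqf 1 2 3 using seq by simp
qed

locale atoms =
  fixes A :: "real set"
  assumes A_finite: "\<And>R. finite (A \<inter> {0<..R})" and A_pos: "A \<subseteq> {0<..}"
begin

abbreviation N :: "real measure" where "N \<equiv> atomic_lborel A"

lemma countable_A: "countable A"
proof -
  have "A \<subseteq> (\<Union>n::nat. A \<inter> {0<..real n})"
  proof
    fix x assume "x \<in> A"
    moreover have "x \<le> real (nat \<lceil>x\<rceil>)" by linarith
    ultimately show "x \<in> (\<Union>n::nat. A \<inter> {0<..real n})" using A_pos by (auto intro!: exI[of _ "nat \<lceil>x\<rceil>"])
  qed
  moreover have "countable (\<Union>n::nat. A \<inter> {0<..real n})"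
    by (intro countable_UN countableI_type countable_finite A_finite)
  ultimately show ?thesis by (rule countable_subset)
qed

lemma A_borel[measurable]: "A \<in> sets borel"
  by (rule sets.countable[OF _ countable_A]) simp

lemma emeasure_N:
  assumes "0 \<le> a" "a \<le> b"
  shows "emeasure N {a<..b} = ennreal (b - a + card (A \<inter> {a<..b}))"
proof -
  have "finite ({a<..b} \<inter> A)"
    by (rule finite_subset[OF _ A_finite[of b]]) (use assms in auto)
  then show ?thesis using assms
    by (subst emeasure_atomic_lborel)
       (auto simp: emeasure_count_space ennreal_plus ennreal_of_nat_eq_real_of_nat Int_commute)
qed

lemma emeasure_N_finite: "0 \<le> a \<Longrightarrow> emeasure N {a<..b} < \<infinity>"
  by (cases "a \<le> b") (simp_all add: emeasure_N)

lemma emeasure_N_Icc: "emeasure N {0<..R} \<noteq> \<infinity>"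
  using emeasure_N_finite[of 0 R] by auto

lemma emeasure_N_ball: "emeasure N {-r..r} \<noteq> \<infinity>"
proof -
  have "A \<inter> {- r..r} = A \<inter> {0<..r}" using A_pos by force
  then have "finite ({- r..r} \<inter> A)" using A_finite[of r] by (simp add: Int_commute)
  then show ?thesis by (subst emeasure_atomic_lborel) (auto simp: emeasure_count_space emeasure_lborel_Icc_eq)
qed

lemma sigma_finite_N: "sigma_finite_measure N"
proof
  have "\<exists>n::nat. x \<in> {-real n..real n}" for x :: real
    by (rule exI[of _ "nat \<lceil>\<bar>x\<bar>\<rceil>"]) (simp add: abs_le_iff, linarith)
  then show "\<exists>F. countable F \<and> F \<subseteq> sets N \<and> \<Union> F = space N \<and> (\<forall>a\<in>F. emeasure N a \<noteq> \<infinity>)"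
    using emeasure_N_ball by (intro exI[of _ "range (\<lambda>n::nat. {-real n..real n})"]) auto
qed

sublocale N: sigma_finite_measure N by (rule sigma_finite_N)

definition Nm :: "real \<Rightarrow> real" where "Nm R = measure N {0<..R}"

lemma Nm_nonneg: "Nm R \<ge> 0" by (simp add: Nm_def)

lemma measure_no_atoms: "0 \<le> a \<Longrightarrow> a \<le> b \<Longrightarrow> A \<inter> {a<..b} = {} \<Longrightarrow> measure N {a<..b} = b - a"
  unfolding measure_def by (simp add: emeasure_N)

lemma measure_atom: "0 < y \<Longrightarrow> y \<notin> A \<Longrightarrow> emeasure N {y} = 0"
  by (subst emeasure_atomic_lborel) (auto simp: emeasure_count_space)

lemma measure_atom': "y \<in> A \<Longrightarrow> emeasure N {y} = 1"
  by (subst emeasure_atomic_lborel) (auto simp: emeasure_count_space)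

lemma integrable_N:
  assumes [measurable]: "F \<in> borel_measurable borel"
    and B: "\<And>z. 0 < z \<Longrightarrow> z \<le> R \<Longrightarrow> \<bar>F z\<bar> \<le> B" and zero: "\<And>z. \<not> (0 < z \<and> z \<le> R) \<Longrightarrow> F z = 0"
  shows "integrable N F" and "\<bar>LINT z|N. F z\<bar> \<le> B * Nm R"
proof -
  have int: "integrable N (\<lambda>z. B * indicator {0<..R} z)"
    using emeasure_N_Icc[of R] by (intro integrable_mult_right integrable_real_indicator) (auto simp: less_top)
  show *: "integrable N F"
    by (rule Bochner_Integration.integrable_bound[OF int]) (use B zero in \<open>auto simp: indicator_def intro!: AE_I2\<close>, fastforce)
  have "norm (LINT z|N. F z) \<le> (LINT z|N. B * indicator {0<..R} z)"
    by (rule Bochner_Integration.integral_norm_bound_integral[OF * int]) (use B zero in \<open>auto simp: indicator_def\<close>)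
  then show "\<bar>LINT z|N. F z\<bar> \<le> B * Nm R" by (simp add: Nm_def)
qed

text \<open>Needed where the two parts are handled by different means: in the choice of the weight,
  where atoms and Lebesgue measure are made small by different parameters, and in the construction
  of the density of the speed.\<close>

lemma integral_N_split:
  fixes F :: "real \<Rightarrow> real"
  assumes [measurable]: "F \<in> borel_measurable borel"
    and B: "\<And>z. 0 < z \<Longrightarrow> z \<le> R \<Longrightarrow> \<bar>F z\<bar> \<le> B" and zero: "\<And>z. \<not> (0 < z \<and> z \<le> R) \<Longrightarrow> F z = 0"
  shows "(LINT z|N. F z) = (LINT z|lborel. F z) + (\<Sum>a\<in>A \<inter> {0<..R}. F a)"
proof -
  have iN: "integrable N F" by (rule integrable_N(1)[of F R B]) (use B zero in auto)
  have "integrable lborel (\<lambda>z. B * indicator {0<..R} z)"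
    by (intro integrable_mult_right integrable_real_indicator emeasure_bounded_finite) auto
  then have iL: "integrable lborel F"
    by (rule Bochner_Integration.integrable_bound) (use B zero in \<open>auto simp: indicator_def intro!: AE_I2\<close>, fastforce)
  have count: "(\<integral>\<^sup>+x. ennreal (G x) * indicator A x \<partial>count_space UNIV) = ennreal (\<Sum>a\<in>A \<inter> {0<..R}. max 0 (G a))"
    if "\<And>z. \<not> (0 < z \<and> z \<le> R) \<Longrightarrow> G z = 0" for G :: "real \<Rightarrow> real"
  proof -
    have "(\<integral>\<^sup>+x. ennreal (G x) * indicator A x \<partial>count_space UNIV) = (\<Sum>a\<in>A \<inter> {0<..R}. ennreal (G a) * indicator A a)"
    proof (rule nn_integral_count_space'[OF A_finite])
      show "ennreal (G x) * indicator A x = 0" if "x \<notin> A \<inter> {0<..R}" for x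
        using that \<open>\<And>z. \<not> (0 < z \<and> z \<le> R) \<Longrightarrow> G z = 0\<close>[of x] by (cases "x \<in> A") auto
    qed auto
    also have "\<dots> = (\<Sum>a\<in>A \<inter> {0<..R}. ennreal (max 0 (G a)))"
      by (intro sum.cong) (auto simp: ennreal_neg max_def ennreal_eq_0_iff)
    finally show ?thesis by simp
  qed
  have part: "enn2real (\<integral>\<^sup>+x. ennreal (G x) \<partial>N) = enn2real (\<integral>\<^sup>+x. ennreal (G x) \<partial>lborel) + (\<Sum>a\<in>A \<inter> {0<..R}. max 0 (G a))"
    if G: "integrable lborel G" "G \<in> borel_measurable borel" "\<And>z. \<not> (0 < z \<and> z \<le> R) \<Longrightarrow> G z = 0" for G :: "real \<Rightarrow> real"
  proof -
    have "(\<integral>\<^sup>+x. ennreal (G x) \<partial>lborel) < \<infinity>"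
      using integrableD(2)[OF G(1)] by (metis ennreal_eq_0_iff top.not_eq_extremum infinity_ennreal_def)
    then show ?thesis using G(2) by (simp add: nn_integral_atomic_lborel count[OF G(3)] enn2real_plus sum_nonneg less_top)
  qed
  have "(LINT z|N. F z) = enn2real (\<integral>\<^sup>+x. ennreal (F x) \<partial>N) - enn2real (\<integral>\<^sup>+x. ennreal (- F x) \<partial>N)"
    by (rule real_lebesgue_integral_def[OF iN])
  also have "\<dots> = (LINT z|lborel. F z) + ((\<Sum>a\<in>A \<inter> {0<..R}. max 0 (F a)) - (\<Sum>a\<in>A \<inter> {0<..R}. max 0 (- F a)))"
    using part[OF iL] part[of "\<lambda>x. - F x"] iL zero by (simp add: real_lebesgue_integral_def[OF iL])
  also have "(\<Sum>a\<in>A \<inter> {0<..R}. max 0 (F a)) - (\<Sum>a\<in>A \<inter> {0<..R}. max 0 (- F a)) = (\<Sum>a\<in>A \<inter> {0<..R}. F a)"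
    unfolding sum_subtractf[symmetric] by (intro sum.cong) (auto simp: max_def)
  finally show ?thesis .
qed

end

section \<open>Speeds with jumps and the memory kernels\<close>

locale medium = atoms A for A :: "real set" +
  fixes J c :: "real \<Rightarrow> real" and cm L :: real
  assumes J_meas[measurable]: "J \<in> borel_measurable borel" and J_bound: "\<And>y. \<bar>J y\<bar> \<le> L"
    and c_diff: "\<And>a b. 0 \<le> a \<Longrightarrow> a \<le> b \<Longrightarrow>
      c b - c a = (LINT z|atomic_lborel A. (if a < z \<and> z \<le> b then J z else 0))"
    and cm_pos: "cm > 0" and c_ge: "\<And>y. y \<ge> 0 \<Longrightarrow> c y \<ge> cm" and cl_ge': "\<And>a. a \<in> A \<Longrightarrow> c a - J a \<ge> cm"
begin

text \<open>The left limit of \<open>c\<close>. The intervals in \<open>c_diff\<close> are open on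
  the left and closed on the right, so \<open>c\<close> is continuous from the right, and its jump
  at an atom \<open>a\<close> is \<open>J a\<close> because the atom has mass 1. The last assumption
  of the locale is thus a lower bound for left limits.\<close>

definition cl :: "real \<Rightarrow> real" where "cl y = (if y \<in> A then c y - J y else c y)"

lemma cl_ge: "y \<ge> 0 \<Longrightarrow> cl y \<ge> cm"
  using c_ge cl_ge' by (simp add: cl_def)

lemma cl_0: "cl 0 = c 0"
  using A_pos by (auto simp: cl_def)

lemma L_nonneg: "L \<ge> 0"
  using J_bound[of 0] by simp

text \<open>For \<open>t \<ge> 0\<close> the set \<open>0 \<le> y\<close>,
  \<open>y + t \<le> R\<close> is a triangle of dependence: the kernels evaluate \<open>q\<close>
  only at points where this sum is not larger than at the point considered. Bounds are therefore
  asked for on each triangle separately, and measurability in both variables jointly, because the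
  kernels are integrals with parameters.\<close>

definition causal :: "(real \<Rightarrow> real \<Rightarrow> real) \<Rightarrow> bool" where
  "causal q \<longleftrightarrow> (\<lambda>x. q (fst x) (snd x)) \<in> borel_measurable borel \<and> (\<forall>y t. t < 0 \<longrightarrow> q y t = 0) \<and>
     (\<forall>R. \<exists>B. \<forall>y t. 0 \<le> y \<longrightarrow> y + t \<le> R \<longrightarrow> \<bar>q y t\<bar> \<le> B)"

text \<open>Continuity is asked for in time only: the iterates of the fixed point argument may jump
  in \<open>y\<close> at the atoms. Continuity in \<open>y\<close> is a property of solutions,
  proved afterwards.\<close>

definition cauc :: "(real \<Rightarrow> real \<Rightarrow> real) \<Rightarrow> bool" where
  "cauc q \<longleftrightarrow> causal q \<and> (\<forall>y\<ge>0. continuous_on UNIV (q y))"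

text \<open>\<open>K1\<close> collects what reaches \<open>(y, t)\<close> along the characteristic
  that comes from larger \<open>z\<close>, \<open>K2\<close> what comes from smaller
  \<open>z\<close>; both are Stieltjes integrals of \<open>q\<close> against \<open>c\<close>. An
  atom at \<open>y\<close> itself is left out of both. Its share sits in the coefficients that
  accompany the kernels, \<open>c y\<close> for \<open>K1\<close> and \<open>cl y\<close> for
  \<open>K2\<close>.\<close>

definition K1 :: "(real \<Rightarrow> real \<Rightarrow> real) \<Rightarrow> real \<Rightarrow> real \<Rightarrow> real" where
  "K1 q y t = (LINT z|N. (if y < z then J z * q z (t + y - z) else 0))"

definition K2 :: "(real \<Rightarrow> real \<Rightarrow> real) \<Rightarrow> real \<Rightarrow> real \<Rightarrow> real" where
  "K2 q y t = (LINT z|N. (if 0 < z \<and> z < y then J z * q z (t - y + z) else 0))"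

lemma causal_meas:
  assumes q: "causal q" and [measurable]: "f \<in> borel_measurable M" "g \<in> borel_measurable M"
  shows "(\<lambda>x. q (f x) (g x)) \<in> borel_measurable M"
proof -
  have "(\<lambda>x. (f x, g x)) \<in> borel_measurable M" by measurable
  from measurable_compose[OF this, of "\<lambda>x. q (fst x) (snd x)" borel] q show ?thesis
    by (simp add: causal_def)
qed

lemma causal_neg: "causal q \<Longrightarrow> t < 0 \<Longrightarrow> q y t = 0"
  by (simp add: causal_def)

lemma causal_bound:
  assumes "causal q" obtains B where "B \<ge> 0" "\<And>y t. 0 \<le> y \<Longrightarrow> y + t \<le> R \<Longrightarrow> \<bar>q y t\<bar> \<le> B"
proof -
  obtain B where B: "\<And>y t. 0 \<le> y \<Longrightarrow> y + t \<le> R \<Longrightarrow> \<bar>q y t\<bar> \<le> B" using assms unfolding causal_def by metis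
  show ?thesis by (rule that[of "max 0 B"]) (use B in \<open>auto intro: order_trans[OF _ max.cobounded2]\<close>)
qed

lemma cauc_causal: "cauc q \<Longrightarrow> causal q"
  by (simp add: cauc_def)

lemma cauc_cont: "cauc q \<Longrightarrow> y \<ge> 0 \<Longrightarrow> isCont (q y) t"
  by (simp add: cauc_def continuous_on_eq_continuous_at)

lemma cauc_nonpos: assumes q: "cauc q" and "y \<ge> 0" "t \<le> 0" shows "q y t = 0"
proof (cases "t < 0")
  case True then show ?thesis using causal_neg[OF cauc_causal[OF q]] by simp
next
  case False
  then have t: "t = 0" using assms by simp
  have "((q y) \<longlongrightarrow> q y 0) (at_left 0)"
    using cauc_cont[OF q \<open>y \<ge> 0\<close>, of 0] by (auto simp: isCont_def filterlim_at_split)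
  moreover have "((q y) \<longlongrightarrow> 0) (at_left 0)"
  proof (rule tendsto_eventually)
    show "\<forall>\<^sub>F x in at_left 0. q y x = 0" using causal_neg[OF cauc_causal[OF q]]
      by (auto simp: eventually_at_filter)
  qed
  ultimately have "q y 0 = 0" by (rule tendsto_unique[rotated]) simp
  then show ?thesis using t by simp
qed

lemma K1_meas':
  assumes q: "causal q" shows "(\<lambda>z. if y < z then J z * q z (t + y - z) else 0) \<in> borel_measurable borel"
  by (intro measurable_If borel_measurable_times causal_meas[OF q]) measurable

lemma K2_meas':
  assumes q: "causal q" shows "(\<lambda>z. if 0 < z \<and> z < y then J z * q z (t - y + z) else 0) \<in> borel_measurable borel"
  by (intro measurable_If borel_measurable_times causal_meas[OF q]) measurable

lemma K1_zero: "causal q \<Longrightarrow> y \<ge> 0 \<Longrightarrow> y + t \<le> R \<Longrightarrow> \<not> (0 < z \<and> z \<le> R) \<Longrightarrow> (if y < z then J z * q z (t + y - z) else 0) = 0"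
  using causal_neg by auto

lemma K2_zero: "causal q \<Longrightarrow> \<not> (0 < z \<and> z \<le> y) \<Longrightarrow> (if 0 < z \<and> z < y then J z * q z (t - y + z) else 0) = 0"
  by auto

lemma JB: "\<bar>x\<bar> \<le> B \<Longrightarrow> \<bar>J z * x\<bar> \<le> L * B"
  unfolding abs_mult using J_bound[of z] by (intro mult_mono) auto

lemma K1_integrable:
  assumes q: "causal q" and y: "y \<ge> 0"
  shows "integrable N (\<lambda>z. if y < z then J z * q z (t + y - z) else 0)"
proof -
  obtain B where B: "B \<ge> 0" "\<And>z s. 0 \<le> z \<Longrightarrow> z + s \<le> y + t \<Longrightarrow> \<bar>q z s\<bar> \<le> B" using causal_bound[OF q] by blast
  show ?thesis
    by (rule integrable_N(1)[where R = "y + t" and B = "L * B", OF K1_meas'[OF q] _ K1_zero[OF q y]])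
       (use B L_nonneg in \<open>auto intro!: JB\<close>)
qed

lemma K2_integrable:
  assumes q: "causal q" and y: "y \<ge> 0"
  shows "integrable N (\<lambda>z. if 0 < z \<and> z < y then J z * q z (t - y + z) else 0)"
proof -
  obtain B where B: "B \<ge> 0" "\<And>z s. 0 \<le> z \<Longrightarrow> z + s \<le> y + t \<Longrightarrow> \<bar>q z s\<bar> \<le> B" using causal_bound[OF q] by blast
  show ?thesis
    by (rule integrable_N(1)[where R = y and B = "L * B", OF K2_meas'[OF q] _ K2_zero[OF q]])
       (use B L_nonneg in \<open>auto intro!: JB\<close>)
qed

lemma K1_diff: "causal q \<Longrightarrow> causal r \<Longrightarrow> y \<ge> 0 \<Longrightarrow> K1 (\<lambda>y t. q y t - r y t) y t = K1 q y t - K1 r y t"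
  unfolding K1_def
  by (subst Bochner_Integration.integral_diff[symmetric, OF K1_integrable K1_integrable])
     (auto intro!: Bochner_Integration.integral_cong simp: algebra_simps)

lemma K2_diff: "causal q \<Longrightarrow> causal r \<Longrightarrow> y \<ge> 0 \<Longrightarrow> K2 (\<lambda>y t. q y t - r y t) y t = K2 q y t - K2 r y t"
  unfolding K2_def
  by (subst Bochner_Integration.integral_diff[symmetric, OF K2_integrable K2_integrable])
     (auto intro!: Bochner_Integration.integral_cong simp: algebra_simps)

lemma causal_diff:
  assumes q: "causal q" and r: "causal r" shows "causal (\<lambda>y t. q y t - r y t)"
  unfolding causal_def
proof (intro conjI allI impI)
  show "(\<lambda>x. q (fst x) (snd x) - r (fst x) (snd x)) \<in> borel_measurable borel"
    using q r unfolding causal_def by (intro borel_measurable_diff) auto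
  show "q y t - r y t = 0" if "t < 0" for y t using causal_neg[OF q that] causal_neg[OF r that] by simp
  fix R
  obtain B C where "\<And>y t. 0 \<le> y \<Longrightarrow> y + t \<le> R \<Longrightarrow> \<bar>q y t\<bar> \<le> B" "\<And>y t. 0 \<le> y \<Longrightarrow> y + t \<le> R \<Longrightarrow> \<bar>r y t\<bar> \<le> C"
    using causal_bound[OF q] causal_bound[OF r] by metis
  then have "\<bar>q y t - r y t\<bar> \<le> B + C" if "0 \<le> y" "y + t \<le> R" for y t using that by (smt (verit))
  then show "\<exists>B. \<forall>y t. 0 \<le> y \<longrightarrow> y + t \<le> R \<longrightarrow> \<bar>q y t - r y t\<bar> \<le> B" by blast
qed

lemma cauc_diff: "cauc q \<Longrightarrow> cauc r \<Longrightarrow> cauc (\<lambda>y t. q y t - r y t)"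
  unfolding cauc_def by (auto intro!: causal_diff continuous_on_diff)

lemma K1_bound:
  assumes q: "causal q" and B: "\<And>z s. 0 \<le> z \<Longrightarrow> z + s \<le> R \<Longrightarrow> \<bar>q z s\<bar> \<le> B" and y: "y \<ge> 0" "y + t \<le> R"
  shows "\<bar>K1 q y t\<bar> \<le> L * B * Nm R"
  unfolding K1_def
  by (rule integrable_N(2)[OF K1_meas'[OF q] _ K1_zero[OF q y]])
     (use B y L_nonneg order_trans[OF abs_ge_zero B[of y t]] in \<open>auto intro!: JB\<close>)

lemma K2_bound:
  assumes q: "causal q" and B: "\<And>z s. 0 \<le> z \<Longrightarrow> z + s \<le> R \<Longrightarrow> \<bar>q z s\<bar> \<le> B" and y: "y \<ge> 0" "y + t \<le> R" and "t \<ge> 0"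
  shows "\<bar>K2 q y t\<bar> \<le> L * B * Nm R"
  unfolding K2_def
proof (rule integrable_N(2)[OF K2_meas'[OF q]])
  show "(if 0 < z \<and> z < y then J z * q z (t - y + z) else 0) = 0" if "\<not> (0 < z \<and> z \<le> R)" for z
    using that assms by auto
qed (use B y L_nonneg order_trans[OF abs_ge_zero B[of y t]] in \<open>auto intro!: JB\<close>)

lemma K2_neg: "causal q \<Longrightarrow> t < 0 \<Longrightarrow> K2 q y t = 0"
  unfolding K2_def using causal_neg by (auto intro!: integral_eq_zero_AE)

lemma K1_neg: "causal q \<Longrightarrow> t < 0 \<Longrightarrow> K1 q y t = 0"
  unfolding K1_def using causal_neg by (auto intro!: integral_eq_zero_AE)

lemma K1_meas:
  assumes q: "causal q" shows "(\<lambda>x. K1 q (fst x) (snd x)) \<in> borel_measurable borel"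
  unfolding K1_def borel_prod[symmetric]
proof (rule N.borel_measurable_lebesgue_integral)
  show "(\<lambda>(x, z). if fst x < z then J z * q z (snd x + fst x - z) else 0) \<in> borel_measurable ((borel \<Otimes>\<^sub>M borel) \<Otimes>\<^sub>M N)"
    unfolding case_prod_beta
    by (intro measurable_If borel_measurable_times causal_meas[OF q]) measurable
qed

lemma K2_meas:
  assumes q: "causal q" shows "(\<lambda>x. K2 q (fst x) (snd x)) \<in> borel_measurable borel"
  unfolding K2_def borel_prod[symmetric]
proof (rule N.borel_measurable_lebesgue_integral)
  show "(\<lambda>(x, z). if 0 < z \<and> z < fst x then J z * q z (snd x - fst x + z) else 0) \<in> borel_measurable ((borel \<Otimes>\<^sub>M borel) \<Otimes>\<^sub>M N)"
    unfolding case_prod_beta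
    by (intro measurable_If borel_measurable_times causal_meas[OF q]) measurable
qed

text \<open>The kernels are only regulated in \<open>y\<close>: the correction terms below are exactly the one-sided jumps
  across an atom.\<close>

definition jmp :: "real \<Rightarrow> real" where "jmp y = (if y \<in> A then J y else 0)"

lemma integral_N_singleton: "0 < y \<Longrightarrow> (LINT z|N. (if z = y then k else 0)) = (if y \<in> A then k else 0)" for k :: real
proof -
  have "(LINT z|N. (if z = y then k else 0)) = (LINT z|N. k * indicator {y} z)"
    by (intro Bochner_Integration.integral_cong) (auto simp: indicator_def)
  also assume "0 < y"
  then have "(LINT z|N. k * indicator {y} z) = (if y \<in> A then k else 0)"
    using measure_atom[of y] measure_atom'[of y] by (auto simp: measure_def)
  finally show ?thesis .
qed

lemma K1_tendsto:
  assumes q: "cauc q" and Y: "\<And>n. Y n \<ge> 0" "Y \<longlonglongrightarrow> y" and T: "T \<longlonglongrightarrow> t"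
  shows "(\<lambda>n. K1 q (Y n) (T n) - (if Y n < y then jmp y * q y t else 0)) \<longlonglongrightarrow> K1 q y t"
proof -
  note qc = cauc_causal[OF q]
  have y0: "y \<ge> 0" using Y LIMSEQ_le_const by blast
  obtain Rb where Rb: "\<And>n. \<bar>Y n + T n\<bar> \<le> Rb" 
    using convergent_imp_Bseq[OF convergentI[OF tendsto_add[OF Y(2) T]]] unfolding Bseq_def by auto
  define R where "R = max Rb (y + t)"
  have R: "Y n + T n \<le> R" "y + t \<le> R" for n using Rb[of n] by (auto simp: R_def)
  obtain B where B: "B \<ge> 0" "\<And>z s. 0 \<le> z \<Longrightarrow> z + s \<le> R \<Longrightarrow> \<bar>q z s\<bar> \<le> B" using causal_bound[OF qc] by blast
  \<comment> \<open>Pointwise convergence of the integrand can fail only at \<open>z = y\<close>,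
    which belongs to the range of integration exactly for those \<open>n\<close> with
    \<open>Y n < y\<close>. Subtracting the limiting value of this contribution for the same
    \<open>n\<close> removes the oscillation, and dominated convergence applies.\<close>
  define f where "f n z = (if Y n < z then J z * q z (T n + Y n - z) else 0) - (if z = y then if Y n < y then J y * q y t else 0 else 0)" for n z
  have sing: "integrable N (\<lambda>z. if z = y then if Y n < y then J y * q y t else 0 else 0)" for n
  proof (cases "y > 0")
    case True
    show ?thesis by (rule integrable_N(1)[of _ y "\<bar>J y * q y t\<bar>"]) (use True in auto)
  next
    case False
    then have "\<not> Y n < y" using Y(1)[of n] by simp
    then show ?thesis by simp
  qed
  have eq: "K1 q (Y n) (T n) - (if Y n < y then jmp y * q y t else 0) = (LINT z|N. f n z)" for n
  proof -
    have "(LINT z|N. f n z) = K1 q (Y n) (T n) - (LINT z|N. (if z = y then if Y n < y then J y * q y t else 0 else 0))"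
      unfolding f_def K1_def by (rule Bochner_Integration.integral_diff[OF K1_integrable[OF qc Y(1)] sing])
    moreover have "(LINT z|N. (if z = y then if Y n < y then J y * q y t else 0 else 0)) = (if Y n < y then jmp y * q y t else 0)"
      using integral_N_singleton[of y "J y * q y t"] Y(1)[of n] by (auto simp: jmp_def)
    ultimately show ?thesis by simp
  qed
  have "(\<lambda>n. LINT z|N. f n z) \<longlonglongrightarrow> (LINT z|N. (if y < z then J z * q z (t + y - z) else 0))"
  proof (rule integral_dominated_convergence[where w = "\<lambda>z. 2 * L * B * indicator {0<..max R y} z"])
    show "(\<lambda>z. if y < z then J z * q z (t + y - z) else 0) \<in> borel_measurable N"
      using K1_meas'[OF qc] by simp
    show "f n \<in> borel_measurable N" for n unfolding f_def
      using K1_meas'[OF qc, of "Y n" "T n"] by (intro borel_measurable_diff) auto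
    show "integrable N (\<lambda>z. 2 * L * B * indicator {0<..max R y} z)"
      using emeasure_N_Icc[of "max R y"] by (intro integrable_mult_right integrable_real_indicator) (auto simp: less_top)
    show "AE z in N. (\<lambda>n. f n z) \<longlonglongrightarrow> (if y < z then J z * q z (t + y - z) else 0)"
    proof (rule AE_I2)
      fix z
      have lim: "(\<lambda>n. q z (T n + Y n - z)) \<longlonglongrightarrow> q z (t + y - z)" if "z \<ge> 0"
        by (rule isCont_tendsto_compose[OF cauc_cont[OF q that]]) (intro tendsto_intros T Y)
      consider "z < y" | "y < z" | "z = y" by linarith
      then show "(\<lambda>n. f n z) \<longlonglongrightarrow> (if y < z then J z * q z (t + y - z) else 0)"
      proof cases
        case 1
        have "eventually (\<lambda>n. f n z = 0) sequentially"
          using order_tendstoD(1)[OF Y(2) 1] by eventually_elim (auto simp: f_def)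
        then show ?thesis using 1 by (auto intro: tendsto_eventually)
      next
        case 2
        then have z: "z \<ge> 0" using y0 by simp
        have "(\<lambda>n. J z * q z (T n + Y n - z)) \<longlonglongrightarrow> J z * q z (t + y - z)" by (intro tendsto_intros lim z)
        moreover have "eventually (\<lambda>n. J z * q z (T n + Y n - z) = f n z) sequentially"
          using order_tendstoD(2)[OF Y(2) 2] by eventually_elim (use 2 in \<open>auto simp: f_def\<close>)
        ultimately show ?thesis using 2 by (auto intro: Lim_transform_eventually)
      next
        case 3
        have "(\<lambda>n. J y * (q y (T n + Y n - y) - q y t)) \<longlonglongrightarrow> J y * (q y t - q y t)"
          using lim[unfolded 3] y0 by (intro tendsto_intros) auto
        then have "(\<lambda>n. if Y n < y then J y * (q y (T n + Y n - y) - q y t) else 0) \<longlonglongrightarrow> 0"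
          by (rule_tac tendsto_rabs_zero_cancel, rule_tac tendsto_sandwich[OF always_eventually always_eventually tendsto_const tendsto_rabs_zero]) auto
        moreover have "f n z = (if Y n < y then J y * (q y (T n + Y n - y) - q y t) else 0)" for n
          using 3 by (simp add: f_def right_diff_distrib)
        ultimately show ?thesis using 3 by simp
      qed
    qed
    show "AE z in N. norm (f n z) \<le> 2 * L * B * indicator {0<..max R y} z" for n
    proof (rule AE_I2)
      fix z
      have 1: "\<bar>if Y n < z then J z * q z (T n + Y n - z) else 0\<bar> \<le> L * B * indicator {0<..max R y} z"
      proof (cases "Y n < z \<and> z \<le> R")
        case True
        then have "\<bar>J z * q z (T n + Y n - z)\<bar> \<le> L * B" using R(1)[of n] Y(1)[of n] by (intro JB B) auto
        then show ?thesis using True Y(1)[of n] by (auto simp: indicator_def)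
      next
        case False
        then show ?thesis using causal_neg[OF qc] R(1)[of n] L_nonneg B(1) by (auto simp: indicator_def)
      qed
      have 2: "\<bar>if z = y then if Y n < y then J y * q y t else 0 else 0\<bar> \<le> L * B * indicator {0<..max R y} z"
      proof (cases "z = y \<and> Y n < y")
        case True
        then have "\<bar>J y * q y t\<bar> \<le> L * B" using R(2) y0 by (intro JB B) auto
        then show ?thesis using True Y(1)[of n] by (auto simp: indicator_def)
      qed (use L_nonneg B(1) in \<open>auto simp: indicator_def\<close>)
      show "norm (f n z) \<le> 2 * L * B * indicator {0<..max R y} z"
        unfolding f_def real_norm_def using 1 2 by linarith
    qed
  qed
  then show ?thesis by (simp only: eq K1_def[of q y t])
qed

lemma K2_tendsto:
  assumes q: "cauc q" and Y: "\<And>n. Y n \<ge> 0" "Y \<longlonglongrightarrow> y" and T: "T \<longlonglongrightarrow> t"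
  shows "(\<lambda>n. K2 q (Y n) (T n) - (if y < Y n then jmp y * q y t else 0)) \<longlonglongrightarrow> K2 q y t"
proof -
  note qc = cauc_causal[OF q]
  have y0: "y \<ge> 0" using Y LIMSEQ_le_const by blast
  obtain Rb where Rb: "\<And>n. \<bar>Y n + T n\<bar> \<le> Rb" 
    using convergent_imp_Bseq[OF convergentI[OF tendsto_add[OF Y(2) T]]] unfolding Bseq_def by auto
  obtain Yb where Yb: "\<And>n. \<bar>Y n\<bar> \<le> Yb" 
    using convergent_imp_Bseq[OF convergentI[OF Y(2)]] unfolding Bseq_def by auto
  define R where "R = max Rb (y + t)"
  have R: "Y n + T n \<le> R" "y + t \<le> R" for n using Rb[of n] by (auto simp: R_def)
  obtain B where B: "B \<ge> 0" "\<And>z s. 0 \<le> z \<Longrightarrow> z + s \<le> R \<Longrightarrow> \<bar>q z s\<bar> \<le> B" using causal_bound[OF qc] by blast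
  define C where "C = max Yb y"
  have C: "Y n \<le> C" "y \<le> C" for n using Yb[of n] by (auto simp: C_def)
  \<comment> \<open>As for \<open>K1\<close>, except that the point \<open>y\<close> is now included
    when \<open>Y n\<close> lies to its right; \<open>0 < y\<close> is there because
    \<open>K2\<close> integrates over positive \<open>z\<close> only.\<close>
  define f where "f n z = (if 0 < z \<and> z < Y n then J z * q z (T n - Y n + z) else 0) - (if z = y then if 0 < y \<and> y < Y n then J y * q y t else 0 else 0)" for n z
  have sing: "integrable N (\<lambda>z. if z = y then if 0 < y \<and> y < Y n then J y * q y t else 0 else 0)" for n
    by (rule integrable_N(1)[of _ y "\<bar>J y * q y t\<bar>"]) auto
  have eq: "K2 q (Y n) (T n) - (if y < Y n then jmp y * q y t else 0) = (LINT z|N. f n z)" for n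
  proof -
    have "(LINT z|N. f n z) = K2 q (Y n) (T n) - (LINT z|N. (if z = y then if 0 < y \<and> y < Y n then J y * q y t else 0 else 0))"
      unfolding f_def K2_def by (rule Bochner_Integration.integral_diff[OF K2_integrable[OF qc Y(1)] sing])
    moreover have "(LINT z|N. (if z = y then if 0 < y \<and> y < Y n then J y * q y t else 0 else 0)) = (if y < Y n then jmp y * q y t else 0)"
      using integral_N_singleton[of y "J y * q y t"] y0 A_pos by (cases "y = 0") (auto simp: jmp_def)
    ultimately show ?thesis by simp
  qed
  have "(\<lambda>n. LINT z|N. f n z) \<longlonglongrightarrow> (LINT z|N. (if 0 < z \<and> z < y then J z * q z (t - y + z) else 0))"
  proof (rule integral_dominated_convergence[where w = "\<lambda>z. 2 * L * B * indicator {0<..C} z"])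
    show "(\<lambda>z. if 0 < z \<and> z < y then J z * q z (t - y + z) else 0) \<in> borel_measurable N"
      using K2_meas'[OF qc] by simp
    show "f n \<in> borel_measurable N" for n unfolding f_def
      using K2_meas'[OF qc, of "Y n" "T n"] by (intro borel_measurable_diff) auto
    show "integrable N (\<lambda>z. 2 * L * B * indicator {0<..C} z)"
      using emeasure_N_Icc[of "C"] by (intro integrable_mult_right integrable_real_indicator) (auto simp: less_top)
    show "AE z in N. (\<lambda>n. f n z) \<longlonglongrightarrow> (if 0 < z \<and> z < y then J z * q z (t - y + z) else 0)"
    proof (rule AE_I2)
      fix z
      have lim: "(\<lambda>n. q z (T n - Y n + z)) \<longlonglongrightarrow> q z (t - y + z)" if "z \<ge> 0"
        by (rule isCont_tendsto_compose[OF cauc_cont[OF q that]]) (intro tendsto_intros T Y)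
      consider "z \<le> 0" | "0 < z" "z < y" | "0 < z" "y < z" | "0 < z" "z = y" by linarith
      then show "(\<lambda>n. f n z) \<longlonglongrightarrow> (if 0 < z \<and> z < y then J z * q z (t - y + z) else 0)"
      proof cases
        case 1
        then have "f n z = 0" for n by (auto simp: f_def)
        then show ?thesis using 1 by simp
      next
        case 3
        have "eventually (\<lambda>n. f n z = 0) sequentially"
          using order_tendstoD(2)[OF Y(2) 3(2)] by eventually_elim (auto simp: f_def)
        then show ?thesis using 3 by (auto intro: tendsto_eventually)
      next
        case 2
        have "(\<lambda>n. J z * q z (T n - Y n + z)) \<longlonglongrightarrow> J z * q z (t - y + z)" using 2 by (intro tendsto_intros lim) auto
        moreover have "eventually (\<lambda>n. J z * q z (T n - Y n + z) = f n z) sequentially"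
          using order_tendstoD(1)[OF Y(2) 2(2)] by eventually_elim (use 2 in \<open>auto simp: f_def\<close>)
        ultimately show ?thesis using 2 by (auto intro: Lim_transform_eventually)
      next
        case 4
        have "(\<lambda>n. J y * (q y (T n - Y n + y) - q y t)) \<longlonglongrightarrow> J y * (q y t - q y t)"
          using lim[unfolded 4] y0 by (intro tendsto_intros) auto
        then have "(\<lambda>n. if y < Y n then J y * (q y (T n - Y n + y) - q y t) else 0) \<longlonglongrightarrow> 0"
          by (rule_tac tendsto_rabs_zero_cancel, rule_tac tendsto_sandwich[OF always_eventually always_eventually tendsto_const tendsto_rabs_zero]) auto
        moreover have "f n z = (if y < Y n then J y * (q y (T n - Y n + y) - q y t) else 0)" for n
          using 4 by (simp add: f_def right_diff_distrib)
        ultimately show ?thesis using 4 by simp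
      qed
    qed
    show "AE z in N. norm (f n z) \<le> 2 * L * B * indicator {0<..C} z" for n
    proof (rule AE_I2)
      fix z
      have 1: "\<bar>if 0 < z \<and> z < Y n then J z * q z (T n - Y n + z) else 0\<bar> \<le> L * B * indicator {0<..C} z"
      proof (cases "0 < z \<and> z < Y n")
        case True
        then have "\<bar>J z * q z (T n - Y n + z)\<bar> \<le> L * B" using R(1)[of n] Y(1)[of n] by (intro JB B) auto
        then show ?thesis using True C(1)[of n] by (auto simp: indicator_def)
      qed (use L_nonneg B(1) in \<open>auto simp: indicator_def\<close>)
      have 2: "\<bar>if z = y then if 0 < y \<and> y < Y n then J y * q y t else 0 else 0\<bar> \<le> L * B * indicator {0<..C} z"
      proof (cases "z = y \<and> 0 < y \<and> y < Y n")
        case True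
        then have "\<bar>J y * q y t\<bar> \<le> L * B" using R(2) y0 by (intro JB B) auto
        then show ?thesis using True C(2) by (auto simp: indicator_def)
      qed (use L_nonneg B(1) in \<open>auto simp: indicator_def\<close>)
      show "norm (f n z) \<le> 2 * L * B * indicator {0<..C} z"
        unfolding f_def real_norm_def using 1 2 by linarith
    qed
  qed
  then show ?thesis by (simp only: eq K2_def[of q y t])
qed

end

section \<open>The Volterra equation\<close>

lemma geometric_increments_limit:
  fixes x :: "nat \<Rightarrow> real"
  assumes x: "\<And>n. \<bar>x (Suc n) - x n\<bar> \<le> C / 2 ^ n"
  shows "convergent x" and "\<bar>lim x - x n\<bar> \<le> 2 * C / 2 ^ n"
proof -
  have inc: "\<bar>x (n + k) - x n\<bar> \<le> 2 * C / 2 ^ n - 2 * C / 2 ^ (n + k)" for n k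
  proof (induction k)
    case (Suc k)
    have "C / 2 ^ (n + k) = 2 * C / 2 ^ (n + k) - 2 * C / 2 ^ (n + Suc k)" by (simp add: field_simps)
    then show ?case using Suc x[of "n + k"] by simp
  qed simp
  have C0: "C \<ge> 0" using x[of 0] by simp
  have inc': "\<bar>x (n + k) - x n\<bar> \<le> 2 * C / 2 ^ n" for n k
  proof -
    have "0 \<le> 2 * C / 2 ^ (n + k)" using C0 by simp
    then show ?thesis using inc[of n k] by linarith
  qed
  have lim0: "(\<lambda>n. 2 * C / 2 ^ n) \<longlonglongrightarrow> 0"
    using tendsto_mult_right_zero[OF LIMSEQ_power_zero[of "1/2::real"], of "2 * C"] by (simp add: power_divide)
  show cv: "convergent x"
  proof (rule Cauchy_convergent, rule CauchyI')
    fix e :: real assume "e > 0"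
    then have "eventually (\<lambda>n. 2 * C / 2 ^ n < e) sequentially" using order_tendstoD(2)[OF lim0] by simp
    then obtain n0 where n0: "\<And>n. n \<ge> n0 \<Longrightarrow> 2 * C / 2 ^ n < e" unfolding eventually_sequentially by auto
    show "\<exists>M. \<forall>m\<ge>M. \<forall>n>m. dist (x m) (x n) < e"
    proof (intro exI[of _ n0] allI impI)
      fix m n assume "n0 \<le> m" "m < n"
      then show "dist (x m) (x n) < e" using inc'[of m "n - m"] n0[of m] by (simp add: dist_real_def abs_minus_commute)
    qed
  qed
  have "x \<longlonglongrightarrow> lim x" using cv by (simp add: convergent_LIMSEQ_iff)
  then have "(\<lambda>k. \<bar>x (k + n) - x n\<bar>) \<longlonglongrightarrow> \<bar>lim x - x n\<bar>"
    by (intro tendsto_intros LIMSEQ_ignore_initial_segment)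
  then show "\<bar>lim x - x n\<bar> \<le> 2 * C / 2 ^ n"
    by (rule LIMSEQ_le_const2) (use inc'[of n] in \<open>auto simp: add.commute\<close>)
qed

text \<open>The value \<open>2 / l\<close> is the integral of
  \<open>exp (- l * \<bar>y - z\<bar>)\<close> over the whole line. For nonnegative \<open>y\<close>
  and \<open>z\<close> the sum \<open>y + z\<close> is at least \<open>\<bar>y - z\<bar>\<close>,
  which reduces the second estimate to the first.\<close>

lemma exp_decay_integral:
  fixes \<omega> :: "real \<Rightarrow> real"
  assumes l: "l > 0" and y: "0 \<le> y" "y \<le> R" and w: "\<And>z. 0 \<le> \<omega> z \<and> \<omega> z \<le> 1"
  shows "(LINT z|lborel. (if 0 < z \<and> z \<le> R \<and> z \<noteq> y then exp (-(l * \<bar>y - z\<bar>)) * \<omega> z else 0)) \<le> 2 / l" (is ?A)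
    and "(LINT z|lborel. (if 0 < z \<and> z \<le> R then exp (-(l * (y + z))) * \<omega> z else 0)) \<le> 2 / l" (is ?B)
proof -
  define g where "g z = exp (l * (z - y)) * indicator {0..y} z + exp (l * (y - z)) * indicator {y..R} z" for z
  have 1: "has_bochner_integral lborel (\<lambda>z. exp (l * (z - y)) * indicator {0..y} z) (exp (l * (y - y)) / l - exp (l * (0 - y)) / l)"
    by (rule has_bochner_integral_FTC_Icc_real) (use l y in \<open>auto intro!: derivative_eq_intros continuous_intros\<close>)
  have 2: "has_bochner_integral lborel (\<lambda>z. exp (l * (y - z)) * indicator {y..R} z) (- exp (l * (y - R)) / l - (- exp (l * (y - y)) / l))"
    by (rule has_bochner_integral_FTC_Icc_real) (use l y in \<open>auto intro!: derivative_eq_intros continuous_intros\<close>)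
  have g: "has_bochner_integral lborel g (exp (l * (y - y)) / l - exp (l * (0 - y)) / l + (- exp (l * (y - R)) / l - (- exp (l * (y - y)) / l)))"
    unfolding g_def by (rule has_bochner_integral_add[OF 1 2])
  have gi: "integrable lborel g" and gv: "integral\<^sup>L lborel g \<le> 2 / l"
  proof -
    show "integrable lborel g" using g by (rule integrable.intros)
    have "integral\<^sup>L lborel g = 2 / l - exp (l * (0 - y)) / l - exp (l * (y - R)) / l"
      using has_bochner_integral_integral_eq[OF g] by simp
    also have "\<dots> \<le> 2 / l"
    proof -
      have "0 \<le> exp (l * (0 - y)) / l" "0 \<le> exp (l * (y - R)) / l" using l by simp_all
      then show ?thesis by linarith
    qed
    finally show "integral\<^sup>L lborel g \<le> 2 / l" .
  qed
  have g0: "g z \<ge> 0" for z by (auto simp: g_def indicator_def)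
  have "(if 0 < z \<and> z \<le> R \<and> z \<noteq> y then exp (-(l * \<bar>y - z\<bar>)) * \<omega> z else 0) \<le> g z" for z
  proof (cases "0 < z \<and> z \<le> R \<and> z \<noteq> y")
    case True
    have "exp (-(l * \<bar>y - z\<bar>)) * \<omega> z \<le> exp (-(l * \<bar>y - z\<bar>)) * 1" by (rule mult_left_mono) (use w in auto)
    also have "\<dots> \<le> g z" using True y by (cases "z < y") (auto simp: g_def indicator_def algebra_simps abs_if)
    finally show ?thesis using True by simp
  qed (use g0 in auto)
  then have "(LINT z|lborel. (if 0 < z \<and> z \<le> R \<and> z \<noteq> y then exp (-(l * \<bar>y - z\<bar>)) * \<omega> z else 0)) \<le> integral\<^sup>L lborel g"
    by (rule integral_mono'[OF gi]) (use g0 in auto)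
  then show ?A using gv by simp
  have "(if 0 < z \<and> z \<le> R then exp (-(l * (y + z))) * \<omega> z else 0) \<le> g z" for z
  proof (cases "0 < z \<and> z \<le> R")
    case True
    have "exp (-(l * (y + z))) * \<omega> z \<le> exp (-(l * (y + z))) * 1" by (rule mult_left_mono) (use w in auto)
    also have "\<dots> \<le> exp (-(l * \<bar>y - z\<bar>))" using l y True by (simp add: abs_le_iff)
    also have "\<dots> \<le> g z" using True y by (cases "z < y") (auto simp: g_def indicator_def algebra_simps abs_if)
    finally show ?thesis using True by simp
  qed (use g0 in auto)
  then have "(LINT z|lborel. (if 0 < z \<and> z \<le> R then exp (-(l * (y + z))) * \<omega> z else 0)) \<le> integral\<^sup>L lborel g"
    by (rule integral_mono'[OF gi]) (use g0 in auto)
  then show ?B using gv by simp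
qed

context medium
begin

text \<open>At an atom the weight is smaller by the factor \<open>\<kappa>\<close>. A reflection at an atom is felt without delay nearby, and
  this makes its contribution small; atoms influence each other only after the time between them.\<close>

lemma weight_exists:
  assumes e: "e > 0"
  shows "\<exists>l \<omega> \<kappa>. l > 0 \<and> \<kappa> > 0 \<and> \<omega> \<in> borel_measurable borel \<and> (\<forall>z. \<kappa> \<le> \<omega> z \<and> \<omega> z \<le> 1) \<and>
    (\<forall>y. 0 \<le> y \<and> y \<le> R \<longrightarrow>
      (LINT z|N. (if 0 < z \<and> z \<le> R \<and> z \<noteq> y then exp (-(l * \<bar>y - z\<bar>)) * \<omega> z else 0)) \<le> e * \<omega> y \<and>
      (LINT z|N. (if 0 < z \<and> z \<le> R then exp (-(l * (y + z))) * \<omega> z else 0)) \<le> e * \<omega> y)"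
proof -
  define S where "S = A \<inter> {0<..R}"
  have fS: "finite S" unfolding S_def by (rule A_finite)
  define n where "n = real (card S)"
  \<comment> \<open>The minimum \<open>d\<close> bounds from below the travel time between two atoms
    and between an atom and the boundary; the element 1 keeps it defined when there are no
    atoms.\<close>
  define D where "D = insert 1 (S \<union> (\<lambda>(a, b). \<bar>a - b\<bar>) ` {(a, b) \<in> S \<times> S. a \<noteq> b})"
  have "finite {(a, b) \<in> S \<times> S. a \<noteq> b}" by (rule finite_subset[of _ "S \<times> S"]) (use fS in auto)
  then have fD: "finite D" unfolding D_def using fS by simp
  define d where "d = Min D"
  have "d > 0" unfolding d_def using fD by (subst Min_gr_iff) (auto simp: D_def S_def)
  have dS: "d \<le> a" if "a \<in> S" for a unfolding d_def by (rule Min_le[OF fD]) (use that in \<open>auto simp: D_def\<close>)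
  have dSS: "d \<le> \<bar>a - b\<bar>" if "a \<in> S" "b \<in> S" "a \<noteq> b" for a b unfolding d_def by (rule Min_le[OF fD]) (use that in \<open>auto simp: D_def\<close>)
  \<comment> \<open>With weight \<open>k\<close> the \<open>n\<close> atoms together contribute at
    most \<open>e / 2\<close> at a point that is not an atom.\<close>
  define k where "k = min 1 (e / (2 * n + 2))"
  have n0: "n \<ge> 0" by (simp add: n_def)
  have k: "k > 0" "k \<le> 1" unfolding k_def using e n0 by auto
  have nk: "n * k \<le> e / 2"
  proof -
    have "n * k \<le> n * (e / (2 * n + 2))" unfolding k_def using n0 by (intro mult_left_mono) auto
    also have "\<dots> \<le> e / 2" using n0 e by (simp add: field_simps)
    finally show ?thesis .
  qed
  \<comment> \<open>The first entry brings the Lebesgue part down to \<open>e * k / 2\<close>, small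
    even in comparison with the reduced weight at an atom. The second yields
    \<open>n * exp (-(l * d)) \<le> e / 2\<close>, which controls the effect on an atom of all the
    other ones.\<close>
  define l where "l = max (4 / (e * k)) (2 * n / (e * d) + 1)"
  have l: "l > 0" using e k unfolding l_def by (auto simp: less_max_iff_disj)
  have l1: "2 / l \<le> e * k / 2"
  proof -
    have "4 / (e * k) \<le> l" by (simp add: l_def)
    then show ?thesis using l e k by (simp add: field_simps)
  qed
  have l2: "n * exp (-(l * d)) \<le> e / 2"
  proof -
    have "2 * n / (e * d) \<le> l" by (simp add: l_def)
    then have "2 * n \<le> l * (e * d)" using e \<open>d > 0\<close> by (simp add: field_simps)
    then have "2 * n \<le> e * (l * d)" by (simp add: mult.commute mult.left_commute)
    also have "\<dots> \<le> e * exp (l * d)" using e exp_ge_add_one_self[of "l * d"] by (intro mult_left_mono) linarith+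
    finally show ?thesis by (simp add: exp_minus field_simps)
  qed
  define w where "w z = (if z \<in> S then k else 1)" for z
  have wm[measurable]: "w \<in> borel_measurable borel"
  proof -
    have "S \<in> sets borel" using fS by (simp add: finite_imp_closed borel_closed)
    then show ?thesis unfolding w_def by measurable
  qed
  have wb: "k \<le> w z \<and> w z \<le> 1" "0 \<le> w z \<and> w z \<le> 1" for z using k by (auto simp: w_def)
  have sumk: "(\<Sum>a\<in>S. f a) \<le> n * b" if "\<And>a. a \<in> S \<Longrightarrow> f a \<le> b" for f and b :: real
    using sum_bounded_above[of S f b] that by (simp add: n_def)
  have main: "(LINT z|N. (if 0 < z \<and> z \<le> R \<and> z \<noteq> y then exp (-(l * \<bar>y - z\<bar>)) * w z else 0)) \<le> e * w y \<and>
      (LINT z|N. (if 0 < z \<and> z \<le> R then exp (-(l * (y + z))) * w z else 0)) \<le> e * w y" if y: "0 \<le> y" "y \<le> R" for y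
  proof -
    have b1: "\<bar>exp (-(l * \<bar>y - z\<bar>)) * w z\<bar> \<le> 1" for z
      unfolding abs_mult using wb[of z] l by (intro mult_le_one) auto
    have b2: "\<bar>exp (-(l * (y + z))) * w z\<bar> \<le> 1" if "0 < z" for z
      unfolding abs_mult using wb[of z] l that y by (intro mult_le_one) auto
    have s1: "(LINT z|N. (if 0 < z \<and> z \<le> R \<and> z \<noteq> y then exp (-(l * \<bar>y - z\<bar>)) * w z else 0)) =
       (LINT z|lborel. (if 0 < z \<and> z \<le> R \<and> z \<noteq> y then exp (-(l * \<bar>y - z\<bar>)) * w z else 0)) +
       (\<Sum>z\<in>S. (if 0 < z \<and> z \<le> R \<and> z \<noteq> y then exp (-(l * \<bar>y - z\<bar>)) * w z else 0))"
      unfolding S_def by (rule integral_N_split[where B = 1]) (use b1 in auto)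
    have s2: "(LINT z|N. (if 0 < z \<and> z \<le> R then exp (-(l * (y + z))) * w z else 0)) =
       (LINT z|lborel. (if 0 < z \<and> z \<le> R then exp (-(l * (y + z))) * w z else 0)) +
       (\<Sum>z\<in>S. (if 0 < z \<and> z \<le> R then exp (-(l * (y + z))) * w z else 0))"
      unfolding S_def by (rule integral_N_split[where B = 1]) (use b2 in auto)
    note lb = exp_decay_integral[where \<omega> = w, OF l y wb(2)]
    show ?thesis
    proof (cases "y \<in> S")
      case True
      have t1: "(\<Sum>z\<in>S. (if 0 < z \<and> z \<le> R \<and> z \<noteq> y then exp (-(l * \<bar>y - z\<bar>)) * w z else 0)) \<le> n * (exp (-(l * d)) * k)"
        using dSS[OF True] l k by (intro sumk) (auto simp: w_def)
      have t2: "(\<Sum>z\<in>S. (if 0 < z \<and> z \<le> R then exp (-(l * (y + z))) * w z else 0)) \<le> n * (exp (-(l * d)) * k)"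
      proof (rule sumk)
        fix z assume z: "z \<in> S"
        have "d \<le> y + z" using dS[OF True] z by (auto simp: S_def)
        then show "(if 0 < z \<and> z \<le> R then exp (-(l * (y + z))) * w z else 0) \<le> exp (-(l * d)) * k"
          using l k z by (auto simp: w_def)
      qed
      have "n * (exp (-(l * d)) * k) \<le> e / 2 * k"
        using mult_right_mono[OF l2, of k] k by (simp add: mult.assoc)
      moreover have "e * w y = e * k" using True by (simp add: w_def)
      moreover have "e / 2 * k = e * k / 2" by simp
      ultimately show ?thesis using lb l1 t1 t2 unfolding s1 s2 by (intro conjI) linarith+
    next
      case False
      have t1: "(\<Sum>z\<in>S. (if 0 < z \<and> z \<le> R \<and> z \<noteq> y then exp (-(l * \<bar>y - z\<bar>)) * w z else 0)) \<le> n * k"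
        using l k by (intro sumk) (auto simp: w_def)
      have t2: "(\<Sum>z\<in>S. (if 0 < z \<and> z \<le> R then exp (-(l * (y + z))) * w z else 0)) \<le> n * k"
        using l k y by (intro sumk) (auto simp: w_def)
      have "e * k / 2 \<le> e / 2" using e k by simp
      moreover have "e * w y = e" using False by (simp add: w_def)
      ultimately show ?thesis using lb l1 t1 t2 nk unfolding s1 s2 by (intro conjI) linarith+
    qed
  qed
  show ?thesis
    by (intro exI[of _ l] exI[of _ w] exI[of _ k] conjI allI impI wm) (use l k wb main in auto)
qed

text \<open>In the norm with weight \<open>w z * exp (l * s)\<close> the delay between source and
  receiver becomes the factor \<open>exp (-(l * \<bar>y - z\<bar>))\<close>, and the two integral
  conditions on \<open>w\<close> are the resulting operator bounds. The third estimate concerns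
  signals that return from the boundary and have the delay \<open>y + z\<close>. It covers all
  \<open>r \<le> t - y\<close>, since the trace at time \<open>t - y\<close> depends on everything
  received before.\<close>

lemma K_weighted:
  assumes q: "causal q" and M: "M \<ge> 0" and l: "l > 0" and w[measurable]: "w \<in> borel_measurable borel"
    and wb: "\<And>z. 0 < w z \<and> w z \<le> 1"
    and B: "\<And>z s. 0 \<le> z \<Longrightarrow> z + s \<le> R \<Longrightarrow> \<bar>q z s\<bar> \<le> M * w z * exp (l * s)"
    and y: "0 \<le> y" "y + t \<le> R" and e: "e \<ge> 0"
    and W1: "0 \<le> y \<Longrightarrow> y \<le> R \<Longrightarrow> (LINT z|N. (if 0 < z \<and> z \<le> R \<and> z \<noteq> y then exp (-(l * \<bar>y - z\<bar>)) * w z else 0)) \<le> e * w y"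
    and W2: "0 \<le> y \<Longrightarrow> y \<le> R \<Longrightarrow> (LINT z|N. (if 0 < z \<and> z \<le> R then exp (-(l * (y + z))) * w z else 0)) \<le> e * w y"
  shows "\<bar>K1 q y t\<bar> \<le> L * M * e * (w y * exp (l * t))" (is ?A)
    and "\<bar>K2 q y t\<bar> \<le> L * M * e * (w y * exp (l * t))" (is ?B)
    and "r \<le> t - y \<Longrightarrow> \<bar>K1 q 0 r\<bar> \<le> L * M * e * (w y * exp (l * t))"
proof -
  have nonneg: "0 \<le> L * M * e * (w y * exp (l * t))"
    using L_nonneg M e wb[of y] by simp
  have LB: "\<bar>J z * q z s\<bar> \<le> L * (M * w z * exp (l * s))" if "0 \<le> z" "z + s \<le> R" for z s
    by (rule JB[OF B[OF that]])
  show ?A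
  proof (cases "t < 0")
    case True then show ?thesis using K1_neg[OF q] nonneg by simp
  next
    case False
    then have yR: "y \<le> R" using y by simp
    define f where "f z = (if 0 < z \<and> z \<le> R \<and> z \<noteq> y then exp (-(l * \<bar>y - z\<bar>)) * w z else 0)" for z
    have [measurable]: "f \<in> borel_measurable borel" unfolding f_def by measurable
    have f1: "0 \<le> f z" "\<bar>f z\<bar> \<le> 1" for z unfolding f_def using wb[of z] l by (auto simp: abs_mult intro!: mult_le_one)
    have fi: "integrable N f" by (rule integrable_N(1)[of _ R 1], measurable, rule f1(2), auto simp: f_def)
    have "\<bar>K1 q y t\<bar> \<le> (LINT z|N. \<bar>if y < z then J z * q z (t + y - z) else 0\<bar>)"
      unfolding K1_def by (rule integral_abs_bound)
    also have "\<dots> \<le> (LINT z|N. L * M * exp (l * t) * f z)"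
    proof (rule integral_mono'[OF integrable_mult_right[OF fi]])
      fix z
      show "\<bar>if y < z then J z * q z (t + y - z) else 0\<bar> \<le> L * M * exp (l * t) * f z"
      proof (cases "y < z \<and> z \<le> R")
        case True
        have "\<bar>J z * q z (t + y - z)\<bar> \<le> L * (M * w z * exp (l * (t + y - z)))" by (rule LB) (use True y in auto)
        also have "exp (l * (t + y - z)) = exp (l * t) * exp (-(l * \<bar>y - z\<bar>))" using True by (simp flip: exp_add add: algebra_simps)
        finally show ?thesis using True y by (simp add: f_def mult_ac)
      next
        case False
        have "(if y < z then J z * q z (t + y - z) else 0) = 0" using False y causal_neg[OF q] by auto
        then show ?thesis using f1(1)[of z] L_nonneg M by simp
      qed
      show "0 \<le> L * M * exp (l * t) * f z" using f1(1)[of z] L_nonneg M by simp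
    qed
    also have "\<dots> = L * M * exp (l * t) * (LINT z|N. f z)" by simp
    also have "\<dots> \<le> L * M * exp (l * t) * (e * w y)"
      by (rule mult_left_mono) (use W1[OF y(1) yR] L_nonneg M in \<open>auto simp: f_def\<close>)
    finally show ?thesis by (simp add: mult_ac)
  qed
  show ?B
  proof (cases "t < 0")
    case True then show ?thesis using K2_neg[OF q] nonneg by simp
  next
    case False
    then have yR: "y \<le> R" using y by simp
    define f where "f z = (if 0 < z \<and> z \<le> R \<and> z \<noteq> y then exp (-(l * \<bar>y - z\<bar>)) * w z else 0)" for z
    have [measurable]: "f \<in> borel_measurable borel" unfolding f_def by measurable
    have f1: "0 \<le> f z" "\<bar>f z\<bar> \<le> 1" for z unfolding f_def using wb[of z] l by (auto simp: abs_mult intro!: mult_le_one)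
    have fi: "integrable N f" by (rule integrable_N(1)[of _ R 1], measurable, rule f1(2), auto simp: f_def)
    have "\<bar>K2 q y t\<bar> \<le> (LINT z|N. \<bar>if 0 < z \<and> z < y then J z * q z (t - y + z) else 0\<bar>)"
      unfolding K2_def by (rule integral_abs_bound)
    also have "\<dots> \<le> (LINT z|N. L * M * exp (l * t) * f z)"
    proof (rule integral_mono'[OF integrable_mult_right[OF fi]])
      fix z
      show "\<bar>if 0 < z \<and> z < y then J z * q z (t - y + z) else 0\<bar> \<le> L * M * exp (l * t) * f z"
      proof (cases "0 < z \<and> z < y")
        case True
        have "\<bar>J z * q z (t - y + z)\<bar> \<le> L * (M * w z * exp (l * (t - y + z)))" by (rule LB) (use True y in auto)
        also have "exp (l * (t - y + z)) = exp (l * t) * exp (-(l * \<bar>y - z\<bar>))" using True by (simp flip: exp_add add: algebra_simps)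
        finally show ?thesis using True yR by (simp add: f_def mult_ac)
      next
        case False
        then show ?thesis using f1(1)[of z] L_nonneg M by auto
      qed
      show "0 \<le> L * M * exp (l * t) * f z" using f1(1)[of z] L_nonneg M by simp
    qed
    also have "\<dots> = L * M * exp (l * t) * (LINT z|N. f z)" by simp
    also have "\<dots> \<le> L * M * exp (l * t) * (e * w y)"
      by (rule mult_left_mono) (use W1[OF y(1) yR] L_nonneg M in \<open>auto simp: f_def\<close>)
    finally show ?thesis by (simp add: mult_ac)
  qed
  assume r: "r \<le> t - y"
  show "\<bar>K1 q 0 r\<bar> \<le> L * M * e * (w y * exp (l * t))"
  proof (cases "r < 0")
    case True then show ?thesis using K1_neg[OF q] nonneg by simp
  next
    case False
    then have yR: "y \<le> R" "r \<le> R" using y r by auto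
    define f where "f z = (if 0 < z \<and> z \<le> R then exp (-(l * (y + z))) * w z else 0)" for z
    have [measurable]: "f \<in> borel_measurable borel" unfolding f_def by measurable
    have f1: "0 \<le> f z" "\<bar>f z\<bar> \<le> 1" for z unfolding f_def using wb[of z] l y by (auto simp: abs_mult intro!: mult_le_one)
    have fi: "integrable N f" by (rule integrable_N(1)[of _ R 1], measurable, rule f1(2), auto simp: f_def)
    have "\<bar>K1 q 0 r\<bar> \<le> (LINT z|N. \<bar>if 0 < z then J z * q z (r + 0 - z) else 0\<bar>)"
      unfolding K1_def by (rule integral_abs_bound)
    also have "\<dots> \<le> (LINT z|N. L * M * exp (l * t) * f z)"
    proof (rule integral_mono'[OF integrable_mult_right[OF fi]])
      fix z
      show "\<bar>if 0 < z then J z * q z (r + 0 - z) else 0\<bar> \<le> L * M * exp (l * t) * f z"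
      proof (cases "0 < z \<and> z \<le> R")
        case True
        have "\<bar>J z * q z (r + 0 - z)\<bar> \<le> L * (M * w z * exp (l * (r + 0 - z)))" by (rule LB) (use True yR in auto)
        also have "\<dots> \<le> L * (M * w z * exp (l * (t - y - z)))"
          using l r L_nonneg M wb[of z] by (intro mult_left_mono) auto
        also have "exp (l * (t - y - z)) = exp (l * t) * exp (-(l * (y + z)))" by (simp flip: exp_add add: algebra_simps)
        finally show ?thesis using True yR by (simp add: f_def mult_ac)
      next
        case False
        have "(if 0 < z then J z * q z (r + 0 - z) else 0) = 0" using False yR causal_neg[OF q] by auto
        then show ?thesis using f1(1)[of z] L_nonneg M by simp
      qed
      show "0 \<le> L * M * exp (l * t) * f z" using f1(1)[of z] L_nonneg M by simp
    qed
    also have "\<dots> = L * M * exp (l * t) * (LINT z|N. f z)" by simp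
    also have "\<dots> \<le> L * M * exp (l * t) * (e * w y)"
      by (rule mult_left_mono) (use W2[OF y(1) yR(1)] L_nonneg M in \<open>auto simp: f_def\<close>)
    finally show ?thesis by (simp add: mult_ac)
  qed
qed

end

lemma isCont_sequentiallyI:
  fixes f :: "real \<Rightarrow> real"
  assumes "\<And>S. S \<longlonglongrightarrow> a \<Longrightarrow> (\<lambda>n. f (S n)) \<longlonglongrightarrow> f a"
  shows "isCont f a"
  unfolding isCont_def LIMSEQ_SEQ_conv[symmetric] using assms by blast

context medium
begin

lemma K1_isCont: "cauc q \<Longrightarrow> y \<ge> 0 \<Longrightarrow> isCont (K1 q y) t"
  using K1_tendsto[of q "\<lambda>_. y" y] by (intro isCont_sequentiallyI) simp

lemma K2_isCont: "cauc q \<Longrightarrow> y \<ge> 0 \<Longrightarrow> isCont (K2 q y) t"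
  using K2_tendsto[of q "\<lambda>_. y" y] by (intro isCont_sequentiallyI) simp

lemma jmp_0: "jmp 0 = 0"
  using A_pos by (auto simp: jmp_def)

lemma cl_eq_jmp: "cl y = c y - jmp y"
  by (simp add: cl_def jmp_def)

lemma J_integrable: "0 \<le> a \<Longrightarrow> integrable N (\<lambda>z. if a < z \<and> z \<le> b then J z else 0)"
  by (rule integrable_N(1)[of _ b L]) (use J_bound L_nonneg in auto)

lemma cl_eq: assumes y: "y \<ge> 0" shows "cl y = c 0 + (LINT z|N. (if 0 < z \<and> z < y then J z else 0))"
proof (cases "y = 0")
  case True
  have "(LINT z|N. (if 0 < z \<and> z < 0 then J z else 0)) = (LINT z|N. 0)"
    by (rule Bochner_Integration.integral_cong) auto
  then show ?thesis using True by (simp add: cl_0)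
next
  case False
  have 1: "(LINT z|N. (if 0 < z \<and> z \<le> y then J z else 0)) - (LINT z|N. (if z = y then J y else 0)) =
    (LINT z|N. (if 0 < z \<and> z \<le> y then J z else 0) - (if z = y then J y else 0))"
    by (rule Bochner_Integration.integral_diff[symmetric], rule J_integrable, simp,
        rule integrable_N(1)[of _ y "\<bar>J y\<bar>"]) (use False y in auto)
  have 2: "(LINT z|N. (if 0 < z \<and> z \<le> y then J z else 0) - (if z = y then J y else 0)) = (LINT z|N. (if 0 < z \<and> z < y then J z else 0))"
    by (rule Bochner_Integration.integral_cong) (use False y in auto)
  show ?thesis using 1[unfolded 2] c_diff[of 0 y] integral_N_singleton[of y "J y"] False y
    by (simp add: cl_eq_jmp jmp_def)
qed

text \<open>The truncations \<open>min 1 (max 0 s)\<close> make the indicator of an interval accessible to the limit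
  theorems for the kernels.\<close>

lemma cauc_clamp: "cauc (\<lambda>z s. if z \<le> R then min 1 (max 0 s) else 0)"
  unfolding cauc_def causal_def
proof (intro conjI allI impI)
  show "(\<lambda>x::real \<times> real. if fst x \<le> R then min 1 (max 0 (snd x)) else 0) \<in> borel_measurable borel"
    unfolding borel_prod[symmetric] by measurable
  show "\<exists>B. \<forall>y t. 0 \<le> y \<longrightarrow> y + t \<le> Ra \<longrightarrow> \<bar>if y \<le> R then min 1 (max 0 t) else 0\<bar> \<le> B" for Ra
    by (rule exI[of _ 1]) auto
  show "continuous_on UNIV (\<lambda>s::real. if y \<le> R then min 1 (max 0 s) else (0::real))" for y
    by (cases "y \<le> R") (auto intro!: continuous_intros)
qed auto

lemma c_tendsto:
  assumes Y: "\<And>n. Y n \<ge> 0" "Y \<longlonglongrightarrow> y"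
  shows "(\<lambda>n. c (Y n) + (if Y n < y then jmp y else 0)) \<longlonglongrightarrow> c y"
    and "(\<lambda>n. cl (Y n) - (if y < Y n then jmp y else 0)) \<longlonglongrightarrow> cl y"
proof -
  obtain Yb where Yb: "\<And>n. \<bar>Y n\<bar> \<le> Yb" 
    using convergent_imp_Bseq[OF convergentI[OF Y(2)]] unfolding Bseq_def by auto
  have y0: "y \<ge> 0" using Y LIMSEQ_le_const by blast
  define R where "R = max Yb y"
  have R: "Y n \<le> R" "y \<le> R" for n using Yb[of n] by (auto simp: R_def)
  let ?q = "\<lambda>z s. if z \<le> R then min 1 (max 0 s) else (0::real)"
  \<comment> \<open>At these times the truncated function has reached 1 on the whole range of
    integration, so the kernels return increments of \<open>c\<close> and \<open>cl\<close>; the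
    cutoff at \<open>R\<close> bounds the range of \<open>K1\<close>.\<close>
  have k1: "K1 ?q z (R + 1) = c R - c z" if "0 \<le> z" "z \<le> R" for z
    unfolding K1_def c_diff[OF that] by (rule Bochner_Integration.integral_cong) (use that in auto)
  have k2: "K2 ?q z (z + 1) = cl z - c 0" if "0 \<le> z" "z \<le> R" for z
    unfolding K2_def using cl_eq[OF that(1)] that by (auto intro!: Bochner_Integration.integral_cong)
  have "?q y (R + 1) = 1" using R y0 by auto
  with K1_tendsto[OF cauc_clamp[of R] Y tendsto_const[of "R + 1"]]
  have "(\<lambda>n. K1 ?q (Y n) (R + 1) - (if Y n < y then jmp y * 1 else 0)) \<longlonglongrightarrow> K1 ?q y (R + 1)"
    by (simp only:)
  then have "(\<lambda>n. K1 ?q (Y n) (R + 1) - (if Y n < y then jmp y else 0)) \<longlonglongrightarrow> K1 ?q y (R + 1)"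
    by (simp only: mult_1_right)
  then have "(\<lambda>n. (c R - c (Y n)) - (if Y n < y then jmp y else 0)) \<longlonglongrightarrow> c R - c y"
    using k1 R Y y0 by simp
  from tendsto_diff[OF tendsto_const[of "c R"] this]
  show "(\<lambda>n. c (Y n) + (if Y n < y then jmp y else 0)) \<longlonglongrightarrow> c y" by (simp add: algebra_simps)
  have "?q y (y + 1) = 1" using R y0 by auto
  with K2_tendsto[OF cauc_clamp[of R] Y tendsto_add[OF Y(2) tendsto_const[of 1]]]
  have "(\<lambda>n. K2 ?q (Y n) (Y n + 1) - (if y < Y n then jmp y * 1 else 0)) \<longlonglongrightarrow> K2 ?q y (y + 1)"
    by (simp only:)
  then have "(\<lambda>n. K2 ?q (Y n) (Y n + 1) - (if y < Y n then jmp y else 0)) \<longlonglongrightarrow> K2 ?q y (y + 1)"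
    by (simp only: mult_1_right)
  then have "(\<lambda>n. (cl (Y n) - c 0) - (if y < Y n then jmp y else 0)) \<longlonglongrightarrow> cl y - c 0"
    using k2 R Y y0 by simp
  from tendsto_add[OF this tendsto_const[of "c 0"]]
  show "(\<lambda>n. cl (Y n) - (if y < Y n then jmp y else 0)) \<longlonglongrightarrow> cl y" by (simp add: algebra_simps)
qed

section \<open>Picard iteration and a priori estimate\<close>

lemma c_meas: "(\<lambda>y. if y < 0 then 0 else c y) \<in> borel_measurable borel"
proof -
  have c0: "c y = c 0 + (LINT z|N. (if 0 < z \<and> z \<le> y then J z else 0))" if "\<not> y < 0" for y
    using c_diff[of 0 y] that by simp
  have "(\<lambda>y. if y < 0 then 0 else c y) = (\<lambda>y. if y < 0 then 0 else c 0 + (LINT z|N. (if 0 < z \<and> z \<le> y then J z else 0)))"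
    by (rule ext) (metis c0)
  also have "\<dots> \<in> borel_measurable borel"
  proof (intro measurable_If borel_measurable_add N.borel_measurable_lebesgue_integral)
    show "(\<lambda>(x, z). if 0 < z \<and> z \<le> x then J z else 0) \<in> borel_measurable (borel \<Otimes>\<^sub>M N)"
      unfolding case_prod_beta by measurable
  qed auto
  finally show ?thesis .
qed

lemma csum_meas: "(\<lambda>y. if y < 0 then 0 else c y + cl y) \<in> borel_measurable borel"
proof -
  have "(\<lambda>y. if y < 0 then 0 else c y + cl y) =
    (\<lambda>y. 2 * (if y < 0 then 0 else c y) - (if y \<in> A then J y else 0))"
    using A_pos by (auto simp: fun_eq_iff cl_def)
  also have "\<dots> \<in> borel_measurable borel" using c_meas by measurable
  finally show ?thesis .
qed

lemma csum_ge: "y \<ge> 0 \<Longrightarrow> c y + cl y \<ge> 2 * cm"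
  using c_ge[of y] cl_ge[of y] by simp

text \<open>The equation solved for the value of \<open>q\<close> at \<open>(y, t)\<close>.
  \<open>G\<close> is the forcing, which may itself depend on \<open>q\<close> by way of the
  boundary, and \<open>K1 q 0 (t - y)\<close> is what was received at the boundary at time
  \<open>t - y\<close> and sent back. The value 0 for negative \<open>y\<close> keeps the iterates
  measurable in both variables.\<close>

definition step :: "((real \<Rightarrow> real \<Rightarrow> real) \<Rightarrow> real \<Rightarrow> real \<Rightarrow> real) \<Rightarrow> (real \<Rightarrow> real \<Rightarrow> real) \<Rightarrow> real \<Rightarrow> real \<Rightarrow> real" where
  "step G q y t = (if y < 0 then 0 else (G q y t - K1 q y t + K2 q y t - K1 q 0 (t - y)) / (c y + cl y))"

lemma cauc_step:
  assumes G: "cauc (G q)" and q: "cauc q"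
  shows "cauc (step G q)"
  unfolding cauc_def causal_def
proof (intro conjI allI impI)
  note qc = cauc_causal[OF q] and Gc = cauc_causal[OF G]
  have "(\<lambda>x. step G q (fst x) (snd x)) =
    (\<lambda>x. (if fst x < 0 then 0 else (G q (fst x) (snd x) - K1 q (fst x) (snd x) + K2 q (fst x) (snd x) - K1 q 0 (snd x - fst x)) / (if fst x < 0 then 0 else c (fst x) + cl (fst x))))"
    by (auto simp: step_def fun_eq_iff)
  also have "\<dots> \<in> borel_measurable borel"
  proof -
    have "(\<lambda>x::real \<times> real. (0::real, snd x - fst x)) \<in> borel_measurable borel" unfolding borel_prod[symmetric] by measurable
    from measurable_compose[OF this K1_meas[OF qc]] have 3: "(\<lambda>x. K1 q 0 (snd x - fst x)) \<in> borel_measurable borel" by simp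
    have 4: "(\<lambda>x. G q (fst x) (snd x)) \<in> borel_measurable borel" using Gc by (simp add: causal_def)
    have num: "(\<lambda>x. G q (fst x) (snd x) - K1 q (fst x) (snd x) + K2 q (fst x) (snd x) - K1 q 0 (snd x - fst x)) \<in> borel_measurable borel"
      by (intro borel_measurable_diff borel_measurable_add K2_meas[OF qc] K1_meas[OF qc] 3 4)
    have f: "(fst :: real \<times> real \<Rightarrow> real) \<in> borel_measurable borel" unfolding borel_prod[symmetric] by measurable
    have den: "(\<lambda>x::real \<times> real. if fst x < 0 then 0 else c (fst x) + cl (fst x)) \<in> borel_measurable borel"
      using measurable_compose[OF f csum_meas] by simp
    have pr: "{x \<in> space borel. fst x < (0::real)} \<in> sets (borel :: (real \<times> real) measure)"
      by (rule borel_measurable_less[OF f borel_measurable_const])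
    show ?thesis
      by (rule measurable_If[OF borel_measurable_const borel_measurable_divide[OF num den] pr])
  qed
  finally show "(\<lambda>x. step G q (fst x) (snd x)) \<in> borel_measurable borel" .
  show "step G q y t = 0" if "t < 0" for y t
    using that causal_neg[OF Gc] K1_neg[OF qc] K2_neg[OF qc] by (auto simp: step_def)
  show "continuous_on UNIV (step G q y)" if y: "y \<ge> 0" for y
  proof -
    have "continuous_on UNIV (K1 q y)" "continuous_on UNIV (K2 q y)" "continuous_on UNIV (K1 q 0)" "continuous_on UNIV (G q y)"
      using K1_isCont[OF q] K2_isCont[OF q] y cauc_cont[OF G] by (auto simp: continuous_on_eq_continuous_at)
    then have "continuous_on UNIV (\<lambda>t. (G q y t - K1 q y t + K2 q y t - K1 q 0 (t - y)) / (c y + cl y))"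
      using csum_ge[OF y] cm_pos
      by (intro continuous_intros continuous_on_compose2[of UNIV "K1 q 0" UNIV "\<lambda>t. t - y"]) auto
    moreover have "step G q y = (\<lambda>t. (G q y t - K1 q y t + K2 q y t - K1 q 0 (t - y)) / (c y + cl y))"
      using y by (auto simp: step_def fun_eq_iff)
    ultimately show ?thesis by simp
  qed
  fix R
  obtain B where B: "B \<ge> 0" "\<And>y t. 0 \<le> y \<Longrightarrow> y + t \<le> R \<Longrightarrow> \<bar>q y t\<bar> \<le> B" using causal_bound[OF qc] by metis
  obtain C where C: "C \<ge> 0" "\<And>y t. 0 \<le> y \<Longrightarrow> y + t \<le> R \<Longrightarrow> \<bar>G q y t\<bar> \<le> C" using causal_bound[OF Gc] by metis
  show "\<exists>B. \<forall>y t. 0 \<le> y \<longrightarrow> y + t \<le> R \<longrightarrow> \<bar>step G q y t\<bar> \<le> B"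
  proof (intro exI allI impI)
    fix y t :: real assume y: "0 \<le> y" "y + t \<le> R"
    define M where "M = L * B * Nm R"
    have M0: "M \<ge> 0" using L_nonneg B Nm_nonneg by (simp add: M_def)
    have 1: "\<bar>K1 q y t\<bar> \<le> M" unfolding M_def by (rule K1_bound[OF qc B(2) y])
    have 2: "\<bar>K2 q y t\<bar> \<le> M" using K2_bound[OF qc B(2) y] K2_neg[OF qc, of t y] M0 by (cases "t < 0") (auto simp: M_def)
    have 3: "\<bar>K1 q 0 (t - y)\<bar> \<le> M" unfolding M_def by (rule K1_bound[OF qc B(2)]) (use y in auto)
    have "\<bar>G q y t - K1 q y t + K2 q y t - K1 q 0 (t - y)\<bar> \<le> C + 3 * M" using 1 2 3 C(2)[OF y] by linarith
    moreover have "0 < 2 * cm" "2 * cm \<le> c y + cl y" using csum_ge[OF y(1)] cm_pos by auto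
    ultimately show "\<bar>step G q y t\<bar> \<le> (C + 3 * M) / (2 * cm)"
      using y(1) by (auto simp: step_def abs_divide intro!: frac_le)
  qed
qed

text \<open>The constant stems from the five contributions to a step: \<open>K1\<close>,
  \<open>K2\<close>, the reflected \<open>K1 q 0\<close>, and the forcing, which counts twice. Each
  is at most \<open>L * cm / (5 * (L + 1))\<close> times the norm, so their sum is at most
  \<open>cm\<close>, and division by \<open>c y + cl y \<ge> 2 * cm\<close> leaves the factor one
  half. With \<open>L + 1\<close> in place of \<open>L\<close> the quotient is defined for a
  constant speed as well.\<close>

definition admissible_weight :: "real \<Rightarrow> real \<Rightarrow> (real \<Rightarrow> real) \<Rightarrow> real \<Rightarrow> bool" where
  "admissible_weight R l w \<kappa> \<longleftrightarrow> l > 0 \<and> \<kappa> > 0 \<and> w \<in> borel_measurable borel \<and> (\<forall>z. \<kappa> \<le> w z \<and> w z \<le> 1) \<and>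
    (\<forall>y. 0 \<le> y \<and> y \<le> R \<longrightarrow>
      (LINT z|N. (if 0 < z \<and> z \<le> R \<and> z \<noteq> y then exp (-(l * \<bar>y - z\<bar>)) * w z else 0)) \<le> cm / (5 * (L + 1)) * w y \<and>
      (LINT z|N. (if 0 < z \<and> z \<le> R then exp (-(l * (y + z))) * w z else 0)) \<le> cm / (5 * (L + 1)) * w y)"

lemma admissible_weight_exists: "\<exists>l w \<kappa>. admissible_weight R l w \<kappa>"
proof -
  have "cm / (5 * (L + 1)) > 0" using cm_pos L_nonneg by simp
  from weight_exists[OF this, of R] show ?thesis unfolding admissible_weight_def .
qed

lemma admissible_weightD:
  assumes "admissible_weight R l w \<kappa>"
  shows "l > 0" "\<kappa> > 0" "w \<in> borel_measurable borel" "\<kappa> \<le> w z" "0 < w z \<and> w z \<le> 1"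
    "0 \<le> y \<and> y \<le> R \<Longrightarrow>
      (LINT z|N. (if 0 < z \<and> z \<le> R \<and> z \<noteq> y then exp (-(l * \<bar>y - z\<bar>)) * w z else 0)) \<le> cm / (5 * (L + 1)) * w y \<and>
      (LINT z|N. (if 0 < z \<and> z \<le> R then exp (-(l * (y + z))) * w z else 0)) \<le> cm / (5 * (L + 1)) * w y"
proof -
  note * = assms[unfolded admissible_weight_def]
  show "l > 0" "\<kappa> > 0" "w \<in> borel_measurable borel" "\<kappa> \<le> w z" using * by auto
  show "0 < w z \<and> w z \<le> 1" using * less_le_trans[of 0 \<kappa> "w z"] by auto
  assume "0 \<le> y \<and> y \<le> R"
  then show "(LINT z|N. (if 0 < z \<and> z \<le> R \<and> z \<noteq> y then exp (-(l * \<bar>y - z\<bar>)) * w z else 0)) \<le> cm / (5 * (L + 1)) * w y \<and>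
      (LINT z|N. (if 0 < z \<and> z \<le> R then exp (-(l * (y + z))) * w z else 0)) \<le> cm / (5 * (L + 1)) * w y"
    using * by blast
qed

lemma step_contraction:
  assumes G: "cauc q1" "cauc q2" and M: "M \<ge> 0"
    and lip: "\<And>y t b. y \<ge> 0 \<Longrightarrow> (\<And>r. r \<le> t - y \<Longrightarrow> \<bar>K1 q1 0 r - K1 q2 0 r\<bar> \<le> b) \<Longrightarrow> \<bar>G q1 y t - G q2 y t\<bar> \<le> 2 * b"
    and w: "admissible_weight R l w \<kappa>"
    and B: "\<And>z s. 0 \<le> z \<Longrightarrow> z + s \<le> R \<Longrightarrow> \<bar>q1 z s - q2 z s\<bar> \<le> M * w z * exp (l * s)"
    and y: "0 \<le> y" "y + t \<le> R"
  shows "\<bar>step G q1 y t - step G q2 y t\<bar> \<le> M / 2 * w y * exp (l * t)"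
proof -
  define d where "d = (\<lambda>y t. q1 y t - q2 y t)"
  note c1 = cauc_causal[OF G(1)] and c2 = cauc_causal[OF G(2)]
  have dc: "causal d" unfolding d_def by (rule causal_diff[OF c1 c2])
  define e where "e = cm / (5 * (L + 1))"
  have e0: "e \<ge> 0" using cm_pos L_nonneg by (simp add: e_def)
  define U where "U = L * M * e * (w y * exp (l * t))"
  have Bd: "\<bar>d z s\<bar> \<le> M * w z * exp (l * s)" if "0 \<le> z" "z + s \<le> R" for z s using B[OF that] by (simp add: d_def)
  note wD = admissible_weightD[OF w]
  have W: "(LINT z|N. (if 0 < z \<and> z \<le> R \<and> z \<noteq> y then exp (-(l * \<bar>y - z\<bar>)) * w z else 0)) \<le> e * w y"
    "(LINT z|N. (if 0 < z \<and> z \<le> R then exp (-(l * (y + z))) * w z else 0)) \<le> e * w y" if "0 \<le> y" "y \<le> R"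
    using wD(6)[of y] that unfolding e_def by blast+
  have kw: "\<bar>K1 d y t\<bar> \<le> U" "\<bar>K2 d y t\<bar> \<le> U" "\<And>r. r \<le> t - y \<Longrightarrow> \<bar>K1 d 0 r\<bar> \<le> U"
    unfolding U_def by (rule K_weighted[OF dc M wD(1,3,5) _ y e0]; use Bd W in blast)+
  have k1: "\<bar>K1 q1 y t - K1 q2 y t\<bar> \<le> U" using kw(1) K1_diff[OF c1 c2 y(1)] by (simp add: d_def)
  have k2: "\<bar>K2 q1 y t - K2 q2 y t\<bar> \<le> U" using kw(2) K2_diff[OF c1 c2 y(1)] by (simp add: d_def)
  have k3: "\<bar>K1 q1 0 r - K1 q2 0 r\<bar> \<le> U" if "r \<le> t - y" for r using kw(3)[OF that] K1_diff[OF c1 c2, of 0] by (simp add: d_def)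
  have g: "\<bar>G q1 y t - G q2 y t\<bar> \<le> 2 * U" by (rule lip[OF y(1) k3])
  have "\<bar>(G q1 y t - K1 q1 y t + K2 q1 y t - K1 q1 0 (t - y)) - (G q2 y t - K1 q2 y t + K2 q2 y t - K1 q2 0 (t - y))\<bar> \<le> 5 * U"
    using g k1 k2 k3[OF order_refl] by linarith
  also have "5 * U \<le> cm * (M * w y * exp (l * t))"
  proof -
    have "5 * (L * e) \<le> cm" using L_nonneg cm_pos by (simp add: e_def field_simps)
    then have "5 * (L * e) * (M * w y * exp (l * t)) \<le> cm * (M * w y * exp (l * t))"
      using M wD(5)[of y] by (intro mult_right_mono) auto
    then show ?thesis by (simp add: U_def mult_ac)
  qed
  finally have n: "\<bar>(G q1 y t - K1 q1 y t + K2 q1 y t - K1 q1 0 (t - y)) - (G q2 y t - K1 q2 y t + K2 q2 y t - K1 q2 0 (t - y))\<bar> \<le> cm * (M * w y * exp (l * t))" .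
  have "\<bar>step G q1 y t - step G q2 y t\<bar> = \<bar>(G q1 y t - K1 q1 y t + K2 q1 y t - K1 q1 0 (t - y)) - (G q2 y t - K1 q2 y t + K2 q2 y t - K1 q2 0 (t - y))\<bar> / (c y + cl y)"
    using y csum_ge[OF y(1)] cm_pos by (simp add: step_def abs_divide flip: diff_divide_distrib)
  also have "\<dots> \<le> cm * (M * w y * exp (l * t)) / (2 * cm)"
    using n csum_ge[OF y(1)] cm_pos by (intro frac_le) auto
  also have "\<dots> = M / 2 * w y * exp (l * t)" using cm_pos by simp
  finally show ?thesis .
qed

text \<open>Picard iteration starting from 0. The weighted norm depends on the triangle, the
  iterates do not, so the contractions on all triangles produce a single limit. The first increment
  is bounded on each triangle and vanishes at negative times; since the weight is at least \<kappa>,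
  its weighted norm is finite.\<close>

theorem volterra_exists:
  assumes G: "\<And>q. cauc q \<Longrightarrow> cauc (G q)"
    and lip: "\<And>q1 q2 y t b. cauc q1 \<Longrightarrow> cauc q2 \<Longrightarrow> y \<ge> 0 \<Longrightarrow>
      (\<And>r. r \<le> t - y \<Longrightarrow> \<bar>K1 q1 0 r - K1 q2 0 r\<bar> \<le> b) \<Longrightarrow> \<bar>G q1 y t - G q2 y t\<bar> \<le> 2 * b"
  obtains q where "cauc q" "\<And>y t. y \<ge> 0 \<Longrightarrow> (c y + cl y) * q y t = G q y t - K1 q y t + K2 q y t - K1 q 0 (t - y)"
proof -
  define Q where "Q n = (step G ^^ n) (\<lambda>_ _. 0)" for n
  have Q0: "Q 0 = (\<lambda>_ _. 0)" and QS: "Q (Suc n) = step G (Q n)" for n by (auto simp: Q_def)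
  have z: "cauc (\<lambda>_ _. 0)" unfolding cauc_def causal_def by (auto intro: exI[of _ 0])
  have Qc: "cauc (Q n)" for n
    by (induction n) (simp_all add: Q0 QS z cauc_step G)
  have neg: "Q n y t = 0" if "y < 0" for n y t
    using that by (cases n) (auto simp: Q0 QS step_def)
  define q where "q y t = lim (\<lambda>n. Q n y t)" for y t
  have key: "\<exists>l w \<kappa> M. admissible_weight R l w \<kappa> \<and> M \<ge> 0 \<and>
    (\<forall>n y t. 0 \<le> y \<longrightarrow> y + t \<le> R \<longrightarrow> \<bar>Q (Suc n) y t - Q n y t\<bar> \<le> M * w y * exp (l * t) / 2 ^ n)" for R
  proof -
    obtain l w \<kappa> where W: "admissible_weight R l w \<kappa>" using admissible_weight_exists by blast
    note w = admissible_weightD[OF W]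
    obtain B where B: "B \<ge> 0" "\<And>y t. 0 \<le> y \<Longrightarrow> y + t \<le> R \<Longrightarrow> \<bar>Q 1 y t\<bar> \<le> B"
      using causal_bound[OF cauc_causal[OF Qc]] by metis
    define M where "M = B / \<kappa>"
    have M0: "M \<ge> 0" using B w(2) by (simp add: M_def)
    have "\<forall>y t. 0 \<le> y \<longrightarrow> y + t \<le> R \<longrightarrow> \<bar>Q (Suc n) y t - Q n y t\<bar> \<le> M / 2 ^ n * w y * exp (l * t)" for n
    proof (induction n)
      case 0
      show ?case
      proof (intro allI impI)
        fix y t :: real assume y: "0 \<le> y" "y + t \<le> R"
        show "\<bar>Q (Suc 0) y t - Q 0 y t\<bar> \<le> M / 2 ^ 0 * w y * exp (l * t)"
        proof (cases "t < 0")
          case True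
          then show ?thesis using causal_neg[OF cauc_causal[OF Qc]] M0 w(5)[of y] by simp
        next
          case False
          have "B = M * \<kappa> * 1" using w(2) by (simp add: M_def)
          also have "\<dots> \<le> M * w y * exp (l * t)"
            using w(1,2) w(4)[of y] w(5)[of y] False M0 by (intro mult_mono) auto
          finally show ?thesis using B(2)[OF y] by (simp add: Q0)
        qed
      qed
    next
      case (Suc n)
      show ?case
      proof (intro allI impI)
        fix y t :: real assume y: "0 \<le> y" "y + t \<le> R"
        have "\<bar>step G (Q (Suc n)) y t - step G (Q n) y t\<bar> \<le> M / 2 ^ n / 2 * w y * exp (l * t)"
        proof (rule step_contraction[OF Qc Qc _ _ W _ y])
          show "0 \<le> M / 2 ^ n" using M0 by simp
          show "\<bar>G (Q (Suc n)) y t - G (Q n) y t\<bar> \<le> 2 * b"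
            if "y \<ge> 0" "\<And>r. r \<le> t - y \<Longrightarrow> \<bar>K1 (Q (Suc n)) 0 r - K1 (Q n) 0 r\<bar> \<le> b" for y t b
            by (rule lip[OF Qc Qc that])
          show "\<bar>Q (Suc n) z s - Q n z s\<bar> \<le> M / 2 ^ n * w z * exp (l * s)" if "0 \<le> z" "z + s \<le> R" for z s
            using Suc that by blast
        qed
        then show "\<bar>Q (Suc (Suc n)) y t - Q (Suc n) y t\<bar> \<le> M / 2 ^ Suc n * w y * exp (l * t)"
          by (simp add: QS)
      qed
    qed
    then show ?thesis using W M0 by (intro exI[of _ l] exI[of _ w] exI[of _ \<kappa>] exI[of _ M]) auto
  qed
  have conv: "(\<lambda>n. Q n y t) \<longlonglongrightarrow> q y t" for y t
  proof (cases "y < 0")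
    case True then show ?thesis using neg by (simp add: q_def)
  next
    case False
    from key[of "y + t"] obtain l w \<kappa> M
      where "\<forall>n y' t'. 0 \<le> y' \<longrightarrow> y' + t' \<le> y + t \<longrightarrow> \<bar>Q (Suc n) y' t' - Q n y' t'\<bar> \<le> M * w y' * exp (l * t') / 2 ^ n" by blast
    then have "\<bar>Q (Suc n) y t - Q n y t\<bar> \<le> M * w y * exp (l * t) / 2 ^ n" for n using False by simp
    from geometric_increments_limit(1)[OF this] show ?thesis by (simp add: q_def convergent_LIMSEQ_iff)
  qed
  have unif: "\<exists>C\<ge>0. \<forall>n y t. 0 \<le> y \<longrightarrow> y + t \<le> R \<longrightarrow> \<bar>q y t - Q n y t\<bar> \<le> C / 2 ^ n" for R
  proof -
    obtain l w \<kappa> M where W: "admissible_weight R l w \<kappa>" and M: "M \<ge> 0"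
      and k': "\<And>n y t. 0 \<le> y \<Longrightarrow> y + t \<le> R \<Longrightarrow> \<bar>Q (Suc n) y t - Q n y t\<bar> \<le> M * w y * exp (l * t) / 2 ^ n"
      using key[of R] by blast
    note k = admissible_weightD(1)[OF W] M admissible_weightD(5)[OF W] k'
    show ?thesis
    proof (intro exI[of _ "2 * (M * exp (l * R))"] conjI allI impI)
      show "2 * (M * exp (l * R)) \<ge> 0" using k by simp
      fix n and y t :: real assume y: "0 \<le> y" "y + t \<le> R"
      have "\<bar>q y t - Q n y t\<bar> \<le> 2 * (M * w y * exp (l * t)) / 2 ^ n"
        unfolding q_def by (rule geometric_increments_limit(2)[OF k(4)[OF y]])
      also have "M * w y * exp (l * t) \<le> M * 1 * exp (l * R)"
        using k y by (intro mult_mono) (auto simp: less_imp_le)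
      finally show "\<bar>q y t - Q n y t\<bar> \<le> 2 * (M * exp (l * R)) / 2 ^ n" by (simp add: divide_right_mono)
    qed
  qed
  have geo0: "(\<lambda>n. C / 2 ^ n) \<longlonglongrightarrow> 0" for C :: real
    using tendsto_mult_right_zero[OF LIMSEQ_power_zero[of "1/2::real"], of C] by (simp add: power_divide)
  have qc: "cauc q"
    unfolding cauc_def causal_def
  proof (intro conjI allI impI)
    show "(\<lambda>x. q (fst x) (snd x)) \<in> borel_measurable borel"
    proof (rule borel_measurable_LIMSEQ_real[OF conv])
      show "(\<lambda>x. Q n (fst x) (snd x)) \<in> borel_measurable borel" for n using cauc_causal[OF Qc] by (simp add: causal_def)
    qed
    show "q y t = 0" if "t < 0" for y t using causal_neg[OF cauc_causal[OF Qc] that] by (simp add: q_def)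
    show "\<exists>B. \<forall>y t. 0 \<le> y \<longrightarrow> y + t \<le> R \<longrightarrow> \<bar>q y t\<bar> \<le> B" for R
    proof -
      obtain C where "\<And>y t. 0 \<le> y \<Longrightarrow> y + t \<le> R \<Longrightarrow> \<bar>q y t - Q 0 y t\<bar> \<le> C / 2 ^ 0" using unif[of R] by metis
      then show ?thesis by (auto simp: Q0)
    qed
    show "continuous_on UNIV (q y)" if y: "y \<ge> 0" for y
      unfolding continuous_on_eq_continuous_at[OF open_UNIV]
    proof
      fix t
      obtain C where C: "\<And>n s. s \<le> t + 1 \<Longrightarrow> \<bar>q y s - Q n y s\<bar> \<le> C / 2 ^ n" using unif[of "y + t + 1"] y by (metis add.assoc add_le_cancel_left)
      have ul: "uniform_limit {..<t+1} (\<lambda>n. Q n y) (q y) sequentially"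
      proof (rule uniform_limitI)
        fix e :: real assume "e > 0"
        then have "eventually (\<lambda>n. C / 2 ^ n < e) sequentially" using order_tendstoD(2)[OF geo0] by simp
        then show "\<forall>\<^sub>F n in sequentially. \<forall>x\<in>{..<t+1}. dist (Q n y x) (q y x) < e"
        proof eventually_elim
          case (elim n)
          show ?case
          proof
            fix s assume "s \<in> {..<t+1}"
            then show "dist (Q n y s) (q y s) < e" using C[of s n] elim by (simp add: dist_real_def abs_minus_commute)
          qed
        qed
      qed
      have cQ: "continuous_on UNIV (Q n y)" for n using Qc[of n] y unfolding cauc_def by blast
      have ev: "\<forall>\<^sub>F n in sequentially. continuous_on {..<t+1} (Q n y)"
        by (intro always_eventually allI continuous_on_subset[OF cQ]) simp
      have "continuous_on {..<t+1} (q y)"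
        by (rule uniform_limit_theorem[OF ev ul sequentially_bot])
      then show "isCont (q y) t" by (simp add: continuous_on_eq_continuous_at)
    qed
  qed
  \<comment> \<open>The smallest triangle containing \<open>(y, t)\<close> suffices. The distance of
    the limit to the iterate \<open>n\<close> is \<open>O(1 / 2 ^ n)\<close> in its norm, one more
    step halves it, and both sides of the recursion converge.\<close>
  have fix_q: "step G q y t = q y t" if y: "y \<ge> 0" for y t
  proof -
    obtain l w \<kappa> M where W: "admissible_weight (y + t) l w \<kappa>" and M: "M \<ge> 0"
      and k: "\<And>n y' t'. 0 \<le> y' \<Longrightarrow> y' + t' \<le> y + t \<Longrightarrow> \<bar>Q (Suc n) y' t' - Q n y' t'\<bar> \<le> M * w y' * exp (l * t') / 2 ^ n"
      using key[of "y + t"] by blast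
    have b: "\<bar>q y' t' - Q n y' t'\<bar> \<le> 2 * M / 2 ^ n * w y' * exp (l * t')" if "0 \<le> y'" "y' + t' \<le> y + t" for n y' t'
      using geometric_increments_limit(2)[OF k[OF that], of n] by (simp add: q_def mult_ac)
    have "\<bar>step G q y t - step G (Q n) y t\<bar> \<le> 2 * M / 2 ^ n / 2 * w y * exp (l * t)" for n
    proof (rule step_contraction[OF qc Qc _ _ W b y order_refl])
      show "0 \<le> 2 * M / 2 ^ n" using M by simp
      show "\<bar>G q y t - G (Q n) y t\<bar> \<le> 2 * b"
        if "y \<ge> 0" "\<And>r. r \<le> t - y \<Longrightarrow> \<bar>K1 q 0 r - K1 (Q n) 0 r\<bar> \<le> b" for y t b
        by (rule lip[OF qc Qc that])
    qed
    then have "\<bar>Q (Suc n) y t - step G q y t\<bar> \<le> (M * w y * exp (l * t)) / 2 ^ n" for n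
      by (simp add: QS abs_minus_commute)
    then have "(\<lambda>n. Q (Suc n) y t - step G q y t) \<longlonglongrightarrow> 0"
      by (intro Lim_null_comparison[OF _ geo0] always_eventually) auto
    then have "(\<lambda>n. Q (Suc n) y t) \<longlonglongrightarrow> step G q y t" using LIM_zero_iff by blast
    then show ?thesis using LIMSEQ_unique LIMSEQ_Suc[OF conv] by blast
  qed
  show ?thesis
  proof (rule that[OF qc])
    fix y t :: real assume y: "y \<ge> 0"
    show "(c y + cl y) * q y t = G q y t - K1 q y t + K2 q y t - K1 q 0 (t - y)"
      using fix_q[OF y, of t] y csum_ge[OF y] cm_pos by (auto simp: step_def field_simps)
  qed
qed

text \<open>An inequality is assumed instead of an equation, because for the difference of two
  solutions the influence of the traces is known only through an estimate; \<open>b\<close> stands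
  for a bound of the signal received at the boundary. With five kernel terms as in the contraction,
  a weighted bound \<open>M\<close> improves to \<open>B' + M / 2\<close>, and iteration leaves
  \<open>2 * B'\<close>. The constant depends on \<open>R\<close> and the medium alone.\<close>

theorem volterra_estimate:
  "\<exists>C\<ge>0. \<forall>d B. cauc d \<longrightarrow> B \<ge> 0 \<longrightarrow>
    (\<forall>y t b. 0 \<le> y \<longrightarrow> y + t \<le> R \<longrightarrow> (\<forall>r. r \<le> t - y \<longrightarrow> \<bar>K1 d 0 r\<bar> \<le> b) \<longrightarrow>
      (c y + cl y) * \<bar>d y t\<bar> \<le> B + 2 * b + \<bar>K1 d y t\<bar> + \<bar>K2 d y t\<bar> + \<bar>K1 d 0 (t - y)\<bar>) \<longrightarrow>
    (\<forall>y t. 0 \<le> y \<longrightarrow> y + t \<le> R \<longrightarrow> \<bar>d y t\<bar> \<le> C * B)"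
proof -
  obtain l w \<kappa> where W: "admissible_weight R l w \<kappa>" using admissible_weight_exists by blast
  note w = admissible_weightD[OF W]
  define C where "C = 1 / (cm * \<kappa>) * exp (l * R)"
  have C0: "C \<ge> 0" using cm_pos w(2) by (simp add: C_def)
  have main: "\<bar>d y t\<bar> \<le> C * B" if d: "cauc d" and B: "B \<ge> 0" and
    eq: "\<And>y t b. 0 \<le> y \<Longrightarrow> y + t \<le> R \<Longrightarrow> (\<And>r. r \<le> t - y \<Longrightarrow> \<bar>K1 d 0 r\<bar> \<le> b) \<Longrightarrow>
      (c y + cl y) * \<bar>d y t\<bar> \<le> B + 2 * b + \<bar>K1 d y t\<bar> + \<bar>K2 d y t\<bar> + \<bar>K1 d 0 (t - y)\<bar>"
    and y: "0 \<le> y" "y + t \<le> R" for d B y t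
  proof -
    note dc = cauc_causal[OF d]
    define e where "e = cm / (5 * (L + 1))"
    have e0: "e \<ge> 0" using cm_pos L_nonneg by (simp add: e_def)
    \<comment> \<open>\<open>B / (2 * cm)\<close> is what the inhomogeneity contributes after
      division by the coefficient; the further division by \<kappa> expresses it in the weighted
      norm.\<close>
    define B' where "B' = B / (2 * cm * \<kappa>)"
    have B'0: "B' \<ge> 0" using B cm_pos w(2) by (simp add: B'_def)
    have improve: "\<bar>d y t\<bar> \<le> (B' + M / 2) * w y * exp (l * t)"
      if M: "M \<ge> 0" and Bd: "\<And>z s. 0 \<le> z \<Longrightarrow> z + s \<le> R \<Longrightarrow> \<bar>d z s\<bar> \<le> M * w z * exp (l * s)" and y: "0 \<le> y" "y + t \<le> R" for M y t
    proof (cases "t < 0")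
      case True then show ?thesis using causal_neg[OF dc] B'0 M w(5)[of y] by simp
    next
      case False
      define U where "U = L * M * e * (w y * exp (l * t))"
      have W': "(LINT z|N. (if 0 < z \<and> z \<le> R \<and> z \<noteq> y then exp (-(l * \<bar>y - z\<bar>)) * w z else 0)) \<le> e * w y"
        "(LINT z|N. (if 0 < z \<and> z \<le> R then exp (-(l * (y + z))) * w z else 0)) \<le> e * w y" if "0 \<le> y" "y \<le> R"
        using w(6)[of y] that unfolding e_def by blast+
      have kw: "\<bar>K1 d y t\<bar> \<le> U" "\<bar>K2 d y t\<bar> \<le> U" "\<And>r. r \<le> t - y \<Longrightarrow> \<bar>K1 d 0 r\<bar> \<le> U"
        unfolding U_def by (rule K_weighted[OF dc M w(1,3,5) _ y e0]; use Bd W' in blast)+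
      have "(c y + cl y) * \<bar>d y t\<bar> \<le> B + 2 * U + \<bar>K1 d y t\<bar> + \<bar>K2 d y t\<bar> + \<bar>K1 d 0 (t - y)\<bar>"
        by (rule eq[OF y kw(3)])
      also have "\<dots> \<le> B + 5 * U" using kw(1,2) kw(3)[OF order_refl] by linarith
      also have "5 * U \<le> cm * (M * w y * exp (l * t))"
      proof -
        have "5 * (L * e) \<le> cm" using L_nonneg cm_pos by (simp add: e_def field_simps)
        then have "5 * (L * e) * (M * w y * exp (l * t)) \<le> cm * (M * w y * exp (l * t))"
          using M w(5)[of y] by (intro mult_right_mono) auto
        then show ?thesis by (simp add: U_def mult_ac)
      qed
      finally have 1: "(c y + cl y) * \<bar>d y t\<bar> \<le> B + cm * (M * w y * exp (l * t))" by simp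
      have "2 * cm * \<bar>d y t\<bar> \<le> (c y + cl y) * \<bar>d y t\<bar>" by (rule mult_right_mono[OF csum_ge[OF y(1)]]) simp
      with 1 have 2: "2 * cm * \<bar>d y t\<bar> \<le> B + cm * (M * w y * exp (l * t))" by linarith
      have "B = 2 * cm * (B' * \<kappa> * 1)" using w(2) cm_pos by (simp add: B'_def)
      also have "\<dots> \<le> 2 * cm * (B' * w y * exp (l * t))"
        using w(1,2) w(4)[of y] w(5)[of y] False B'0 cm_pos by (intro mult_left_mono mult_mono) auto
      finally have "2 * cm * \<bar>d y t\<bar> \<le> 2 * cm * ((B' + M / 2) * w y * exp (l * t))" using 2 by (simp add: algebra_simps)
      then show ?thesis using cm_pos by simp
    qed
    obtain D where D: "D \<ge> 0" "\<And>y t. 0 \<le> y \<Longrightarrow> y + t \<le> R \<Longrightarrow> \<bar>d y t\<bar> \<le> D" using causal_bound[OF dc] by metis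
    define M0 where "M0 = D / \<kappa>"
    have M00: "M0 \<ge> 0" using D w(2) by (simp add: M0_def)
    have it: "\<forall>y t. 0 \<le> y \<longrightarrow> y + t \<le> R \<longrightarrow> \<bar>d y t\<bar> \<le> (2 * B' + M0 / 2 ^ n) * w y * exp (l * t)" for n
    proof (induction n)
      case 0
      show ?case
      proof (intro allI impI)
        fix y t :: real assume y: "0 \<le> y" "y + t \<le> R"
        show "\<bar>d y t\<bar> \<le> (2 * B' + M0 / 2 ^ 0) * w y * exp (l * t)"
        proof (cases "t < 0")
          case True
          then show ?thesis using causal_neg[OF dc] M00 B'0 w(5)[of y] by simp
        next
          case False
          have "D = M0 * \<kappa> * 1" using w(2) by (simp add: M0_def)
          also have "\<dots> \<le> (2 * B' + M0) * w y * exp (l * t)"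
            using w(1,2) w(4)[of y] w(5)[of y] False M00 B'0 by (intro mult_mono) auto
          finally show ?thesis using D(2)[OF y] by simp
        qed
      qed
    next
      case (Suc n)
      show ?case
      proof (intro allI impI)
        fix y t :: real assume y: "0 \<le> y" "y + t \<le> R"
        have "\<bar>d y t\<bar> \<le> (B' + (2 * B' + M0 / 2 ^ n) / 2) * w y * exp (l * t)"
          by (rule improve[OF _ _ y]) (use Suc M00 B'0 in auto)
        then show "\<bar>d y t\<bar> \<le> (2 * B' + M0 / 2 ^ Suc n) * w y * exp (l * t)"
          by (simp add: field_simps)
      qed
    qed
    have "(\<lambda>n. (2 * B' + M0 / 2 ^ n) * w y * exp (l * t)) \<longlonglongrightarrow> (2 * B' + 0) * w y * exp (l * t)"
      using tendsto_mult_right_zero[OF LIMSEQ_power_zero[of "1/2::real"], of M0]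
      by (intro tendsto_intros) (simp add: power_divide)
    then have "\<bar>d y t\<bar> \<le> (2 * B' + 0) * w y * exp (l * t)"
      by (rule LIMSEQ_le_const) (use it y in blast)
    also have "\<dots> \<le> (2 * B' + 0) * 1 * exp (l * R)"
      using w(1,2) w(5)[of y] B'0 y by (intro mult_mono) auto
    also have "\<dots> = C * B" using cm_pos w(2) by (simp add: C_def B'_def)
    finally show ?thesis .
  qed
  show ?thesis
  proof (intro exI[of _ C] conjI allI impI C0)
    fix d B and y t :: real
    assume "cauc d" "B \<ge> 0" and eq: "\<forall>y t b. 0 \<le> y \<longrightarrow> y + t \<le> R \<longrightarrow> (\<forall>r. r \<le> t - y \<longrightarrow> \<bar>K1 d 0 r\<bar> \<le> b) \<longrightarrow>
      (c y + cl y) * \<bar>d y t\<bar> \<le> B + 2 * b + \<bar>K1 d y t\<bar> + \<bar>K2 d y t\<bar> + \<bar>K1 d 0 (t - y)\<bar>" and "0 \<le> y" "y + t \<le> R"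
    then show "\<bar>d y t\<bar> \<le> C * B" by (intro main) simp_all
  qed
qed

end

section \<open>Mild solutions\<close>

text \<open>For \<open>t < 0\<close> the interval of integration is empty and the integral is 0.
  Since \<open>f\<close> vanishes there, the formula is a primitive on the whole line, with a
  two-sided derivative at 0 too.\<close>

lemma has_real_derivative_integral_causal:
  fixes f :: "real \<Rightarrow> real"
  assumes f: "continuous_on UNIV f" and z: "\<And>t. t \<le> 0 \<Longrightarrow> f t = 0"
  shows "((\<lambda>t. integral {0..t} f) has_real_derivative f t) (at t)"
proof -
  define a where "a = min t 0 - 1"
  have eq: "integral {0..s} f = integral {a..s} f" if "s > a" for s
  proof (cases "s \<ge> 0")
    case True
    have "integral {a..0} f = integral {a..0} (\<lambda>_. 0)" by (rule integral_cong) (use z in auto)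
    moreover have "integral {a..0} f + integral {0..s} f = integral {a..s} f"
      by (rule Henstock_Kurzweil_Integration.integral_combine)
         (use True in \<open>auto simp: a_def intro!: integrable_continuous_real continuous_on_subset[OF f]\<close>)
    ultimately show ?thesis by simp
  next
    case False
    have "integral {a..s} f = integral {a..s} (\<lambda>_. 0)" by (rule integral_cong) (use z False in auto)
    then show ?thesis using False by simp
  qed
  have t: "t \<in> {a<..<t+1}" by (auto simp: a_def)
  have "((\<lambda>s. integral {a..s} f) has_real_derivative f t) (at t within {a..t+1})"
    by (rule integral_has_real_derivative[OF continuous_on_subset[OF f]]) (use t in auto)
  then have "((\<lambda>s. integral {a..s} f) has_real_derivative f t) (at t)"
    using at_within_Icc_at[of a t "t+1"] t by auto
  then show ?thesis
    by (rule has_field_derivative_transform_within_open[of _ _ _ "{a<..<t+1}"]) (use t eq in auto)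
qed

definition jointly_cont :: "(real \<Rightarrow> real \<Rightarrow> real) \<Rightarrow> bool" where
  "jointly_cont F \<longleftrightarrow> continuous_on ({0..} \<times> UNIV) (\<lambda>x. F (fst x) (snd x))"

lemma jointly_contI:
  assumes "\<And>Y T y t. (\<And>n::nat. Y n \<ge> 0) \<Longrightarrow> Y \<longlonglongrightarrow> y \<Longrightarrow> T \<longlonglongrightarrow> t \<Longrightarrow> y \<ge> 0 \<Longrightarrow> (\<lambda>n. F (Y n) (T n)) \<longlonglongrightarrow> F y t"
  shows "jointly_cont F"
  unfolding jointly_cont_def continuous_on_sequentially
proof (intro allI ballI impI)
  fix x and a :: "real \<times> real" assume a: "a \<in> {0..} \<times> UNIV" and x: "(\<forall>n. x n \<in> {0..} \<times> UNIV) \<and> x \<longlonglongrightarrow> a"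
  have "(\<lambda>n. F (fst (x n)) (snd (x n))) \<longlonglongrightarrow> F (fst a) (snd a)"
  proof (rule assms)
    show "fst (x n) \<ge> 0" for n using x by (metis atLeast_iff mem_Times_iff)
    show "(\<lambda>n. fst (x n)) \<longlonglongrightarrow> fst a" "(\<lambda>n. snd (x n)) \<longlonglongrightarrow> snd a" using x by (auto intro!: tendsto_intros)
    show "fst a \<ge> 0" using a by auto
  qed
  then show "((\<lambda>x. F (fst x) (snd x)) \<circ> x) \<longlonglongrightarrow> F (fst a) (snd a)" by (simp add: comp_def)
qed

lemma jointly_contD:
  assumes F: "jointly_cont F" and Y: "\<And>n::nat. Y n \<ge> 0" "Y \<longlonglongrightarrow> y" "T \<longlonglongrightarrow> t" "y \<ge> 0"
  shows "(\<lambda>n. F (Y n) (T n)) \<longlonglongrightarrow> F y t"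
proof -
  have "(\<lambda>n. (Y n, T n)) \<longlonglongrightarrow> (y, t)" by (intro tendsto_Pair Y)
  from continuous_on_tendsto_compose[OF F[unfolded jointly_cont_def] this]
  show ?thesis using Y by simp
qed

lemma jointly_cont_compose:
  assumes F: "jointly_cont F" and f: "continuous_on S f" "continuous_on S g" and "\<And>x. x \<in> S \<Longrightarrow> f x \<ge> 0"
  shows "continuous_on S (\<lambda>x. F (f x) (g x))"
  using continuous_on_compose2[OF F[unfolded jointly_cont_def] continuous_on_Pair[OF f]] assms(4) by auto

lemma jointly_cont_time: "jointly_cont F \<Longrightarrow> y \<ge> 0 \<Longrightarrow> continuous_on S (F y)"
  using jointly_cont_compose[of F S "\<lambda>_. y" "\<lambda>t. t"] by auto

lemma jointly_cont_add: "jointly_cont F \<Longrightarrow> jointly_cont G \<Longrightarrow> jointly_cont (\<lambda>y t. F y t + G y t)"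
  and jointly_cont_diff: "jointly_cont F \<Longrightarrow> jointly_cont G \<Longrightarrow> jointly_cont (\<lambda>y t. F y t - G y t)"
  and jointly_cont_mult: "jointly_cont F \<Longrightarrow> jointly_cont G \<Longrightarrow> jointly_cont (\<lambda>y t. F y t * G y t)"
  unfolding jointly_cont_def by (auto intro!: continuous_intros)

lemma tendsto_zero_bounded_mult:
  fixes f g :: "nat \<Rightarrow> real"
  assumes "f \<longlonglongrightarrow> 0" "\<And>n. \<bar>g n\<bar> \<le> B"
  shows "(\<lambda>n. g n * f n) \<longlonglongrightarrow> 0"
proof (rule Lim_null_comparison)
  show "\<forall>\<^sub>F n in sequentially. norm (g n * f n) \<le> B * \<bar>f n\<bar>"
    using assms(2) by (auto simp: abs_mult intro!: always_eventually mult_right_mono)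
  show "(\<lambda>n. B * \<bar>f n\<bar>) \<longlonglongrightarrow> 0" using tendsto_mult_right_zero[OF tendsto_rabs_zero[OF assms(1)]] .
qed

section \<open>Cancellation of jumps at the atoms\<close>

context medium
begin

lemma jump_seq_bound: "\<bar>if P then jmp y else 0\<bar> \<le> L"
  using J_bound[of y] L_nonneg by (auto simp: jmp_def)

text \<open>At an atom the coefficients and the kernels jump, the kernels by multiples of the same
  value \<open>q y t\<close>, and in the equation these jumps cancel. What remains in the limit is
  \<open>c + cl\<close> times \<open>q (Y n) (T n) - q y t\<close>, and the coefficient is bounded
  below. For the wave equation this is the continuity of \<open>u\<^sub>x\<close> across the jumps
  of \<open>V\<close>.\<close>

theorem volterra_jointly_cont:
  assumes q: "cauc q" and H: "jointly_cont H"
    and eq: "\<And>y t. y \<ge> 0 \<Longrightarrow> (c y + cl y) * q y t = H y t - K1 q y t + K2 q y t - K1 q 0 (t - y)"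
  shows "jointly_cont q"
proof (rule jointly_contI)
  fix Y T :: "nat \<Rightarrow> real" and y t :: real
  assume Y: "\<And>n. Y n \<ge> 0" "Y \<longlonglongrightarrow> y" and T: "T \<longlonglongrightarrow> t" and y: "y \<ge> 0"
  define i where "i n = (if Y n < y then jmp y else 0)" for n
  define k where "k n = (if y < Y n then jmp y else 0)" for n
  have 1: "(\<lambda>n. K1 q (Y n) (T n) - i n * q y t) \<longlonglongrightarrow> K1 q y t"
    using K1_tendsto[OF q Y T] by (simp add: i_def if_distrib[of "\<lambda>x. x * _"] cong: if_cong)
  have 2: "(\<lambda>n. K2 q (Y n) (T n) - k n * q y t) \<longlonglongrightarrow> K2 q y t"
    using K2_tendsto[OF q Y T] by (simp add: k_def if_distrib[of "\<lambda>x. x * _"] cong: if_cong)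
  have 3: "(\<lambda>n. K1 q 0 (T n - Y n)) \<longlonglongrightarrow> K1 q 0 (t - y)"
    by (rule isCont_tendsto_compose[OF K1_isCont[OF q]]) (auto intro!: tendsto_intros T Y)
  have 4: "(\<lambda>n. (c (Y n) + i n) + (cl (Y n) - k n)) \<longlonglongrightarrow> c y + cl y"
    unfolding i_def k_def by (intro tendsto_add c_tendsto Y)
  have 5: "(\<lambda>n. H (Y n) (T n)) \<longlonglongrightarrow> H y t" by (rule jointly_contD[OF H Y T y])
  have "(\<lambda>n. (H (Y n) (T n) - (K1 q (Y n) (T n) - i n * q y t) + (K2 q (Y n) (T n) - k n * q y t) - K1 q 0 (T n - Y n))
      - ((c (Y n) + i n) + (cl (Y n) - k n)) * q y t) \<longlonglongrightarrow> (H y t - K1 q y t + K2 q y t - K1 q 0 (t - y)) - (c y + cl y) * q y t"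
    by (intro tendsto_intros 1 2 3 4 5)
  moreover have "(H (Y n) (T n) - (K1 q (Y n) (T n) - i n * q y t) + (K2 q (Y n) (T n) - k n * q y t) - K1 q 0 (T n - Y n))
      - ((c (Y n) + i n) + (cl (Y n) - k n)) * q y t = (c (Y n) + cl (Y n)) * (q (Y n) (T n) - q y t)" for n
    using eq[OF Y(1)[of n], of "T n"] by (simp add: algebra_simps)
  ultimately have 6: "(\<lambda>n. (c (Y n) + cl (Y n)) * (q (Y n) (T n) - q y t)) \<longlonglongrightarrow> 0" using eq[OF y, of t] by simp
  have "\<bar>1 / (c (Y n) + cl (Y n))\<bar> \<le> 1 / (2 * cm)" for n
    using csum_ge[OF Y(1)[of n]] cm_pos by (auto intro!: divide_left_mono)
  from tendsto_zero_bounded_mult[OF 6 this]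
  have "(\<lambda>n. q (Y n) (T n) - q y t) \<longlonglongrightarrow> 0"
  proof (rule Lim_transform_eventually)
    have "c (Y n) + cl (Y n) \<noteq> 0" for n using csum_ge[OF Y(1)[of n]] cm_pos by auto
    then show "\<forall>\<^sub>F n in sequentially. 1 / (c (Y n) + cl (Y n)) * ((c (Y n) + cl (Y n)) * (q (Y n) (T n) - q y t)) = q (Y n) (T n) - q y t"
      by simp
  qed
  then show "(\<lambda>n. q (Y n) (T n)) \<longlonglongrightarrow> q y t" using LIM_zero_iff by blast
qed

text \<open>On the left of an atom the jump of \<open>c\<close> and that of \<open>K1\<close> are
  opposite to each other. The invariant of the characteristics running towards the boundary is
  therefore continuous, and \<open>u\<^sub>t\<close> inherits its continuity from it.\<close>

lemma jointly_cont_left_combination: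
  assumes q: "cauc q" and qj: "jointly_cont q"
  shows "jointly_cont (\<lambda>y t. c y * q y t + K1 q y t)"
proof (rule jointly_contI)
  fix Y T :: "nat \<Rightarrow> real" and y t :: real
  assume Y: "\<And>n. Y n \<ge> 0" "Y \<longlonglongrightarrow> y" and T: "T \<longlonglongrightarrow> t" and y: "y \<ge> 0"
  define i where "i n = (if Y n < y then jmp y else 0)" for n
  have 1: "(\<lambda>n. K1 q (Y n) (T n) - i n * q y t) \<longlonglongrightarrow> K1 q y t"
    using K1_tendsto[OF q Y T] by (simp add: i_def if_distrib[of "\<lambda>x. x * _"] cong: if_cong)
  have 2: "(\<lambda>n. q (Y n) (T n)) \<longlonglongrightarrow> q y t" by (rule jointly_contD[OF qj Y T y])
  have 3: "(\<lambda>n. c (Y n) + i n) \<longlonglongrightarrow> c y" unfolding i_def by (intro c_tendsto Y)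
  have 4: "(\<lambda>n. i n * (q y t - q (Y n) (T n))) \<longlonglongrightarrow> 0"
  proof (rule tendsto_zero_bounded_mult)
    show "(\<lambda>n. q y t - q (Y n) (T n)) \<longlonglongrightarrow> 0" using tendsto_diff[OF tendsto_const 2, of "q y t"] by simp
    show "\<bar>i n\<bar> \<le> L" for n unfolding i_def by (rule jump_seq_bound)
  qed
  have "(\<lambda>n. (c (Y n) + i n) * q (Y n) (T n) + (K1 q (Y n) (T n) - i n * q y t) + i n * (q y t - q (Y n) (T n))) \<longlonglongrightarrow> c y * q y t + K1 q y t + 0"
    by (intro tendsto_intros 1 2 3 4)
  then show "(\<lambda>n. c (Y n) * q (Y n) (T n) + K1 q (Y n) (T n)) \<longlonglongrightarrow> c y * q y t + K1 q y t"
    by (simp add: algebra_simps)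
qed

lemma jointly_cont_right_combination:
  assumes q: "cauc q" and qj: "jointly_cont q"
  shows "jointly_cont (\<lambda>y t. K2 q y t - cl y * q y t)"
proof (rule jointly_contI)
  fix Y T :: "nat \<Rightarrow> real" and y t :: real
  assume Y: "\<And>n. Y n \<ge> 0" "Y \<longlonglongrightarrow> y" and T: "T \<longlonglongrightarrow> t" and y: "y \<ge> 0"
  define k where "k n = (if y < Y n then jmp y else 0)" for n
  have 1: "(\<lambda>n. K2 q (Y n) (T n) - k n * q y t) \<longlonglongrightarrow> K2 q y t"
    using K2_tendsto[OF q Y T] by (simp add: k_def if_distrib[of "\<lambda>x. x * _"] cong: if_cong)
  have 2: "(\<lambda>n. q (Y n) (T n)) \<longlonglongrightarrow> q y t" by (rule jointly_contD[OF qj Y T y])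
  have 3: "(\<lambda>n. cl (Y n) - k n) \<longlonglongrightarrow> cl y" unfolding k_def by (intro c_tendsto Y)
  have 4: "(\<lambda>n. k n * (q y t - q (Y n) (T n))) \<longlonglongrightarrow> 0"
  proof (rule tendsto_zero_bounded_mult)
    show "(\<lambda>n. q y t - q (Y n) (T n)) \<longlonglongrightarrow> 0" using tendsto_diff[OF tendsto_const 2, of "q y t"] by simp
    show "\<bar>k n\<bar> \<le> L" for n unfolding k_def by (rule jump_seq_bound)
  qed
  have "(\<lambda>n. (K2 q (Y n) (T n) - k n * q y t) - (cl (Y n) - k n) * q (Y n) (T n) + k n * (q y t - q (Y n) (T n))) \<longlonglongrightarrow> K2 q y t - cl y * q y t + 0"
    by (intro tendsto_intros 1 2 3 4)
  then show "(\<lambda>n. K2 q (Y n) (T n) - cl (Y n) * q (Y n) (T n)) \<longlonglongrightarrow> K2 q y t - cl y * q y t"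
    by (simp add: algebra_simps)
qed

text \<open>The Stieltjes integral of \<open>v\<close> against \<open>c\<close>. An atom at the end
  point \<open>y\<close> is counted, in keeping with the right continuity of
  \<open>c\<close>.\<close>

definition intJ :: "(real \<Rightarrow> real) \<Rightarrow> real \<Rightarrow> real" where
  "intJ v y = (LINT z|N. (if 0 < z \<and> z \<le> y then J z * v z else 0))"

text \<open>Formally \<open>\<beta> v\<close> is \<open>c 0 * v 0\<close> plus the Stieltjes integral of \<open>c\<close> against \<open>v\<close>, integrated by parts;
  it is continuous across the atoms although \<open>c * v\<close> is not.\<close>

definition \<beta> :: "(real \<Rightarrow> real) \<Rightarrow> real \<Rightarrow> real" where
  "\<beta> v y = c y * v y - intJ v y"

lemma bounded_on_Icc:
  assumes "continuous_on UNIV (v :: real \<Rightarrow> real)" obtains B where "B \<ge> 0" "\<And>z. 0 \<le> z \<Longrightarrow> z \<le> R \<Longrightarrow> \<bar>v z\<bar> \<le> B"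
proof -
  have "compact (v ` {0..R})" by (intro compact_continuous_image continuous_on_subset[OF assms]) auto
  then obtain B where "\<forall>x\<in>v ` {0..R}. norm x \<le> B" using compact_imp_bounded bounded_iff by metis
  then show ?thesis by (intro that[of "max 0 B"]) (auto intro: order_trans[OF _ max.cobounded2])
qed

lemma intJ_integrable:
  assumes v: "continuous_on UNIV v" shows "integrable N (\<lambda>z. if 0 < z \<and> z \<le> y then J z * v z else 0)"
proof -
  have [measurable]: "v \<in> borel_measurable borel" using v by (rule borel_measurable_continuous_onI)
  obtain B where "B \<ge> 0" "\<And>z. 0 \<le> z \<Longrightarrow> z \<le> y \<Longrightarrow> \<bar>v z\<bar> \<le> B" using bounded_on_Icc[OF v] by metis
  then show ?thesis by (intro integrable_N(1)[of _ y "L * B"]) (auto intro!: JB)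
qed

lemma cauc_clamp_mult:
  assumes v: "continuous_on UNIV v"
  shows "cauc (\<lambda>z s. v z * min 1 (max 0 s))" and "jointly_cont (\<lambda>z s. v z * min 1 (max 0 s))"
proof -
  have [measurable]: "v \<in> borel_measurable borel" using v by (rule borel_measurable_continuous_onI)
  show "cauc (\<lambda>z s. v z * min 1 (max 0 s))"
    unfolding cauc_def causal_def
  proof (intro conjI allI impI)
    show "(\<lambda>x. v (fst x) * min 1 (max 0 (snd x))) \<in> borel_measurable borel"
      unfolding borel_prod[symmetric] by measurable
    show "continuous_on UNIV (\<lambda>s. v y * min 1 (max 0 s))" for y by (intro continuous_intros)
    fix R
    obtain B where B: "B \<ge> 0" "\<And>z. 0 \<le> z \<Longrightarrow> z \<le> R \<Longrightarrow> \<bar>v z\<bar> \<le> B" using bounded_on_Icc[OF v] by metis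
    have "\<bar>v y * min 1 (max 0 t)\<bar> \<le> B" if "0 \<le> y" "y + t \<le> R" for y t
    proof (cases "t \<le> 0")
      case False
      then have "\<bar>v y\<bar> * \<bar>min 1 (max 0 t)\<bar> \<le> B * 1" using that B by (intro mult_mono) auto
      then show ?thesis by (simp add: abs_mult)
    qed (use B in auto)
    then show "\<exists>B. \<forall>y t. 0 \<le> y \<longrightarrow> y + t \<le> R \<longrightarrow> \<bar>v y * min 1 (max 0 t)\<bar> \<le> B" by blast
  qed auto
  show "jointly_cont (\<lambda>z s. v z * min 1 (max 0 s))" unfolding jointly_cont_def
    by (intro continuous_intros continuous_on_compose2[OF v]) auto
qed

text \<open>With \<open>K2\<close> and \<open>cl\<close> applied to a function that has long been
  switched on, \<beta> becomes a special case of the right combination, in which the cancellation of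
  jumps is already known.\<close>

lemma \<beta>_alt:
  assumes v: "continuous_on UNIV v" and y: "y \<ge> 0"
  shows "\<beta> v y = - (K2 (\<lambda>z s. v z * min 1 (max 0 s)) y (y + 1) - cl y * (v y * min 1 (max 0 (y + 1))))"
proof -
  have k2: "K2 (\<lambda>z s. v z * min 1 (max 0 s)) y (y + 1) = (LINT z|N. (if 0 < z \<and> z < y then J z * v z else 0))"
    unfolding K2_def by (rule Bochner_Integration.integral_cong) auto
  have "intJ v y = (LINT z|N. (if 0 < z \<and> z < y then J z * v z else 0)) + jmp y * v y"
  proof (cases "y = 0")
    case True
    have "(\<lambda>z. if 0 < z \<and> z \<le> 0 then J z * v z else 0) = (\<lambda>z. 0)"
      "(\<lambda>z. if 0 < z \<and> z < 0 then J z * v z else 0) = (\<lambda>z. 0)" by auto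
    then have "intJ v 0 = 0" "(LINT z|N. (if 0 < z \<and> z < 0 then J z * v z else 0)) = 0"
      unfolding intJ_def by simp_all
    then show ?thesis using True jmp_0 by simp
  next
    case False
    have 1: "intJ v y - (LINT z|N. (if z = y then J y * v y else 0)) =
      (LINT z|N. (if 0 < z \<and> z \<le> y then J z * v z else 0) - (if z = y then J y * v y else 0))"
      unfolding intJ_def
      by (rule Bochner_Integration.integral_diff[symmetric], rule intJ_integrable[OF v],
          rule integrable_N(1)[of _ y "\<bar>J y * v y\<bar>"]) (use False y in auto)
    have 2: "(LINT z|N. (if 0 < z \<and> z \<le> y then J z * v z else 0) - (if z = y then J y * v y else 0)) = (LINT z|N. (if 0 < z \<and> z < y then J z * v z else 0))"
      by (rule Bochner_Integration.integral_cong) (use False y in auto)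
    show ?thesis using 1[unfolded 2] integral_N_singleton[of y "J y * v y"] False y
      by (auto simp: jmp_def split: if_splits)
  qed
  moreover have "min 1 (max 0 (y + 1)) = 1" using y by simp
  ultimately show ?thesis unfolding k2 \<beta>_def cl_eq_jmp by (simp add: algebra_simps)
qed

lemma \<beta>_cont:
  assumes v: "continuous_on UNIV v"
  shows "continuous_on {0..} (\<beta> v)"
proof -
  have "continuous_on {0..} (\<lambda>y. - (K2 (\<lambda>z s. v z * min 1 (max 0 s)) y (y + 1) - cl y * (v y * min 1 (max 0 (y + 1)))))"
    by (intro continuous_on_minus jointly_cont_compose[OF jointly_cont_right_combination[OF cauc_clamp_mult[OF v]]] continuous_intros) auto
  then show ?thesis by (rule continuous_on_eq) (use \<beta>_alt[OF v] in auto)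
qed

lemma \<beta>_0: "\<beta> v 0 = c 0 * v 0"
proof -
  have "intJ v 0 = (LINT z|N. 0)" unfolding intJ_def by (rule Bochner_Integration.integral_cong) auto
  then show ?thesis by (simp add: \<beta>_def)
qed

section \<open>Derivatives of the kernels and integration in time\<close>

lemma N_has_real_derivative:
  fixes U :: "real \<Rightarrow> real \<Rightarrow> real"
  assumes \<delta>: "\<delta> > 0"
    and int: "\<And>x. \<bar>x - x0\<bar> < \<delta> \<Longrightarrow> integrable N (U x)" and D: "D \<in> borel_measurable borel"
    and lip: "\<And>x z. \<bar>x - x0\<bar> < \<delta> \<Longrightarrow> 0 < z \<Longrightarrow> z \<le> R \<Longrightarrow> \<bar>U x z - U x0 z\<bar> \<le> C * \<bar>x - x0\<bar>" and C: "C \<ge> 0"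
    and zero: "\<And>x z. \<bar>x - x0\<bar> < \<delta> \<Longrightarrow> \<not> (0 < z \<and> z \<le> R) \<Longrightarrow> U x z = 0"
    and der: "AE z in N. ((\<lambda>x. U x z) has_real_derivative D z) (at x0)"
  shows "((\<lambda>x. LINT z|N. U x z) has_real_derivative (LINT z|N. D z)) (at x0)"
  unfolding has_field_derivative_iff LIMSEQ_SEQ_conv[symmetric]
proof (intro allI impI, elim conjE)
  fix S :: "nat \<Rightarrow> real" assume S: "\<forall>n. S n \<noteq> x0" "S \<longlonglongrightarrow> x0"
  have "eventually (\<lambda>n. dist (S n) x0 < \<delta>) sequentially" using S(2) \<delta> by (rule tendstoD)
  then obtain n0 where n0: "\<And>n. n \<ge> n0 \<Longrightarrow> \<bar>S n - x0\<bar> < \<delta>" unfolding eventually_sequentially by (auto simp: dist_real_def)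
  define T where "T n = S (n + n0)" for n
  have T: "T n \<noteq> x0" "\<bar>T n - x0\<bar> < \<delta>" for n using S n0[of "n + n0"] by (auto simp: T_def)
  have Tl: "T \<longlonglongrightarrow> x0" unfolding T_def using S(2) by (rule LIMSEQ_ignore_initial_segment)
  have i0: "integrable N (U x0)" using int[of x0] \<delta> by simp
  have eq: "((LINT z|N. U (T n) z) - (LINT z|N. U x0 z)) / (T n - x0) = (LINT z|N. (U (T n) z - U x0 z) / (T n - x0))" for n
    using Bochner_Integration.integral_diff[OF int[OF T(2)] i0] by simp
  have "(\<lambda>n. LINT z|N. (U (T n) z - U x0 z) / (T n - x0)) \<longlonglongrightarrow> (LINT z|N. D z)"
  proof (rule integral_dominated_convergence[where w = "\<lambda>z. C * indicator {0<..R} z"])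
    show "D \<in> borel_measurable N" using D by simp
    show "(\<lambda>z. (U (T n) z - U x0 z) / (T n - x0)) \<in> borel_measurable N" for n
      by (intro borel_measurable_divide borel_measurable_diff borel_measurable_const borel_measurable_integrable i0 int T)
    show "integrable N (\<lambda>z. C * indicator {0<..R} z)"
      using emeasure_N_Icc[of "R"] by (intro integrable_mult_right integrable_real_indicator) (auto simp: less_top)
    show "AE z in N. (\<lambda>n. (U (T n) z - U x0 z) / (T n - x0)) \<longlonglongrightarrow> D z"
      using der
    proof eventually_elim
      case (elim z)
      then show ?case unfolding has_field_derivative_iff LIMSEQ_SEQ_conv[symmetric] using T(1) Tl by blast
    qed
    show "AE z in N. norm ((U (T n) z - U x0 z) / (T n - x0)) \<le> C * indicator {0<..R} z" for n
    proof (rule AE_I2)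
      fix z
      show "norm ((U (T n) z - U x0 z) / (T n - x0)) \<le> C * indicator {0<..R} z"
      proof (cases "0 < z \<and> z \<le> R")
        case True
        then have "\<bar>U (T n) z - U x0 z\<bar> \<le> C * \<bar>T n - x0\<bar>" using lip[OF T(2)] by simp
        moreover have "\<bar>T n - x0\<bar> > 0" using T(1) by simp
        ultimately show ?thesis using True by (simp add: abs_divide divide_le_eq)
      next
        case False
        then show ?thesis using zero[OF T(2) False] zero[of x0 z] \<delta> by simp
      qed
    qed
  qed
  then have "(\<lambda>n. ((LINT z|N. U (S (n + n0)) z) - (LINT z|N. U x0 z)) / (S (n + n0) - x0)) \<longlonglongrightarrow> (LINT z|N. D z)"
    unfolding T_def[symmetric] eq .
  then show "(\<lambda>n. ((LINT z|N. U (S n) z) - (LINT z|N. U x0 z)) / (S n - x0)) \<longlonglongrightarrow> (LINT z|N. D z)"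
    by (rule LIMSEQ_offset)
qed

definition tint :: "(real \<Rightarrow> real \<Rightarrow> real) \<Rightarrow> real \<Rightarrow> real \<Rightarrow> real" where
  "tint r y t = (if y < 0 then 0 else integral {0..t} (r y))"

lemma tint_deriv:
  assumes r: "cauc r" and y: "y \<ge> 0"
  shows "(tint r y has_real_derivative r y t) (at t)"
proof -
  have "tint r y = (\<lambda>t. integral {0..t} (r y))" using y by (auto simp: tint_def fun_eq_iff)
  then show ?thesis using has_real_derivative_integral_causal[of "r y" t] r y cauc_nonpos[OF r y] by (simp add: cauc_def)
qed

lemma tint_lipschitz:
  assumes r: "cauc r" and z: "z \<ge> 0" and B: "\<And>s. s \<le> R \<Longrightarrow> \<bar>r z s\<bar> \<le> B" and ab: "a \<le> R" "b \<le> R"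
  shows "\<bar>tint r z a - tint r z b\<bar> \<le> B * \<bar>a - b\<bar>"
proof -
  have "norm (tint r z a - tint r z b) \<le> B * norm (a - b)"
    by (rule field_differentiable_bound[of "{..R}" "tint r z" "r z" B])
       (use ab B in \<open>auto intro!: has_field_derivative_at_within tint_deriv[OF r z]\<close>)
  then show ?thesis by simp
qed

lemma tint_nonpos: "t \<le> 0 \<Longrightarrow> tint r y t = 0"
  by (cases "t = 0") (auto simp: tint_def)

lemma cauc_tint:
  assumes r: "cauc r" shows "cauc (tint r)"
  unfolding cauc_def causal_def
proof (intro conjI allI impI)
  have leb: "integral {0..t} (r y) = (LINT s|lborel. indicator {0..t} s * r y s)" if y: "y \<ge> 0" for y t
  proof -
    have "set_integrable lborel {0..t} (r y)"
      using borel_integrable_atLeastAtMost'[of 0 t "r y"] r y by (auto simp: cauc_def intro: continuous_on_subset)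
    from set_borel_integral_eq_integral(2)[OF this] show ?thesis by (simp add: set_lebesgue_integral_def)
  qed
  have "(\<lambda>x. tint r (fst x) (snd x)) = (\<lambda>x. if fst x < 0 then 0 else (LINT s|lborel. (if 0 \<le> s \<and> s \<le> snd x then r (fst x) s else 0)))"
    by (auto simp: tint_def leb fun_eq_iff indicator_def intro!: Bochner_Integration.integral_cong)
  also have "\<dots> \<in> borel_measurable (borel \<Otimes>\<^sub>M borel)"
  proof (rule measurable_If)
    show "(\<lambda>x::real \<times> real. LINT s|lborel. (if 0 \<le> s \<and> s \<le> snd x then r (fst x) s else 0)) \<in> borel_measurable (borel \<Otimes>\<^sub>M borel)"
    proof (rule lborel.borel_measurable_lebesgue_integral)
      show "(\<lambda>(x, s). if 0 \<le> s \<and> s \<le> snd x then r (fst x) s else 0) \<in> borel_measurable ((borel \<Otimes>\<^sub>M borel) \<Otimes>\<^sub>M (lborel :: real measure))"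
        unfolding case_prod_beta by (intro measurable_If causal_meas[OF cauc_causal[OF r]]) measurable
    qed
  qed measurable
  finally show "(\<lambda>x. tint r (fst x) (snd x)) \<in> borel_measurable borel" unfolding borel_prod .
  show "tint r y t = 0" if "t < 0" for y t using that by (simp add: tint_nonpos)
  show "continuous_on UNIV (tint r y)" if "y \<ge> 0" for y
    using tint_deriv[OF r that] by (auto intro!: continuous_at_imp_continuous_on DERIV_isCont)
  fix R
  obtain B where B: "B \<ge> 0" "\<And>y t. 0 \<le> y \<Longrightarrow> y + t \<le> R \<Longrightarrow> \<bar>r y t\<bar> \<le> B" using causal_bound[OF cauc_causal[OF r]] by metis
  have "\<bar>tint r y t\<bar> \<le> B * \<bar>R\<bar>" if y: "0 \<le> y" "y + t \<le> R" for y t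
  proof (cases "t \<le> 0")
    case False
    have "\<bar>tint r y t - tint r y 0\<bar> \<le> B * \<bar>t - 0\<bar>"
      by (rule tint_lipschitz[OF r y(1), of t]) (use B y False in auto)
    also have "\<dots> \<le> B * \<bar>R\<bar>" using B y False by (intro mult_left_mono) auto
    finally show ?thesis by (simp add: tint_nonpos)
  qed (use B in \<open>auto simp: tint_nonpos\<close>)
  then show "\<exists>B. \<forall>y t. 0 \<le> y \<longrightarrow> y + t \<le> R \<longrightarrow> \<bar>tint r y t\<bar> \<le> B" by blast
qed

lemma K1_tint_deriv:
  assumes r: "cauc r" and y: "y \<ge> 0"
  shows "(K1 (tint r) y has_real_derivative K1 r y t) (at t)"
proof -
  note Rc = cauc_causal[OF cauc_tint[OF r]] and rc = cauc_causal[OF r]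
  obtain B where B: "B \<ge> 0" "\<And>z s. 0 \<le> z \<Longrightarrow> z + s \<le> y + t + 1 \<Longrightarrow> \<bar>r z s\<bar> \<le> B" using causal_bound[OF rc] by metis
  show ?thesis unfolding K1_def[abs_def]
  proof (rule N_has_real_derivative[of 1 _ _ _ "y + t + 1" "L * B"])
    show "integrable N (\<lambda>z. if y < z then J z * tint r z (x + y - z) else 0)" for x by (rule K1_integrable[OF Rc y])
    show "(\<lambda>z. if y < z then J z * r z (t + y - z) else 0) \<in> borel_measurable borel" by (rule K1_meas'[OF rc])
    show "L * B \<ge> 0" using L_nonneg B by simp
    show "(if y < z then J z * tint r z (x + y - z) else 0) = 0" if "\<bar>x - t\<bar> < 1" "\<not> (0 < z \<and> z \<le> y + t + 1)" for x z
      by (rule K1_zero[OF Rc y _ that(2)]) (use that in auto)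
    show "\<bar>(if y < z then J z * tint r z (x + y - z) else 0) - (if y < z then J z * tint r z (t + y - z) else 0)\<bar> \<le> L * B * \<bar>x - t\<bar>"
      if "\<bar>x - t\<bar> < 1" "0 < z" "z \<le> y + t + 1" for x z
    proof (cases "y < z")
      case True
      have "\<bar>tint r z (x + y - z) - tint r z (t + y - z)\<bar> \<le> B * \<bar>(x + y - z) - (t + y - z)\<bar>"
        by (rule tint_lipschitz[OF r, of _ "y + t + 1 - z"]) (use that B in auto)
      then have "\<bar>J z * (tint r z (x + y - z) - tint r z (t + y - z))\<bar> \<le> L * (B * \<bar>x - t\<bar>)" by (intro JB) simp
      then show ?thesis using True by (simp add: right_diff_distrib mult.assoc)
    qed (use L_nonneg B in auto)
    show "AE z in N. ((\<lambda>x. if y < z then J z * tint r z (x + y - z) else 0) has_real_derivative (if y < z then J z * r z (t + y - z) else 0)) (at t)"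
    proof (rule AE_I2)
      fix z
      show "((\<lambda>x. if y < z then J z * tint r z (x + y - z) else 0) has_real_derivative (if y < z then J z * r z (t + y - z) else 0)) (at t)"
      proof (cases "y < z")
        case True
        have "((\<lambda>x. tint r z (x + y - z)) has_real_derivative r z (t + y - z) * 1) (at t)"
          by (rule DERIV_chain2[OF tint_deriv[OF r]]) (use True y in \<open>auto intro!: derivative_eq_intros\<close>)
        from DERIV_cmult[OF this, of "J z"] show ?thesis using True by simp
      qed simp
    qed
  qed simp
qed

lemma K2_tint_deriv:
  assumes r: "cauc r" and y: "y \<ge> 0"
  shows "(K2 (tint r) y has_real_derivative K2 r y t) (at t)"
proof -
  note Rc = cauc_causal[OF cauc_tint[OF r]] and rc = cauc_causal[OF r]
  obtain B where B: "B \<ge> 0" "\<And>z s. 0 \<le> z \<Longrightarrow> z + s \<le> y + t + 1 \<Longrightarrow> \<bar>r z s\<bar> \<le> B" using causal_bound[OF rc] by metis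
  show ?thesis unfolding K2_def[abs_def]
  proof (rule N_has_real_derivative[of 1 _ _ _ y "L * B"])
    show "integrable N (\<lambda>z. if 0 < z \<and> z < y then J z * tint r z (x - y + z) else 0)" for x by (rule K2_integrable[OF Rc y])
    show "(\<lambda>z. if 0 < z \<and> z < y then J z * r z (t - y + z) else 0) \<in> borel_measurable borel" by (rule K2_meas'[OF rc])
    show "L * B \<ge> 0" using L_nonneg B by simp
    show "(if 0 < z \<and> z < y then J z * tint r z (x - y + z) else 0) = 0" if "\<bar>x - t\<bar> < 1" "\<not> (0 < z \<and> z \<le> y)" for x z
      by (rule K2_zero[OF Rc that(2)])
    show "\<bar>(if 0 < z \<and> z < y then J z * tint r z (x - y + z) else 0) - (if 0 < z \<and> z < y then J z * tint r z (t - y + z) else 0)\<bar> \<le> L * B * \<bar>x - t\<bar>"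
      if "\<bar>x - t\<bar> < 1" "0 < z" "z \<le> y" for x z
    proof (cases "z < y")
      case True
      have "\<bar>tint r z (x - y + z) - tint r z (t - y + z)\<bar> \<le> B * \<bar>(x - y + z) - (t - y + z)\<bar>"
        by (rule tint_lipschitz[OF r, of _ "y + t + 1 - z"]) (use that B True in auto)
      then have "\<bar>J z * (tint r z (x - y + z) - tint r z (t - y + z))\<bar> \<le> L * (B * \<bar>x - t\<bar>)" by (intro JB) simp
      then show ?thesis using True that by (simp add: right_diff_distrib mult.assoc)
    qed (use L_nonneg B in auto)
    show "AE z in N. ((\<lambda>x. if 0 < z \<and> z < y then J z * tint r z (x - y + z) else 0) has_real_derivative (if 0 < z \<and> z < y then J z * r z (t - y + z) else 0)) (at t)"
    proof (rule AE_I2)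
      fix z
      show "((\<lambda>x. if 0 < z \<and> z < y then J z * tint r z (x - y + z) else 0) has_real_derivative (if 0 < z \<and> z < y then J z * r z (t - y + z) else 0)) (at t)"
      proof (cases "0 < z \<and> z < y")
        case True
        have "((\<lambda>x. tint r z (x - y + z)) has_real_derivative r z (t - y + z) * 1) (at t)"
          by (rule DERIV_chain2[OF tint_deriv[OF r]]) (use True y in \<open>auto intro!: derivative_eq_intros\<close>)
        from DERIV_cmult[OF this, of "J z"] show ?thesis using True by simp
      qed auto
    qed
  qed simp
qed

text \<open>The two sides have the same derivative in time, by the equation for \<open>r\<close>,
  and both vanish at negative times.\<close>

lemma tint_equation:
  assumes r: "cauc r" and H: "\<And>y. y \<ge> 0 \<Longrightarrow> continuous_on UNIV (H y)" "\<And>y t. y \<ge> 0 \<Longrightarrow> t \<le> 0 \<Longrightarrow> H y t = 0"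
    and eq: "\<And>y t. y \<ge> 0 \<Longrightarrow> (c y + cl y) * r y t = H y t - K1 r y t + K2 r y t - K1 r 0 (t - y)"
    and y: "y \<ge> 0"
  shows "(c y + cl y) * tint r y t = tint H y t - K1 (tint r) y t + K2 (tint r) y t - K1 (tint r) 0 (t - y)"
proof -
  note Rc = cauc_causal[OF cauc_tint[OF r]]
  define D where "D t = (c y + cl y) * tint r y t - (tint H y t - K1 (tint r) y t + K2 (tint r) y t - K1 (tint r) 0 (t - y))" for t
  have Hd: "(tint H y has_real_derivative H y t) (at t)" for t
  proof -
    have "tint H y = (\<lambda>t. integral {0..t} (H y))" using y by (auto simp: tint_def fun_eq_iff)
    then show ?thesis using has_real_derivative_integral_causal[of "H y" t] H y by simp
  qed
  have K0: "((\<lambda>t. K1 (tint r) 0 (t - y)) has_real_derivative K1 r 0 (t - y) * 1) (at t)" for t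
    by (rule DERIV_chain2[OF K1_tint_deriv[OF r]]) (auto intro!: derivative_eq_intros)
  have "(D has_real_derivative ((c y + cl y) * r y t - (H y t - K1 r y t + K2 r y t - K1 r 0 (t - y) * 1))) (at t)" for t
    unfolding D_def[abs_def]
    by (intro DERIV_diff DERIV_add DERIV_cmult tint_deriv[OF r y] Hd K1_tint_deriv[OF r y] K2_tint_deriv[OF r y] K0)
  then have "(D has_real_derivative 0) (at t)" for t using eq[OF y, of t] by (metis diff_self mult_1_right)
  then have "D t = D (min t 0 - 1)" by (intro DERIV_isconst_all) auto
  also have "\<dots> = 0" unfolding D_def using K1_neg[OF Rc] K2_neg[OF Rc] y by (simp add: tint_nonpos)
  finally show ?thesis by (simp add: D_def)
qed

text \<open>Off the atoms the two kernels form one integral with delay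
  \<open>\<bar>y - z\<bar>\<close>, and the kink at \<open>z = y\<close> is a null set. The slope of
  the delay has opposite signs on its two sides, which is why the kernels appear with opposite
  signs. The time integral is essential: \<open>r\<close> itself is only continuous in time, so the
  integrand could not be differentiated in \<open>y\<close>.\<close>

lemma K12_tint_deriv_space:
  assumes r: "cauc r" and y: "y > 0" "y \<notin> A"
  shows "((\<lambda>y. LINT z|N. (if 0 < z then J z * tint r z (t - \<bar>y - z\<bar>) else 0)) has_real_derivative K1 r y t - K2 r y t) (at y)"
proof -
  note Rc = cauc_causal[OF cauc_tint[OF r]] and rc = cauc_causal[OF r]
  obtain B where B: "B \<ge> 0" "\<And>z s. 0 \<le> z \<Longrightarrow> z + s \<le> \<bar>y\<bar> + \<bar>t\<bar> + 1 \<Longrightarrow> \<bar>r z s\<bar> \<le> B" using causal_bound[OF rc] by metis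
  define R where "R = \<bar>y\<bar> + \<bar>t\<bar> + 1"
  define D where "D z = (if 0 < z then J z * (r z (t - \<bar>y - z\<bar>) * (if z < y then -1 else if y < z then 1 else 0)) else 0)" for z
  have Dm: "D \<in> borel_measurable borel" unfolding D_def
    by (intro measurable_If borel_measurable_times causal_meas[OF rc]) measurable
  have zR: "tint r z (t - \<bar>x - z\<bar>) = 0" if "\<bar>x - y\<bar> < 1" "R < z" for x z
    by (rule tint_nonpos) (use that in \<open>auto simp: R_def\<close>)
  have Tb: "\<bar>tint r z s - tint r z s'\<bar> \<le> B * \<bar>s - s'\<bar>" if "0 \<le> z" "z + s \<le> R" "z + s' \<le> R" for z s s'
    by (rule tint_lipschitz[OF r, of _ "R - z"]) (use that B in \<open>auto simp: R_def\<close>)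
  have meas: "(\<lambda>z. if 0 < z then J z * tint r z (t - \<bar>x - z\<bar>) else 0) \<in> borel_measurable borel" for x
    by (intro measurable_If borel_measurable_times causal_meas[OF Rc]) measurable
  have "((\<lambda>y. LINT z|N. (if 0 < z then J z * tint r z (t - \<bar>y - z\<bar>) else 0)) has_real_derivative (LINT z|N. D z)) (at y)"
  proof (rule N_has_real_derivative[of 1 _ _ _ R "L * B"])
    show "integrable N (\<lambda>z. if 0 < z then J z * tint r z (t - \<bar>x - z\<bar>) else 0)" if x: "\<bar>x - y\<bar> < 1" for x
    proof (rule integrable_N(1)[OF meas])
      fix z assume z: "0 < z" "z \<le> R"
      have "\<bar>tint r z (t - \<bar>x - z\<bar>) - tint r z (min 0 (t - \<bar>x - z\<bar>))\<bar> \<le> B * \<bar>(t - \<bar>x - z\<bar>) - min 0 (t - \<bar>x - z\<bar>)\<bar>"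
        by (rule Tb) (use z x in \<open>auto simp: R_def\<close>)
      also have "\<dots> \<le> B * R" by (rule mult_left_mono) (use B in \<open>auto simp: R_def\<close>)
      finally have "\<bar>J z * tint r z (t - \<bar>x - z\<bar>)\<bar> \<le> L * (B * R)" by (intro JB) (simp add: tint_nonpos)
      then show "\<bar>if 0 < z then J z * tint r z (t - \<bar>x - z\<bar>) else 0\<bar> \<le> L * (B * R)" using z by simp
    qed (use zR[OF x] in auto)
    show "D \<in> borel_measurable borel" by (rule Dm)
    show "L * B \<ge> 0" using L_nonneg B by simp
    show "(if 0 < z then J z * tint r z (t - \<bar>x - z\<bar>) else 0) = 0" if "\<bar>x - y\<bar> < 1" "\<not> (0 < z \<and> z \<le> R)" for x z
      using that zR[OF that(1)] by auto
    show "\<bar>(if 0 < z then J z * tint r z (t - \<bar>x - z\<bar>) else 0) - (if 0 < z then J z * tint r z (t - \<bar>y - z\<bar>) else 0)\<bar> \<le> L * B * \<bar>x - y\<bar>"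
      if x: "\<bar>x - y\<bar> < 1" and z: "0 < z" "z \<le> R" for x z
    proof -
      have "\<bar>tint r z (t - \<bar>x - z\<bar>) - tint r z (t - \<bar>y - z\<bar>)\<bar> \<le> B * \<bar>(t - \<bar>x - z\<bar>) - (t - \<bar>y - z\<bar>)\<bar>"
        by (rule Tb) (use z x in \<open>auto simp: R_def\<close>)
      also have "\<dots> \<le> B * \<bar>x - y\<bar>" by (rule mult_left_mono) (use B in auto)
      finally have "\<bar>J z * (tint r z (t - \<bar>x - z\<bar>) - tint r z (t - \<bar>y - z\<bar>))\<bar> \<le> L * (B * \<bar>x - y\<bar>)" by (rule JB)
      then show ?thesis using z by (simp add: right_diff_distrib mult.assoc)
    qed
    have "AE z in N. z \<noteq> y"
      using measure_atom[OF y] by (intro AE_I[of _ _ "{y}"]) auto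
    then show "AE z in N. ((\<lambda>x. if 0 < z then J z * tint r z (t - \<bar>x - z\<bar>) else 0) has_real_derivative D z) (at y)"
    proof eventually_elim
      case (elim z)
      have "((\<lambda>x. t - \<bar>x - z\<bar>) has_real_derivative (if z < y then -1 else if y < z then 1 else 0)) (at y)"
      proof (cases "z < y")
        case True
        have "((\<lambda>x. t - (x - z)) has_real_derivative -1) (at y)" by (auto intro!: derivative_eq_intros)
        then have "((\<lambda>x. t - \<bar>x - z\<bar>) has_real_derivative -1) (at y)"
          by (rule has_field_derivative_transform_within_open[of _ _ _ "{z<..}"]) (use True in auto)
        then show ?thesis using True by simp
      next
        case False
        then have "y < z" using elim by simp
        have "((\<lambda>x. t - (z - x)) has_real_derivative 1) (at y)" by (auto intro!: derivative_eq_intros)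
        then have "((\<lambda>x. t - \<bar>x - z\<bar>) has_real_derivative 1) (at y)"
          by (rule has_field_derivative_transform_within_open[of _ _ _ "{..<z}"]) (use \<open>y < z\<close> in auto)
        then show ?thesis using \<open>y < z\<close> by simp
      qed
      note ch = this
      show ?case
      proof (cases "0 < z")
        case True
        from DERIV_cmult[OF DERIV_chain2[OF tint_deriv[OF r, of z] ch], of "J z"]
        show ?thesis using True by (simp add: D_def)
      qed (simp add: D_def)
    qed
  qed simp
  moreover have "(LINT z|N. D z) = K1 r y t - K2 r y t"
    unfolding K1_def K2_def
    by (subst Bochner_Integration.integral_diff[symmetric, OF K1_integrable[OF rc] K2_integrable[OF rc]])
       (use y in \<open>auto simp: D_def algebra_simps abs_if intro!: Bochner_Integration.integral_cong\<close>)
  ultimately show ?thesis by simp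
qed

lemma K12_off_atoms:
  assumes q: "causal q" and y: "y > 0" "y \<notin> A"
  shows "K1 q y t + K2 q y t = (LINT z|N. (if 0 < z then J z * q z (t - \<bar>y - z\<bar>) else 0))"
proof -
  have ne: "AE z in N. z \<noteq> y"
    using measure_atom[OF y] by (intro AE_I[of _ _ "{y}"]) auto
  have "K1 q y t + K2 q y t = (LINT z|N. (if y < z then J z * q z (t + y - z) else 0) + (if 0 < z \<and> z < y then J z * q z (t - y + z) else 0))"
    unfolding K1_def K2_def by (rule Bochner_Integration.integral_add[symmetric]) (use y in \<open>auto intro!: K1_integrable K2_integrable q\<close>)
  also have "\<dots> = (LINT z|N. (if 0 < z then J z * q z (t - \<bar>y - z\<bar>) else 0))"
  proof (rule integral_cong_AE)
    show "(\<lambda>z. if 0 < z then J z * q z (t - \<bar>y - z\<bar>) else 0) \<in> borel_measurable N"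
      using causal_meas[OF q, of "\<lambda>z. z" N "\<lambda>z. t - \<bar>y - z\<bar>"] by measurable
    show "(\<lambda>z. (if y < z then J z * q z (t + y - z) else 0) + (if 0 < z \<and> z < y then J z * q z (t - y + z) else 0)) \<in> borel_measurable N"
      using K1_meas'[OF q, of y t] K2_meas'[OF q, of y t] by measurable
    show "AE z in N. (if y < z then J z * q z (t + y - z) else 0) + (if 0 < z \<and> z < y then J z * q z (t - y + z) else 0) = (if 0 < z then J z * q z (t - \<bar>y - z\<bar>) else 0)"
      using ne by eventually_elim (use y in \<open>auto simp: abs_if algebra_simps\<close>)
  qed
  finally show ?thesis .
qed

section \<open>Data terms and existence of mild solutions\<close>

lemma cauc_continuousI:
  assumes F: "continuous_on UNIV (\<lambda>x. F (fst x) (snd x))" and z: "\<And>y t. t \<le> 0 \<Longrightarrow> F y t = 0"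
  shows "cauc F" and "jointly_cont F"
proof -
  show "jointly_cont F" unfolding jointly_cont_def using F by (rule continuous_on_subset) simp
  show "cauc F" unfolding cauc_def causal_def
  proof (intro conjI allI impI)
    show "(\<lambda>x. F (fst x) (snd x)) \<in> borel_measurable borel" using F by (rule borel_measurable_continuous_onI)
    show "F y t = 0" if "t < 0" for y t using z that by simp
    show "continuous_on UNIV (F y)" for y
      using continuous_on_compose2[OF F continuous_on_Pair[OF continuous_on_const[of UNIV y] continuous_on_id]] by simp
    fix R
    have "compact ((\<lambda>x. F (fst x) (snd x)) ` ({0..R} \<times> {0..R}))"
      by (intro compact_continuous_image continuous_on_subset[OF F] compact_Times compact_Icc) simp
    then obtain B where B: "\<forall>x\<in>(\<lambda>x. F (fst x) (snd x)) ` ({0..R} \<times> {0..R}). norm x \<le> B"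
      using compact_imp_bounded bounded_iff by metis
    have "\<bar>F y t\<bar> \<le> max 0 B" if "0 \<le> y" "y + t \<le> R" for y t
    proof (cases "t \<le> 0")
      case False
      then have "(y, t) \<in> {0..R} \<times> {0..R}" using that by simp
      then have "\<bar>F y t\<bar> \<le> B" using B by force
      then show ?thesis by simp
    qed (simp add: z)
    then show "\<exists>B. \<forall>y t. 0 \<le> y \<longrightarrow> y + t \<le> R \<longrightarrow> \<bar>F y t\<bar> \<le> B" by blast
  qed
qed

lemma K1_nonpos: assumes q: "cauc q" and y: "y \<ge> 0" "t \<le> 0" shows "K1 q y t = 0"
proof -
  have "(\<lambda>z. if y < z then J z * q z (t + y - z) else 0) = (\<lambda>z. 0)" using cauc_nonpos[OF q] y by auto
  then show ?thesis by (simp add: K1_def)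
qed

lemma K2_nonpos: assumes q: "cauc q" and y: "t \<le> 0" shows "K2 q y t = 0"
proof -
  have "(\<lambda>z. if 0 < z \<and> z < y then J z * q z (t - y + z) else 0) = (\<lambda>z. 0)" using cauc_nonpos[OF q] y by auto
  then show ?thesis by (simp add: K2_def)
qed

lemma K2_0: "K2 q 0 t = 0"
proof -
  have "(\<lambda>z. if 0 < z \<and> z < 0 then J z * q z (t - 0 + z) else 0) = (\<lambda>z. 0)" by auto
  then show ?thesis by (simp add: K2_def)
qed

text \<open>The initial value of the invariant belonging to \<open>u\<^sub>t + c u\<^sub>x\<close>,
  with the Stieltjes correction contained in \<beta>; \<open>Fm\<close> belongs to
  \<open>u\<^sub>t - c u\<^sub>x\<close>. For negative \<open>y\<close>, where there are no data,
  the value at 0 is kept, so that one formula serves before and after the arrival of the boundary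
  signal.\<close>

definition Fp :: "(real \<Rightarrow> real) \<Rightarrow> (real \<Rightarrow> real) \<Rightarrow> real \<Rightarrow> real" where
  "Fp v0 v1 y = v1 (max 0 y) + \<beta> v0 (max 0 y)"

definition Fm :: "(real \<Rightarrow> real) \<Rightarrow> (real \<Rightarrow> real) \<Rightarrow> real \<Rightarrow> real" where
  "Fm v0 v1 y = v1 (max 0 y) - \<beta> v0 (max 0 y)"

lemma Fp_cont:
  assumes "continuous_on UNIV v0" "continuous_on UNIV v1" shows "continuous_on S (Fp v0 v1)"
  unfolding Fp_def by (intro continuous_intros continuous_on_compose2[OF \<beta>_cont] continuous_on_compose2[OF assms(2)] assms) auto

lemma Fm_cont:
  assumes "continuous_on UNIV v0" "continuous_on UNIV v1" shows "continuous_on S (Fm v0 v1)"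
  unfolding Fm_def by (intro continuous_intros continuous_on_compose2[OF \<beta>_cont] continuous_on_compose2[OF assms(2)] assms) auto

definition Hf :: "(real \<Rightarrow> real) \<Rightarrow> (real \<Rightarrow> real) \<Rightarrow> real \<Rightarrow> real \<Rightarrow> real" where
  "Hf v0 v1 y t = Fp v0 v1 (max 0 y + max 0 t) - Fp v0 v1 (max 0 y) + Fm v0 v1 (max 0 y) - Fm v0 v1 (max 0 y - max 0 t)
     + Fp v0 v1 (max 0 t - max 0 y) - Fp v0 v1 0"

lemma Hf_nonpos: "t \<le> 0 \<Longrightarrow> Hf v0 v1 y t = 0"
  by (simp add: Hf_def Fp_def)

lemma Hf_cauc:
  assumes "continuous_on UNIV v0" "continuous_on UNIV v1" shows "cauc (Hf v0 v1)" "jointly_cont (Hf v0 v1)"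
proof -
  have "continuous_on UNIV (\<lambda>x. Hf v0 v1 (fst x) (snd x))" unfolding Hf_def
    by (intro continuous_intros continuous_on_compose2[OF Fp_cont[OF assms, of UNIV]] continuous_on_compose2[OF Fm_cont[OF assms, of UNIV]]) auto
  from cauc_continuousI[OF this Hf_nonpos] show "cauc (Hf v0 v1)" "jointly_cont (Hf v0 v1)" by auto
qed

text \<open>In the straightened coordinate \<open>y\<close>, with \<open>v0 = u\<^sub>0'\<close>, \<open>v1 = u\<^sub>1\<close>: \<open>p\<close> is \<open>u\<^sub>t\<close> and \<open>r\<close> is \<open>u\<^sub>x - u\<^sub>0'\<close>,
  continued by \<open>0\<close> to \<open>t \<le> 0\<close>.\<close>

definition mild_solution :: "(real \<Rightarrow> real) \<Rightarrow> (real \<Rightarrow> real) \<Rightarrow> (real \<Rightarrow> real) \<Rightarrow> (real \<Rightarrow> real \<Rightarrow> real) \<Rightarrow> (real \<Rightarrow> real \<Rightarrow> real) \<Rightarrow> bool" where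
  "mild_solution f v0 v1 r p \<longleftrightarrow> cauc r \<and> jointly_cont r \<and>
     (\<forall>y\<ge>0. \<forall>t\<ge>0. p y t + c y * r y t + \<beta> v0 y = Fp v0 v1 (y + t) - K1 r y t) \<and>
     (\<forall>y\<ge>0. \<forall>t. (c y + cl y) * r y t = (Hf v0 v1 y t - 2 * (p 0 (max 0 (t - y)) - v1 0)) - K1 r y t + K2 r y t - K1 r 0 (t - y)) \<and>
     (\<forall>t\<ge>0. f (p 0 t) = f (v1 0) + v0 0 * t + tint r 0 t)"

lemma mild_p_cont:
  assumes v: "continuous_on UNIV v0" "continuous_on UNIV v1" and r: "cauc r" "jointly_cont r"
    and w: "\<And>y t. y \<ge> 0 \<Longrightarrow> t \<ge> 0 \<Longrightarrow> p y t + c y * r y t + \<beta> v0 y = Fp v0 v1 (y + t) - K1 r y t"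
  shows "jointly_cont (\<lambda>y t. p y (max 0 t))"
proof -
  have "jointly_cont (\<lambda>y t. Fp v0 v1 (y + max 0 t) - \<beta> v0 y - (c y * r y (max 0 t) + K1 r y (max 0 t)))"
    unfolding jointly_cont_def
    by (intro continuous_intros continuous_on_compose2[OF Fp_cont[OF v, of UNIV]] continuous_on_compose2[OF \<beta>_cont[OF v(1)]]
          jointly_cont_compose[OF jointly_cont_left_combination[OF r]]) auto
  moreover have "Fp v0 v1 (y + max 0 t) - \<beta> v0 y - (c y * r y (max 0 t) + K1 r y (max 0 t)) = p y (max 0 t)" if "y \<ge> 0" for y t
    using w[OF that, of "max 0 t"] by simp
  ultimately show ?thesis unfolding jointly_cont_def by (elim continuous_on_eq) auto
qed

lemma c0_pos: "c 0 > 0"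
  using c_ge[of 0] cm_pos by simp

text \<open>The a priori estimate with inhomogeneity 0, applied to the difference on the triangle
  through \<open>(y, t)\<close>.\<close>

lemma volterra_unique:
  assumes "cauc q1" "cauc q2"
    and "\<And>y t. y \<ge> 0 \<Longrightarrow> (c y + cl y) * q1 y t = H y t - K1 q1 y t + K2 q1 y t - K1 q1 0 (t - y)"
    and "\<And>y t. y \<ge> 0 \<Longrightarrow> (c y + cl y) * q2 y t = H y t - K1 q2 y t + K2 q2 y t - K1 q2 0 (t - y)"
    and y: "y \<ge> 0"
  shows "q1 y t = q2 y t"
proof -
  define d where "d = (\<lambda>y t. q1 y t - q2 y t)"
  have d: "cauc d" unfolding d_def by (rule cauc_diff[OF assms(1,2)])
  note c1 = cauc_causal[OF assms(1)] and c2 = cauc_causal[OF assms(2)]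
  obtain C where C: "\<forall>d B. cauc d \<longrightarrow> B \<ge> 0 \<longrightarrow>
    (\<forall>y' t' b. 0 \<le> y' \<longrightarrow> y' + t' \<le> y + t \<longrightarrow> (\<forall>r. r \<le> t' - y' \<longrightarrow> \<bar>K1 d 0 r\<bar> \<le> b) \<longrightarrow>
      (c y' + cl y') * \<bar>d y' t'\<bar> \<le> B + 2 * b + \<bar>K1 d y' t'\<bar> + \<bar>K2 d y' t'\<bar> + \<bar>K1 d 0 (t' - y')\<bar>) \<longrightarrow>
    (\<forall>y' t'. 0 \<le> y' \<longrightarrow> y' + t' \<le> y + t \<longrightarrow> \<bar>d y' t'\<bar> \<le> C * B)"
    using volterra_estimate[of "y + t"] by blast
  have "\<bar>d y t\<bar> \<le> C * 0"
  proof (rule C[rule_format, OF d])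
    fix y' t' b :: real
    assume y': "0 \<le> y'" "y' + t' \<le> y + t" and b: "\<And>r. r \<le> t' - y' \<Longrightarrow> \<bar>K1 d 0 r\<bar> \<le> b"
    have "b \<ge> 0" using b[OF order_refl] by simp
    have "(c y' + cl y') * d y' t' = - K1 d y' t' + K2 d y' t' - K1 d 0 (t' - y')"
      using assms(3,4)[OF y'(1), of t'] unfolding d_def K1_diff[OF c1 c2 y'(1)] K2_diff[OF c1 c2 y'(1)] K1_diff[OF c1 c2 order_refl]
      by (simp add: algebra_simps)
    then have "\<bar>(c y' + cl y') * d y' t'\<bar> \<le> \<bar>K1 d y' t'\<bar> + \<bar>K2 d y' t'\<bar> + \<bar>K1 d 0 (t' - y')\<bar>" by linarith
    moreover have "\<bar>(c y' + cl y') * d y' t'\<bar> = (c y' + cl y') * \<bar>d y' t'\<bar>"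
      using csum_ge[OF y'(1)] cm_pos by (simp add: abs_mult)
    ultimately show "(c y' + cl y') * \<bar>d y' t'\<bar> \<le> 0 + 2 * b + \<bar>K1 d y' t'\<bar> + \<bar>K2 d y' t'\<bar> + \<bar>K1 d 0 (t' - y')\<bar>"
      using \<open>b \<ge> 0\<close> by simp
  qed (use y in auto)
  then show ?thesis by (simp add: d_def)
qed

lemma integral_delay:
  fixes e :: "real \<Rightarrow> real"
  assumes e: "continuous_on UNIV e" "\<And>s. s \<le> 0 \<Longrightarrow> e s = 0" and y: "y \<ge> 0"
  shows "integral {0..t} (\<lambda>s. e (s - y)) = integral {0..t - y} e"
proof -
  define D where "D t = integral {0..t} (\<lambda>s. e (s - y)) - integral {0..t - y} e" for t
  have d1: "((\<lambda>t. integral {0..t} (\<lambda>s. e (s - y))) has_real_derivative e (t - y)) (at t)" for t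
    by (rule has_real_derivative_integral_causal) (use y in \<open>auto intro!: continuous_intros continuous_on_compose2[OF e(1)] e(2)\<close>)
  have d2: "((\<lambda>t. integral {0..t - y} e) has_real_derivative e (t - y) * 1) (at t)" for t
    by (rule DERIV_chain2[OF has_real_derivative_integral_causal[OF e]]) (auto intro!: derivative_eq_intros)
  have "(D has_real_derivative e (t - y) - e (t - y) * 1) (at t)" for t
    unfolding D_def[abs_def] by (intro DERIV_diff d1 d2)
  then have "D t = D (-1)" by (intro DERIV_isconst_all) simp
  also have "\<dots> = 0" using y by (simp add: D_def)
  finally show ?thesis by (simp add: D_def)
qed

lemma tint_Hf_0:
  assumes v: "continuous_on UNIV v0" "continuous_on UNIV v1" and t: "t \<ge> 0"
  shows "tint (Hf v0 v1) 0 t = 2 * integral {0..t} (Fp v0 v1) - 2 * t * (v1 0 + c 0 * v0 0)"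
proof -
  have "tint (Hf v0 v1) 0 t = integral {0..t} (\<lambda>s. 2 * Fp v0 v1 s - 2 * (v1 0 + c 0 * v0 0))"
    unfolding tint_def by (auto intro!: integral_cong simp: Hf_def Fm_def Fp_def \<beta>_0 max_def)
  also have "\<dots> = 2 * integral {0..t} (Fp v0 v1) - 2 * t * (v1 0 + c 0 * v0 0)"
    using t by (subst Henstock_Kurzweil_Integration.integral_diff)
       (auto intro!: integrable_continuous_real continuous_intros Fp_cont v)
  finally show ?thesis .
qed

text \<open>Let \<open>q\<close> be the time integral of \<open>r\<close> and \<open>E\<close> that
  of the trace. Integrated over time, the left invariant at \<open>y = 0\<close> reads \<open>E + c
  0 * (v0 0 * t + q 0 t) = integral {0..t} (Fp v0 v1) - K1 q 0 t\<close>. Eliminating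
  \<open>v0 0 * t + q 0 t\<close> from the integrated boundary condition leads to
  \<open>f (p 0 t) = \<psi> - E / c 0\<close>, where \<open>b = f (v1 0)\<close>. The unknown occurs
  in \<psi> through \<open>K1 q 0\<close> only, as the contraction demands.\<close>

definition \<psi> :: "(real \<Rightarrow> real) \<Rightarrow> (real \<Rightarrow> real) \<Rightarrow> real \<Rightarrow> (real \<Rightarrow> real \<Rightarrow> real) \<Rightarrow> real \<Rightarrow> real" where
  "\<psi> v0 v1 b q t = b + (integral {0..t} (Fp v0 v1) - K1 q 0 t) / c 0"

lemma \<psi>_cont:
  assumes v: "continuous_on UNIV v0" "continuous_on UNIV v1" and q: "cauc q"
  shows "continuous_on {0..} (\<psi> v0 v1 b q)"
proof -
  have "continuous_on {0..} (\<lambda>t. integral {0..t} (Fp v0 v1))"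
    unfolding continuous_on_eq_continuous_within
  proof
    fix t :: real assume t: "t \<in> {0..}"
    have "continuous_on {0..t+1} (\<lambda>t. integral {0..t} (Fp v0 v1))"
      by (intro indefinite_integral_continuous_1 integrable_continuous_real Fp_cont v)
    then have "continuous (at t within {0..t+1}) (\<lambda>t. integral {0..t} (Fp v0 v1))"
      using t by (simp add: continuous_on_eq_continuous_within)
    moreover have "at t within {0..t+1} = at t within {0..}"
      by (rule at_within_nhd[of _ "{t-1<..<t+1}"]) auto
    ultimately show "continuous (at t within {0..}) (\<lambda>t. integral {0..t} (Fp v0 v1))"
      by (simp add: continuous_within)
  qed
  moreover have "continuous_on {0..} (K1 q 0)"
    using K1_isCont[OF q order_refl] by (intro continuous_at_imp_continuous_on) auto
  ultimately show ?thesis unfolding \<psi>_def using c0_pos by (intro continuous_intros) auto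
qed

text \<open>The fixed point is sought for \<open>q\<close>, the time integral of \<open>r\<close>:
  its forcing contains the trace through \<open>E\<close> alone, and \<open>E\<close> is Lipschitz
  in \<open>K1 q 0\<close>. Afterwards \<open>p0 = E'\<close> is a known continuous function, the
  linear equation with this trace is solved for \<open>r\<close>, and uniqueness identifies the time
  integral of \<open>r\<close> with \<open>q\<close>. In this way \<open>q\<close> never has to be
  differentiated.\<close>

theorem mild_exists:
  assumes g: "mono g" "continuous_on UNIV g" and fg: "\<And>x. f (g x) = x" "\<And>x. g (f x) = x"
    and v: "continuous_on UNIV v0" "continuous_on UNIV v1"
  shows "\<exists>r p. mild_solution f v0 v1 r p"
proof -
  define P where "P q E \<longleftrightarrow> E 0 = (0::real) \<and> (\<forall>t\<ge>0. (E has_real_derivative g (\<psi> v0 v1 (f (v1 0)) q t - E t / c 0)) (at t within {0..}))" for q E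
  define E where "E q = (SOME E. P q E)" for q
  have PE: "P q (E q)" if q: "cauc q" for q
  proof -
    have "\<exists>E. P q E" unfolding P_def
      by (rule ode_exists[OF g, of "f 0"]) (use fg c0_pos \<psi>_cont[OF v q] in auto)
    then show ?thesis unfolding E_def by (rule someI_ex)
  qed
  have Ec: "continuous_on {0..} (E q)" if "cauc q" for q
    by (rule DERIV_continuous_on) (use PE[OF that] in \<open>auto simp: P_def\<close>)
  \<comment> \<open>The time integral of the trace minus its initial value, once the trace has been
    identified as the derivative of \<open>E q\<close>. It will be evaluated at
    \<open>t - y\<close>, the time at which a signal seen at \<open>(y, t)\<close> left the
    boundary.\<close>
  define h where "h q s = E q (max 0 s) - max 0 s * v1 0" for q s
  define G where "G q y t = tint (Hf v0 v1) y t - 2 * h q (t - max 0 y)" for q y t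
  have hc: "continuous_on UNIV (h q)" if "cauc q" for q
    unfolding h_def by (intro continuous_intros continuous_on_compose2[OF Ec[OF that]]) auto
  have h0: "h q s = 0" if "cauc q" "s \<le> 0" for q s using PE[OF that(1)] that(2) by (auto simp: h_def P_def)
  have caucG: "cauc (G q)" if q: "cauc q" for q
  proof -
    have "cauc (\<lambda>y t. 2 * h q (t - max 0 y))"
    proof (rule cauc_continuousI)
      show "continuous_on UNIV (\<lambda>x. 2 * h q (snd x - max 0 (fst x)))"
        by (intro continuous_intros continuous_on_compose2[OF hc[OF q]]) auto
      show "2 * h q (t - max 0 y) = 0" if "t \<le> 0" for y t using h0[OF q, of "t - max 0 y"] that by simp
    qed
    then show ?thesis unfolding G_def by (intro cauc_diff cauc_tint Hf_cauc v)
  qed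
  have lipG: "\<bar>G q1 y t - G q2 y t\<bar> \<le> 2 * b"
    if q: "cauc q1" "cauc q2" and y: "y \<ge> 0" and b: "\<And>r. r \<le> t - y \<Longrightarrow> \<bar>K1 q1 0 r - K1 q2 0 r\<bar> \<le> b" for q1 q2 y t b
  proof (cases "t - y \<le> 0")
    case True
    have "b \<ge> 0" using b[OF order_refl] by simp
    then show ?thesis using True y h0 q by (simp add: G_def max_def)
  next
    case False
    then have ty: "t - y \<ge> 0" by simp
    \<comment> \<open>The factor \<open>c 0\<close> in the stability lemma cancels the division by
      \<open>c 0\<close> in \<psi>. Hence \<open>E\<close> has Lipschitz constant 1 and the forcing,
      which contains it twice, the constant 2, whatever the length of the time interval.\<close>
    have "\<bar>E q1 (t - y) - E q2 (t - y)\<bar> \<le> c 0 * (b / c 0)"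
    proof (rule ode_stability[where T = "t - y" and t = "t - y" and E = "E q1" and F = "E q2" and \<phi> = "\<psi> v0 v1 (f (v1 0)) q1" and \<psi> = "\<psi> v0 v1 (f (v1 0)) q2", OF g(1) c0_pos])
      show "t - y \<in> {0..t - y}" using ty by simp
      show "(E q1 has_real_derivative g (\<psi> v0 v1 (f (v1 0)) q1 s - E q1 s / c 0)) (at s within {0..t - y})" if "s \<in> {0..t - y}" for s
        by (rule DERIV_subset[of _ _ _ "{0..}"]) (use PE[OF q(1)] that in \<open>auto simp: P_def\<close>)
      show "(E q2 has_real_derivative g (\<psi> v0 v1 (f (v1 0)) q2 s - E q2 s / c 0)) (at s within {0..t - y})" if "s \<in> {0..t - y}" for s
        by (rule DERIV_subset[of _ _ _ "{0..}"]) (use PE[OF q(2)] that in \<open>auto simp: P_def\<close>)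
      show "E q1 0 = E q2 0" using PE q by (simp add: P_def)
      show "\<bar>\<psi> v0 v1 (f (v1 0)) q1 s - \<psi> v0 v1 (f (v1 0)) q2 s\<bar> \<le> b / c 0" if "s \<in> {0..t - y}" for s
      proof -
        have "\<psi> v0 v1 (f (v1 0)) q1 s - \<psi> v0 v1 (f (v1 0)) q2 s = - (K1 q1 0 s - K1 q2 0 s) / c 0"
          by (simp add: \<psi>_def diff_divide_distrib)
        then show ?thesis using b[of s] that c0_pos by (simp add: abs_divide divide_right_mono)
      qed
    qed
    then show ?thesis using y ty c0_pos by (simp add: G_def h_def max_def)
  qed
  obtain q where q: "cauc q" and qe: "\<And>y t. y \<ge> 0 \<Longrightarrow> (c y + cl y) * q y t = G q y t - K1 q y t + K2 q y t - K1 q 0 (t - y)"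
  proof (rule volterra_exists[of G])
    show "cauc (G q)" if "cauc q" for q by (rule caucG[OF that])
    show "\<bar>G q1 y t - G q2 y t\<bar> \<le> 2 * b"
      if "cauc q1" "cauc q2" "y \<ge> 0" "\<And>r. r \<le> t - y \<Longrightarrow> \<bar>K1 q1 0 r - K1 q2 0 r\<bar> \<le> b" for q1 q2 y t b
      by (rule lipG[OF that])
  qed blast
  define p0 where "p0 t = g (\<psi> v0 v1 (f (v1 0)) q t - E q t / c 0)" for t
  have p0c: "continuous_on {0..} p0" unfolding p0_def
    by (rule continuous_on_compose2[OF g(2)]) (use c0_pos in \<open>auto intro!: continuous_intros \<psi>_cont v q Ec\<close>)
  have p00: "p0 0 = v1 0" using PE[OF q] K1_nonpos[OF q, of 0 0] fg by (simp add: p0_def \<psi>_def P_def)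
  have Ed: "(E q has_real_derivative p0 t) (at t within {0..})" if "t \<ge> 0" for t using PE[OF q] that by (simp add: P_def p0_def)
  define e where "e s = p0 (max 0 s) - v1 0" for s
  have ec: "continuous_on UNIV e" unfolding e_def by (intro continuous_intros continuous_on_compose2[OF p0c]) auto
  have e0: "e s = 0" if "s \<le> 0" for s using that p00 by (simp add: e_def max_def)
  have hint: "h q s = integral {0..s} e" for s
  proof (cases "s \<le> 0")
    case True then show ?thesis using h0[OF q True] by (cases "s = 0") auto
  next
    case False
    have "(e has_integral (E q s - s * v1 0) - (E q 0 - 0 * v1 0)) {0..s}"
    proof (rule fundamental_theorem_of_calculus)
      fix x assume x: "x \<in> {0..s}"
      have "((\<lambda>x. E q x - x * v1 0) has_real_derivative p0 x - 1 * v1 0) (at x within {0..s})"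
        by (intro DERIV_diff DERIV_cmult_right DERIV_ident DERIV_subset[OF Ed]) (use x in auto)
      then show "((\<lambda>x. E q x - x * v1 0) has_vector_derivative e x) (at x within {0..s})"
        using x by (simp add: e_def has_real_derivative_iff_has_vector_derivative)
    qed (use False in auto)
    moreover have "E q 0 = 0" using PE[OF q] by (simp add: P_def)
    ultimately show ?thesis using False by (simp add: h_def integral_unique)
  qed
  \<comment> \<open>The forcing of the equation for \<open>r\<close> itself. The trace being fixed
    now, it does not depend on the unknown.\<close>
  define H where "H = (\<lambda>y t. Hf v0 v1 y t - 2 * e (t - max 0 y))"
  have "continuous_on UNIV (\<lambda>x. 2 * e (snd x - max 0 (fst x)))"
    by (intro continuous_intros continuous_on_compose2[OF ec]) auto
  moreover have "2 * e (t - max 0 y) = 0" if "t \<le> 0" for y t using e0[of "t - max 0 y"] that by simp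
  ultimately have e2: "cauc (\<lambda>y t. 2 * e (t - max 0 y))" "jointly_cont (\<lambda>y t. 2 * e (t - max 0 y))"
    using cauc_continuousI[of "\<lambda>y t. 2 * e (t - max 0 y)"] by blast+
  have H: "cauc H" "jointly_cont H" unfolding H_def
    by (intro cauc_diff jointly_cont_diff Hf_cauc v e2)+
  obtain r where r: "cauc r" and re: "\<And>y t. y \<ge> 0 \<Longrightarrow> (c y + cl y) * r y t = H y t - K1 r y t + K2 r y t - K1 r 0 (t - y)"
  proof (rule volterra_exists[of "\<lambda>_. H"])
    show "cauc H" by (rule H)
    show "\<bar>H y t - H y t\<bar> \<le> 2 * b" if "\<And>r. r \<le> t - y \<Longrightarrow> \<bar>K1 q1 0 r - K1 q2 0 r\<bar> \<le> b" for q1 q2 y t b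
      using that[OF order_refl] by simp
  qed blast
  have rj: "jointly_cont r" by (rule volterra_jointly_cont[OF r H(2) re])
  have tH: "tint H y t = G q y t" if y: "y \<ge> 0" for y t
  proof -
    have i1: "(Hf v0 v1 y) integrable_on {0..t}"
      using Hf_cauc(1)[OF v] y by (intro integrable_continuous_real) (auto simp: cauc_def intro: continuous_on_subset)
    have "integral {0..t} (\<lambda>s. 2 * e (s - max 0 y)) = 2 * h q (t - max 0 y)"
      using integral_delay[OF ec e0, of y t] y hint by simp
    moreover have "tint H y t = integral {0..t} (Hf v0 v1 y) - integral {0..t} (\<lambda>s. 2 * e (s - max 0 y))"
    proof -
      have i2: "(\<lambda>s. 2 * e (s - max 0 y)) integrable_on {0..t}"
        by (intro integrable_continuous_real continuous_intros continuous_on_compose2[OF ec]) auto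
      have "tint H y t = integral {0..t} (\<lambda>s. Hf v0 v1 y s - 2 * e (s - max 0 y))"
        using y by (simp add: tint_def H_def)
      then show ?thesis using Henstock_Kurzweil_Integration.integral_diff[OF i1 i2] by simp
    qed
    ultimately show ?thesis using y by (simp add: G_def tint_def)
  qed
  have Rq: "tint r y t = q y t" if y: "y \<ge> 0" for y t
  proof (rule volterra_unique[OF cauc_tint[OF r] q _ qe y])
    fix y t :: real assume y: "y \<ge> 0"
    have "(c y + cl y) * tint r y t = tint H y t - K1 (tint r) y t + K2 (tint r) y t - K1 (tint r) 0 (t - y)"
    proof (rule tint_equation[OF r _ _ re y])
      show "continuous_on UNIV (H y)" if "y \<ge> 0" for y using H(1) that by (simp add: cauc_def)
      show "H y t = 0" if "y \<ge> 0" "t \<le> 0" for y t using cauc_nonpos[OF H(1) that] .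
    qed
    then show "(c y + cl y) * tint r y t = G q y t - K1 (tint r) y t + K2 (tint r) y t - K1 (tint r) 0 (t - y)"
      using tH[OF y] by simp
  qed
  define p where "p y t = Fp v0 v1 (y + t) - K1 r y t - c y * r y t - \<beta> v0 y" for y t
  have p_0: "p 0 t = p0 t" if t: "t \<ge> 0" for t
  proof -
    have "2 * c 0 * r 0 t = Hf v0 v1 0 t - 2 * e t - 2 * K1 r 0 t"
      using re[of 0 t] by (simp add: cl_0 K2_0 H_def)
    moreover have "Hf v0 v1 0 t = 2 * Fp v0 v1 t - 2 * Fp v0 v1 0" using t by (simp add: Hf_def Fm_def)
    moreover have "Fp v0 v1 0 = v1 0 + \<beta> v0 0" by (simp add: Fp_def)
    ultimately show ?thesis using t by (simp add: p_def e_def algebra_simps)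
  qed
  have "mild_solution f v0 v1 r p"
    unfolding mild_solution_def
  proof (intro conjI allI impI r rj)
    show "p y t + c y * r y t + \<beta> v0 y = Fp v0 v1 (y + t) - K1 r y t" for y t by (simp add: p_def)
    show "(c y + cl y) * r y t = Hf v0 v1 y t - 2 * (p 0 (max 0 (t - y)) - v1 0) - K1 r y t + K2 r y t - K1 r 0 (t - y)"
      if "y \<ge> 0" for y t using re[OF that, of t] that by (simp add: H_def e_def p_0)
    fix t :: real assume t: "t \<ge> 0"
    have 1: "2 * c 0 * q 0 t = tint (Hf v0 v1) 0 t - 2 * h q t - 2 * K1 q 0 t"
      using qe[of 0 t] by (simp add: cl_0 K2_0 G_def)
    have 2: "f (p0 t) = f (v1 0) + (integral {0..t} (Fp v0 v1) - K1 q 0 t) / c 0 - E q t / c 0"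
      by (simp add: p0_def fg \<psi>_def)
    have 3: "c 0 * f (p0 t) = c 0 * f (v1 0) + (integral {0..t} (Fp v0 v1) - K1 q 0 t) - E q t"
    proof -
      have *: "c 0 * (x / c 0) = x" for x using c0_pos by simp
      show ?thesis unfolding 2 by (simp only: distrib_left right_diff_distrib *)
    qed
    have "c 0 * f (p0 t) = c 0 * (f (v1 0) + v0 0 * t + q 0 t)"
      using 1 3 t by (simp add: tint_Hf_0[OF v t] h_def algebra_simps)
    then show "f (p 0 t) = f (v1 0) + v0 0 * t + tint r 0 t"
      using c0_pos Rq[of 0 t] p_0[OF t] by simp
  qed
  then show ?thesis by blast
qed

end

section \<open>Continuous dependence of mild solutions\<close>

lemma abs_five_terms:
  fixes a i x y z :: real
  assumes "\<bar>a\<bar> \<le> a'" "\<bar>i\<bar> \<le> i'"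
  shows "\<bar>a - 2 * i - x + y - z\<bar> \<le> a' + 2 * i' + \<bar>x\<bar> + \<bar>y\<bar> + \<bar>z\<bar>"
proof -
  have "\<bar>a - 2 * i\<bar> \<le> a' + 2 * i'" using assms by linarith
  moreover have "\<bar>- x + y - z\<bar> \<le> \<bar>x\<bar> + \<bar>y\<bar> + \<bar>z\<bar>" by linarith
  ultimately show ?thesis using abs_triangle_ineq[of "a - 2 * i" "- x + y - z"] by (simp add: algebra_simps)
qed

context medium
begin

lemma mildD:
  assumes "mild_solution f v0 v1 r p"
  shows "cauc r" "jointly_cont r"
    "y \<ge> 0 \<Longrightarrow> t \<ge> 0 \<Longrightarrow> p y t + c y * r y t + \<beta> v0 y = Fp v0 v1 (y + t) - K1 r y t"
    "y \<ge> 0 \<Longrightarrow> (c y + cl y) * r y \<tau> = (Hf v0 v1 y \<tau> - 2 * (p 0 (max 0 (\<tau> - y)) - v1 0)) - K1 r y \<tau> + K2 r y \<tau> - K1 r 0 (\<tau> - y)"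
    "t \<ge> 0 \<Longrightarrow> f (p 0 t) = f (v1 0) + v0 0 * t + tint r 0 t"
  using assms unfolding mild_solution_def by blast+

lemma mild_initial: assumes m: "mild_solution f v0 v1 r p" and y: "y \<ge> 0" shows "p y 0 = v1 y" "r y 0 = 0"
proof -
  show r0: "r y 0 = 0" using cauc_nonpos[OF mildD(1)[OF m] y] by simp
  show "p y 0 = v1 y" using mildD(3)[OF m y order_refl] K1_nonpos[OF mildD(1)[OF m] y order_refl] r0 y by (simp add: Fp_def max_def)
qed

lemma mild_trace_cont:
  assumes m: "mild_solution f v0 v1 r p" and v: "continuous_on UNIV v0" "continuous_on UNIV v1"
  shows "continuous_on {0..} (p 0)" and "continuous_on UNIV (\<lambda>s. p 0 (max 0 s) - v1 0)"
proof -
  have "jointly_cont (\<lambda>y t. p y (max 0 t))" by (rule mild_p_cont[OF v mildD(1,2)[OF m] mildD(3)[OF m]])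
  from jointly_cont_time[OF this order_refl]
  have *: "continuous_on UNIV (\<lambda>s. p 0 (max 0 s))" .
  then show "continuous_on UNIV (\<lambda>s. p 0 (max 0 s) - v1 0)" by (intro continuous_intros)
  have "continuous_on {0..} (\<lambda>s. p 0 (max 0 s))" by (rule continuous_on_subset[OF *]) simp
  then show "continuous_on {0..} (p 0)" by (rule continuous_on_eq) auto
qed

text \<open>The equation behind the existence proof, here for an arbitrary mild solution. It
  contains the trace through its integral, and on this level the comparison of two solutions is
  Lipschitz.\<close>

lemma mild_integrated:
  assumes m: "mild_solution f v0 v1 r p" and v: "continuous_on UNIV v0" "continuous_on UNIV v1" and y: "y \<ge> 0"
  shows "(c y + cl y) * tint r y t = tint (Hf v0 v1) y t - 2 * integral {0..t - y} (\<lambda>s. p 0 (max 0 s) - v1 0)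
     - K1 (tint r) y t + K2 (tint r) y t - K1 (tint r) 0 (t - y)"
proof -
  define e where "e s = p 0 (max 0 s) - v1 0" for s
  have ec: "continuous_on UNIV e" unfolding e_def by (rule mild_trace_cont[OF m v])
  have e0: "e s = 0" if "s \<le> 0" for s using mild_initial[OF m order_refl] that by (simp add: e_def max_def)
  define H where "H = (\<lambda>y t. Hf v0 v1 y t - 2 * e (t - y))"
  have Hc: "continuous_on S (Hf v0 v1 y)" if "y \<ge> 0" for S y
    using Hf_cauc(1)[OF v] that by (auto simp: cauc_def intro: continuous_on_subset)
  have e2: "continuous_on S (\<lambda>s. e (s - y))" for S y by (intro continuous_intros continuous_on_compose2[OF ec]) auto
  have "(c y + cl y) * tint r y t = tint H y t - K1 (tint r) y t + K2 (tint r) y t - K1 (tint r) 0 (t - y)"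
  proof (rule tint_equation[OF mildD(1)[OF m] _ _ _ y])
    show "continuous_on UNIV (H y)" if "y \<ge> 0" for y unfolding H_def by (intro continuous_intros Hc that e2)
    show "H y t = 0" if "y \<ge> 0" "t \<le> 0" for y t using that e0[of "t - y"] by (simp add: H_def Hf_nonpos)
    show "(c y + cl y) * r y t = H y t - K1 r y t + K2 r y t - K1 r 0 (t - y)" if "y \<ge> 0" for y t
      unfolding H_def e_def by (rule mildD(4)[OF m that])
  qed
  moreover have "tint H y t = tint (Hf v0 v1) y t - 2 * integral {0..t - y} e"
  proof -
    have "(\<lambda>s. 2 * e (s - y)) integrable_on {0..t}" by (intro integrable_continuous_real continuous_intros e2)
    from Henstock_Kurzweil_Integration.integral_diff[OF integrable_continuous_real[OF Hc[OF y]] this]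
    show ?thesis using y integral_delay[OF ec e0 y, of t] by (simp add: tint_def H_def)
  qed
  ultimately show ?thesis unfolding e_def by simp
qed

lemma trace_integral:
  assumes "continuous_on {0..} (p0 :: real \<Rightarrow> real)" "s \<ge> 0"
  shows "integral {0..s} (\<lambda>s. p0 (max 0 s) - a) = integral {0..s} p0 - s * a"
proof -
  have "integral {0..s} (\<lambda>s. p0 (max 0 s) - a) = integral {0..s} (\<lambda>s. p0 s - a)"
    by (rule integral_cong) (auto simp: max_def)
  also have "\<dots> = integral {0..s} p0 - s * a"
    using assms by (subst Henstock_Kurzweil_Integration.integral_diff)
      (auto intro!: integrable_continuous_real continuous_on_subset[OF assms(1)])
  finally show ?thesis .
qed

text \<open>Every mild solution, however it was obtained, has an integrated trace that solves the
  monotone boundary equation. The comparison principle can thus be applied to any two of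
  them.\<close>

lemma mild_boundary_ode:
  assumes m: "mild_solution f v0 v1 r p" and v: "continuous_on UNIV v0" "continuous_on UNIV v1"
    and gf: "\<And>x. g (f x) = x" and t: "t \<ge> 0"
  shows "p 0 t = g (\<psi> v0 v1 (f (v1 0)) (tint r) t - integral {0..t} (p 0) / c 0)"
proof -
  note tr = mild_trace_cont[OF m v]
  have 1: "2 * c 0 * tint r 0 t = tint (Hf v0 v1) 0 t - 2 * (integral {0..t} (p 0) - t * v1 0) - 2 * K1 (tint r) 0 t"
    using mild_integrated[OF m v order_refl, of t] trace_integral[OF tr(1) t, of "v1 0"] by (simp add: cl_0 K2_0)
  then have "c 0 * (f (v1 0) + v0 0 * t + tint r 0 t) =
    c 0 * f (v1 0) + (integral {0..t} (Fp v0 v1) - K1 (tint r) 0 t) - integral {0..t} (p 0)"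
    by (simp add: tint_Hf_0[OF v t] algebra_simps)
  also have "\<dots> = c 0 * (\<psi> v0 v1 (f (v1 0)) (tint r) t - integral {0..t} (p 0) / c 0)"
  proof -
    have *: "c 0 * (x / c 0) = x" for x using c0_pos by simp
    show ?thesis unfolding \<psi>_def by (simp only: distrib_left right_diff_distrib *)
  qed
  finally have "f (p 0 t) = \<psi> v0 v1 (f (v1 0)) (tint r) t - integral {0..t} (p 0) / c 0"
    using c0_pos mildD(5)[OF m t] by simp
  then show ?thesis using gf by metis
qed

definition cbound :: "real \<Rightarrow> real" where "cbound R = \<bar>c 0\<bar> + L * Nm R"

lemma cbound_nonneg: "cbound R \<ge> 0"
  using L_nonneg Nm_nonneg by (simp add: cbound_def)

lemma c_bound: assumes "0 \<le> y" "y \<le> R" shows "\<bar>c y\<bar> \<le> cbound R"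
proof -
  have "\<bar>c y - c 0\<bar> \<le> L * Nm R"
    unfolding c_diff[OF order_refl assms(1)] by (rule integrable_N(2)) (use assms J_bound L_nonneg in auto)
  then show ?thesis by (simp add: cbound_def)
qed

lemma intJ_diff_bound:
  assumes v: "continuous_on UNIV v" "continuous_on UNIV w" and y: "0 \<le> y" "y \<le> R"
    and e: "\<And>z. 0 \<le> z \<Longrightarrow> z \<le> R \<Longrightarrow> \<bar>v z - w z\<bar> \<le> e"
  shows "\<bar>intJ v y - intJ w y\<bar> \<le> L * e * Nm R"
proof -
  have [measurable]: "v \<in> borel_measurable borel" "w \<in> borel_measurable borel" using v by (auto intro: borel_measurable_continuous_onI)
  have "e \<ge> 0" using e[OF y] by simp
  have "intJ v y - intJ w y = (LINT z|N. (if 0 < z \<and> z \<le> y then J z * (v z - w z) else 0))"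
    unfolding intJ_def by (subst Bochner_Integration.integral_diff[symmetric, OF intJ_integrable[OF v(1)] intJ_integrable[OF v(2)]])
      (auto intro!: Bochner_Integration.integral_cong simp: algebra_simps)
  also have "\<bar>\<dots>\<bar> \<le> L * e * Nm R"
    by (rule integrable_N(2)) (use y e \<open>e \<ge> 0\<close> L_nonneg in \<open>auto intro!: JB\<close>)
  finally show ?thesis .
qed

text \<open>A Lipschitz constant on \<open>{0..R}\<close> for the passage from the data to
  \<open>Fp\<close> and \<open>Fm\<close>: 1 for the velocity, \<open>cbound R\<close> for the
  product with \<open>c\<close> and \<open>L * Nm R\<close> for the Stieltjes integral.\<close>

definition Kb :: "real \<Rightarrow> real" where "Kb R = 1 + cbound R + L * Nm R"

lemma Kb_pos: "Kb R \<ge> 1"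
  using cbound_nonneg[of R] L_nonneg Nm_nonneg by (simp add: Kb_def)

lemma \<beta>_diff_bound:
  assumes v: "continuous_on UNIV v" "continuous_on UNIV w" and y: "0 \<le> y" "y \<le> R"
    and e: "\<And>z. 0 \<le> z \<Longrightarrow> z \<le> R \<Longrightarrow> \<bar>v z - w z\<bar> \<le> e"
  shows "\<bar>\<beta> v y - \<beta> w y\<bar> \<le> (cbound R + L * Nm R) * e"
proof -
  have 1: "\<bar>intJ v y - intJ w y\<bar> \<le> L * e * Nm R" by (rule intJ_diff_bound[OF v y e])
  have 2: "\<bar>c y * (v y - w y)\<bar> \<le> cbound R * e" unfolding abs_mult
    by (rule mult_mono) (use c_bound[OF y] e[OF y] cbound_nonneg in auto)
  have "\<beta> v y - \<beta> w y = c y * (v y - w y) - (intJ v y - intJ w y)" by (simp add: \<beta>_def algebra_simps)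
  then have "\<bar>\<beta> v y - \<beta> w y\<bar> \<le> cbound R * e + L * e * Nm R" using 1 2 by linarith
  then show ?thesis by (simp add: algebra_simps)
qed

lemma F_diff_bound:
  assumes v: "continuous_on UNIV v0" "continuous_on UNIV w0" and y: "y \<le> R" and R: "R \<ge> 0"
    and e: "\<And>z. 0 \<le> z \<Longrightarrow> z \<le> R \<Longrightarrow> \<bar>v0 z - w0 z\<bar> \<le> e" "\<And>z. 0 \<le> z \<Longrightarrow> z \<le> R \<Longrightarrow> \<bar>v1 z - w1 z\<bar> \<le> e"
  shows "\<bar>Fp v0 v1 y - Fp w0 w1 y\<bar> \<le> Kb R * e" "\<bar>Fm v0 v1 y - Fm w0 w1 y\<bar> \<le> Kb R * e"
proof -
  have y': "0 \<le> max 0 y" "max 0 y \<le> R" using y R by auto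
  have 1: "\<bar>\<beta> v0 (max 0 y) - \<beta> w0 (max 0 y)\<bar> \<le> (cbound R + L * Nm R) * e" by (rule \<beta>_diff_bound[OF v y' e(1)])
  note 2 = e(2)[OF y']
  have K: "Kb R * e = e + (cbound R + L * Nm R) * e" by (simp add: Kb_def algebra_simps)
  show "\<bar>Fp v0 v1 y - Fp w0 w1 y\<bar> \<le> Kb R * e" "\<bar>Fm v0 v1 y - Fm w0 w1 y\<bar> \<le> Kb R * e"
    unfolding Fp_def Fm_def K using 1 2 by linarith+
qed

lemma Hf_diff_bound:
  assumes v: "continuous_on UNIV v0" "continuous_on UNIV w0" and y: "0 \<le> y" "y + t \<le> R" and R: "R \<ge> 0"
    and e: "\<And>z. 0 \<le> z \<Longrightarrow> z \<le> R \<Longrightarrow> \<bar>v0 z - w0 z\<bar> \<le> e" "\<And>z. 0 \<le> z \<Longrightarrow> z \<le> R \<Longrightarrow> \<bar>v1 z - w1 z\<bar> \<le> e"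
  shows "\<bar>Hf v0 v1 y t - Hf w0 w1 y t\<bar> \<le> 6 * (Kb R * e)"
proof (cases "t \<le> 0")
  case True
  have "e \<ge> 0" using e(1)[of 0] R by auto
  then show ?thesis using True Kb_pos[of R] by (simp add: Hf_nonpos)
next
  case False
  define a where "a x = Fp v0 v1 x - Fp w0 w1 x" for x
  define b where "b x = Fm v0 v1 x - Fm w0 w1 x" for x
  have ab: "\<bar>a x\<bar> \<le> Kb R * e" "\<bar>b x\<bar> \<le> Kb R * e" if "x \<le> R" for x
    unfolding a_def b_def by (rule F_diff_bound[OF v that R e]; assumption)+
  have "Hf v0 v1 y t - Hf w0 w1 y t = a (y + t) - a y + b y - b (y - t) + a (t - y) - a 0"
    using False y by (simp add: Hf_def a_def b_def)
  moreover have "\<bar>a (y + t)\<bar> \<le> Kb R * e" "\<bar>a y\<bar> \<le> Kb R * e" "\<bar>b y\<bar> \<le> Kb R * e" "\<bar>b (y - t)\<bar> \<le> Kb R * e"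
     "\<bar>a (t - y)\<bar> \<le> Kb R * e" "\<bar>a 0\<bar> \<le> Kb R * e"
    by (rule ab; use y R False in linarith)+
  ultimately show ?thesis by linarith
qed

lemma integral_diff_bound:
  fixes f g :: "real \<Rightarrow> real"
  assumes "continuous_on {0..t} f" "continuous_on {0..t} g" and b: "\<And>s. 0 \<le> s \<Longrightarrow> s \<le> t \<Longrightarrow> \<bar>f s - g s\<bar> \<le> b" and t: "0 \<le> t"
  shows "\<bar>integral {0..t} f - integral {0..t} g\<bar> \<le> b * t"
proof -
  have "integral {0..t} f - integral {0..t} g = integral {0..t} (\<lambda>s. f s - g s)"
    by (rule Henstock_Kurzweil_Integration.integral_diff[symmetric]) (intro integrable_continuous_real assms)+
  moreover have "norm (integral {0..t} (\<lambda>s. f s - g s)) \<le> b * (t - 0)"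
    by (rule integral_bound) (use assms in \<open>auto intro!: continuous_intros\<close>)
  ultimately show ?thesis by simp
qed

lemma tint_Hf_diff_bound:
  assumes v: "continuous_on UNIV v0" "continuous_on UNIV v1" "continuous_on UNIV w0" "continuous_on UNIV w1"
    and y: "0 \<le> y" "y + t \<le> R" and R: "R \<ge> 0"
    and e: "\<And>z. 0 \<le> z \<Longrightarrow> z \<le> R \<Longrightarrow> \<bar>v0 z - w0 z\<bar> \<le> e" "\<And>z. 0 \<le> z \<Longrightarrow> z \<le> R \<Longrightarrow> \<bar>v1 z - w1 z\<bar> \<le> e"
  shows "\<bar>tint (Hf v0 v1) y t - tint (Hf w0 w1) y t\<bar> \<le> 6 * (Kb R * e) * R"
proof -
  have e0: "0 \<le> 6 * (Kb R * e)" using e(1)[of 0] R Kb_pos[of R] by auto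
  show ?thesis
  proof (cases "t \<le> 0")
    case True then show ?thesis using e0 R by (simp add: tint_nonpos)
  next
    case False
    have c: "continuous_on {0..t} (Hf v0 v1 y)" "continuous_on {0..t} (Hf w0 w1 y)"
      using Hf_cauc(1)[OF v(1,2)] Hf_cauc(1)[OF v(3,4)] y by (auto simp: cauc_def intro: continuous_on_subset)
    have "\<bar>integral {0..t} (Hf v0 v1 y) - integral {0..t} (Hf w0 w1 y)\<bar> \<le> 6 * (Kb R * e) * t"
    proof (rule integral_diff_bound[OF c])
      show "\<bar>Hf v0 v1 y s - Hf w0 w1 y s\<bar> \<le> 6 * (Kb R * e)" if "0 \<le> s" "s \<le> t" for s
        by (rule Hf_diff_bound[OF v(1,3) y(1) _ R e]) (use that y in auto)
    qed (use False in simp)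
    also have "\<dots> \<le> 6 * (Kb R * e) * R" by (rule mult_left_mono[OF _ e0]) (use y in simp)
    finally show ?thesis using y by (simp add: tint_def)
  qed
qed

lemma mild_trace_integral_diff:
  assumes g: "mono g" and gf: "\<And>x. g (f x) = x"
    and m: "mild_solution f v0 v1 r p" "mild_solution f w0 w1 r' p'"
    and v: "continuous_on UNIV v0" "continuous_on UNIV v1" "continuous_on UNIV w0" "continuous_on UNIV w1"
    and s: "0 \<le> s" "s \<le> R"
    and e: "\<And>z. 0 \<le> z \<Longrightarrow> z \<le> R \<Longrightarrow> \<bar>v0 z - w0 z\<bar> \<le> e" "\<And>z. 0 \<le> z \<Longrightarrow> z \<le> R \<Longrightarrow> \<bar>v1 z - w1 z\<bar> \<le> e"
      "\<bar>f (v1 0) - f (w1 0)\<bar> \<le> e"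
    and b: "\<And>\<rho>. \<rho> \<le> s \<Longrightarrow> \<bar>K1 (tint r) 0 \<rho> - K1 (tint r') 0 \<rho>\<bar> \<le> b"
  shows "\<bar>integral {0..s} (p 0) - integral {0..s} (p' 0)\<bar> \<le> c 0 * e + Kb R * e * R + b"
proof -
  have R: "R \<ge> 0" using s by simp
  have e0: "e \<ge> 0" using e(3) by simp
  have Kbe: "Kb R * e \<ge> 0" using e0 Kb_pos[of R] by simp
  have E: "((\<lambda>t. integral {0..t} (p 0)) has_real_derivative g (\<psi> v0 v1 (f (v1 0)) (tint r) t - integral {0..t} (p 0) / c 0)) (at t within {0..s})"
    if m: "mild_solution f v0 v1 r p" and v: "continuous_on UNIV v0" "continuous_on UNIV v1" and t: "t \<in> {0..s}" for v0 v1 r p t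
  proof -
    have "((\<lambda>t. integral {0..t} (p 0)) has_real_derivative p 0 t) (at t within {0..s})"
      by (rule integral_has_real_derivative[OF continuous_on_subset[OF mild_trace_cont(1)[OF m v]] t]) simp
    then show ?thesis using mild_boundary_ode[OF m v gf, of t] t by simp
  qed
  have "\<bar>integral {0..s} (p 0) - integral {0..s} (p' 0)\<bar> \<le> c 0 * (e + (Kb R * e * R + b) / c 0)"
  proof (rule ode_stability[where T = s and t = s and E = "\<lambda>t. integral {0..t} (p 0)" and F = "\<lambda>t. integral {0..t} (p' 0)" and
        \<phi> = "\<psi> v0 v1 (f (v1 0)) (tint r)" and \<psi> = "\<psi> w0 w1 (f (w1 0)) (tint r')", OF g c0_pos _ E[OF m(1) v(1,2)] E[OF m(2) v(3,4)]])
    fix t assume t: "t \<in> {0..s}"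
    have I: "\<bar>integral {0..t} (Fp v0 v1) - integral {0..t} (Fp w0 w1)\<bar> \<le> Kb R * e * t"
      by (rule integral_diff_bound) (use t s in \<open>auto intro!: Fp_cont v F_diff_bound[OF v(1,3) _ R e(1,2)]\<close>)
    have "Kb R * e * t \<le> Kb R * e * R" by (rule mult_left_mono[OF _ Kbe]) (use t s in auto)
    then have "\<bar>(integral {0..t} (Fp v0 v1) - K1 (tint r) 0 t) - (integral {0..t} (Fp w0 w1) - K1 (tint r') 0 t)\<bar> \<le> Kb R * e * R + b"
      using I b[of t] t by auto
    then have "\<bar>((integral {0..t} (Fp v0 v1) - K1 (tint r) 0 t) - (integral {0..t} (Fp w0 w1) - K1 (tint r') 0 t)) / c 0\<bar> \<le> (Kb R * e * R + b) / c 0"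
      using c0_pos by (simp add: abs_divide divide_right_mono)
    then show "\<bar>\<psi> v0 v1 (f (v1 0)) (tint r) t - \<psi> w0 w1 (f (w1 0)) (tint r') t\<bar> \<le> e + (Kb R * e * R + b) / c 0"
      using e(3) unfolding \<psi>_def diff_divide_distrib by linarith
  qed (use s in auto)
  also have "\<dots> = c 0 * e + Kb R * e * R + b"
  proof -
    have *: "c 0 * (x / c 0) = x" for x using c0_pos by simp
    show ?thesis by (simp only: distrib_left[of "c 0"] * add.assoc)
  qed
  finally show ?thesis .
qed

text \<open>The Lipschitz estimate is claimed for the time integrals only. The distance between
  \<open>f (v1 0)\<close> and \<open>f (w1 0)\<close> is bounded separately from that of the data,
  because it is the initial value in the integrated boundary condition and \<open>f\<close> need not
  be Lipschitz.\<close>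

lemma mild_integrated_stability:
  assumes g: "mono g" and gf: "\<And>x. g (f x) = x" and R: "R \<ge> 0"
  shows "\<exists>C\<ge>0. \<forall>v0 v1 w0 w1 r p r' p' e. mild_solution f v0 v1 r p \<longrightarrow> mild_solution f w0 w1 r' p' \<longrightarrow>
    continuous_on UNIV v0 \<longrightarrow> continuous_on UNIV v1 \<longrightarrow> continuous_on UNIV w0 \<longrightarrow> continuous_on UNIV w1 \<longrightarrow>
    (\<forall>z. 0 \<le> z \<longrightarrow> z \<le> R \<longrightarrow> \<bar>v0 z - w0 z\<bar> \<le> e \<and> \<bar>v1 z - w1 z\<bar> \<le> e) \<longrightarrow> \<bar>f (v1 0) - f (w1 0)\<bar> \<le> e \<longrightarrow>
    (\<forall>y t. 0 \<le> y \<longrightarrow> y + t \<le> R \<longrightarrow> \<bar>tint r y t - tint r' y t\<bar> \<le> C * e)"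
proof -
  obtain C where C0: "C \<ge> 0" and C: "\<forall>d B. cauc d \<longrightarrow> B \<ge> 0 \<longrightarrow>
    (\<forall>y' t' b. 0 \<le> y' \<longrightarrow> y' + t' \<le> R \<longrightarrow> (\<forall>r. r \<le> t' - y' \<longrightarrow> \<bar>K1 d 0 r\<bar> \<le> b) \<longrightarrow>
      (c y' + cl y') * \<bar>d y' t'\<bar> \<le> B + 2 * b + \<bar>K1 d y' t'\<bar> + \<bar>K2 d y' t'\<bar> + \<bar>K1 d 0 (t' - y')\<bar>) \<longrightarrow>
    (\<forall>y' t'. 0 \<le> y' \<longrightarrow> y' + t' \<le> R \<longrightarrow> \<bar>d y' t'\<bar> \<le> C * B)"
    using volterra_estimate[of R] by blast
  \<comment> \<open>The first term comes from \<open>Hf\<close>. The others are twice the error of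
    the integrated trace: \<open>c 0\<close> for the initial value of \<open>f\<close>,
    \<open>Kb R * R\<close> for the integral of \<open>Fp\<close>, and \<open>R\<close> for the
    subtracted initial velocity.\<close>
  define M where "M = 6 * Kb R * R + 2 * c 0 + 2 * Kb R * R + 2 * R"
  have M0: "M \<ge> 0" using Kb_pos[of R] R c0_pos by (simp add: M_def)
  have main: "\<bar>tint r y t - tint r' y t\<bar> \<le> C * M * e"
    if m: "mild_solution f v0 v1 r p" "mild_solution f w0 w1 r' p'"
    and v: "continuous_on UNIV v0" "continuous_on UNIV v1" "continuous_on UNIV w0" "continuous_on UNIV w1"
    and e: "\<And>z. 0 \<le> z \<Longrightarrow> z \<le> R \<Longrightarrow> \<bar>v0 z - w0 z\<bar> \<le> e" "\<And>z. 0 \<le> z \<Longrightarrow> z \<le> R \<Longrightarrow> \<bar>v1 z - w1 z\<bar> \<le> e"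
      "\<bar>f (v1 0) - f (w1 0)\<bar> \<le> e" and y: "0 \<le> y" "y + t \<le> R" for v0 v1 w0 w1 r p r' p' e y t
  proof -
    note cr = cauc_tint[OF mildD(1)[OF m(1)]] and cr' = cauc_tint[OF mildD(1)[OF m(2)]]
    note cc = cauc_causal[OF cr] cauc_causal[OF cr']
    define d where "d = (\<lambda>y t. tint r y t - tint r' y t)"
    have d: "cauc d" unfolding d_def by (rule cauc_diff[OF cr cr'])
    have e0: "e \<ge> 0" using e(3) by simp
    have Kbe: "Kb R * e \<ge> 0" using e0 Kb_pos[of R] by simp
    have "\<bar>d y t\<bar> \<le> C * (M * e)"
    proof (rule C[rule_format, OF d])
      show "0 \<le> M * e" using M0 e0 by simp
      fix y t b :: real
      assume y: "0 \<le> y" "y + t \<le> R" and b: "\<And>\<rho>. \<rho> \<le> t - y \<Longrightarrow> \<bar>K1 d 0 \<rho>\<bar> \<le> b"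
      have b0: "b \<ge> 0" using b[OF order_refl] by simp
      have b': "\<bar>K1 (tint r) 0 \<rho> - K1 (tint r') 0 \<rho>\<bar> \<le> b" if "\<rho> \<le> t - y" for \<rho>
        using b[OF that] K1_diff[OF cc order_refl, of \<rho>] by (simp add: d_def)
      define I where "I = integral {0..t - y} (\<lambda>s. p 0 (max 0 s) - v1 0)"
      define I' where "I' = integral {0..t - y} (\<lambda>s. p' 0 (max 0 s) - w1 0)"
      have II: "\<bar>I - I'\<bar> \<le> c 0 * e + Kb R * e * R + b + R * e"
      proof (cases "t - y < 0")
        case True
        have "0 \<le> Kb R * e * R" "0 \<le> c 0 * e" "0 \<le> R * e" using Kbe R c0_pos e0 by simp_all
        then show ?thesis using True b0 by (simp add: I_def I'_def)
      next
        case False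
        then have s: "0 \<le> t - y" "t - y \<le> R" using y by auto
        have 1: "\<bar>integral {0..t - y} (p 0) - integral {0..t - y} (p' 0)\<bar> \<le> c 0 * e + Kb R * e * R + b"
          by (rule mild_trace_integral_diff[OF g gf m v s e b'])
        have "\<bar>(t - y) * (v1 0 - w1 0)\<bar> \<le> R * e" unfolding abs_mult
          by (rule mult_mono) (use s e(2)[of 0] R in auto)
        then show ?thesis using 1
          unfolding I_def I'_def trace_integral[OF mild_trace_cont(1)[OF m(1) v(1,2)] s(1)] trace_integral[OF mild_trace_cont(1)[OF m(2) v(3,4)] s(1)]
          by (simp add: right_diff_distrib)
      qed
      have HH: "\<bar>tint (Hf v0 v1) y t - tint (Hf w0 w1) y t\<bar> \<le> 6 * (Kb R * e) * R"
        by (rule tint_Hf_diff_bound[OF v y R e(1,2)])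
      have deq: "(c y + cl y) * d y t = (tint (Hf v0 v1) y t - tint (Hf w0 w1) y t) - 2 * (I - I') - K1 d y t + K2 d y t - K1 d 0 (t - y)"
        using mild_integrated[OF m(1) v(1,2) y(1), of t] mild_integrated[OF m(2) v(3,4) y(1), of t]
        unfolding d_def K1_diff[OF cc y(1)] K2_diff[OF cc y(1)] K1_diff[OF cc order_refl] I_def I'_def
        by (simp add: right_diff_distrib)
      have "\<bar>(c y + cl y) * d y t\<bar> \<le> 6 * (Kb R * e) * R + 2 * (c 0 * e + Kb R * e * R + b + R * e) + \<bar>K1 d y t\<bar> + \<bar>K2 d y t\<bar> + \<bar>K1 d 0 (t - y)\<bar>"
        unfolding deq by (rule abs_five_terms[OF HH II])
      also have "\<dots> = M * e + 2 * b + \<bar>K1 d y t\<bar> + \<bar>K2 d y t\<bar> + \<bar>K1 d 0 (t - y)\<bar>"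
        by (simp add: M_def algebra_simps)
      finally show "(c y + cl y) * \<bar>d y t\<bar> \<le> M * e + 2 * b + \<bar>K1 d y t\<bar> + \<bar>K2 d y t\<bar> + \<bar>K1 d 0 (t - y)\<bar>"
        using csum_ge[OF y(1)] cm_pos by (simp add: abs_mult)
    qed (use y in auto)
    then show ?thesis by (simp add: d_def mult.assoc)
  qed
  show ?thesis
  proof (intro exI[of _ "C * M"] conjI allI impI)
    show "C * M \<ge> 0" using C0 M0 by simp
    fix v0 v1 w0 w1 r p r' p' e and y t :: real
    assume m: "mild_solution f v0 v1 r p" "mild_solution f w0 w1 r' p'"
      and v: "continuous_on UNIV v0" "continuous_on UNIV v1" "continuous_on UNIV w0" "continuous_on UNIV w1"
      and e: "\<forall>z. 0 \<le> z \<longrightarrow> z \<le> R \<longrightarrow> \<bar>v0 z - w0 z\<bar> \<le> e \<and> \<bar>v1 z - w1 z\<bar> \<le> e" "\<bar>f (v1 0) - f (w1 0)\<bar> \<le> e"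
      and y: "0 \<le> y" "y + t \<le> R"
    show "\<bar>tint r y t - tint r' y t\<bar> \<le> C * M * e"
      by (rule main[OF m v _ _ e(2) y]) (use e(1) in blast)+
  qed
qed

text \<open>The integrated estimate and the boundary condition make \<open>f\<close> of the traces
  uniformly close, and uniform continuity of \<open>g\<close> on a compact interval makes the traces
  themselves close, without a rate. With the difference of the traces regarded as part of the
  inhomogeneity, the a priori estimate applies to \<open>r\<close>, and the left invariant then
  yields \<open>p\<close>.\<close>

theorem mild_stability:
  assumes g: "mono g" "continuous_on UNIV g" and gf: "\<And>x. g (f x) = x" and fc: "continuous_on UNIV f" and R: "R \<ge> 0"
    and m: "mild_solution f v0 v1 r p" "\<And>n. mild_solution f (w0 n) (w1 n) (r' n) (p' n)"
    and v: "continuous_on UNIV v0" "continuous_on UNIV v1" "\<And>n::nat. continuous_on UNIV (w0 n)" "\<And>n. continuous_on UNIV (w1 n)"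
    and conv: "\<And>e. e > 0 \<Longrightarrow> eventually (\<lambda>n. \<forall>z. 0 \<le> z \<longrightarrow> z \<le> R \<longrightarrow> \<bar>v0 z - w0 n z\<bar> \<le> e \<and> \<bar>v1 z - w1 n z\<bar> \<le> e) sequentially"
    and \<epsilon>: "\<epsilon> > 0"
  shows "eventually (\<lambda>n. \<forall>y t. 0 \<le> y \<longrightarrow> 0 \<le> t \<longrightarrow> y + t \<le> R \<longrightarrow> \<bar>r y t - r' n y t\<bar> \<le> \<epsilon> \<and> \<bar>p y t - p' n y t\<bar> \<le> \<epsilon>) sequentially"
proof -
  obtain C1 where C10: "C1 \<ge> 0" and C1: "\<forall>v0 v1 w0 w1 r p r' p' e. mild_solution f v0 v1 r p \<longrightarrow> mild_solution f w0 w1 r' p' \<longrightarrow>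
    continuous_on UNIV v0 \<longrightarrow> continuous_on UNIV v1 \<longrightarrow> continuous_on UNIV w0 \<longrightarrow> continuous_on UNIV w1 \<longrightarrow>
    (\<forall>z. 0 \<le> z \<longrightarrow> z \<le> R \<longrightarrow> \<bar>v0 z - w0 z\<bar> \<le> e \<and> \<bar>v1 z - w1 z\<bar> \<le> e) \<longrightarrow> \<bar>f (v1 0) - f (w1 0)\<bar> \<le> e \<longrightarrow>
    (\<forall>y t. 0 \<le> y \<longrightarrow> y + t \<le> R \<longrightarrow> \<bar>tint r y t - tint r' y t\<bar> \<le> C1 * e)"
    using mild_integrated_stability[OF g(1) gf R] by blast
  obtain C where C0: "C \<ge> 0" and C: "\<forall>d B. cauc d \<longrightarrow> B \<ge> 0 \<longrightarrow>
    (\<forall>y' t' b. 0 \<le> y' \<longrightarrow> y' + t' \<le> R \<longrightarrow> (\<forall>r. r \<le> t' - y' \<longrightarrow> \<bar>K1 d 0 r\<bar> \<le> b) \<longrightarrow>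
      (c y' + cl y') * \<bar>d y' t'\<bar> \<le> B + 2 * b + \<bar>K1 d y' t'\<bar> + \<bar>K2 d y' t'\<bar> + \<bar>K1 d 0 (t' - y')\<bar>) \<longrightarrow>
    (\<forall>y' t'. 0 \<le> y' \<longrightarrow> y' + t' \<le> R \<longrightarrow> \<bar>d y' t'\<bar> \<le> C * B)"
    using volterra_estimate[of R] by blast
  define D where "D = C * (6 * Kb R + 4)"
  have D0: "D \<ge> 0" using C0 Kb_pos[of R] by (simp add: D_def)
  \<comment> \<open>Bounds the final error of \<open>p\<close> in units of \<mu>:
    \<open>Kb R\<close> once for \<open>Fp\<close> and once for \<beta>, then the terms with
    \<open>K1\<close> and with \<open>c\<close>, in which \<open>r\<close> is known up to
    \<open>D * \<mu>\<close>.\<close>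
  define Ct where "Ct = 1 + D + 2 * Kb R + L * D * Nm R + cbound R * D"
  have Ct: "Ct \<ge> 1" "Ct \<ge> D" using D0 Kb_pos[of R] L_nonneg Nm_nonneg[of R] cbound_nonneg[of R] by (simp_all add: Ct_def)
  define \<mu> where "\<mu> = \<epsilon> / Ct"
  have \<mu>: "\<mu> > 0" "Ct * \<mu> = \<epsilon>" using \<epsilon> Ct by (auto simp: \<mu>_def)
  have "compact ((\<lambda>t. f (p 0 t)) ` {0..R})"
    by (intro compact_continuous_image continuous_on_compose2[OF fc] continuous_on_subset[OF mild_trace_cont(1)[OF m(1) v(1,2)]]) auto
  then obtain b where "\<forall>x\<in>(\<lambda>t. f (p 0 t)) ` {0..R}. norm x \<le> b" using compact_imp_bounded bounded_iff by metis
  then have b: "\<bar>f (p 0 t)\<bar> \<le> b" if "0 \<le> t" "t \<le> R" for t using that by simp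
  \<comment> \<open>Along the limit solution the values of \<open>f\<close> lie between
    \<open>-b\<close> and \<open>b\<close>; the margin 1 makes room for those of the approximating
    solutions.\<close>
  have "uniformly_continuous_on {-(b+1)..b+1} g"
    by (intro compact_uniformly_continuous continuous_on_subset[OF g(2)]) auto
  then obtain \<delta> where \<delta>: "\<delta> > 0" "\<And>x x'. x \<in> {-(b+1)..b+1} \<Longrightarrow> x' \<in> {-(b+1)..b+1} \<Longrightarrow> dist x' x < \<delta> \<Longrightarrow> dist (g x') (g x) < \<mu>"
    unfolding uniformly_continuous_on_def using \<mu>(1) by metis
  \<comment> \<open>The deviation of \<open>f (p 0 t)\<close> will be at most
    \<open>(1 + R + C1) * \<eta>\<close>: 1 for the initial value, \<open>R\<close> for the term
    linear in \<open>t\<close>, \<open>C1\<close> for the time integral of \<open>r\<close>. It must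
    stay below \<delta> for the uniform continuity and below 1 to remain in the enlarged
    interval.\<close>
  define \<eta> where "\<eta> = min \<mu> (min (\<delta> / 2) 1 / (1 + R + C1))"
  have den: "1 + R + C1 > 0" using R C10 by simp
  have \<eta>: "\<eta> > 0" "\<eta> \<le> \<mu>" using \<mu> \<delta> den by (auto simp: \<eta>_def)
  have \<eta>2: "(1 + R + C1) * \<eta> \<le> min (\<delta> / 2) 1"
  proof -
    have "\<eta> \<le> min (\<delta> / 2) 1 / (1 + R + C1)" by (simp add: \<eta>_def)
    then show ?thesis using den by (simp add: pos_le_divide_eq mult.commute)
  qed
  have "isCont f (v1 0)" using fc by (simp add: continuous_on_eq_continuous_at)
  then obtain \<delta>' where \<delta>': "\<delta>' > 0" "\<And>x. dist x (v1 0) < \<delta>' \<Longrightarrow> dist (f x) (f (v1 0)) < \<eta>"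
    unfolding continuous_at_eps_delta using \<eta>(1) by metis
  have "eventually (\<lambda>n. \<forall>z. 0 \<le> z \<longrightarrow> z \<le> R \<longrightarrow> \<bar>v0 z - w0 n z\<bar> \<le> min \<eta> (\<delta>' / 2) \<and> \<bar>v1 z - w1 n z\<bar> \<le> min \<eta> (\<delta>' / 2)) sequentially"
    by (rule conv) (use \<eta> \<delta>' in auto)
  then show ?thesis
  proof eventually_elim
    case (elim n)
    note mn = m(2)[of n] and vn = v(3)[of n] v(4)[of n]
    have e: "\<bar>v0 z - w0 n z\<bar> \<le> \<eta>" "\<bar>v1 z - w1 n z\<bar> \<le> \<eta>" if "0 \<le> z" "z \<le> R" for z using elim that by auto
    have ef: "\<bar>f (v1 0) - f (w1 n 0)\<bar> \<le> \<eta>"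
    proof -
      have "\<bar>v1 0 - w1 n 0\<bar> \<le> \<delta>' / 2" using elim R by auto
      then show ?thesis using \<delta>'(2)[of "w1 n 0"] \<delta>'(1) by (simp add: dist_real_def abs_minus_commute)
    qed
    have pp: "\<bar>p 0 t - p' n 0 t\<bar> \<le> \<mu>" if t: "0 \<le> t" "t \<le> R" for t
    proof -
      have 1: "\<bar>tint r 0 t - tint (r' n) 0 t\<bar> \<le> C1 * \<eta>"
        by (rule C1[rule_format, OF m(1) mn v(1,2) vn _ ef]) (use e t in auto)
      have 2: "\<bar>(v0 0 - w0 n 0) * t\<bar> \<le> \<eta> * R" unfolding abs_mult by (rule mult_mono) (use e[of 0] t R in auto)
      have "\<bar>f (p 0 t) - f (p' n 0 t)\<bar> \<le> \<eta> + \<eta> * R + C1 * \<eta>"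
        using 1 2 ef mildD(5)[OF m(1) t(1)] mildD(5)[OF mn t(1)] by (simp add: left_diff_distrib)
      also have "\<dots> = (1 + R + C1) * \<eta>" by (simp add: algebra_simps)
      finally have 3: "\<bar>f (p 0 t) - f (p' n 0 t)\<bar> \<le> min (\<delta> / 2) 1" using \<eta>2 by simp
      have "dist (g (f (p' n 0 t))) (g (f (p 0 t))) < \<mu>"
        by (rule \<delta>(2)) (use 3 b[OF t] \<delta>(1) in \<open>auto simp: dist_real_def abs_minus_commute\<close>)
      then show ?thesis by (simp add: gf dist_real_def abs_minus_commute)
    qed
    define d where "d = (\<lambda>y t. r y t - r' n y t)"
    note cr = mildD(1)[OF m(1)] and cr' = mildD(1)[OF mn]
    note cc = cauc_causal[OF cr] cauc_causal[OF cr']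
    have d: "cauc d" unfolding d_def by (rule cauc_diff[OF cr cr'])
    have dB: "\<bar>d y t\<bar> \<le> D * \<mu>" if y: "0 \<le> y" "y + t \<le> R" for y t
    proof -
      have "\<bar>d y t\<bar> \<le> C * ((6 * Kb R + 4) * \<mu>)"
      proof (rule C[rule_format, OF d _ _ y])
        show "0 \<le> (6 * Kb R + 4) * \<mu>" using Kb_pos[of R] \<mu> by simp
        fix y t b :: real
        assume y: "0 \<le> y" "y + t \<le> R" and b: "\<And>\<rho>. \<rho> \<le> t - y \<Longrightarrow> \<bar>K1 d 0 \<rho>\<bar> \<le> b"
        have b0: "b \<ge> 0" using b[OF order_refl] by simp
        have 1: "\<bar>Hf v0 v1 y t - Hf (w0 n) (w1 n) y t\<bar> \<le> 6 * (Kb R * \<eta>)"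
          by (rule Hf_diff_bound[OF v(1) vn(1) y R e]) 
        also have "6 * (Kb R * \<eta>) \<le> 6 * (Kb R * \<mu>)" using \<eta> Kb_pos[of R] by (intro mult_left_mono) auto
        finally have HH: "\<bar>Hf v0 v1 y t - Hf (w0 n) (w1 n) y t\<bar> \<le> 6 * (Kb R * \<mu>)" .
        have "\<bar>p 0 (max 0 (t - y)) - p' n 0 (max 0 (t - y))\<bar> \<le> \<mu>" by (rule pp) (use y R in auto)
        moreover have "\<bar>v1 0 - w1 n 0\<bar> \<le> \<mu>" using e(2)[of 0] R \<eta> by simp
        ultimately have PP: "\<bar>(p 0 (max 0 (t - y)) - v1 0) - (p' n 0 (max 0 (t - y)) - w1 n 0)\<bar> \<le> \<mu> + \<mu>" by linarith
        have deq: "(c y + cl y) * d y t = (Hf v0 v1 y t - Hf (w0 n) (w1 n) y t)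
            - 2 * ((p 0 (max 0 (t - y)) - v1 0) - (p' n 0 (max 0 (t - y)) - w1 n 0)) - K1 d y t + K2 d y t - K1 d 0 (t - y)"
          using mildD(4)[OF m(1) y(1), of t] mildD(4)[OF mn y(1), of t]
          unfolding d_def K1_diff[OF cc y(1)] K2_diff[OF cc y(1)] K1_diff[OF cc order_refl]
          by (simp add: right_diff_distrib)
        have "\<bar>(c y + cl y) * d y t\<bar> \<le> 6 * (Kb R * \<mu>) + 2 * (\<mu> + \<mu>) + \<bar>K1 d y t\<bar> + \<bar>K2 d y t\<bar> + \<bar>K1 d 0 (t - y)\<bar>"
          unfolding deq by (rule abs_five_terms[OF HH PP])
        moreover have "\<bar>(c y + cl y) * d y t\<bar> = (c y + cl y) * \<bar>d y t\<bar>"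
          using csum_ge[OF y(1)] cm_pos by (simp add: abs_mult)
        moreover have "6 * (Kb R * \<mu>) + 2 * (\<mu> + \<mu>) = (6 * Kb R + 4) * \<mu>" by (simp add: distrib_right)
        ultimately show "(c y + cl y) * \<bar>d y t\<bar> \<le> (6 * Kb R + 4) * \<mu> + 2 * b + \<bar>K1 d y t\<bar> + \<bar>K2 d y t\<bar> + \<bar>K1 d 0 (t - y)\<bar>"
          using b0 by simp
      qed
      then show ?thesis by (simp add: D_def mult.assoc)
    qed
    show ?case
    proof (intro allI impI conjI)
      fix y t :: real assume y: "0 \<le> y" "0 \<le> t" "y + t \<le> R"
      have "D * \<mu> \<le> Ct * \<mu>" by (rule mult_right_mono) (use Ct \<mu> in auto)
      then show "\<bar>r y t - r' n y t\<bar> \<le> \<epsilon>" using dB[OF y(1,3)] \<mu>(2) by (simp add: d_def)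
      have yR: "y \<le> R" using y by simp
      have 1: "\<bar>K1 d y t\<bar> \<le> L * (D * \<mu>) * Nm R" by (rule K1_bound[OF cauc_causal[OF d] dB y(1,3)])
      have 2: "\<bar>c y * d y t\<bar> \<le> cbound R * (D * \<mu>)" unfolding abs_mult
        by (rule mult_mono) (use c_bound[OF y(1) yR] dB[OF y(1,3)] cbound_nonneg in auto)
      have K\<eta>: "Kb R * \<eta> \<le> Kb R * \<mu>" using \<eta> Kb_pos[of R] by (intro mult_left_mono) auto
      have 3: "\<bar>Fp v0 v1 (y + t) - Fp (w0 n) (w1 n) (y + t)\<bar> \<le> Kb R * \<eta>"
        by (rule F_diff_bound(1)[OF v(1) vn(1) y(3) R e])
      have 4: "\<bar>\<beta> v0 y - \<beta> (w0 n) y\<bar> \<le> Kb R * \<eta>"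
        using \<beta>_diff_bound[OF v(1) vn(1) y(1) yR e(1)] \<eta> by (simp add: Kb_def distrib_right)
      have "p y t - p' n y t = (Fp v0 v1 (y + t) - Fp (w0 n) (w1 n) (y + t)) - K1 d y t - c y * d y t - (\<beta> v0 y - \<beta> (w0 n) y)"
        using mildD(3)[OF m(1) y(1,2)] mildD(3)[OF mn y(1,2)] unfolding d_def K1_diff[OF cc y(1)] right_diff_distrib by linarith
      then have "\<bar>p y t - p' n y t\<bar> \<le> Kb R * \<mu> + L * (D * \<mu>) * Nm R + cbound R * (D * \<mu>) + Kb R * \<mu>"
        using 1 2 3 4 K\<eta> by linarith
      also have "\<dots> \<le> Ct * \<mu>" using D0 \<mu>(1) by (simp add: Ct_def algebra_simps)
      finally show "\<bar>p y t - p' n y t\<bar> \<le> \<epsilon>" using \<mu>(2) by simp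
    qed
  qed
qed

end

section \<open>From characteristics to the mild equations and back\<close>

lemma antiderivative_exists:
  fixes f :: "real \<Rightarrow> real"
  assumes "continuous_on UNIV f"
  shows "\<exists>F. \<forall>x. (F has_real_derivative f x) (at x)"
proof -
  have "\<exists>F. \<forall>x::real. - \<infinity> < ereal x \<longrightarrow> ereal x < \<infinity> \<longrightarrow> (F has_vector_derivative f x) (at x)"
    by (rule einterval_antiderivative) (use assms in \<open>auto simp: continuous_on_eq_continuous_at\<close>)
  then show ?thesis by (auto simp: has_real_derivative_iff_has_vector_derivative)
qed

text \<open>Subtracting a primitive of the continuous function \<open>k\<close> leaves a continuous
  function with derivative 0 off a countable set, hence a constant. Exceptional points, including
  the end point 0, thereby become points of differentiability.\<close>

lemma derivative_off_countable:
  fixes f k :: "real \<Rightarrow> real"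
  assumes f: "continuous_on {0..} f" and k: "continuous_on {0..} k" and S: "countable S"
    and der: "\<And>y. y > 0 \<Longrightarrow> y \<notin> S \<Longrightarrow> (f has_real_derivative k y) (at y)" and y: "y \<ge> 0"
  shows "(f has_real_derivative k y) (at y within {0..})"
proof -
  have "continuous_on UNIV (\<lambda>y. k (max 0 y))" by (rule continuous_on_compose2[OF k]) (auto intro!: continuous_intros)
  from antiderivative_exists[OF this] obtain K where K': "\<forall>x. (K has_real_derivative k (max 0 x)) (at x)" by blast
  then have K: "(K has_real_derivative k (max 0 x)) (at x)" for x by blast
  have Kc: "continuous_on T K" for T using K by (auto intro!: continuous_at_imp_continuous_on DERIV_isCont)
  have const: "f z - K z = f 0 - K 0" if "z \<ge> 0" for z
  proof (rule constant_off_countable[where f = "\<lambda>z. f z - K z", OF that _ S])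
    show "continuous_on {0..z} (\<lambda>z. f z - K z)" by (intro continuous_intros Kc continuous_on_subset[OF f]) auto
    show "((\<lambda>z. f z - K z) has_real_derivative 0) (at x)" if "0 < x" "x < z" "x \<notin> S" for x
      using DERIV_diff[OF der[OF that(1,3)] K[of x]] that by simp
  qed
  have "((\<lambda>z. K z + (f 0 - K 0)) has_real_derivative k (max 0 y) + 0) (at y within {0..})"
    by (intro DERIV_add has_field_derivative_at_within[OF K] DERIV_const)
  then have "((\<lambda>z. K z + (f 0 - K 0)) has_real_derivative k y) (at y within {0..})" using y by simp
  then show ?thesis
    by (rule has_field_derivative_transform_within[OF _ zero_less_one]) (use y const in \<open>auto simp: algebra_simps\<close>)
qed

text \<open>The diagonal increment is split into a move in \<open>y\<close> at the fixed time
  \<open>t0\<close> and a move in time at the position \<open>y0 + s\<close>. The first requires the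
  derivative in \<open>y\<close> at a single point; the second is handled by the mean value theorem
  and the joint continuity of the time derivative.\<close>

lemma DERIV_diagonal:
  fixes X x :: "real \<Rightarrow> real \<Rightarrow> real"
  assumes ky: "((\<lambda>y. X y t0) has_real_derivative k) (at y0)"
    and xt: "\<And>y t. \<bar>y - y0\<bar> < d \<Longrightarrow> \<bar>t - t0\<bar> < d \<Longrightarrow> (X y has_real_derivative x y t) (at t)" and d: "d > 0"
    and xc: "isCont (\<lambda>p. x (fst p) (snd p)) (y0, t0)"
  shows "((\<lambda>s. X (y0 + s) (t0 + s)) has_real_derivative k + x y0 t0) (at 0)"
proof -
  have 1: "((\<lambda>s. (X (y0 + s) t0 - X y0 t0) / s) \<longlongrightarrow> k) (at 0)"
    using ky unfolding DERIV_def by simp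
  have 2: "((\<lambda>s. (X (y0 + s) (t0 + s) - X (y0 + s) t0) / s) \<longlongrightarrow> x y0 t0) (at 0)"
  proof (rule tendstoI)
    fix e :: real assume "e > 0"
    then obtain d' where d': "d' > 0" "\<And>q. dist q (y0, t0) < d' \<Longrightarrow> dist (x (fst q) (snd q)) (x y0 t0) < e"
      using xc unfolding continuous_at_eps_delta by (metis fst_conv snd_conv)
    show "\<forall>\<^sub>F s in at 0. dist ((X (y0 + s) (t0 + s) - X (y0 + s) t0) / s) (x y0 t0) < e"
      unfolding eventually_at
    proof (intro exI[of _ "min d (d' / 2)"] conjI ballI impI)
      show "min d (d' / 2) > 0" using d d' by simp
      fix s :: real assume "s \<in> UNIV" and s: "s \<noteq> 0 \<and> dist s 0 < min d (d' / 2)"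
      have mvt: "\<exists>\<xi>. \<bar>\<xi> - t0\<bar> \<le> \<bar>s\<bar> \<and> X (y0 + s) (t0 + s) - X (y0 + s) t0 = s * x (y0 + s) \<xi>"
      proof (cases "s > 0")
        case True
        have "\<exists>z>t0. z < t0 + s \<and> X (y0 + s) (t0 + s) - X (y0 + s) t0 = (t0 + s - t0) * x (y0 + s) z"
          by (rule MVT2) (use True s in \<open>auto intro!: xt\<close>)
        then obtain z where "z > t0" "z < t0 + s" "X (y0 + s) (t0 + s) - X (y0 + s) t0 = (t0 + s - t0) * x (y0 + s) z" by blast
        then show ?thesis using True by (intro exI[of _ z]) auto
      next
        case False
        then have "s < 0" using s by simp
        have "\<exists>z>t0 + s. z < t0 \<and> X (y0 + s) t0 - X (y0 + s) (t0 + s) = (t0 - (t0 + s)) * x (y0 + s) z"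
          by (rule MVT2) (use \<open>s < 0\<close> s in \<open>auto intro!: xt\<close>)
        then obtain z where z: "z > t0 + s" "z < t0" "X (y0 + s) t0 - X (y0 + s) (t0 + s) = (t0 - (t0 + s)) * x (y0 + s) z" by blast
        then show ?thesis using \<open>s < 0\<close> by (intro exI[of _ z]) (auto simp: algebra_simps)
      qed
      then obtain \<xi> where \<xi>: "\<bar>\<xi> - t0\<bar> \<le> \<bar>s\<bar>" "X (y0 + s) (t0 + s) - X (y0 + s) t0 = s * x (y0 + s) \<xi>" by blast
      have "dist (y0 + s, \<xi>) (y0, t0) \<le> \<bar>s\<bar> + \<bar>\<xi> - t0\<bar>"
        unfolding dist_prod_def using sqrt_sum_squares_le_sum_abs[of s "\<xi> - t0"] by (simp add: dist_real_def)
      also have "\<dots> < d'" using \<xi>(1) s by (simp add: dist_real_def)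
      finally show "dist ((X (y0 + s) (t0 + s) - X (y0 + s) t0) / s) (x y0 t0) < e"
        using d'(2)[of "(y0 + s, \<xi>)"] \<xi>(2) s by simp
    qed
  qed
  from tendsto_add[OF 1 2] show ?thesis unfolding DERIV_def by (simp add: add_divide_distrib[symmetric])
qed

context medium
begin

lemma atoms_isolated: assumes "y \<notin> A" shows "\<exists>d>0. A \<inter> {y - d<..<y + d} = {}"
proof -
  obtain d where d: "d > 0" "\<And>x. x \<in> A \<inter> {0<..y + 1} \<Longrightarrow> x \<noteq> y \<Longrightarrow> d \<le> dist y x"
    using finite_set_avoid[OF A_finite, of "y + 1" y] by blast
  have "A \<inter> {y - min d 1<..<y + min d 1} = {}"
  proof (rule ccontr)
    assume "A \<inter> {y - min d 1<..<y + min d 1} \<noteq> {}"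
    then obtain x where x: "x \<in> A" "y - min d 1 < x" "x < y + min d 1" by auto
    then have "x \<in> A \<inter> {0<..y + 1}" using A_pos by auto
    then have "d \<le> dist y x" using d(2) x assms by auto
    then show False using x by (auto simp: dist_real_def)
  qed
  then show ?thesis using d(1) by (intro exI[of _ "min d 1"]) auto
qed

lemma intJ_increment:
  assumes v: "continuous_on UNIV v" and ab: "0 \<le> a" "a \<le> b" and na: "A \<inter> {a<..b} = {}"
    and e: "\<And>z. a < z \<Longrightarrow> z \<le> b \<Longrightarrow> \<bar>v z - k\<bar> \<le> e" and e0: "e \<ge> 0"
  shows "\<bar>(intJ v b - intJ v a) - k * (c b - c a)\<bar> \<le> L * e * (b - a)"
proof -
  have [measurable]: "v \<in> borel_measurable borel" using v by (rule borel_measurable_continuous_onI)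
  have "intJ v b - intJ v a = (LINT z|N. (if 0 < z \<and> z \<le> b then J z * v z else 0) - (if 0 < z \<and> z \<le> a then J z * v z else 0))"
    unfolding intJ_def by (rule Bochner_Integration.integral_diff[symmetric]) (rule intJ_integrable[OF v])+
  moreover have "k * (c b - c a) = (LINT z|N. k * (if a < z \<and> z \<le> b then J z else 0))"
    unfolding c_diff[OF ab] by simp
  ultimately have "(intJ v b - intJ v a) - k * (c b - c a) =
      (LINT z|N. ((if 0 < z \<and> z \<le> b then J z * v z else 0) - (if 0 < z \<and> z \<le> a then J z * v z else 0)) - k * (if a < z \<and> z \<le> b then J z else 0))"
    using Bochner_Integration.integral_diff[OF Bochner_Integration.integrable_diff[OF intJ_integrable[OF v, of b] intJ_integrable[OF v, of a]] integrable_mult_right[OF J_integrable[OF ab(1), of b], of k]]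
    by simp
  also have "\<dots> = (LINT z|N. (if a < z \<and> z \<le> b then J z * (v z - k) else 0))"
    by (rule Bochner_Integration.integral_cong) (use ab in \<open>auto simp: algebra_simps\<close>)
  finally have eq: "(intJ v b - intJ v a) - k * (c b - c a) = (LINT z|N. (if a < z \<and> z \<le> b then J z * (v z - k) else 0))" .
  have bd: "\<bar>if a < z \<and> z \<le> b then J z * (v z - k) else 0\<bar> \<le> L * e * indicator {a<..b} z" for z
    using JB[OF e] by (auto simp: indicator_def)
  have int: "integrable N (\<lambda>z. L * e * indicator {a<..b} z)"
    using emeasure_N_finite[OF ab(1), of b] by (intro integrable_mult_right integrable_real_indicator) auto
  have "norm (LINT z|N. (if a < z \<and> z \<le> b then J z * (v z - k) else 0)) \<le> (LINT z|N. L * e * indicator {a<..b} z)"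
  proof (rule Bochner_Integration.integral_norm_bound_integral[OF _ int])
    show "integrable N (\<lambda>z. if a < z \<and> z \<le> b then J z * (v z - k) else 0)"
      by (rule Bochner_Integration.integrable_bound[OF int]) (use bd L_nonneg e0 in auto)
  qed (use bd in auto)
  then show ?thesis unfolding eq using measure_no_atoms[OF ab na] by simp
qed

text \<open>The density \<open>J\<close> determines the derivative of \<open>c\<close> almost
  everywhere, whereas here the derivative at a prescribed point is required. With \<open>v\<close>
  frozen at its value at \<open>y\<close> the integral is \<open>v y\<close> times the increment of
  \<open>c\<close>; the error is at most \<open>L\<close> times the oscillation of \<open>v\<close>
  times the length of the interval.\<close>

lemma intJ_deriv:
  assumes v: "continuous_on UNIV v" and y: "y \<ge> 0" "y \<notin> A" and m: "(c has_real_derivative m) (at y within {0..})"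
  shows "(intJ v has_real_derivative m * v y) (at y within {0..})"
proof -
  define \<phi> where "\<phi> z = intJ v z - v y * c z" for z
  have "(\<phi> has_real_derivative 0) (at y within {0..})"
    unfolding has_field_derivative_iff
  proof (rule tendstoI)
    fix e :: real assume e: "e > 0"
    define e1 where "e1 = e / (L + 1)"
    have e1: "e1 > 0" "L * e1 < e" using e L_nonneg by (auto simp: e1_def field_simps)
    have "isCont v y" using v by (simp add: continuous_on_eq_continuous_at)
    then obtain d1 where d1: "d1 > 0" "\<And>z. \<bar>z - y\<bar> < d1 \<Longrightarrow> \<bar>v z - v y\<bar> < e1"
      unfolding continuous_at_eps_delta dist_real_def using e1(1) by metis
    have d1': "\<bar>v w - v y\<bar> \<le> e1" if "\<bar>w - y\<bar> < d1" for w using d1(2)[OF that] by simp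
    obtain d2 where d2: "d2 > 0" "A \<inter> {y - d2<..<y + d2} = {}" using atoms_isolated[OF y(2)] by blast
    show "\<forall>\<^sub>F z in at y within {0..}. dist ((\<phi> z - \<phi> y) / (z - y)) 0 < e"
      unfolding eventually_at
    proof (intro exI[of _ "min d1 d2"] conjI ballI impI)
      show "min d1 d2 > 0" using d1 d2 by simp
      fix z assume z0: "z \<in> {0..}" and "z \<noteq> y \<and> dist z y < min d1 d2"
      then have z: "z \<noteq> y" "\<bar>z - y\<bar> < d1" "\<bar>z - y\<bar> < d2" by (auto simp: dist_real_def)
      have "\<bar>\<phi> z - \<phi> y\<bar> \<le> L * e1 * \<bar>z - y\<bar>"
      proof (cases "y < z")
        case True
        have "A \<inter> {y<..z} = {}" using d2(2) z by auto
        then have "\<bar>(intJ v z - intJ v y) - v y * (c z - c y)\<bar> \<le> L * e1 * (z - y)"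
          by (intro intJ_increment[OF v y(1) less_imp_le[OF True]] d1') (use z e1 in auto)
        then show ?thesis using True by (simp add: \<phi>_def algebra_simps)
      next
        case False
        then have zy: "z < y" using z by simp
        have "A \<inter> {z<..y} = {}" using d2(2) z by auto
        then have "\<bar>(intJ v y - intJ v z) - v y * (c y - c z)\<bar> \<le> L * e1 * (y - z)"
          by (intro intJ_increment[OF v _ less_imp_le[OF zy]] d1') (use z e1 z0 in auto)
        moreover have "\<phi> z - \<phi> y = - ((intJ v y - intJ v z) - v y * (c y - c z))" by (simp add: \<phi>_def algebra_simps)
        ultimately show ?thesis using zy by simp
      qed
      then have "\<bar>(\<phi> z - \<phi> y) / (z - y)\<bar> \<le> L * e1" using z(1) by (simp add: abs_divide divide_le_eq)
      then show "dist ((\<phi> z - \<phi> y) / (z - y)) 0 < e" using e1 by simp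
    qed
  qed
  from DERIV_add[OF this DERIV_cmult[OF m, of "v y"]] show ?thesis
    by (simp add: \<phi>_def mult.commute)
qed

text \<open>On the line \<open>y + t = T\<close> the integrand of \<open>K1\<close> does not depend
  on \<open>y\<close>, only the range of integration does. Along the characteristic
  \<open>K1\<close> is therefore a constant minus a Stieltjes integral, to which the differentiation
  rule for \<open>intJ\<close> applies.\<close>

lemma K1_characteristic:
  assumes r: "cauc r" "jointly_cont r" and y: "y \<ge> 0"
  shows "K1 r y (T - y) = K1 r 0 T - intJ (\<lambda>z. r (max 0 z) (T - max 0 z)) y"
    and "continuous_on UNIV (\<lambda>z. r (max 0 z) (T - max 0 z))"
proof -
  show v: "continuous_on UNIV (\<lambda>z. r (max 0 z) (T - max 0 z))"
    by (intro jointly_cont_compose[OF r(2)] continuous_intros) auto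
  have "K1 r 0 T - intJ (\<lambda>z. r (max 0 z) (T - max 0 z)) y =
     (LINT z|N. (if 0 < z then J z * r z (T + 0 - z) else 0) - (if 0 < z \<and> z \<le> y then J z * r (max 0 z) (T - max 0 z) else 0))"
    unfolding K1_def intJ_def
    by (rule Bochner_Integration.integral_diff[symmetric, OF K1_integrable[OF cauc_causal[OF r(1)] order_refl] intJ_integrable[OF v]])
  also have "\<dots> = K1 r y (T - y)" unfolding K1_def
    by (rule Bochner_Integration.integral_cong) (use y in auto)
  finally show "K1 r y (T - y) = K1 r 0 T - intJ (\<lambda>z. r (max 0 z) (T - max 0 z)) y" by simp
qed

text \<open>Along \<open>y + t = T\<close> the function \<phi> is continuous across the atoms,
  although the products with \<open>c\<close> are not. Off \<open>B\<close> its derivative vanishes: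
  the characteristic derivative contributes \<open>m * (r + v0)\<close>, and the Stieltjes integrals
  in \<beta> and \<open>K1\<close> remove \<open>m * v0\<close> and \<open>m * r\<close>. At the
  foot of the characteristic, where \<open>t = 0\<close>, its value is \<open>Fp\<close>.\<close>

lemma left_invariant:
  assumes r: "cauc r" "jointly_cont r" and v: "continuous_on UNIV v0" "continuous_on UNIV v1"
    and p: "jointly_cont (\<lambda>y t. p y (max 0 t))" "\<And>y. y \<ge> 0 \<Longrightarrow> p y 0 = v1 y" and bad: "countable B" "A \<subseteq> B"
    and char: "\<And>y t. y > 0 \<Longrightarrow> t > 0 \<Longrightarrow> y \<notin> B \<Longrightarrow> \<exists>m. (c has_real_derivative m) (at y within {0..}) \<and>
      ((\<lambda>s. p (y - s) (t + s) + c (y - s) * (r (y - s) (t + s) + v0 (y - s))) has_real_derivative - m * (r y t + v0 y)) (at 0)"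
    and y: "y \<ge> 0" and t: "t \<ge> 0"
  shows "p y t + c y * r y t + \<beta> v0 y = Fp v0 v1 (y + t) - K1 r y t"
proof -
  define T where "T = y + t"
  define F where "F z = r (max 0 z) (T - max 0 z)" for z
  note KF = K1_characteristic[OF r, of _ T, folded F_def[abs_def]]
  define \<phi> where "\<phi> z = p z (max 0 (T - z)) + (c z * r z (T - z) + K1 r z (T - z)) + \<beta> v0 z" for z
  have c\<phi>: "continuous_on {0..} \<phi>" unfolding \<phi>_def
    by (intro continuous_intros jointly_cont_compose[OF p(1)] jointly_cont_compose[OF jointly_cont_left_combination[OF r]] \<beta>_cont v) auto
  have "\<phi> T = \<phi> y"
  proof (rule constant_off_countable[where f = \<phi> and a = y and b = T, OF _ _ bad(1)])
    show "y \<le> T" using t by (simp add: T_def)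
    show "continuous_on {y..T} \<phi>" by (rule continuous_on_subset[OF c\<phi>]) (use y in auto)
    fix z assume z: "y < z" "z < T" "z \<notin> B"
    have z0: "z > 0" "z \<notin> A" using z y bad(2) by auto
    obtain m where m: "(c has_real_derivative m) (at z within {0..})"
      "((\<lambda>s. p (z - s) (T - z + s) + c (z - s) * (r (z - s) (T - z + s) + v0 (z - s))) has_real_derivative - m * (r z (T - z) + v0 z)) (at 0)"
      using char[of z "T - z"] z z0 by auto
    have at: "at z within {0..} = at z" by (rule at_within_open_subset[of _ "{0<..}"]) (use z0 in auto)
    \<comment> \<open>Expressed through the position \<open>x\<close>, the parameter of the
      characteristic is \<open>z - x\<close>, so the derivative changes its sign.\<close>
    have "((\<lambda>x. z - x) has_real_derivative -1) (at z)" by (auto intro!: derivative_eq_intros)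
    from DERIV_chain2[where g = "\<lambda>x. z - x" and x = z, OF _ this] m(2)
    have 1: "((\<lambda>x. p x (T - x) + c x * (r x (T - x) + v0 x)) has_real_derivative m * (r z (T - z) + v0 z)) (at z)"
      by fastforce
    have 2: "(intJ v0 has_real_derivative m * v0 z) (at z)" "(intJ F has_real_derivative m * F z) (at z)"
      using intJ_deriv[OF v(1) _ z0(2) m(1)] intJ_deriv[OF KF(2) _ z0(2) m(1)] z0 unfolding at by auto
    have "((\<lambda>x. (p x (T - x) + c x * (r x (T - x) + v0 x)) - intJ v0 x + K1 r 0 T - intJ F x) has_real_derivative
       m * (r z (T - z) + v0 z) - m * v0 z + 0 - m * F z) (at z)"
      by (intro DERIV_diff DERIV_add DERIV_const 1 2)
    moreover have "m * (r z (T - z) + v0 z) - m * v0 z + 0 - m * F z = 0" using z0 by (simp add: F_def algebra_simps)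
    ultimately have "((\<lambda>x. (p x (T - x) + c x * (r x (T - x) + v0 x)) - intJ v0 x + K1 r 0 T - intJ F x) has_real_derivative 0) (at z)" by simp
    then show "(\<phi> has_real_derivative 0) (at z)"
    proof (rule has_field_derivative_transform_within_open[of _ _ _ "{0<..<T}"])
      fix x assume x: "x \<in> {0<..<T}"
      then show "(p x (T - x) + c x * (r x (T - x) + v0 x)) - intJ v0 x + K1 r 0 T - intJ F x = \<phi> x"
        using KF(1)[of x] by (simp add: \<phi>_def \<beta>_def algebra_simps)
    qed (use z z0 in auto)
  qed
  moreover have "\<phi> y = p y t + (c y * r y t + K1 r y t) + \<beta> v0 y" using t by (simp add: \<phi>_def T_def)
  moreover have "\<phi> T = Fp v0 v1 T"
    using y t cauc_nonpos[OF r(1), of T 0] K1_nonpos[OF r(1), of T 0] p(2)[of T] by (simp add: \<phi>_def Fp_def T_def)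
  ultimately show ?thesis unfolding T_def by simp
qed

lemma integral_K12:
  assumes r: "cauc r" and y: "y > 0" "y \<notin> A" and t: "t \<ge> 0"
  shows "((\<lambda>s. K1 r y s + K2 r y s) has_integral (LINT z|N. (if 0 < z then J z * tint r z (t - \<bar>y - z\<bar>) else 0))) {0..t}"
proof -
  have y0: "y \<ge> 0" using y by simp
  have "((\<lambda>s. K1 r y s + K2 r y s) has_integral ((K1 (tint r) y t + K2 (tint r) y t) - (K1 (tint r) y 0 + K2 (tint r) y 0))) {0..t}"
  proof (rule fundamental_theorem_of_calculus[OF t])
    show "((\<lambda>t. K1 (tint r) y t + K2 (tint r) y t) has_vector_derivative K1 r y x + K2 r y x) (at x within {0..t})" for x
      unfolding has_real_derivative_iff_has_vector_derivative[symmetric]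
      by (rule has_field_derivative_at_within[OF DERIV_add[OF K1_tint_deriv[OF r y0] K2_tint_deriv[OF r y0]]])
  qed
  moreover have "K1 (tint r) y 0 = 0" "K2 (tint r) y 0 = 0"
    using K1_nonpos[OF cauc_tint[OF r] y0] K2_nonpos[OF cauc_tint[OF r]] by simp_all
  ultimately show ?thesis using K12_off_atoms[OF cauc_causal[OF cauc_tint[OF r]] y] by simp
qed

lemma DERIV_shift_sum:
  assumes "\<And>x. (F has_real_derivative f x) (at x)"
  shows "((\<lambda>y. F (y + t) - F y) has_real_derivative f (y + t) - f y) (at y)"
    and "((\<lambda>y. F (t - y) - F (- y)) has_real_derivative - f (t - y) + f (- y)) (at y)"
proof -
  have "((\<lambda>y. F (y + t)) has_real_derivative f (y + t) * 1) (at y)"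
    by (rule DERIV_chain2[OF assms]) (auto intro!: derivative_eq_intros)
  then show "((\<lambda>y. F (y + t) - F y) has_real_derivative f (y + t) - f y) (at y)"
    using DERIV_diff[OF _ assms[of y]] by simp
  have 1: "((\<lambda>y. F (t - y)) has_real_derivative f (t - y) * - 1) (at y)"
    by (rule DERIV_chain2[OF assms]) (auto intro!: derivative_eq_intros)
  have 2: "((\<lambda>y. F (- y)) has_real_derivative f (- y) * - 1) (at y)"
    by (rule DERIV_chain2[OF assms]) (auto intro!: derivative_eq_intros)
  show "((\<lambda>y. F (t - y) - F (- y)) has_real_derivative - f (t - y) + f (- y)) (at y)"
    using DERIV_diff[OF 1 2] by simp
qed

lemma integral_antiderivative:
  assumes F: "\<And>x. (F has_real_derivative f x) (at x)" and t: "t \<ge> (0::real)"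
  shows "((\<lambda>s. f (y + s)) has_integral F (y + t) - F y) {0..t}" "((\<lambda>s. f (s - y)) has_integral F (t - y) - F (- y)) {0..t}"
proof -
  have "((\<lambda>s. f (y + s)) has_integral F (y + t) - F (y + 0)) {0..t}"
  proof (rule fundamental_theorem_of_calculus[OF t])
    fix x
    have "((\<lambda>s. F (y + s)) has_real_derivative f (y + x) * 1) (at x within {0..t})"
      by (rule DERIV_chain2[OF F]) (auto intro!: derivative_eq_intros)
    then show "((\<lambda>s. F (y + s)) has_vector_derivative f (y + x)) (at x within {0..t})"
      by (simp add: has_real_derivative_iff_has_vector_derivative)
  qed
  then show "((\<lambda>s. f (y + s)) has_integral F (y + t) - F y) {0..t}" by simp
  have "((\<lambda>s. f (s - y)) has_integral F (t - y) - F (0 - y)) {0..t}"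
  proof (rule fundamental_theorem_of_calculus[OF t])
    fix x
    have "((\<lambda>s. F (s - y)) has_real_derivative f (x - y) * 1) (at x within {0..t})"
      by (rule DERIV_chain2[OF F]) (auto intro!: derivative_eq_intros)
    then show "((\<lambda>s. F (s - y)) has_vector_derivative f (x - y)) (at x within {0..t})"
      by (simp add: has_real_derivative_iff_has_vector_derivative)
  qed
  then show "((\<lambda>s. f (s - y)) has_integral F (t - y) - F (- y)) {0..t}" by simp
qed

lemma off_atoms_open: "open ({0<..} - A)"
proof (rule openI)
  fix y assume y: "y \<in> {0<..} - A"
  then obtain d where d: "d > 0" "A \<inter> {y - d<..<y + d} = {}" using atoms_isolated by blast
  show "\<exists>e>0. ball y e \<subseteq> {0<..} - A"
    by (rule exI[of _ "min d y"]) (use y d in \<open>auto simp: dist_real_def abs_less_iff\<close>)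
qed

text \<open>The compatibility which says that \<open>p\<close> and \<open>u\<^sub>0' + r\<close> are
  the partial derivatives of one function. Half the sum of the two invariants expresses
  \<open>p\<close> off the atoms with \<open>r\<close> occurring inside the kernels only, and there
  the integration in time supplies differentiability in \<open>y\<close>.\<close>

theorem mild_P_deriv:
  assumes m: "mild_solution f v0 v1 r p" and v: "continuous_on UNIV v0" "continuous_on UNIV v1"
    and y: "y > 0" "y \<notin> A" and t: "t \<ge> 0"
  shows "((\<lambda>y. integral {0..t} (p y)) has_real_derivative c y * r y t) (at y)"
proof -
  note r = mildD(1,2)[OF m]
  define th where "th \<sigma> = Fm v0 v1 (- \<sigma>) + (2 * (p 0 (max 0 \<sigma>) - v1 0) - Fp v0 v1 (max 0 \<sigma>) + Fp v0 v1 0 + K1 r 0 \<sigma>)" for \<sigma>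
  have K10: "continuous_on UNIV (K1 r 0)" using K1_isCont[OF r(1) order_refl] by (intro continuous_at_imp_continuous_on) auto
  have thc: "continuous_on UNIV th" unfolding th_def
    by (intro continuous_intros mild_trace_cont(2)[OF m v] K10 continuous_on_compose2[OF Fp_cont[OF v, of UNIV]] continuous_on_compose2[OF Fm_cont[OF v, of UNIV]]) auto
  obtain \<Theta> where "\<forall>x. (\<Theta> has_real_derivative th x) (at x)" using antiderivative_exists[OF thc] by blast
  then have \<Theta>: "(\<Theta> has_real_derivative th x) (at x)" for x by blast
  obtain \<Phi> where "\<forall>x. (\<Phi> has_real_derivative Fp v0 v1 x) (at x)" using antiderivative_exists[OF Fp_cont[OF v]] by blast
  then have \<Phi>: "(\<Phi> has_real_derivative Fp v0 v1 x) (at x)" for x by blast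
  have z: "p y t - cl y * r y t - \<beta> v0 y = th (t - y) - K2 r y t" if "y \<ge> 0" "t \<ge> 0" for y t
  proof -
    have "Hf v0 v1 y t = Fp v0 v1 (y + t) - 2 * \<beta> v0 y - Fm v0 v1 (y - t) + Fp v0 v1 (max 0 (t - y)) - Fp v0 v1 0"
      using that by (simp add: Hf_def Fp_def Fm_def)
    then show ?thesis using mildD(3)[OF m that] mildD(4)[OF m that(1), of t]
      by (simp add: th_def algebra_simps)
  qed
  define M where "M y = (LINT z|N. (if 0 < z then J z * tint r z (t - \<bar>y - z\<bar>) else 0))" for y
  have P: "integral {0..t} (p y) = ((\<Phi> (y + t) - \<Phi> y) + (\<Theta> (t - y) - \<Theta> (- y)) - M y) / 2" if y: "y \<in> {0<..} - A" for y
  proof -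
    have "((\<lambda>s. (Fp v0 v1 (y + s) + th (s - y) - (K1 r y s + K2 r y s)) / 2) has_integral ((\<Phi> (y + t) - \<Phi> y) + (\<Theta> (t - y) - \<Theta> (- y)) - M y) / 2) {0..t}"
      unfolding M_def by (intro has_integral_divide has_integral_diff has_integral_add integral_antiderivative[OF \<Phi> t] integral_antiderivative[OF \<Theta> t] integral_K12 r t) (use y in auto)
    moreover have "(Fp v0 v1 (y + s) + th (s - y) - (K1 r y s + K2 r y s)) / 2 = p y s" if "s \<in> {0..t}" for s
      using z[of y s] mildD(3)[OF m, of y s] that y by (simp add: cl_def)
    ultimately have "(p y has_integral ((\<Phi> (y + t) - \<Phi> y) + (\<Theta> (t - y) - \<Theta> (- y)) - M y) / 2) {0..t}"
      by (subst has_integral_cong[symmetric]) auto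
    then show ?thesis by (rule integral_unique)
  qed
  have "((\<lambda>y. ((\<Phi> (y + t) - \<Phi> y) + (\<Theta> (t - y) - \<Theta> (- y)) - M y) / 2) has_real_derivative
     ((Fp v0 v1 (y + t) - Fp v0 v1 y) + (- th (t - y) + th (- y)) - (K1 r y t - K2 r y t)) / 2) (at y)"
    unfolding M_def by (intro DERIV_cdivide DERIV_diff[of "\<lambda>y. (\<Phi> (y + t) - \<Phi> y) + (\<Theta> (t - y) - \<Theta> (- y))"] DERIV_add DERIV_shift_sum[OF \<Phi>] DERIV_shift_sum[OF \<Theta>] K12_tint_deriv_space r y)
  moreover have "((Fp v0 v1 (y + t) - Fp v0 v1 y) + (- th (t - y) + th (- y)) - (K1 r y t - K2 r y t)) / 2 = c y * r y t"
  proof -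
    have "th (- y) = Fm v0 v1 y"
      using y mild_initial[OF m order_refl] K1_nonpos[OF r(1) order_refl, of "- y"] by (simp add: th_def max_def)
    then show ?thesis using z[of y t] mildD(3)[OF m, of y t] y t by (simp add: cl_def Fp_def Fm_def max_def field_simps)
  qed
  ultimately have "((\<lambda>y. ((\<Phi> (y + t) - \<Phi> y) + (\<Theta> (t - y) - \<Theta> (- y)) - M y) / 2) has_real_derivative c y * r y t) (at y)" by simp
  then show ?thesis
    by (rule has_field_derivative_transform_within_open[OF _ off_atoms_open]) (use y P in auto)
qed

text \<open>No equation along the characteristics leaving the boundary is among the hypotheses. The
  quantity \<open>x\<close> that should be constant on them has a time integral \<open>X\<close>
  with time derivative \<open>x\<close> and space derivative \<open>Fm - x\<close>, the latter by
  \<open>P\<close> and the left invariant. So \<open>X\<close> minus a primitive of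
  \<open>Fm\<close> is constant along diagonals, and differentiating this identity in time gives the
  same for \<open>x\<close>.\<close>

theorem equation_from_left_invariant:
  assumes r: "cauc r" "jointly_cont r" and v: "continuous_on UNIV v0" "continuous_on UNIV v1"
    and pj: "jointly_cont (\<lambda>y t. p y (max 0 t))" and p0: "\<And>y. y \<ge> 0 \<Longrightarrow> p y 0 = v1 y"
    and w: "\<And>y t. y \<ge> 0 \<Longrightarrow> t \<ge> 0 \<Longrightarrow> p y t + c y * r y t + \<beta> v0 y = Fp v0 v1 (y + t) - K1 r y t"
    and P: "\<And>y t. y > 0 \<Longrightarrow> y \<notin> A \<Longrightarrow> t \<ge> 0 \<Longrightarrow> ((\<lambda>y. integral {0..t} (p y)) has_real_derivative c y * r y t) (at y)"
    and y: "y \<ge> 0"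
  shows "(c y + cl y) * r y t = (Hf v0 v1 y t - 2 * (p 0 (max 0 (t - y)) - v1 0)) - K1 r y t + K2 r y t - K1 r 0 (t - y)"
proof (cases "t \<le> 0")
  case True
  moreover have "max 0 (t - y) = 0" using True y by simp
  ultimately show ?thesis using cauc_nonpos[OF r(1) y True] K1_nonpos[OF r(1) y True] K2_nonpos[OF r(1) True]
    K1_nonpos[OF r(1) order_refl, of "t - y"] y p0[of 0] by (simp add: Hf_nonpos)
next
  case False
  define x where "x y t = p y (max 0 t) + (K2 r y t - cl y * r y t) - \<beta> v0 y" for y t
  have xj: "jointly_cont x"
  proof -
    have "jointly_cont (\<lambda>y t. \<beta> v0 y)" unfolding jointly_cont_def by (intro continuous_on_compose2[OF \<beta>_cont[OF v(1)]] continuous_intros) auto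
    then show ?thesis unfolding x_def by (intro jointly_cont_diff jointly_cont_add pj jointly_cont_right_combination r)
  qed
  define X where "X y t = integral {0..t} (x y)" for y t
  obtain \<Phi> where "\<forall>x. (\<Phi> has_real_derivative Fp v0 v1 x) (at x)" using antiderivative_exists[OF Fp_cont[OF v]] by blast
  then have \<Phi>: "(\<Phi> has_real_derivative Fp v0 v1 x) (at x)" for x by blast
  obtain \<Psi> where "\<forall>x. (\<Psi> has_real_derivative Fm v0 v1 x) (at x)" using antiderivative_exists[OF Fm_cont[OF v]] by blast
  then have \<Psi>: "(\<Psi> has_real_derivative Fm v0 v1 x) (at x)" for x by blast
  have X_t: "(X y has_real_derivative x y t) (at t)" if "y \<ge> 0" "t > 0" for y t
  proof -
    have "(X y has_real_derivative x y t) (at t within {0..t+1})"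
      unfolding X_def by (rule integral_has_real_derivative[OF jointly_cont_time[OF xj that(1)]]) (use that in auto)
    then show ?thesis using at_within_Icc_at[of 0 t "t+1"] that by auto
  qed
  have pi: "(p y) integrable_on {0..t}" if "y \<ge> 0" for y t
  proof -
    have "continuous_on {0..t} (\<lambda>s. p y (max 0 s))" by (rule jointly_cont_time[OF pj that])
    then have "continuous_on {0..t} (p y)" by (rule continuous_on_eq) auto
    then show ?thesis by (rule integrable_continuous_real)
  qed
  have X_off: "X y t = 2 * integral {0..t} (p y) - (\<Phi> (y + t) - \<Phi> y) + (LINT z|N. (if 0 < z then J z * tint r z (t - \<bar>y - z\<bar>) else 0))"
    if y: "y \<in> {0<..} - A" and t: "t \<ge> 0" for y t
  proof -
    have "((\<lambda>s. 2 * p y s - Fp v0 v1 (y + s) + (K1 r y s + K2 r y s)) has_integral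
      2 * integral {0..t} (p y) - (\<Phi> (y + t) - \<Phi> y) + (LINT z|N. (if 0 < z then J z * tint r z (t - \<bar>y - z\<bar>) else 0))) {0..t}"
      by (intro has_integral_diff has_integral_add has_integral_mult_right integrable_integral pi integral_antiderivative[OF \<Phi> t] integral_K12 r t) (use y in auto)
    moreover have "2 * p y s - Fp v0 v1 (y + s) + (K1 r y s + K2 r y s) = x y s" if "s \<in> {0..t}" for s
      using w[of y s] that y by (simp add: cl_def x_def)
    ultimately have "(x y has_integral 2 * integral {0..t} (p y) - (\<Phi> (y + t) - \<Phi> y) + (LINT z|N. (if 0 < z then J z * tint r z (t - \<bar>y - z\<bar>) else 0))) {0..t}"
      by (subst has_integral_cong[symmetric]) auto
    then show ?thesis unfolding X_def by (rule integral_unique)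
  qed
  have X_y_off: "((\<lambda>y. X y t) has_real_derivative Fm v0 v1 y - x y t) (at y)" if y: "y > 0" "y \<notin> A" and t: "t \<ge> 0" for y t
  proof -
    have "((\<lambda>y. 2 * integral {0..t} (p y) - (\<Phi> (y + t) - \<Phi> y) + (LINT z|N. (if 0 < z then J z * tint r z (t - \<bar>y - z\<bar>) else 0)))
      has_real_derivative 2 * (c y * r y t) - (Fp v0 v1 (y + t) - Fp v0 v1 y) + (K1 r y t - K2 r y t)) (at y)"
      by (intro DERIV_add DERIV_diff[of "\<lambda>y. 2 * integral {0..t} (p y)"] DERIV_cmult P DERIV_shift_sum[OF \<Phi>] K12_tint_deriv_space r y t)
    moreover have "2 * (c y * r y t) - (Fp v0 v1 (y + t) - Fp v0 v1 y) + (K1 r y t - K2 r y t) = Fm v0 v1 y - x y t"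
      using w[of y t] y t by (simp add: x_def cl_def Fp_def Fm_def max_def)
    ultimately have "((\<lambda>y. 2 * integral {0..t} (p y) - (\<Phi> (y + t) - \<Phi> y) + (LINT z|N. (if 0 < z then J z * tint r z (t - \<bar>y - z\<bar>) else 0)))
      has_real_derivative Fm v0 v1 y - x y t) (at y)" by simp
    then show ?thesis
      by (rule has_field_derivative_transform_within_open[OF _ off_atoms_open]) (use y t X_off in auto)
  qed
  \<comment> \<open>The formula for the derivative is continuous in \<open>y\<close>, so it extends
    to the atoms.\<close>
  have X_y: "((\<lambda>y. X y t) has_real_derivative Fm v0 v1 y - x y t) (at y)" if y: "y > 0" and t: "t \<ge> 0" for y t
  proof -
    have "((\<lambda>y. X y t) has_real_derivative Fm v0 v1 y - x y t) (at y within {0..})"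
    proof (rule derivative_off_countable[OF _ _ countable_A])
      have "continuous_on ({0..} \<times> cbox 0 t) (\<lambda>(y, s). x y s)"
        using continuous_on_subset[OF xj[unfolded jointly_cont_def], of "{0..} \<times> cbox 0 t"] by (auto simp: case_prod_beta)
      from integral_continuous_on_param[OF this]
      show "continuous_on {0..} (\<lambda>y. X y t)" unfolding X_def by simp
      show "continuous_on {0..} (\<lambda>y. Fm v0 v1 y - x y t)"
        by (intro continuous_intros Fm_cont v jointly_cont_compose[OF xj]) auto
    qed (use X_y_off t y in auto)
    moreover have "at y within {0..} = at y" by (rule at_within_open_subset[of _ "{0<..}"]) (use y in auto)
    ultimately show ?thesis by simp
  qed
  have xint: "x (y + s) (t + s) = x y t" if y: "y > 0" and t: "t > 0" and s: "s \<ge> 0" for y t s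
  proof -
    define D where "D t \<sigma> = X (y + \<sigma>) (t + \<sigma>) - \<Psi> (y + \<sigma>)" for t \<sigma>
    have D0: "(D t has_real_derivative 0) (at \<sigma>)" if "\<sigma> \<ge> 0" "t > 0" for \<sigma> t
    proof -
      define d where "d = min (y + \<sigma>) (t + \<sigma>)"
      have d: "d > 0" using y that by (simp add: d_def)
      have "((\<lambda>s. X (y + \<sigma> + s) (t + \<sigma> + s)) has_real_derivative (Fm v0 v1 (y + \<sigma>) - x (y + \<sigma>) (t + \<sigma>)) + x (y + \<sigma>) (t + \<sigma>)) (at 0)"
      proof (rule DERIV_diagonal[OF _ _ d])
        show "((\<lambda>y. X y (t + \<sigma>)) has_real_derivative Fm v0 v1 (y + \<sigma>) - x (y + \<sigma>) (t + \<sigma>)) (at (y + \<sigma>))"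
          by (rule X_y) (use y that in auto)
        show "(X y' has_real_derivative x y' t') (at t')" if "\<bar>y' - (y + \<sigma>)\<bar> < d" "\<bar>t' - (t + \<sigma>)\<bar> < d" for y' t'
          by (rule X_t) (use that in \<open>auto simp: d_def\<close>)
        have "continuous_on ({0<..} \<times> UNIV) (\<lambda>q. x (fst q) (snd q))"
          by (rule continuous_on_subset[OF xj[unfolded jointly_cont_def]]) auto
        then show "isCont (\<lambda>q. x (fst q) (snd q)) (y + \<sigma>, t + \<sigma>)"
          using y that by (subst (asm) continuous_on_eq_continuous_at) (auto intro!: open_Times)
      qed
      moreover have "((\<lambda>s. \<Psi> (y + \<sigma> + s)) has_real_derivative Fm v0 v1 (y + \<sigma> + 0) * 1) (at 0)"
        by (rule DERIV_chain2[OF \<Psi>]) (auto intro!: derivative_eq_intros)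
      ultimately have "((\<lambda>s. D t (s + \<sigma>)) has_real_derivative 0) (at 0)"
        unfolding D_def using DERIV_diff by (fastforce simp: add_ac)
      then show ?thesis using DERIV_shift[of "D t" 0 0 \<sigma>] by (simp add: add.commute)
    qed
    have Dc: "D t s = D t 0" if "t > 0" for t
    proof (rule constant_off_countable[where f = "D t", OF s _ countable_empty])
      show "continuous_on {0..s} (D t)" using D0 that by (auto intro!: continuous_at_imp_continuous_on DERIV_isCont)
      show "(D t has_real_derivative 0) (at \<sigma>)" if "0 < \<sigma>" for \<sigma> using D0 that \<open>t > 0\<close> by auto
    qed
    have eqn: "X (y + s) (t + s) = X y t + (\<Psi> (y + s) - \<Psi> y)" if "t > 0" for t using Dc[OF that] by (simp add: D_def)
    have 1: "((\<lambda>t. X (y + s) (t + s)) has_real_derivative x (y + s) (t + s) * 1) (at t)"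
      by (rule DERIV_chain2[OF X_t]) (use y t s in \<open>auto intro!: derivative_eq_intros\<close>)
    have "((\<lambda>t. X y t + (\<Psi> (y + s) - \<Psi> y)) has_real_derivative x y t + 0) (at t)"
      by (intro DERIV_add DERIV_const X_t) (use y t in auto)
    then have 2: "((\<lambda>t. X (y + s) (t + s)) has_real_derivative x y t + 0) (at t)"
      by (rule has_field_derivative_transform_within_open[of _ _ _ "{0<..}"]) (use eqn t in auto)
    from DERIV_unique[OF 1 2] show ?thesis by simp
  qed
  \<comment> \<open>Diagonals that start on an edge of the quadrant are limits of diagonals in the
    interior.\<close>
  have xinv: "x (y + s) (t + s) = x y t" if y: "y \<ge> 0" and t: "t \<ge> 0" and s: "s \<ge> 0" for y t s
  proof -
    have e: "(\<lambda>n. 1 / real (Suc n)) \<longlonglongrightarrow> 0" using LIMSEQ_inverse_real_of_nat by (simp add: inverse_eq_divide)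
    have "(\<lambda>n. x (y + s + 1 / real (Suc n)) (t + s + 1 / real (Suc n))) \<longlonglongrightarrow> x (y + s) (t + s)"
      by (rule jointly_contD[OF xj]) (use tendsto_add[OF tendsto_const e] y s in auto)
    moreover have "(\<lambda>n. x (y + 1 / real (Suc n)) (t + 1 / real (Suc n))) \<longlonglongrightarrow> x y t"
      by (rule jointly_contD[OF xj]) (use tendsto_add[OF tendsto_const e] y in auto)
    moreover have "x (y + s + 1 / real (Suc n)) (t + s + 1 / real (Suc n)) = x (y + 1 / real (Suc n)) (t + 1 / real (Suc n))" for n
    proof -
      have "0 < y + 1 / real (Suc n)" "0 < t + 1 / real (Suc n)" using y t by (auto intro: add_nonneg_pos)
      from xint[OF this s] show ?thesis by (simp add: add_ac)
    qed
    ultimately show ?thesis using LIMSEQ_unique by auto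
  qed
  have t: "t \<ge> 0" using False by simp
  note wyt = w[OF y t]
  have xyt: "x y t = p y t + (K2 r y t - cl y * r y t) - \<beta> v0 y" using t by (simp add: x_def)
  have Fpm: "Fp v0 v1 y - Fm v0 v1 y = 2 * \<beta> v0 y" using y by (simp add: Fp_def Fm_def)
  \<comment> \<open>The diagonal through \<open>(y, t)\<close> is followed back to the initial line
    if \<open>t \<le> y\<close>, and otherwise to the boundary, where the left invariant at
    \<open>y = 0\<close> eliminates \<open>r\<close> in favour of the trace.\<close>
  show ?thesis
  proof (cases "t \<le> y")
    case True
    have "x y t = x (y - t) 0" using xinv[of "y - t" 0 t] True t by simp
    also have "\<dots> = Fm v0 v1 (y - t)"
      using True p0[of "y - t"] K2_nonpos[OF r(1), of 0] cauc_nonpos[OF r(1), of "y - t" 0] by (simp add: x_def Fm_def)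
    finally have "x y t = Fm v0 v1 (y - t)" .
    moreover have "p 0 (max 0 (t - y)) = v1 0" "K1 r 0 (t - y) = 0" "Fp v0 v1 (max 0 t - max 0 y) = Fp v0 v1 0"
      using True p0[of 0] K1_nonpos[OF r(1) order_refl, of "t - y"] t y by (auto simp: max_def Fp_def)
    ultimately show ?thesis using wyt xyt Fpm t y by (simp add: Hf_def algebra_simps)
  next
    case False
    have "x y t = x 0 (t - y)" using xinv[of 0 "t - y" y] False y by simp
    also have "\<dots> = 2 * p 0 (t - y) - Fp v0 v1 (t - y) + K1 r 0 (t - y)"
      using False w[of 0 "t - y"] by (simp add: x_def K2_0 cl_0)
    finally have "x y t = 2 * p 0 (t - y) - Fp v0 v1 (t - y) + K1 r 0 (t - y)" .
    moreover have "Fm v0 v1 (y - t) = 2 * v1 0 - Fp v0 v1 0" using False by (simp add: Fm_def Fp_def max_def)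
    ultimately show ?thesis using wyt xyt Fpm t y False by (simp add: Hf_def algebra_simps)
  qed
qed

end

section \<open>The travel time coordinate\<close>

text \<open>The difference quotients are bounded by \<open>L\<close> and converge off a countable
  set. Their integrals are difference quotients of a primitive of \<open>H\<close> and converge to
  increments of \<open>H\<close>, so dominated convergence gives the fundamental theorem. It will
  supply the absolutely continuous part of the speed.\<close>

lemma lipschitz_fundamental_theorem:
  fixes G :: "real \<Rightarrow> real"
  assumes lip: "\<And>a b. 0 \<le> a \<Longrightarrow> a \<le> b \<Longrightarrow> \<bar>G b - G a\<bar> \<le> L * (b - a)" and L: "L \<ge> 0" and S: "countable S"
    and der: "\<And>y. y > 0 \<Longrightarrow> y \<notin> S \<Longrightarrow> \<exists>D. (G has_real_derivative D) (at y)"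
  shows "\<exists>m. m \<in> borel_measurable borel \<and> (\<forall>y. \<bar>m y\<bar> \<le> L) \<and>
    (\<forall>a b. 0 \<le> a \<longrightarrow> a \<le> b \<longrightarrow> (LINT z|lborel. (if a < z \<and> z \<le> b then m z else 0)) = G b - G a)"
proof -
  define H where "H y = G (max 0 y)" for y
  have Hlip: "\<bar>H b - H a\<bar> \<le> L * \<bar>b - a\<bar>" for a b
  proof -
    have *: "\<bar>H b - H a\<bar> \<le> L * (b - a)" if "a \<le> b" for a b
    proof -
      have "\<bar>H b - H a\<bar> \<le> L * (max 0 b - max 0 a)" unfolding H_def by (rule lip) (use that in auto)
      also have "\<dots> \<le> L * (b - a)" by (rule mult_left_mono[OF _ L]) (use that in auto)
      finally show ?thesis .
    qed
    show ?thesis using *[of a b] *[of b a] by (cases "a \<le> b") (auto simp: abs_minus_commute)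
  qed
  have Hc: "continuous_on UNIV H"
    by (rule lipschitz_on_continuous_on[of L], rule lipschitz_onI) (use Hlip L in \<open>auto simp: dist_real_def abs_minus_commute\<close>)
  obtain K where "\<forall>x. (K has_real_derivative H x) (at x)" using antiderivative_exists[OF Hc] by blast
  then have K: "(K has_real_derivative H x) (at x)" for x by blast
  define h where "h n = 1 / real (Suc n)" for n
  have h0: "h n > 0" for n by (simp add: h_def)
  have hl: "h \<longlonglongrightarrow> 0" unfolding h_def using LIMSEQ_inverse_real_of_nat by (simp add: inverse_eq_divide)
  define q where "q n y = (H (y + h n) - H y) / h n" for n y
  have qb: "\<bar>q n y\<bar> \<le> L" for n y
    using Hlip[of "y + h n" y] h0[of n] by (simp add: q_def abs_divide divide_le_eq)
  have qc: "continuous_on T (q n)" for n T unfolding q_def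
    using h0[of n] by (intro continuous_intros continuous_on_compose2[OF Hc]) auto
  define S' where "S' = S \<union> {..0}"
  define m where "m y = lim (\<lambda>n. if y \<in> S' then 0 else q n y)" for y
  have lim: "(\<lambda>n. if y \<in> S' then 0 else q n y) \<longlonglongrightarrow> m y" for y
  proof (cases "y \<in> S'")
    case True then show ?thesis by (simp add: m_def)
  next
    case False
    then have y: "y > 0" "y \<notin> S" by (auto simp: S'_def)
    obtain D where D: "(G has_real_derivative D) (at y)" using der[OF y] by blast
    have "(H has_real_derivative D) (at y)"
      by (rule has_field_derivative_transform_within_open[OF D, of "{0<..}"]) (use y in \<open>auto simp: H_def\<close>)
    then have "((\<lambda>e. (H (y + e) - H y) / e) \<longlongrightarrow> D) (at 0)" unfolding DERIV_def .
    then have "(\<lambda>n. q n y) \<longlonglongrightarrow> D" unfolding q_def LIMSEQ_SEQ_conv[symmetric] using hl h0 by (metis less_numeral_extra(3))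
    then have "(\<lambda>n. if y \<in> S' then 0 else q n y) \<longlonglongrightarrow> D" using False by simp
    then show ?thesis unfolding m_def by (simp add: limI)
  qed
  have S'b[measurable]: "S' \<in> sets borel"
    unfolding S'_def using sets.countable[OF _ S, of borel] by auto
  have [measurable]: "q n \<in> borel_measurable borel" for n by (rule borel_measurable_continuous_onI[OF qc])
  have mm[measurable]: "m \<in> borel_measurable borel"
    by (rule borel_measurable_LIMSEQ_real[OF lim]) measurable
  have mb: "\<bar>m y\<bar> \<le> L" for y
    by (rule LIMSEQ_le_const2[OF tendsto_rabs[OF lim]]) (use qb L in auto)
  have ftc: "(LINT z|lborel. (if a < z \<and> z \<le> b then m z else 0)) = G b - G a" if ab: "0 \<le> a" "a \<le> b" for a b
  proof -
    have nS: "AE z in lborel. z \<notin> S \<union> {a}"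
      using countable_imp_null_set_lborel[of "S \<union> {a}"] S by (intro AE_not_in) auto
    have q_int: "(LINT z|lborel. q n z * indicator {a..b} z) = (K (b + h n) - K b) / h n - (K (a + h n) - K a) / h n" for n
    proof (rule has_bochner_integral_integral_eq, rule has_bochner_integral_FTC_Icc_real[OF ab(2)])
      fix x
      have "((\<lambda>y. K (y + h n)) has_real_derivative H (x + h n) * 1) (at x)"
        by (rule DERIV_chain2[OF K]) (auto intro!: derivative_eq_intros)
      from DERIV_cdivide[OF DERIV_diff[OF this K[of x]], of "h n"]
      show "((\<lambda>y. (K (y + h n) - K y) / h n) has_real_derivative q n x) (at x)" by (simp add: q_def)
      show "isCont (q n) x" using qc[of UNIV n] unfolding continuous_on_eq_continuous_at[OF open_UNIV] by blast
    qed
    have "(\<lambda>n. (LINT z|lborel. q n z * indicator {a..b} z)) \<longlonglongrightarrow> (LINT z|lborel. (if a < z \<and> z \<le> b then m z else 0))"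
    proof (rule integral_dominated_convergence[where w = "\<lambda>z. L * indicator {a..b} z"])
      show "integrable lborel (\<lambda>z. L * indicator {a..b} z)"
        by (intro integrable_mult_right integrable_real_indicator emeasure_bounded_finite) auto
      show "AE z in lborel. (\<lambda>n. q n z * indicator {a..b} z) \<longlonglongrightarrow> (if a < z \<and> z \<le> b then m z else 0)"
        using nS
      proof eventually_elim
        case (elim z)
        show ?case
        proof (cases "a < z \<and> z \<le> b")
          case True
          then have "z \<notin> S'" using elim ab by (auto simp: S'_def)
          then show ?thesis using lim[of z] True by simp
        next
          case False
          then show ?thesis using elim by (auto simp: indicator_def)
        qed
      qed
      show "AE z in lborel. norm (q n z * indicator {a..b} z) \<le> L * indicator {a..b} z" for n
        using qb by (auto simp: indicator_def)
      show "(\<lambda>z. if a < z \<and> z \<le> b then m z else 0) \<in> borel_measurable lborel" by measurable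
      show "(\<lambda>z. q n z * indicator {a..b} z) \<in> borel_measurable lborel" for n by measurable
    qed
    moreover have "(\<lambda>n. (K (x + h n) - K x) / h n) \<longlonglongrightarrow> H x" for x
      using K[of x] hl h0 unfolding DERIV_def LIMSEQ_SEQ_conv[symmetric] by (metis less_numeral_extra(3))
    then have "(\<lambda>n. (LINT z|lborel. q n z * indicator {a..b} z)) \<longlonglongrightarrow> H b - H a"
      unfolding q_int by (intro tendsto_diff)
    ultimately have "(LINT z|lborel. (if a < z \<and> z \<le> b then m z else 0)) = H b - H a" using LIMSEQ_unique by blast
    then show ?thesis using ab by (simp add: H_def)
  qed
  show ?thesis using mm mb ftc by blast
qed

text \<open>The rate of approach is part of the claim, since later estimates across a jump start
  from the one-sided limit.\<close>

lemma lipschitz_right_limit: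
  fixes f :: "real \<Rightarrow> real"
  assumes ab: "a < b" and lip: "\<And>x y. a < x \<Longrightarrow> x \<le> y \<Longrightarrow> y < b \<Longrightarrow> \<bar>f y - f x\<bar> \<le> L * (y - x)" and L: "L \<ge> 0"
  shows "\<exists>l. \<forall>x. a < x \<longrightarrow> x < b \<longrightarrow> \<bar>f x - l\<bar> \<le> L * (x - a)"
proof -
  define x where "x n = a + (b - a) / real (Suc (Suc n))" for n
  have xn: "a < x n" "x n < b" for n
  proof -
    show "a < x n" using ab by (simp add: x_def)
    have "(b - a) / real (Suc (Suc n)) < (b - a) / 1" using ab by (intro divide_strict_left_mono) auto
    then show "x n < b" by (simp add: x_def)
  qed
  have "(\<lambda>n. inverse (real (Suc n))) \<longlonglongrightarrow> 0" by (rule LIMSEQ_inverse_real_of_nat)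
  then have "(\<lambda>n. inverse (real (Suc (Suc n)))) \<longlonglongrightarrow> 0" by (rule LIMSEQ_Suc)
  then have "(\<lambda>n. a + (b - a) * inverse (real (Suc (Suc n)))) \<longlonglongrightarrow> a + (b - a) * 0" by (intro tendsto_intros)
  then have xl: "x \<longlonglongrightarrow> a" by (simp add: x_def[abs_def] divide_inverse)
  have lip2: "\<bar>f u - f v\<bar> \<le> L * \<bar>u - v\<bar>" if "a < u" "u < b" "a < v" "v < b" for u v
    using lip[of u v] lip[of v u] that by (cases "u \<le> v") (auto simp: abs_minus_commute)
  have "Cauchy (\<lambda>n. f (x n))"
  proof (rule metric_CauchyI)
    fix e :: real assume e: "e > 0"
    have "Cauchy x" using xl by (rule LIMSEQ_imp_Cauchy)
    then obtain M where M: "\<And>m n. m \<ge> M \<Longrightarrow> n \<ge> M \<Longrightarrow> dist (x m) (x n) < e / (L + 1)"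
      using e L unfolding Cauchy_def by (metis add_nonneg_pos divide_pos_pos zero_less_one)
    show "\<exists>M. \<forall>m\<ge>M. \<forall>n\<ge>M. dist (f (x m)) (f (x n)) < e"
    proof (intro exI[of _ M] allI impI)
      fix m n assume mn: "m \<ge> M" "n \<ge> M"
      have "\<bar>f (x m) - f (x n)\<bar> \<le> L * \<bar>x m - x n\<bar>" by (rule lip2) (rule xn)+
      also have "\<dots> \<le> L * (e / (L + 1))" using M[OF mn] L by (intro mult_left_mono) (auto simp: dist_real_def)
      also have "\<dots> < e" using e L by (simp add: field_simps)
      finally show "dist (f (x m)) (f (x n)) < e" by (simp add: dist_real_def)
    qed
  qed
  then obtain l where l: "(\<lambda>n. f (x n)) \<longlonglongrightarrow> l" using Cauchy_convergent_iff convergent_def by blast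
  have "\<bar>f y - l\<bar> \<le> L * (y - a)" if y: "a < y" "y < b" for y
  proof -
    have "(\<lambda>n. L * \<bar>y - x n\<bar> - \<bar>f y - f (x n)\<bar>) \<longlonglongrightarrow> L * \<bar>y - a\<bar> - \<bar>f y - l\<bar>"
      by (intro tendsto_intros l xl)
    then have "0 \<le> L * \<bar>y - a\<bar> - \<bar>f y - l\<bar>"
      by (rule LIMSEQ_le_const) (use lip2[OF y xn] in auto)
    then show ?thesis using y by simp
  qed
  then show ?thesis by blast
qed

text \<open>An abstract speed: \<open>Dd\<close> contains its jumps, \<open>E\<close> is a countable
  set off which it is differentiable with bounded derivative. The bounds are stated off these sets
  because those on \<open>V\<close> hold almost everywhere and say nothing about isolated points.
  Since 0 takes part in the separation, other jumps also keep the distance \<delta> from the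
  boundary.\<close>

locale profile =
  fixes s :: "real \<Rightarrow> real" and Dd E :: "real set" and cm cM Ls \<delta> :: real
  assumes Dd_sub: "Dd \<subseteq> {0..}" and sep: "\<And>a b. a \<in> insert 0 Dd \<Longrightarrow> b \<in> insert 0 Dd \<Longrightarrow> a \<noteq> b \<Longrightarrow> \<delta> \<le> \<bar>a - b\<bar>" and \<delta>: "\<delta> > 0"
    and E: "countable E" "Dd \<subseteq> E"
    and s_cont: "\<And>x. x \<ge> 0 \<Longrightarrow> x \<notin> Dd \<Longrightarrow> continuous (at x within {0..}) s"
    and s_bound: "\<And>x. x \<ge> 0 \<Longrightarrow> x \<notin> Dd \<Longrightarrow> cm \<le> s x \<and> s x \<le> cM" and cm: "cm > 0"
    and s_deriv: "\<And>x. x \<ge> 0 \<Longrightarrow> x \<notin> E \<Longrightarrow> \<exists>D. (s has_real_derivative D) (at x within {0..}) \<and> \<bar>D\<bar> \<le> Ls"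
    and Ls: "Ls \<ge> 0"
begin

text \<open>Points that are \<delta> apart have different integer parts after division by
  \<delta>.\<close>

lemma Dd_finite: "finite (Dd \<inter> {..R})"
proof (rule finite_imageD)
  show "inj_on (\<lambda>x. \<lfloor>x / \<delta>\<rfloor>) (Dd \<inter> {..R})"
  proof (rule inj_onI)
    fix a b assume ab: "a \<in> Dd \<inter> {..R}" "b \<in> Dd \<inter> {..R}" "\<lfloor>a / \<delta>\<rfloor> = \<lfloor>b / \<delta>\<rfloor>"
    show "a = b"
    proof (rule ccontr)
      assume "a \<noteq> b"
      then have "\<delta> \<le> \<bar>a - b\<bar>" using sep[of a b] ab by auto
      then have "1 \<le> \<bar>a - b\<bar> / \<delta>" using \<delta> by simp
      also have "\<dots> = \<bar>a / \<delta> - b / \<delta>\<bar>" using \<delta> by (simp add: diff_divide_distrib[symmetric] abs_divide)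
      finally show False using ab(3) by linarith
    qed
  qed
  have "(\<lambda>x. \<lfloor>x / \<delta>\<rfloor>) ` (Dd \<inter> {..R}) \<subseteq> {0..\<lfloor>R / \<delta>\<rfloor>}"
    using Dd_sub \<delta> by (auto intro!: floor_mono divide_right_mono divide_nonneg_pos)
  then show "finite ((\<lambda>x. \<lfloor>x / \<delta>\<rfloor>) ` (Dd \<inter> {..R}))" by (rule finite_subset) simp
qed

lemma Dd_isolated: "\<exists>e>0. \<forall>a\<in>Dd. \<bar>a - x\<bar> < e \<longrightarrow> a = x"
proof -
  obtain e where e: "e > 0" "\<And>a. a \<in> Dd \<inter> {..x + 1} \<Longrightarrow> a \<noteq> x \<Longrightarrow> e \<le> dist x a"
    using finite_set_avoid[OF Dd_finite, of "x + 1" x] by blast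
  have "a = x" if "a \<in> Dd" "\<bar>a - x\<bar> < min e 1" for a
  proof (rule ccontr)
    assume "a \<noteq> x"
    moreover have "a \<le> x + 1" using that by (auto simp: abs_less_iff)
    ultimately show False using e(2)[of a] that by (auto simp: dist_real_def abs_minus_commute)
  qed
  then show ?thesis using e(1) by (intro exI[of _ "min e 1"]) auto
qed

lemma at_pos: "x > 0 \<Longrightarrow> at x within {0..} = at (x::real)"
  by (rule at_within_open_subset[of _ "{0<..}"]) auto

lemma s_lip:
  assumes "0 \<le> a" "a \<le> b" "{a..b} \<inter> Dd = {}"
  shows "\<bar>s b - s a\<bar> \<le> Ls * (b - a)"
proof -
  have c: "continuous_on {a..b} s" unfolding continuous_on_eq_continuous_within
    using assms by (intro ballI continuous_within_subset[OF s_cont]) auto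
  have d: "\<exists>D. (s has_real_derivative D) (at x) \<and> \<bar>D\<bar> \<le> Ls" if "a < x" "x \<notin> E" for x
    using s_deriv[of x] at_pos[of x] that assms by auto
  have "s b - s a \<le> Ls * (b - a)"
    by (rule increment_bound_off_countable[OF assms(2) c E(1)]) (use d in \<open>fastforce simp: abs_le_iff\<close>)
  moreover have "- s b - - s a \<le> Ls * (b - a)"
  proof (rule increment_bound_off_countable[where f = "\<lambda>x. - s x", OF assms(2) continuous_on_minus[OF c] E(1)])
    fix x assume "a < x" "x < b" "x \<notin> E"
    then obtain D where "(s has_real_derivative D) (at x)" "\<bar>D\<bar> \<le> Ls" using d by blast
    then show "\<exists>d. ((\<lambda>x. - s x) has_real_derivative d) (at x) \<and> d \<le> Ls"
      by (intro exI[of _ "- D"]) (auto intro: DERIV_minus)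
  qed
  ultimately show ?thesis by (simp add: abs_le_iff)
qed

text \<open>The right limit at a jump, selected together with its rate of approach
  \<open>Ls\<close>, and the speed itself elsewhere; \<open>sL\<close> is the analogue on the
  left.\<close>

definition sR :: "real \<Rightarrow> real" where
  "sR x = (if x \<in> Dd then SOME l. \<exists>e>0. \<forall>\<xi>. x < \<xi> \<longrightarrow> \<xi> < x + e \<longrightarrow> \<bar>s \<xi> - l\<bar> \<le> Ls * (\<xi> - x) else s x)"

definition sL :: "real \<Rightarrow> real" where
  "sL x = (if x \<in> Dd then SOME l. \<exists>e>0. \<forall>\<xi>. x - e < \<xi> \<longrightarrow> \<xi> < x \<longrightarrow> \<bar>s \<xi> - l\<bar> \<le> Ls * (x - \<xi>) else s x)"

lemma sR_lip:
  assumes x: "x \<ge> 0"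
  shows "\<exists>e>0. \<forall>\<xi>. x < \<xi> \<longrightarrow> \<xi> < x + e \<longrightarrow> \<bar>s \<xi> - sR x\<bar> \<le> Ls * (\<xi> - x) \<and> \<xi> \<notin> Dd"
proof -
  obtain e where e: "e > 0" "\<And>a. a \<in> Dd \<Longrightarrow> \<bar>a - x\<bar> < e \<Longrightarrow> a = x" using Dd_isolated by blast
  have nd: "\<xi> \<notin> Dd" if "x < \<xi>" "\<xi> < x + e" for \<xi> using e(2)[of \<xi>] that by auto
  show ?thesis
  proof (cases "x \<in> Dd")
    case True
    have "\<exists>l. \<forall>\<xi>. x < \<xi> \<longrightarrow> \<xi> < x + e \<longrightarrow> \<bar>s \<xi> - l\<bar> \<le> Ls * (\<xi> - x)"
      by (rule lipschitz_right_limit[OF _ s_lip Ls]) (use e(1) x nd in auto)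
    then have "\<exists>l. \<exists>e>0. \<forall>\<xi>. x < \<xi> \<longrightarrow> \<xi> < x + e \<longrightarrow> \<bar>s \<xi> - l\<bar> \<le> Ls * (\<xi> - x)" using e(1) by blast
    from someI_ex[OF this] obtain e' where e': "e' > 0" "\<forall>\<xi>. x < \<xi> \<longrightarrow> \<xi> < x + e' \<longrightarrow> \<bar>s \<xi> - sR x\<bar> \<le> Ls * (\<xi> - x)"
      using True by (auto simp: sR_def)
    then show ?thesis using e(1) nd by (intro exI[of _ "min e e'"]) auto
  next
    case False
    have "\<bar>s \<xi> - sR x\<bar> \<le> Ls * (\<xi> - x)" if "x < \<xi>" "\<xi> < x + e" for \<xi>
    proof -
      have "{x..\<xi>} \<inter> Dd = {}" using nd False that by (auto, metis less_eq_real_def order.strict_trans1)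
      then show ?thesis using s_lip[of x \<xi>] that x False by (simp add: sR_def)
    qed
    then show ?thesis using e(1) nd by (intro exI[of _ e]) auto
  qed
qed

lemma sL_lip:
  assumes x: "x > 0"
  shows "\<exists>e>0. e \<le> x \<and> (\<forall>\<xi>. x - e < \<xi> \<longrightarrow> \<xi> < x \<longrightarrow> \<bar>s \<xi> - sL x\<bar> \<le> Ls * (x - \<xi>) \<and> \<xi> \<notin> Dd)"
proof -
  obtain e' where e': "e' > 0" "\<And>a. a \<in> Dd \<Longrightarrow> \<bar>a - x\<bar> < e' \<Longrightarrow> a = x" using Dd_isolated by blast
  define e where "e = min e' x"
  have e: "e > 0" "e \<le> x" and e_le: "e \<le> e'" using e' x by (simp_all add: e_def)
  have nd: "\<xi> \<notin> Dd" if "x - e < \<xi>" "\<xi> < x" for \<xi> using e'(2)[of \<xi>] that e_le e(2) by (force simp: abs_less_iff)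
  show ?thesis
  proof (cases "x \<in> Dd")
    case True
    have "\<exists>l. \<forall>\<xi>. - x < \<xi> \<longrightarrow> \<xi> < - x + e \<longrightarrow> \<bar>s (- \<xi>) - l\<bar> \<le> Ls * (\<xi> - - x)"
    proof (rule lipschitz_right_limit[OF _ _ Ls])
      fix u v assume "- x < u" "u \<le> v" "v < - x + e"
      then show "\<bar>s (- v) - s (- u)\<bar> \<le> Ls * (v - u)"
        using s_lip[of "- v" "- u"] nd e by (simp add: abs_minus_commute disjoint_iff)
    qed (use e in simp)
    then obtain l where l: "\<And>\<xi>. - x < \<xi> \<Longrightarrow> \<xi> < - x + e \<Longrightarrow> \<bar>s (- \<xi>) - l\<bar> \<le> Ls * (\<xi> + x)" by auto
    have "\<bar>s \<xi> - l\<bar> \<le> Ls * (x - \<xi>)" if "x - e < \<xi>" "\<xi> < x" for \<xi> using l[of "- \<xi>"] that by (simp add: algebra_simps)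
    then have "\<exists>l. \<exists>e>0. \<forall>\<xi>. x - e < \<xi> \<longrightarrow> \<xi> < x \<longrightarrow> \<bar>s \<xi> - l\<bar> \<le> Ls * (x - \<xi>)" using e(1) by blast
    from someI_ex[OF this] obtain e'' where e'': "e'' > 0" "\<forall>\<xi>. x - e'' < \<xi> \<longrightarrow> \<xi> < x \<longrightarrow> \<bar>s \<xi> - sL x\<bar> \<le> Ls * (x - \<xi>)"
      using True by (auto simp: sL_def)
    then show ?thesis using e nd by (intro exI[of _ "min e e''"]) auto
  next
    case False
    have "\<bar>s \<xi> - sL x\<bar> \<le> Ls * (x - \<xi>)" if "x - e < \<xi>" "\<xi> < x" for \<xi>
    proof -
      have "{\<xi>..x} \<inter> Dd = {}" using nd False that by (auto, metis less_eq_real_def order.strict_trans2)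
      then show ?thesis using s_lip[of \<xi> x] that x e False by (simp add: sL_def abs_minus_commute)
    qed
    then show ?thesis using e nd by (intro exI[of _ e]) auto
  qed
qed

lemma cM_pos: "cM \<ge> cm" "cM > 0"
proof -
  obtain e where "e > 0" "\<forall>\<xi>. 0 < \<xi> \<longrightarrow> \<xi> < 0 + e \<longrightarrow> \<bar>s \<xi> - sR 0\<bar> \<le> Ls * (\<xi> - 0) \<and> \<xi> \<notin> Dd" using sR_lip[of 0] by auto
  then have "cm \<le> s (e / 2)" "s (e / 2) \<le> cM" using s_bound[of "e / 2"] by auto
  then show "cM \<ge> cm" "cM > 0" using cm by auto
qed

lemma sR_bound: assumes x: "x \<ge> 0" shows "cm \<le> sR x" "sR x \<le> cM"
proof -
  obtain e where e: "e > 0" "\<And>\<xi>. x < \<xi> \<Longrightarrow> \<xi> < x + e \<Longrightarrow> \<bar>s \<xi> - sR x\<bar> \<le> Ls * (\<xi> - x) \<and> \<xi> \<notin> Dd" using sR_lip[OF x] by blast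
  have "\<exists>\<xi>\<ge>0. \<xi> \<notin> Dd \<and> \<bar>s \<xi> - sR x\<bar> \<le> \<eta>" if "\<eta> > 0" for \<eta>
  proof -
    define d where "d = min (e / 2) (\<eta> / (Ls + 1))"
    have d: "d > 0" "d < e" using e(1) that Ls by (auto simp: d_def)
    have "Ls * d \<le> Ls * (\<eta> / (Ls + 1))" by (rule mult_left_mono[OF _ Ls]) (simp add: d_def)
    also have "\<dots> \<le> \<eta>" using that Ls by (simp add: field_simps)
    finally have "Ls * d \<le> \<eta>" .
    then show ?thesis using e(2)[of "x + d"] d x by (intro exI[of _ "x + d"]) auto
  qed
  then have *: "\<exists>v. cm \<le> v \<and> v \<le> cM \<and> \<bar>v - sR x\<bar> \<le> \<eta>" if "\<eta> > 0" for \<eta> using s_bound that by blast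
  show "cm \<le> sR x" by (rule field_le_epsilon) (use * in force)
  show "sR x \<le> cM" by (rule field_le_epsilon) (use * in force)
qed

lemma sL_bound: assumes x: "x > 0" shows "cm \<le> sL x" "sL x \<le> cM"
proof -
  obtain e where e: "e > 0" "e \<le> x" "\<And>\<xi>. x - e < \<xi> \<Longrightarrow> \<xi> < x \<Longrightarrow> \<bar>s \<xi> - sL x\<bar> \<le> Ls * (x - \<xi>) \<and> \<xi> \<notin> Dd" using sL_lip[OF x] by blast
  have "\<exists>\<xi>\<ge>0. \<xi> \<notin> Dd \<and> \<bar>s \<xi> - sL x\<bar> \<le> \<eta>" if "\<eta> > 0" for \<eta>
  proof -
    define d where "d = min (e / 2) (\<eta> / (Ls + 1))"
    have d: "d > 0" "d < e" using e(1) that Ls by (auto simp: d_def)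
    have "Ls * d \<le> Ls * (\<eta> / (Ls + 1))" by (rule mult_left_mono[OF _ Ls]) (simp add: d_def)
    also have "\<dots> \<le> \<eta>" using that Ls by (simp add: field_simps)
    finally have "Ls * d \<le> \<eta>" .
    then show ?thesis using e(2) e(3)[of "x - d"] d x by (intro exI[of _ "x - d"]) auto
  qed
  then have *: "\<exists>v. cm \<le> v \<and> v \<le> cM \<and> \<bar>v - sL x\<bar> \<le> \<eta>" if "\<eta> > 0" for \<eta> using s_bound that by blast
  show "cm \<le> sL x" by (rule field_le_epsilon) (use * in force)
  show "sL x \<le> cM" by (rule field_le_epsilon) (use * in force)
qed

text \<open>Travel time from the boundary; the values of \<open>s\<close> at the jumps carry no information.\<close>

definition \<rho> :: "real \<Rightarrow> real" where "\<rho> x = (if x < 0 \<or> x \<in> Dd then 1 / cm else 1 / s x)"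

definition \<kappa> :: "real \<Rightarrow> real" where "\<kappa> x = integral {0..x} \<rho>"

text \<open>The inverse of the travel time, continued by 0 to negative arguments so that
  compositions with it are continuous on the whole line.\<close>

definition \<zeta> :: "real \<Rightarrow> real" where "\<zeta> y = inv_into {0..} \<kappa> (max 0 y)"

lemma \<rho>_bound: "1 / cM \<le> \<rho> x" "\<rho> x \<le> 1 / cm"
  using s_bound[of x] cm cM_pos by (auto simp: \<rho>_def not_less intro!: divide_left_mono)

lemma Dd_open: "open ({0<..} - Dd)"
proof (rule openI)
  fix x assume x: "x \<in> {0<..} - Dd"
  obtain e where e: "e > 0" "\<And>a. a \<in> Dd \<Longrightarrow> \<bar>a - x\<bar> < e \<Longrightarrow> a = x" using Dd_isolated by blast
  show "\<exists>T>0. ball x T \<subseteq> {0<..} - Dd"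
  proof (intro exI[of _ "min e x"] conjI subsetI)
    fix z assume "z \<in> ball x (min e x)"
    then have z: "\<bar>z - x\<bar> < e" "\<bar>z - x\<bar> < x" by (auto simp: dist_real_def abs_minus_commute)
    then show "z \<in> {0<..} - Dd" using e(2)[of z] x by (auto simp: abs_less_iff)
  qed (use e x in auto)
qed

lemma \<rho>_meas: "\<rho> \<in> borel_measurable borel"
proof (rule borel_measurable_continuous_countable_exceptions)
  show "countable (insert 0 Dd)" using E countable_subset by auto
  have eq: "- insert 0 Dd = {..<0} \<union> ({0<..} - Dd)" using Dd_sub by auto
  have "continuous_on {..<0} \<rho>" by (rule continuous_on_eq[OF continuous_on_const[of _ "1 / cm"]]) (auto simp: \<rho>_def)
  moreover have "continuous_on ({0<..} - Dd) \<rho>"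
  proof -
    have "continuous_on ({0<..} - Dd) s" unfolding continuous_on_eq_continuous_within
      by (intro ballI continuous_within_subset[OF s_cont]) auto
    moreover have "s x \<noteq> 0" if "x \<in> {0<..} - Dd" for x using s_bound[of x] cm that by auto
    ultimately have "continuous_on ({0<..} - Dd) (\<lambda>x. 1 / s x)"
      by (intro continuous_intros) auto
    then show ?thesis by (rule continuous_on_eq) (auto simp: \<rho>_def)
  qed
  ultimately show "continuous_on (- insert 0 Dd) \<rho>" unfolding eq
    by (intro continuous_on_open_Un Dd_open) auto
qed

lemma \<rho>_int: "\<rho> integrable_on {a..b}"
proof -
  have "integrable lborel (\<lambda>z. (1 / cm) * indicator {a..b} z)"
    by (intro integrable_mult_right integrable_real_indicator emeasure_bounded_finite) auto
  then have "set_integrable lborel {a..b} \<rho>" unfolding set_integrable_def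
  proof (rule Bochner_Integration.integrable_bound)
    show "(\<lambda>x. indicator {a..b} x *\<^sub>R \<rho> x) \<in> borel_measurable lborel" using \<rho>_meas by measurable
    have "0 \<le> \<rho> x" for x using \<rho>_bound(1)[of x] cM_pos by (meson divide_nonneg_pos order_trans zero_le_one)
    then show "AE x in lborel. norm (indicator {a..b} x *\<^sub>R \<rho> x) \<le> norm ((1 / cm) * indicator {a..b} x)"
      using \<rho>_bound(2) cm by (auto simp: indicator_def)
  qed
  then show ?thesis by (rule set_borel_integral_eq_integral(1))
qed

lemma \<kappa>_diff: assumes "0 \<le> a" "a \<le> b" shows "(b - a) / cM \<le> \<kappa> b - \<kappa> a" "\<kappa> b - \<kappa> a \<le> (b - a) / cm"
proof -
  have eq: "\<kappa> b - \<kappa> a = integral {a..b} \<rho>"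
    using Henstock_Kurzweil_Integration.integral_combine[of 0 a b \<rho>] assms \<rho>_int by (simp add: \<kappa>_def)
  have 1: "((\<lambda>_. 1 / cM) has_integral (1 / cM) * (b - a)) {a..b}" "((\<lambda>_. 1 / cm) has_integral (1 / cm) * (b - a)) {a..b}"
    using has_integral_const_real[of "1 / cM" a b] has_integral_const_real[of "1 / cm" a b] assms by (simp_all add: mult.commute)
  have "(1 / cM) * (b - a) \<le> integral {a..b} \<rho>" "integral {a..b} \<rho> \<le> (1 / cm) * (b - a)"
    using has_integral_le[OF 1(1) integrable_integral[OF \<rho>_int]] has_integral_le[OF integrable_integral[OF \<rho>_int] 1(2)] \<rho>_bound by auto
  then show "(b - a) / cM \<le> \<kappa> b - \<kappa> a" "\<kappa> b - \<kappa> a \<le> (b - a) / cm" unfolding eq by auto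
qed

lemma \<kappa>_0: "\<kappa> 0 = 0" by (simp add: \<kappa>_def)

lemma \<kappa>_less: assumes "0 \<le> a" "a < b" shows "\<kappa> a < \<kappa> b"
proof -
  have "0 < (b - a) / cM" using assms cM_pos by simp
  then show ?thesis using \<kappa>_diff(1)[of a b] assms by linarith
qed

lemma \<kappa>_nonneg: "x \<ge> 0 \<Longrightarrow> \<kappa> x \<ge> 0"
  using \<kappa>_less[of 0 x] \<kappa>_0 by (cases "x = 0") auto

lemma \<kappa>_inj: "inj_on \<kappa> {0..}"
  by (rule inj_onI) (metis \<kappa>_less atLeast_iff less_irrefl linorder_less_linear)

lemma \<kappa>_cont: "continuous_on {0..} \<kappa>"
proof (rule lipschitz_on_continuous_on[of "1 / cm"], rule lipschitz_onI)
  fix x y :: real assume "x \<in> {0..}" "y \<in> {0..}"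
  then show "dist (\<kappa> x) (\<kappa> y) \<le> 1 / cm * dist x y"
    using \<kappa>_diff[of x y] \<kappa>_diff[of y x] \<kappa>_less[of x y] \<kappa>_less[of y x]
    by (cases x y rule: linorder_cases) (auto simp: dist_real_def)
qed (use cm in simp)

lemma \<kappa>_surj: assumes "y \<ge> 0" shows "y \<in> \<kappa> ` {0..}"
proof -
  have X: "cM * y \<ge> 0" using assms cM_pos by simp
  have "y \<le> \<kappa> (cM * y)" using \<kappa>_diff(1)[OF order_refl X] \<kappa>_0 cM_pos by simp
  then have "\<exists>x\<ge>0. x \<le> cM * y \<and> \<kappa> x = y"
    using assms X \<kappa>_0 by (intro IVT') (auto intro: continuous_on_subset[OF \<kappa>_cont])
  then show ?thesis by auto
qed

lemma \<zeta>_nonneg: "\<zeta> y \<ge> 0"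
  using inv_into_into[OF \<kappa>_surj[of "max 0 y"]] by (simp add: \<zeta>_def)

lemma \<kappa>_\<zeta>: "y \<ge> 0 \<Longrightarrow> \<kappa> (\<zeta> y) = y"
  using f_inv_into_f[OF \<kappa>_surj[of y]] by (simp add: \<zeta>_def)

lemma \<zeta>_\<kappa>: "x \<ge> 0 \<Longrightarrow> \<zeta> (\<kappa> x) = x"
  using inv_into_f_f[OF \<kappa>_inj, of x] \<kappa>_nonneg[of x] by (simp add: \<zeta>_def)

lemma \<zeta>_max: "\<zeta> y = \<zeta> (max 0 y)" by (simp add: \<zeta>_def)

lemma \<zeta>_0: "\<zeta> 0 = 0" using \<zeta>_\<kappa>[of 0] \<kappa>_0 by simp

lemma \<zeta>_less: assumes "0 \<le> a" "a < b" shows "\<zeta> a < \<zeta> b"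
proof (rule ccontr)
  assume "\<not> \<zeta> a < \<zeta> b"
  then have "\<kappa> (\<zeta> b) \<le> \<kappa> (\<zeta> a)" using \<kappa>_less[OF \<zeta>_nonneg, of b "\<zeta> a"] by (cases "\<zeta> a = \<zeta> b") auto
  then show False using assms \<kappa>_\<zeta> by simp
qed

lemma \<zeta>_lip: assumes "0 \<le> a" "a \<le> b" shows "0 \<le> \<zeta> b - \<zeta> a" "\<zeta> b - \<zeta> a \<le> cM * (b - a)"
proof -
  have le: "\<zeta> a \<le> \<zeta> b" using \<zeta>_less[of a b] assms by (cases "a = b") auto
  then show "0 \<le> \<zeta> b - \<zeta> a" by simp
  have "(\<zeta> b - \<zeta> a) / cM \<le> b - a" using \<kappa>_diff(1)[OF \<zeta>_nonneg le] \<kappa>_\<zeta> assms by simp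
  then show "\<zeta> b - \<zeta> a \<le> cM * (b - a)" using cM_pos by (simp add: divide_le_eq mult.commute)
qed

lemma \<zeta>_cont: "continuous_on S \<zeta>"
proof -
  have l: "\<bar>\<zeta> a - \<zeta> b\<bar> \<le> cM * \<bar>a - b\<bar>" if "0 \<le> a" "0 \<le> b" for a b
    using \<zeta>_lip[of a b] \<zeta>_lip[of b a] that by (cases "a \<le> b") (auto simp: abs_minus_commute)
  have "continuous_on {0..} \<zeta>"
    by (rule lipschitz_on_continuous_on[of cM], rule lipschitz_onI) (use l cM_pos in \<open>auto simp: dist_real_def\<close>)
  then have "continuous_on S (\<lambda>y. \<zeta> (max 0 y))" by (rule continuous_on_compose2) (auto intro!: continuous_intros)
  then show ?thesis using \<zeta>_max by (simp flip: \<zeta>_max)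
qed

lemma \<kappa>_deriv: assumes x: "x \<ge> 0" "x \<notin> Dd" shows "(\<kappa> has_real_derivative 1 / s x) (at x within {0..})"
proof -
  obtain e where e: "e > 0" "\<And>a. a \<in> Dd \<Longrightarrow> \<bar>a - x\<bar> < e \<Longrightarrow> a = x" using Dd_isolated by blast
  have c: "continuous (at x within {0..}) \<rho>"
  proof (rule continuous_transform_within)
    show "continuous (at x within {0..}) (\<lambda>x. 1 / s x)"
      using s_cont[OF x] s_bound[OF x] cm by (intro continuous_intros) auto
    show "e > 0" by (rule e)
    show "1 / s z = \<rho> z" if "z \<in> {0..}" "dist z x < e" for z
      using that e(2)[of z] x by (auto simp: \<rho>_def dist_real_def)
  qed (use x in simp)
  have "((\<lambda>u. integral {0..u} \<rho>) has_vector_derivative \<rho> x) (at x within {0..x + 1} - {})"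
    by (rule integral_has_vector_derivative_continuous_at[OF \<rho>_int]) (use x in \<open>auto intro: continuous_within_subset[OF c]\<close>)
  then have "(\<kappa> has_real_derivative 1 / s x) (at x within {0..x+1})"
    using x by (simp add: \<kappa>_def[abs_def] has_real_derivative_iff_has_vector_derivative \<rho>_def)
  moreover have "at x within {0..x+1} = at x within {0..}"
    by (rule at_within_nhd[of _ "{x-1<..<x+1}"]) auto
  ultimately show ?thesis by simp
qed

lemma \<zeta>_deriv: assumes y: "y \<ge> 0" "\<zeta> y \<notin> Dd" shows "(\<zeta> has_real_derivative s (\<zeta> y)) (at y within {0..})"
proof -
  have "((\<lambda>\<xi>. (\<kappa> \<xi> - \<kappa> (\<zeta> y)) / (\<xi> - \<zeta> y)) \<longlongrightarrow> 1 / s (\<zeta> y)) (at (\<zeta> y) within {0..})"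
    using \<kappa>_deriv[OF \<zeta>_nonneg y(2)] by (simp add: has_field_derivative_iff)
  moreover have "filterlim \<zeta> (at (\<zeta> y) within {0..}) (at y within {0..})"
    unfolding filterlim_at
  proof
    show "(\<zeta> \<longlongrightarrow> \<zeta> y) (at y within {0..})" using \<zeta>_cont[of "{0..}"] y by (simp add: continuous_on_def)
    show "\<forall>\<^sub>F x in at y within {0..}. \<zeta> x \<in> {0..} \<and> \<zeta> x \<noteq> \<zeta> y"
      using y \<zeta>_nonneg \<kappa>_\<zeta> by (auto simp: eventually_at_filter intro!: always_eventually) metis
  qed
  ultimately have "((\<lambda>z. (\<kappa> (\<zeta> z) - \<kappa> (\<zeta> y)) / (\<zeta> z - \<zeta> y)) \<longlongrightarrow> 1 / s (\<zeta> y)) (at y within {0..})"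
    by (rule filterlim_compose)
  then have "((\<lambda>z. inverse ((\<kappa> (\<zeta> z) - \<kappa> (\<zeta> y)) / (\<zeta> z - \<zeta> y))) \<longlongrightarrow> inverse (1 / s (\<zeta> y))) (at y within {0..})"
    by (rule tendsto_inverse) (use s_bound[OF \<zeta>_nonneg y(2)] cm in auto)
  moreover have ev: "\<forall>\<^sub>F z in at y within {0..}. inverse ((\<kappa> (\<zeta> z) - \<kappa> (\<zeta> y)) / (\<zeta> z - \<zeta> y)) = (\<zeta> z - \<zeta> y) / (z - y)"
    using y \<kappa>_\<zeta> by (auto simp: eventually_at_filter)
  ultimately show ?thesis unfolding has_field_derivative_iff tendsto_cong[OF ev] by simp
qed

text \<open>A jump at the boundary point itself is dropped: there only the right limit of the speed
  is seen from inside the domain, and atoms are to be positive.\<close>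

definition A :: "real set" where "A = \<kappa> ` (Dd - {0})"

definition c :: "real \<Rightarrow> real" where "c y = sR (\<zeta> y)"

definition jj :: "real \<Rightarrow> real" where "jj y = sR (\<zeta> y) - sL (\<zeta> y)"

lemma A_iff:
  assumes y: "y \<ge> 0"
  shows "y \<in> A \<longleftrightarrow> \<zeta> y \<in> Dd \<and> y \<noteq> 0"
proof
  assume "y \<in> A"
  then obtain x where x: "y = \<kappa> x" "x \<in> Dd" "x \<noteq> 0" by (auto simp: A_def)
  then have "x > 0" using Dd_sub by force
  then show "\<zeta> y \<in> Dd \<and> y \<noteq> 0" using x \<kappa>_less[of 0 x] \<kappa>_0 \<zeta>_\<kappa>[of x] by auto
next
  assume *: "\<zeta> y \<in> Dd \<and> y \<noteq> 0"
  then have "\<zeta> y \<noteq> 0" using \<kappa>_\<zeta>[OF y] \<kappa>_0 by auto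
  then show "y \<in> A" unfolding A_def using * \<kappa>_\<zeta>[OF y] by (intro image_eqI[of _ _ "\<zeta> y"]) auto
qed

sublocale atoms A
proof
  show "A \<subseteq> {0<..}"
  proof
    fix y assume "y \<in> A"
    then obtain x where x: "y = \<kappa> x" "x \<in> Dd" "x \<noteq> 0" by (auto simp: A_def)
    then have "x > 0" using Dd_sub by force
    then show "y \<in> {0<..}" using x \<kappa>_less[of 0 x] \<kappa>_0 by simp
  qed
  show "finite (A \<inter> {0<..R})" for R
  proof (rule finite_subset)
    show "A \<inter> {0<..R} \<subseteq> \<kappa> ` (Dd \<inter> {..\<zeta> R})"
    proof
      fix y assume y: "y \<in> A \<inter> {0<..R}"
      then have "\<zeta> y \<in> Dd" "\<zeta> y \<le> \<zeta> R" using A_iff[of y] \<zeta>_lip(1)[of y R] by auto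
      then show "y \<in> \<kappa> ` (Dd \<inter> {..\<zeta> R})" using y \<kappa>_\<zeta>[of y] by (intro image_eqI[of _ _ "\<zeta> y"]) auto
    qed
    show "finite (\<kappa> ` (Dd \<inter> {..\<zeta> R}))" by (intro finite_imageI Dd_finite)
  qed
qed

text \<open>The speed with its jumps subtracted. It is Lipschitz, so its increments are Lebesgue
  integrals.\<close>

definition G :: "real \<Rightarrow> real" where "G y = c y - (\<Sum>a\<in>A \<inter> {0<..y}. jj a)"

lemma A_isolated: "\<exists>e>0. \<forall>a\<in>A. \<bar>a - y\<bar> < e \<longrightarrow> a = y"
proof -
  obtain e where e: "e > 0" "\<And>a. a \<in> A \<inter> {0<..y + 1} \<Longrightarrow> a \<noteq> y \<Longrightarrow> e \<le> dist y a"
    using finite_set_avoid[OF A_finite, of "y + 1" y] by blast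
  have "a = y" if "a \<in> A" "\<bar>a - y\<bar> < min e 1" for a
  proof (rule ccontr)
    assume "a \<noteq> y"
    moreover have "a \<le> y + 1" using that by (auto simp: abs_less_iff)
    ultimately show False using e(2)[of a] that A_pos by (auto simp: dist_real_def abs_minus_commute)
  qed
  then show ?thesis using e(1) by (intro exI[of _ "min e 1"]) auto
qed

lemma isCont_\<zeta>: "isCont \<zeta> y"
  using \<zeta>_cont[of UNIV] by (simp add: continuous_on_eq_continuous_at)

text \<open>On the right of \<open>y\<close> no atom is met and \<open>c\<close> starts from its
  right limit. On the left, the jump subtracted at \<open>y\<close> is exactly the difference of
  \<open>sR\<close> and \<open>sL\<close>, so the increment of \<open>G\<close> is measured from the
  left limit. The factor \<open>cM\<close> is the Lipschitz constant of \<zeta>. This local bound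
  serves to show that \<open>G\<close> is continuous at the atoms too.\<close>

lemma G_local:
  assumes y: "y \<ge> 0"
  shows "\<exists>e>0. \<forall>z\<ge>0. \<bar>z - y\<bar> < e \<longrightarrow> \<bar>G z - G y\<bar> \<le> Ls * cM * \<bar>z - y\<bar>"
proof -
  obtain e1 where e1: "e1 > 0" "\<And>a. a \<in> A \<Longrightarrow> \<bar>a - y\<bar> < e1 \<Longrightarrow> a = y" using A_isolated by blast
  obtain e2 where e2: "e2 > 0" "\<And>\<xi>. \<zeta> y < \<xi> \<Longrightarrow> \<xi> < \<zeta> y + e2 \<Longrightarrow> \<bar>s \<xi> - sR (\<zeta> y)\<bar> \<le> Ls * (\<xi> - \<zeta> y) \<and> \<xi> \<notin> Dd"
    using sR_lip[OF \<zeta>_nonneg] by blast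
  obtain e3 where e3: "e3 > 0" "\<And>\<xi>. y > 0 \<Longrightarrow> \<zeta> y - e3 < \<xi> \<Longrightarrow> \<xi> < \<zeta> y \<Longrightarrow> \<bar>s \<xi> - sL (\<zeta> y)\<bar> \<le> Ls * (\<zeta> y - \<xi>) \<and> \<xi> \<notin> Dd"
  proof (cases "y > 0")
    case True
    then have "\<zeta> y > 0" using \<zeta>_less[of 0 y] \<zeta>_0 by simp
    then show ?thesis using sL_lip[of "\<zeta> y"] that by blast
  next
    case False then show ?thesis using that[of 1] by simp
  qed
  obtain e4 where e4: "e4 > 0" "\<And>z. \<bar>z - y\<bar> < e4 \<Longrightarrow> \<bar>\<zeta> z - \<zeta> y\<bar> < min e2 e3"
  proof -
    have "0 < min e2 e3" using e2(1) e3(1) by simp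
    then have "\<exists>d>0. \<forall>x'. dist x' y < d \<longrightarrow> dist (\<zeta> x') (\<zeta> y) < min e2 e3"
      using isCont_\<zeta>[of y] unfolding continuous_at_eps_delta by blast
    then show thesis using that by (auto simp: dist_real_def)
  qed
  have "\<bar>G z - G y\<bar> \<le> Ls * cM * \<bar>z - y\<bar>" if z: "z \<ge> 0" "\<bar>z - y\<bar> < min e1 e4" for z
  proof -
    have cz: "\<bar>\<zeta> z - \<zeta> y\<bar> < e2" "\<bar>\<zeta> z - \<zeta> y\<bar> < e3" using e4(2)[of z] z by auto
    consider "z = y" | "z > y" | "z < y" by linarith
    then show ?thesis
    proof cases
      case 2
      have "\<zeta> y < \<zeta> z" using \<zeta>_less[OF y 2] .
      then have "\<bar>s (\<zeta> z) - sR (\<zeta> y)\<bar> \<le> Ls * (\<zeta> z - \<zeta> y) \<and> \<zeta> z \<notin> Dd" using e2(2)[of "\<zeta> z"] cz by auto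
      moreover have "A \<inter> {0<..z} = A \<inter> {0<..y}"
      proof -
        have "a \<le> y" if "a \<in> A" "a \<le> z" for a using e1(2)[of a] that z 2 by (cases "a \<le> y") auto
        then show ?thesis using 2 by auto
      qed
      moreover have "Ls * (\<zeta> z - \<zeta> y) \<le> Ls * (cM * (z - y))" by (rule mult_left_mono[OF _ Ls]) (use \<zeta>_lip(2)[OF y, of z] 2 in auto)
      ultimately show ?thesis using 2 by (simp add: G_def c_def sR_def[of "\<zeta> z"] mult.assoc)
    next
      case 3
      have y0: "y > 0" using 3 z by simp
      have "\<zeta> z < \<zeta> y" using \<zeta>_less[OF z(1) 3] .
      then have "\<bar>s (\<zeta> z) - sL (\<zeta> y)\<bar> \<le> Ls * (\<zeta> y - \<zeta> z) \<and> \<zeta> z \<notin> Dd" using e3(2)[of "\<zeta> z", OF y0] cz by auto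
      moreover have "Ls * (\<zeta> y - \<zeta> z) \<le> Ls * (cM * (y - z))" by (rule mult_left_mono[OF _ Ls]) (use \<zeta>_lip(2)[OF z(1), of y] 3 in auto)
      moreover have "G z - G y = s (\<zeta> z) - sL (\<zeta> y)" if "\<zeta> z \<notin> Dd"
      proof (cases "y \<in> A")
        case True
        have "A \<inter> {0<..y} = insert y (A \<inter> {0<..z})"
        proof -
          have key: "a = y \<or> a \<le> z" if "a \<in> A" "a \<le> y" for a
          proof (rule disjCI)
            assume "\<not> a \<le> z"
            then have "\<bar>a - y\<bar> < e1" using that z 3 by linarith
            then show "a = y" using e1(2) that(1) by blast
          qed
          show ?thesis
          proof (intro equalityI subsetI)
            show "a \<in> insert y (A \<inter> {0<..z})" if "a \<in> A \<inter> {0<..y}" for a using key[of a] that by auto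
            show "a \<in> A \<inter> {0<..y}" if "a \<in> insert y (A \<inter> {0<..z})" for a using 3 True y0 that by auto
          qed
        qed
        then have "(\<Sum>a\<in>A \<inter> {0<..y}. jj a) = jj y + (\<Sum>a\<in>A \<inter> {0<..z}. jj a)"
          using A_finite[of z] 3 by simp
        then show ?thesis using that by (simp add: G_def c_def jj_def sR_def[of "\<zeta> z"])
      next
        case False
        have "A \<inter> {0<..y} = A \<inter> {0<..z}"
        proof -
          have key: "a \<le> z" if "a \<in> A" "a \<le> y" for a
          proof (rule ccontr)
            assume "\<not> a \<le> z"
            then have "\<bar>a - y\<bar> < e1" using that z 3 by linarith
            then show False using e1(2) that(1) False by blast
          qed
          show ?thesis
          proof (intro equalityI subsetI)
            show "a \<in> A \<inter> {0<..z}" if "a \<in> A \<inter> {0<..y}" for a using key[of a] that by auto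
            show "a \<in> A \<inter> {0<..y}" if "a \<in> A \<inter> {0<..z}" for a using 3 that by auto
          qed
        qed
        moreover have "\<zeta> y \<notin> Dd" using A_iff[OF y] False y0 by auto
        ultimately show ?thesis using that by (simp add: G_def c_def sL_def sR_def)
      qed
      ultimately show ?thesis using 3 by (simp add: mult.assoc)
    qed simp
  qed
  then show ?thesis using e1(1) e4(1) by (intro exI[of _ "min e1 e4"]) auto
qed

lemma c_deriv:
  assumes y: "y \<ge> 0" "\<zeta> y \<notin> Dd" and D: "(s has_real_derivative D) (at (\<zeta> y) within {0..})"
  shows "(c has_real_derivative D * s (\<zeta> y)) (at y within {0..})"
proof -
  obtain e where e: "e > 0" "\<And>a. a \<in> Dd \<Longrightarrow> \<bar>a - \<zeta> y\<bar> < e \<Longrightarrow> a = \<zeta> y" using Dd_isolated by blast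
  obtain d where d: "d > 0" "\<And>z. \<bar>z - y\<bar> < d \<Longrightarrow> \<bar>\<zeta> z - \<zeta> y\<bar> < e"
  proof -
    have "\<exists>d>0. \<forall>x'. dist x' y < d \<longrightarrow> dist (\<zeta> x') (\<zeta> y) < e"
      using isCont_\<zeta>[of y] e(1) unfolding continuous_at_eps_delta by blast
    then show thesis using that by (auto simp: dist_real_def)
  qed
  have "((s \<circ> \<zeta>) has_real_derivative D * s (\<zeta> y)) (at y within {0..})"
    by (rule DERIV_image_chain[OF DERIV_subset[OF D] \<zeta>_deriv[OF y]]) (use \<zeta>_nonneg in auto)
  then show ?thesis
  proof (rule has_field_derivative_transform_within[OF _ d(1)])
    show "(s \<circ> \<zeta>) z = c z" if "z \<in> {0..}" "dist z y < d" for z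
      using d(2)[of z] e(2)[of "\<zeta> z"] that y(2) by (auto simp: c_def sR_def dist_real_def)
  qed (use y in simp)
qed

lemma G_deriv:
  assumes y: "y > 0" "y \<notin> \<kappa> ` E"
  shows "\<exists>D. (G has_real_derivative D) (at y) \<and> \<bar>D\<bar> \<le> Ls * cM"
proof -
  have "\<zeta> y \<notin> E" using y \<kappa>_\<zeta>[of y] by (metis imageI less_imp_le)
  then obtain D where D: "(s has_real_derivative D) (at (\<zeta> y) within {0..})" "\<bar>D\<bar> \<le> Ls" and nd: "\<zeta> y \<notin> Dd"
    using s_deriv[OF \<zeta>_nonneg] E by blast
  have "y \<notin> A" using A_iff[of y] nd y by auto
  then obtain e where e: "e > 0" "\<And>a. a \<in> A \<Longrightarrow> \<not> \<bar>a - y\<bar> < e" using A_isolated[of y] by blast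
  have "(c has_real_derivative D * s (\<zeta> y)) (at y)"
    using c_deriv[OF _ nd D(1)] at_pos[of y] y by simp
  then have "((\<lambda>z. c z - (\<Sum>a\<in>A \<inter> {0<..y}. jj a)) has_real_derivative D * s (\<zeta> y) - 0) (at y)"
    by (intro DERIV_diff DERIV_const)
  then have "(G has_real_derivative D * s (\<zeta> y) - 0) (at y)"
  proof (rule has_field_derivative_transform_within_open[of _ _ _ "{y-e<..<y+e}"])
    fix z assume z: "z \<in> {y-e<..<y+e}"
    have "A \<inter> {0<..y} = A \<inter> {0<..z}"
    proof -
      have "a \<le> y \<longleftrightarrow> a \<le> z" if "a \<in> A" for a using e(2)[OF that] z by auto
      then show ?thesis by auto
    qed
    then show "c z - (\<Sum>a\<in>A \<inter> {0<..y}. jj a) = G z" by (simp add: G_def)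
  qed (use e in auto)
  moreover have "\<bar>D * s (\<zeta> y) - 0\<bar> \<le> Ls * cM"
    using D(2) s_bound[OF \<zeta>_nonneg nd] cm by (auto simp: abs_mult intro!: mult_mono)
  ultimately show ?thesis by blast
qed

lemma G_lip: assumes ab: "0 \<le> a" "a \<le> b" shows "\<bar>G b - G a\<bar> \<le> Ls * cM * (b - a)"
proof -
  have cont: "continuous_on {0..} G" unfolding continuous_on_eq_continuous_within
  proof
    fix y assume y: "y \<in> {0::real..}"
    obtain e where e: "e > 0" "\<And>z. z \<ge> 0 \<Longrightarrow> \<bar>z - y\<bar> < e \<Longrightarrow> \<bar>G z - G y\<bar> \<le> Ls * cM * \<bar>z - y\<bar>"
      using G_local[of y] y by auto
    have "((\<lambda>z. G z - G y) \<longlongrightarrow> 0) (at y within {0..})"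
    proof (rule Lim_null_comparison)
      show "\<forall>\<^sub>F z in at y within {0..}. norm (G z - G y) \<le> Ls * cM * \<bar>z - y\<bar>"
        unfolding eventually_at using e by (intro exI[of _ e]) (auto simp: dist_real_def)
      show "((\<lambda>z. Ls * cM * \<bar>z - y\<bar>) \<longlongrightarrow> 0) (at y within {0..})" by (auto intro!: tendsto_eq_intros)
    qed
    then show "continuous (at y within {0..}) G" unfolding continuous_within using LIM_zero_iff by blast
  qed
  have c': "continuous_on {a..b} G" by (rule continuous_on_subset[OF cont]) (use ab in auto)
  have S: "countable (\<kappa> ` E)" using E by simp
  have "G b - G a \<le> Ls * cM * (b - a)"
  proof (rule increment_bound_off_countable[OF ab(2) c' S])
    fix x assume "a < x" "x < b" "x \<notin> \<kappa> ` E"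
    then obtain D where "(G has_real_derivative D) (at x)" "\<bar>D\<bar> \<le> Ls * cM" using G_deriv[of x] ab by auto
    then show "\<exists>d. (G has_real_derivative d) (at x) \<and> d \<le> Ls * cM" by (intro exI[of _ D]) auto
  qed
  moreover have "- G b - - G a \<le> Ls * cM * (b - a)"
  proof (rule increment_bound_off_countable[where f = "\<lambda>x. - G x", OF ab(2) continuous_on_minus[OF c'] S])
    fix x assume "a < x" "x < b" "x \<notin> \<kappa> ` E"
    then obtain D where "(G has_real_derivative D) (at x)" "\<bar>D\<bar> \<le> Ls * cM" using G_deriv[of x] ab by auto
    then show "\<exists>d. ((\<lambda>x. - G x) has_real_derivative d) (at x) \<and> d \<le> Ls * cM"
      by (intro exI[of _ "- D"]) (auto intro: DERIV_minus)
  qed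
  ultimately show ?thesis by (simp add: abs_le_iff)
qed

text \<open>\<open>J\<close> is the density of \<open>G\<close> off the atoms and the jump of the
  speed at an atom. Changing the density on a countable set leaves its Lebesgue integral unchanged,
  so both parts can be stored in one function.\<close>

lemma medium_exists: "\<exists>J L. medium A J c cm L"
proof -
  have L0: "Ls * cM \<ge> 0" using Ls cM_pos by simp
  obtain m where m[measurable]: "m \<in> borel_measurable borel" and mb: "\<And>y. \<bar>m y\<bar> \<le> Ls * cM"
    and ftc: "\<And>a b. 0 \<le> a \<Longrightarrow> a \<le> b \<Longrightarrow> (LINT z|lborel. (if a < z \<and> z \<le> b then m z else 0)) = G b - G a"
  proof -
    have "countable (\<kappa> ` E)" using E(1) by simp
    moreover have "\<exists>D. (G has_real_derivative D) (at y)" if "y > 0" "y \<notin> \<kappa> ` E" for y using G_deriv[OF that] by blast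
    ultimately show thesis using lipschitz_fundamental_theorem[OF G_lip L0, of "\<kappa> ` E"] that by blast
  qed
  define J where "J y = (if y \<in> A then jj y else m y)" for y
  have Jm: "J \<in> borel_measurable borel"
  proof -
    show ?thesis by (rule measurable_discrete_difference[OF m countable_A]) (auto simp: J_def)
  qed
  have jb: "\<bar>jj a\<bar> \<le> 2 * cM" if "a \<in> A" for a
  proof -
    have "\<zeta> a > 0" using that A_pos \<zeta>_less[of 0 a] \<zeta>_0 by auto
    then show ?thesis using sR_bound[OF \<zeta>_nonneg, of a] sL_bound[of "\<zeta> a"] cm by (auto simp: jj_def abs_le_iff)
  qed
  have Jb: "\<bar>J y\<bar> \<le> 2 * cM + Ls * cM" for y
  proof (cases "y \<in> A")
    case True then show ?thesis using jb[OF True] L0 by (simp add: J_def)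
  next
    case False then show ?thesis using mb[of y] cM_pos by (simp add: J_def)
  qed
  have "medium A J c cm (2 * cM + Ls * cM)"
  proof
    show "J \<in> borel_measurable borel" by (rule Jm)
    show "\<bar>J y\<bar> \<le> 2 * cM + Ls * cM" for y by (rule Jb)
    show "cm > 0" by (rule cm)
    show "cm \<le> c y" for y unfolding c_def by (rule sR_bound[OF \<zeta>_nonneg])
    show "cm \<le> c a - J a" if "a \<in> A" for a
    proof -
      have "\<zeta> a > 0" using that A_pos \<zeta>_less[of 0 a] \<zeta>_0 by auto
      then show ?thesis using sL_bound[of "\<zeta> a"] that by (simp add: c_def J_def jj_def)
    qed
    fix a b :: real assume ab: "0 \<le> a" "a \<le> b"
    have "(LINT z|N. (if a < z \<and> z \<le> b then J z else 0)) =
        (LINT z|lborel. (if a < z \<and> z \<le> b then J z else 0)) + (\<Sum>z\<in>A \<inter> {0<..b}. (if a < z \<and> z \<le> b then J z else 0))"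
      using Jm by (intro integral_N_split[of _ b "2 * cM + Ls * cM"]) (use ab Jb L0 cM_pos in auto)
    also have "(LINT z|lborel. (if a < z \<and> z \<le> b then J z else 0)) = (LINT z|lborel. (if a < z \<and> z \<le> b then m z else 0))"
    proof (rule integral_cong_AE)
      have "AE z in lborel. z \<notin> A" using countable_imp_null_set_lborel[OF countable_A] by (intro AE_not_in)
      then show "AE z in lborel. (if a < z \<and> z \<le> b then J z else 0) = (if a < z \<and> z \<le> b then m z else 0)"
        by eventually_elim (auto simp: J_def)
    qed (use Jm in measurable)
    also have "\<dots> = G b - G a" by (rule ftc[OF ab])
    also have "(\<Sum>z\<in>A \<inter> {0<..b}. (if a < z \<and> z \<le> b then J z else 0)) = (\<Sum>z\<in>A \<inter> {a<..b}. jj z)"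
      using ab A_finite[of b] by (intro sum.mono_neutral_cong_right) (auto simp: J_def)
    also have "(\<Sum>z\<in>A \<inter> {a<..b}. jj z) = (\<Sum>z\<in>A \<inter> {0<..b}. jj z) - (\<Sum>z\<in>A \<inter> {0<..a}. jj z)"
    proof -
      have "A \<inter> {0<..b} = (A \<inter> {0<..a}) \<union> (A \<inter> {a<..b})" using ab by auto
      moreover have "(\<Sum>z\<in>(A \<inter> {0<..a}) \<union> (A \<inter> {a<..b}). jj z) = (\<Sum>z\<in>A \<inter> {0<..a}. jj z) + (\<Sum>z\<in>A \<inter> {a<..b}. jj z)"
        by (rule sum.union_disjoint) (use ab A_finite[of b] A_finite[of a] in \<open>auto intro: finite_subset[of _ "A \<inter> {0<..b}"]\<close>)
      ultimately show ?thesis by simp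
    qed
    finally show "c b - c a = (LINT z|N. (if a < z \<and> z \<le> b then J z else 0))" by (simp add: G_def)
  qed
  then show ?thesis by (intro exI)
qed

end

section \<open>Admissible potentials\<close>

text \<open>Every point is singled out by an interval with rational end points.\<close>

lemma countable_discrete_real:
  fixes D :: "real set"
  assumes D: "discrete D"
  shows "countable D"
proof -
  define F where "F q = (case q of (a, b) \<Rightarrow> if \<exists>x. {a<..<b} \<inter> D = {x} then {a<..<b} \<inter> D else {})" for q :: "real \<times> real"
  have "D \<subseteq> (\<Union>q\<in>\<rat> \<times> \<rat>. F q)"
  proof
    fix x assume x: "x \<in> D"
    then have "\<forall>\<^sub>F y in at x. y \<notin> D" using D by (simp add: discrete_altdef)
    then obtain e where e: "e > 0" "\<And>y. y \<noteq> x \<Longrightarrow> dist y x < e \<Longrightarrow> y \<notin> D" unfolding eventually_at by auto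
    obtain a where a: "a \<in> \<rat>" "x - e < a" "a < x" using Rats_dense_in_real[of "x - e" x] e(1) by auto
    obtain b where b: "b \<in> \<rat>" "x < b" "b < x + e" using Rats_dense_in_real[of x "x + e"] e(1) by auto
    have "{a<..<b} \<inter> D = {x}" using x a b e(2) by (force simp: dist_real_def abs_less_iff)
    then have "x \<in> F (a, b)" using x a b by (auto simp: F_def)
    then show "x \<in> (\<Union>q\<in>\<rat> \<times> \<rat>. F q)" using a b by blast
  qed
  moreover have "countable (F q)" for q by (auto simp: F_def split: prod.splits)
  then have "countable (\<Union>q\<in>\<rat> \<times> \<rat>. F q)" by (intro countable_UN countable_SIGMA countable_rat)
  ultimately show ?thesis by (rule countable_subset)
qed

text \<open>An interval has positive measure, so a null set together with a countable set cannot
  exhaust it. This turns essential bounds into bounds at points arbitrarily close to a given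
  one.\<close>

lemma AE_lebesgue_halfline_dense:
  fixes P :: "real \<Rightarrow> bool"
  assumes P: "AE y in lebesgue_on {0..}. P y" and S: "countable S" and x: "x \<ge> 0" "e > 0"
  shows "\<exists>y. x < y \<and> y < x + e \<and> y \<notin> S \<and> P y"
proof (rule ccontr)
  assume none: "\<not> ?thesis"
  have "AE y in lebesgue. y \<in> {0..} \<longrightarrow> P y" using P by (subst (asm) AE_restrict_space_iff) auto
  moreover have "AE y in lebesgue. y \<notin> S"
    using countable_imp_null_set_lborel[OF S] by (intro AE_not_in null_sets_completionI)
  ultimately have "AE y in lebesgue. y \<notin> {x<..<x + e}"
    by eventually_elim (use none x in auto)
  then have "{x<..<x + e} \<in> null_sets lebesgue" by (simp add: AE_iff_null_sets)
  then show False using x by (simp add: null_sets_def)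
qed

lemma nontrivial_halfline:
  fixes x :: real
  assumes "x \<ge> 0" "countable D"
  shows "at x within {0..} - D \<noteq> bot"
proof -
  have "\<exists>y\<in>{0..} - D. y \<noteq> x \<and> dist y x < e" if "e > 0" for e
    using AE_lebesgue_halfline_dense[of "\<lambda>_. True", OF _ assms(2,1) that] assms(1) by (force simp: dist_real_def)
  then have "x islimpt ({0..} - D)" unfolding islimpt_approachable by blast
  then show ?thesis using trivial_limit_within[of x "{0..} - D"] by simp
qed

lemma deriv_onI:
  assumes "(g has_real_derivative d) (at x within S)" "at x within S \<noteq> bot"
  shows "deriv_on S g x = d"
  unfolding deriv_on_def using assms
  by (intro vector_derivative_within) (simp_all add: has_real_derivative_iff_has_vector_derivative)

lemma differentiable_deriv_on:
  assumes "g differentiable (at x within S)" "at x within S \<noteq> bot"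
  shows "(g has_real_derivative deriv_on S g x) (at x within S)"
proof -
  obtain d where "(g has_real_derivative d) (at x within S)" using assms(1) by (auto simp: real_differentiable_def)
  then show ?thesis using deriv_onI[OF _ assms(2)] by simp
qed

lemma halfline_deriv_on:
  fixes x :: real
  shows "x \<ge> 0 \<Longrightarrow> (g has_real_derivative d) (at x within {0..}) \<Longrightarrow> deriv_on {0..} g x = d"
    and "x \<ge> 0 \<Longrightarrow> g differentiable (at x within {0..}) \<Longrightarrow> (g has_real_derivative deriv_on {0..} g x) (at x within {0..})"
  using deriv_onI[of g d x "{0..}"] differentiable_deriv_on[of g x "{0..}"] nontrivial_halfline[of x "{}"] by auto

lemma AE_bound_at_continuity:
  fixes g h :: "real \<Rightarrow> real"
  assumes M: "AE y in lebesgue_on {0..}. \<bar>g y\<bar> \<le> M" and E: "countable E" and x: "x \<ge> 0"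
    and h: "continuous (at x within {0..} - D) h" and D: "D \<subseteq> E" and gh: "\<And>y. y \<ge> 0 \<Longrightarrow> y \<notin> E \<Longrightarrow> h y = g y"
  shows "\<bar>h x\<bar> \<le> M"
proof (rule field_le_epsilon)
  fix e :: real assume e: "e > 0"
  have "\<exists>d>0. \<forall>y\<in>{0..} - D. dist y x < d \<longrightarrow> dist (h y) (h x) < e" using h e unfolding continuous_within_eps_delta by blast
  then obtain d where d: "d > 0" "\<And>y. y \<in> {0..} - D \<Longrightarrow> \<bar>y - x\<bar> < d \<Longrightarrow> \<bar>h y - h x\<bar> < e"
    by (auto simp: dist_real_def)
  obtain y where y: "x < y" "y < x + d" "y \<notin> E" "\<bar>g y\<bar> \<le> M"
    using AE_lebesgue_halfline_dense[OF M E x d(1)] by blast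
  have "\<bar>h y - h x\<bar> < e" by (rule d(2)) (use y x D in auto)
  moreover have "h y = g y" using gh y x by auto
  ultimately show "\<bar>h x\<bar> \<le> M + e" using y(4) by linarith
qed

text \<open>The piecewise class provides the derivative along the complement of \<open>D\<close>. At
  a nearby point of \<open>D\<close> the difference quotient is the limit of quotients at points
  outside \<open>D\<close>, because \<open>g\<close> is continuous there, and so it obeys the same
  estimate.\<close>

lemma has_derivative_add_discrete:
  fixes g :: "real \<Rightarrow> real"
  assumes g: "(g has_real_derivative d) (at x within {0..} - D)" and D: "countable D" and x: "x \<ge> 0"
    and e: "e > 0" "\<And>y. y \<ge> 0 \<Longrightarrow> \<bar>y - x\<bar> < e \<Longrightarrow> continuous (at y within {0..}) g"
  shows "(g has_real_derivative d) (at x within {0..})"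
  unfolding has_field_derivative_iff
proof (rule tendstoI)
  fix \<epsilon> :: real assume \<epsilon>: "\<epsilon> > 0"
  have "\<forall>\<^sub>F y in at x within {0..} - D. dist ((g y - g x) / (y - x)) d < \<epsilon> / 2"
    using g \<epsilon> unfolding has_field_derivative_iff by (intro tendstoD) auto
  then obtain \<eta> where \<eta>: "\<eta> > 0" "\<And>y. y \<in> {0..} - D \<Longrightarrow> y \<noteq> x \<Longrightarrow> \<bar>y - x\<bar> < \<eta> \<Longrightarrow> \<bar>(g y - g x) / (y - x) - d\<bar> < \<epsilon> / 2"
    unfolding eventually_at by (auto simp: dist_real_def)
  have "dist ((g y - g x) / (y - x)) d < \<epsilon>" if y: "y \<ge> 0" "y \<noteq> x" "\<bar>y - x\<bar> < min \<eta> e" for y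
  proof -
    have c: "((\<lambda>z. \<bar>(g z - g x) / (z - x) - d\<bar>) \<longlongrightarrow> \<bar>(g y - g x) / (y - x) - d\<bar>) (at y within {0..} - D)"
    proof -
      have "continuous (at y within {0..}) g" using e(2)[of y] y by simp
      then have "continuous (at y within {0..} - D) g" by (rule continuous_within_subset) auto
      then have "(g \<longlongrightarrow> g y) (at y within {0..} - D)" by (simp add: continuous_within)
      then show ?thesis using y(2) by (intro tendsto_intros) auto
    qed
    have "\<forall>\<^sub>F z in at y within {0..} - D. \<bar>z - y\<bar> < min (\<eta> - \<bar>y - x\<bar>) \<bar>y - x\<bar> \<and> z \<in> {0..} - D"
      unfolding eventually_at using y by (intro exI[of _ "min (\<eta> - \<bar>y - x\<bar>) \<bar>y - x\<bar>"]) (auto simp: dist_real_def)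
    then have "\<forall>\<^sub>F z in at y within {0..} - D. \<bar>(g z - g x) / (z - x) - d\<bar> \<le> \<epsilon> / 2"
    proof eventually_elim
      case (elim z)
      have "\<bar>z - x\<bar> < \<eta>" "z \<noteq> x" using elim by auto
      then show ?case using \<eta>(2)[of z] elim by (auto intro: less_imp_le)
    qed
    then have "\<bar>(g y - g x) / (y - x) - d\<bar> \<le> \<epsilon> / 2"
      by (rule tendsto_upperbound[OF c]) (rule nontrivial_halfline[OF y(1) D])
    then show ?thesis using \<epsilon> by (simp add: dist_real_def)
  qed
  then show "\<forall>\<^sub>F y in at x within {0..}. dist ((g y - g x) / (y - x)) d < \<epsilon>"
    unfolding eventually_at using \<eta>(1) e(1) by (intro exI[of _ "min \<eta> e"]) (auto simp: dist_real_def)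
qed

text \<open>The derivative may also exist at points of \<open>E\<close> close to \<open>x\<close>,
  where no formula for it is given. The mean value inequality off a countable set controls all
  difference quotients near \<open>x\<close> by the known values of \<open>h\<close>, and hence the
  derivative at such points as well.\<close>

lemma not_in_disc_deriv:
  fixes s h :: "real \<Rightarrow> real"
  assumes E: "countable E" "x \<notin> E" "x \<ge> 0"
    and s: "\<And>y. y \<ge> 0 \<Longrightarrow> y \<notin> E \<Longrightarrow> (s has_real_derivative h y) (at y within {0..})"
    and h: "continuous (at x within {0..} - E) h"
    and e: "e > 0" "\<And>y. y \<ge> 0 \<Longrightarrow> \<bar>y - x\<bar> < e \<Longrightarrow> continuous (at y within {0..}) s"
  shows "x \<notin> disc_deriv {0..} s"
proof -
  let ?Z = "{y\<in>{0..}. s differentiable (at y within {0..})}"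
  have sx: "(s has_real_derivative h x) (at x within {0..})" using s E by blast
  have "continuous (at x within ?Z) (deriv_on {0..} s)"
    unfolding continuous_within_eps_delta
  proof (intro allI impI)
    fix \<epsilon> :: real assume \<epsilon>: "\<epsilon> > 0"
    have "\<exists>d>0. \<forall>y\<in>{0..} - E. dist y x < d \<longrightarrow> dist (h y) (h x) < \<epsilon> / 2"
      using h \<epsilon> unfolding continuous_within_eps_delta by (meson half_gt_zero)
    then obtain d where d: "d > 0" "\<And>y. y \<ge> 0 \<Longrightarrow> y \<notin> E \<Longrightarrow> \<bar>y - x\<bar> < d \<Longrightarrow> \<bar>h y - h x\<bar> < \<epsilon> / 2"
      by (auto simp: dist_real_def)
    define \<eta> where "\<eta> = min d e"
    have \<eta>: "\<eta> > 0" "\<eta> \<le> d" "\<eta> \<le> e" using d e by (auto simp: \<eta>_def)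
    have inc: "\<bar>s b - s a - h x * (b - a)\<bar> \<le> \<epsilon> / 2 * (b - a)"
      if ab: "0 \<le> a" "a \<le> b" "\<bar>a - x\<bar> < \<eta>" "\<bar>b - x\<bar> < \<eta>" for a b
    proof -
      have c: "continuous_on {a..b} (\<lambda>z. \<sigma> * (s z - h x * z))" for \<sigma>
      proof -
        have "continuous_on {a..b} s" unfolding continuous_on_eq_continuous_within
        proof
          fix z assume z: "z \<in> {a..b}"
          then have "\<bar>z - x\<bar> < e" using ab \<eta> by (auto simp: abs_less_iff)
          then have "continuous (at z within {0..}) s" using e(2)[of z] z ab by simp
          then show "continuous (at z within {a..b}) s" by (rule continuous_within_subset) (use ab in auto)
        qed
        then show ?thesis by (intro continuous_intros)
      qed
      have der: "\<exists>D. ((\<lambda>z. \<sigma> * (s z - h x * z)) has_real_derivative D) (at z) \<and> D \<le> \<epsilon> / 2"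
        if z: "a < z" "z < b" "z \<notin> E" and \<sigma>: "\<bar>\<sigma>\<bar> = 1" for z \<sigma>
      proof -
        have zx: "\<bar>z - x\<bar> < d" using z ab \<eta> by (auto simp: abs_less_iff)
        have "at z within {0..} = at z" by (rule at_within_open_subset[of _ "{0<..}"]) (use z ab in auto)
        then have "(s has_real_derivative h z) (at z)" using s[of z] z ab by simp
        then have "((\<lambda>z. \<sigma> * (s z - h x * z)) has_real_derivative \<sigma> * (h z - h x)) (at z)"
          by (auto intro!: derivative_eq_intros)
        moreover have "\<sigma> * (h z - h x) \<le> \<bar>\<sigma>\<bar> * \<bar>h z - h x\<bar>" by (simp add: abs_mult[symmetric])
        then have "\<sigma> * (h z - h x) \<le> \<epsilon> / 2" using d(2)[of z] zx z ab \<sigma> by simp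
        ultimately show ?thesis by blast
      qed
      have "1 * (s b - h x * b) - 1 * (s a - h x * a) \<le> \<epsilon> / 2 * (b - a)"
        by (rule increment_bound_off_countable[where f = "\<lambda>z. 1 * (s z - h x * z)", OF ab(2) c E(1)]) (rule der; simp)
      moreover have "-1 * (s b - h x * b) - -1 * (s a - h x * a) \<le> \<epsilon> / 2 * (b - a)"
        by (rule increment_bound_off_countable[where f = "\<lambda>z. -1 * (s z - h x * z)", OF ab(2) c E(1)]) (rule der; simp)
      ultimately show ?thesis by (intro abs_leI) (simp_all add: algebra_simps)
    qed
    have "\<bar>deriv_on {0..} s y - h x\<bar> \<le> \<epsilon> / 2" if y: "y \<in> ?Z" "\<bar>y - x\<bar> < \<eta>" for y
    proof -
      have lim: "((\<lambda>z. \<bar>(s z - s y) / (z - y) - h x\<bar>) \<longlongrightarrow> \<bar>deriv_on {0..} s y - h x\<bar>) (at y within {0..})"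
        using halfline_deriv_on(2)[of y s] y unfolding has_field_derivative_iff by (intro tendsto_intros) auto
      have "\<forall>\<^sub>F z in at y within {0..}. \<bar>z - y\<bar> < \<eta> - \<bar>y - x\<bar> \<and> z \<in> {0..} \<and> z \<noteq> y"
        unfolding eventually_at using y by (intro exI[of _ "\<eta> - \<bar>y - x\<bar>"]) (auto simp: dist_real_def)
      then have "\<forall>\<^sub>F z in at y within {0..}. \<bar>(s z - s y) / (z - y) - h x\<bar> \<le> \<epsilon> / 2"
      proof eventually_elim
        case (elim z)
        then have zx: "\<bar>z - x\<bar> < \<eta>" by linarith
        have eq: "(s z - s y) / (z - y) - h x = (s z - s y - h x * (z - y)) / (z - y)" using elim by (simp add: field_simps)
        have "\<bar>s z - s y - h x * (z - y)\<bar> \<le> \<epsilon> / 2 * \<bar>z - y\<bar>"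
        proof (cases "y \<le> z")
          case True then show ?thesis using inc[of y z] y zx by auto
        next
          case False
          then have "\<bar>s y - s z - h x * (y - z)\<bar> \<le> \<epsilon> / 2 * (y - z)" using inc[of z y] y elim zx by auto
          moreover have "\<bar>s z - s y - h x * (z - y)\<bar> = \<bar>s y - s z - h x * (y - z)\<bar>"
            by (subst abs_minus_cancel[symmetric]) (simp add: algebra_simps)
          ultimately show ?thesis using False by simp
        qed
        then show ?case unfolding eq abs_divide using elim by (simp add: divide_le_eq)
      qed
      then show ?thesis by (rule tendsto_upperbound[OF lim]) (use nontrivial_halfline[of y "{}"] y in auto)
    qed
    then have "dist (deriv_on {0..} s y) (deriv_on {0..} s x) < \<epsilon>" if "y \<in> ?Z" "dist y x < \<eta>" for y
      using that \<epsilon> halfline_deriv_on(1)[OF E(3) sx] by (force simp: dist_real_def)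
    then show "\<exists>d>0. \<forall>y\<in>?Z. dist y x < d \<longrightarrow> dist (deriv_on {0..} s y) (deriv_on {0..} s x) < \<epsilon>"
      using \<eta>(1) by blast
  qed
  moreover have "s differentiable (at x within {0..})" using sx by (auto simp: real_differentiable_def)
  ultimately show ?thesis by (simp add: disc_deriv_def)
qed

text \<open>\<open>V\<close> and its speed determine each other by formulas that preserve
  continuity, so they have the same jumps and the separation of the jumps carries over. Essential
  bounds for \<open>V\<close> and its derivative become pointwise ones by continuity, and the chain
  rule yields those for the speed.\<close>

lemma admissible_potential_profile:
  assumes V: "admissible_potential V"
  shows "\<exists>E cm cM Ls \<delta>. profile (speed V) (disc {0..} (speed V)) E cm cM Ls \<delta> \<and> disc_deriv {0..} (speed V) \<subseteq> E"
proof -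
  have PC: "PC 1 {0..} V" and LV: "L_inf {0..} V" and LV': "L_inf {0..} (deriv_on {0..} V)"
    and inf: "(INF x\<in>{0..}. ereal (V x)) > 0"
    and sep: "Inf {ereal \<bar>d1 - d2\<bar> | d1 d2. d1 \<in> disc {0..} V \<union> {0} \<and> d2 \<in> disc {0..} V \<union> {0} \<and> d1 \<noteq> d2} > 0"
    using V by (simp_all add: admissible_potential_def)
  obtain vm where vm: "0 < vm" "ereal vm < (INF x\<in>{0..}. ereal (V x))" using ereal_dense2[OF inf] by auto
  have Vge: "vm \<le> V x" if "x \<ge> 0" for x
  proof -
    have "ereal vm < ereal (V x)" by (rule less_le_trans[OF vm(2)]) (rule INF_lower, use that in auto)
    then show ?thesis by simp
  qed
  obtain \<delta> where \<delta>: "0 < \<delta>" "ereal \<delta> < Inf {ereal \<bar>d1 - d2\<bar> | d1 d2. d1 \<in> disc {0..} V \<union> {0} \<and> d2 \<in> disc {0..} V \<union> {0} \<and> d1 \<noteq> d2}"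
    using ereal_dense2[OF sep] by auto
  have \<delta>le: "\<delta> \<le> \<bar>a - b\<bar>" if "a \<in> insert 0 (disc {0..} V)" "b \<in> insert 0 (disc {0..} V)" "a \<noteq> b" for a b
  proof -
    have "ereal \<delta> < ereal \<bar>a - b\<bar>" by (rule less_le_trans[OF \<delta>(2)]) (rule Inf_lower, use that in blast)
    then show ?thesis by simp
  qed
  have cs: "continuous (at x within {0..}) (speed V)" if "x \<ge> 0" "continuous (at x within {0..}) V" for x
    unfolding speed_def[abs_def] using that Vge[of x] vm(1) by (intro continuous_intros) auto
  have cV: "continuous (at x within {0..}) V" if x: "x \<ge> 0" "continuous (at x within {0..}) (speed V)" for x
  proof (rule continuous_transform_within[where f = "\<lambda>x. 1 / (speed V x)\<^sup>2" and \<delta> = 1])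
    have "(speed V x)\<^sup>2 \<noteq> 0" using Vge[OF x(1)] vm(1) by (simp add: speed_def)
    then show "continuous (at x within {0..}) (\<lambda>x. 1 / (speed V x)\<^sup>2)"
      using x(2) by (intro continuous_intros)
    show "1 / (speed V z)\<^sup>2 = V z" if "z \<in> {0..}" for z
      using that Vge[of z] vm(1) by (simp add: speed_def power_divide)
  qed (use x in auto)
  define Dd where "Dd = disc {0..} (speed V)"
  have Dd: "Dd = disc {0..} V" using cs cV by (auto simp: Dd_def disc_def)
  have cont: "continuous (at x within {0..}) V" if "x \<ge> 0" "x \<notin> Dd" for x using that by (auto simp: Dd disc_def)
  obtain D where D: "D \<subseteq> {0..}" "discrete D" "C_k 1 ({0..} - D) V" using PC unfolding PC_def by (elim exE conjE)
  have cD: "countable D" by (rule countable_discrete_real[OF D(2)])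
  have "a = b" if "a \<in> Dd" "b \<in> Dd" "dist a b < \<delta>" for a b
    using \<delta>le[of a b] that Dd by (cases "a = b") (auto simp: dist_real_def)
  then have ud: "uniform_discrete Dd" unfolding uniform_discrete_def using \<delta>(1) by blast
  from ud have "countable Dd" by (intro countable_discrete_real uniform_discrete_imp_discrete)
  \<comment> \<open>The set \<open>D\<close> of the piecewise class is discrete, but its points need
    not keep a positive distance from each other. It therefore serves as a countable exceptional set
    for the derivative, whereas the atoms come from \<open>Dd\<close>.\<close>
  define E where "E = D \<union> Dd"
  have E: "countable E" "Dd \<subseteq> E" "D \<subseteq> E" unfolding E_def using cD \<open>countable Dd\<close> by simp_all
  have near: "\<exists>e>0. \<forall>y\<ge>0. \<bar>y - x\<bar> < e \<longrightarrow> y \<notin> Dd" if "x \<ge> 0" "x \<notin> Dd" for x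
  proof -
    have "open (- Dd)" by (rule open_Compl[OF uniform_discrete_imp_closed[OF ud]])
    then obtain e where e: "e > 0" "ball x e \<subseteq> - Dd" by (rule openE[of _ x]) (use \<open>x \<notin> Dd\<close> in auto)
    have "y \<notin> Dd" if "\<bar>y - x\<bar> < e" for y
      using subsetD[OF e(2), of y] that by (auto simp: dist_real_def abs_minus_commute)
    then show ?thesis using e(1) by blast
  qed
  define V' where "V' = deriv_on ({0..} - D) V"
  have V'c: "continuous_on ({0..} - D) V'" and V'd: "\<And>x. x \<in> {0..} - D \<Longrightarrow> V differentiable (at x within {0..} - D)"
    using D(3) unfolding C_k_def V'_def by auto
  have Vd: "(V has_real_derivative V' x) (at x within {0..})" if x: "x \<ge> 0" "x \<notin> E" for x
  proof -
    have xs: "x \<notin> D" "x \<notin> Dd" using x by (auto simp: E_def)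
    obtain e where e: "e > 0" "\<And>y. y \<ge> 0 \<Longrightarrow> \<bar>y - x\<bar> < e \<Longrightarrow> y \<notin> Dd" using near[OF x(1) xs(2)] by blast
    have "(V has_real_derivative V' x) (at x within {0..} - D)" unfolding V'_def
      by (rule differentiable_deriv_on[OF V'd nontrivial_halfline[OF x(1) cD]]) (use x xs in auto)
    then show ?thesis
      by (rule has_derivative_add_discrete[OF _ cD x(1) e(1)]) (use e cont in blast)
  qed
  obtain M where M: "AE x in lebesgue_on {0..}. \<bar>V x\<bar> \<le> M" using LV by (auto simp: L_inf_def)
  obtain M' where M': "AE x in lebesgue_on {0..}. \<bar>deriv_on {0..} V x\<bar> \<le> M'" using LV' by (auto simp: L_inf_def)
  have VM: "V x \<le> M" if x: "x \<ge> 0" "x \<notin> Dd" for x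
    using AE_bound_at_continuity[OF M countable_empty x(1), of "{}" V] cont[OF x] by auto
  have V'M: "\<bar>V' x\<bar> \<le> M'" if x: "x \<ge> 0" "x \<notin> E" for x
  proof (rule AE_bound_at_continuity[OF M' E(1) x(1) _ E(3)])
    show "continuous (at x within {0..} - D) V'" using V'c x E(3) by (auto simp: continuous_on_eq_continuous_within)
    show "V' y = deriv_on {0..} V y" if "y \<ge> 0" "y \<notin> E" for y using halfline_deriv_on(1)[OF that(1) Vd[OF that]] by simp
  qed
  \<comment> \<open>One regular point is enough to see that the upper bounds satisfy
    \<open>M > 0\<close> and \<open>M' \<ge> 0\<close>.\<close>
  have "\<exists>y. 0 < y \<and> y < 0 + 1 \<and> y \<notin> E \<and> True"
    by (rule AE_lebesgue_halfline_dense[where P = "\<lambda>_. True", OF _ E(1)]) simp_all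
  then obtain x0 where "x0 > 0" "x0 \<notin> E" by blast
  then have x0: "x0 \<ge> 0" "x0 \<notin> E" by simp_all
  have "x0 \<notin> Dd" using x0 E(2) by (rule_tac notI) (simp add: subset_iff)
  then have "V x0 \<le> M" "vm \<le> V x0" "\<bar>V' x0\<bar> \<le> M'" using VM V'M Vge x0 by blast+
  then have Mp: "M > 0" "M' \<ge> 0" using vm(1) by linarith+
  have sd: "(speed V has_real_derivative - V' x / (2 * V x * sqrt (V x))) (at x within {0..})" if x: "x \<ge> 0" "x \<notin> E" for x
  proof -
    have V0: "V x > 0" using Vge[OF x(1)] vm(1) by simp
    have "(inverse has_real_derivative - (inverse (sqrt (V x)) ^ Suc (Suc 0))) (at (sqrt (V x)))"
      by (rule DERIV_inverse) (use V0 in simp)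
    from DERIV_chain2[OF this DERIV_chain2[OF DERIV_real_sqrt[OF V0] Vd[OF x]]]
    have "((\<lambda>x. inverse (sqrt (V x))) has_real_derivative - (inverse (sqrt (V x)) ^ Suc (Suc 0)) * (inverse (sqrt (V x)) / 2 * V' x)) (at x within {0..})" .
    moreover have "- (inverse (sqrt (V x)) ^ Suc (Suc 0)) * (inverse (sqrt (V x)) / 2 * V' x) = - V' x / (2 * V x * sqrt (V x))"
    proof -
      have alg: "- (inverse q ^ Suc (Suc 0)) * (inverse q / 2 * d) = - d / (2 * (q * q) * q)" if "q > 0" for q d :: real
        using that by (simp add: field_simps)
      show ?thesis using alg[of "sqrt (V x)" "V' x"] V0 by simp
    qed
    ultimately show ?thesis unfolding speed_def[abs_def] by (simp only: inverse_eq_divide)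
  qed
  have "profile (speed V) Dd E (1 / sqrt M) (1 / sqrt vm) (M' / (2 * vm * sqrt vm)) \<delta>"
  proof
    show "Dd \<subseteq> {0..}" by (auto simp: Dd disc_def)
    show "\<delta> \<le> \<bar>a - b\<bar>" if "a \<in> insert 0 Dd" "b \<in> insert 0 Dd" "a \<noteq> b" for a b using \<delta>le that Dd by simp
    show "\<delta> > 0" "countable E" "Dd \<subseteq> E" by fact+
    show "continuous (at x within {0..}) (speed V)" if "x \<ge> 0" "x \<notin> Dd" for x using cs cont that by blast
    show "1 / sqrt M \<le> speed V x \<and> speed V x \<le> 1 / sqrt vm" if x: "x \<ge> 0" "x \<notin> Dd" for x
      using VM[OF x] Vge[OF x(1)] vm(1) unfolding speed_def by (intro conjI divide_left_mono) auto
    show "1 / sqrt M > 0" using Mp by simp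
    show "M' / (2 * vm * sqrt vm) \<ge> 0" using Mp vm by simp
    show "\<exists>D. (speed V has_real_derivative D) (at x within {0..}) \<and> \<bar>D\<bar> \<le> M' / (2 * vm * sqrt vm)" if x: "x \<ge> 0" "x \<notin> E" for x
    proof (intro exI conjI)
      show "(speed V has_real_derivative - V' x / (2 * V x * sqrt (V x))) (at x within {0..})" by (rule sd[OF x])
      have V0: "V x > 0" using Vge[OF x(1)] vm(1) by simp
      have "\<bar>V' x\<bar> / (2 * V x * sqrt (V x)) \<le> M' / (2 * vm * sqrt vm)"
        using V'M[OF x] Vge[OF x(1)] vm(1) by (intro frac_le mult_mono) auto
      then show "\<bar>- V' x / (2 * V x * sqrt (V x))\<bar> \<le> M' / (2 * vm * sqrt vm)" using V0 by (simp add: abs_divide abs_mult)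
    qed
  qed
  moreover have "x \<in> E" if "x \<in> disc_deriv {0..} (speed V)" for x
  proof (rule ccontr)
    assume xE: "x \<notin> E"
    have x0: "x \<ge> 0" using that by (simp add: disc_deriv_def)
    have xs: "x \<notin> D" "x \<notin> Dd" using xE by (auto simp: E_def)
    obtain e where e: "e > 0" "\<And>y. y \<ge> 0 \<Longrightarrow> \<bar>y - x\<bar> < e \<Longrightarrow> y \<notin> Dd" using near[OF x0 xs(2)] by blast
    have cq: "continuous (at x within {0..} - E) (\<lambda>x. - V' x / (2 * V x * sqrt (V x)))"
    proof -
      have "continuous (at x within {0..} - D) V'" using V'c x0 xs by (auto simp: continuous_on_eq_continuous_within)
      then have 1: "continuous (at x within {0..} - E) V'" by (rule continuous_within_subset) (auto simp: E_def)
      have 2: "continuous (at x within {0..} - E) V" by (rule continuous_within_subset[OF cont[OF x0 xs(2)]]) auto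
      show ?thesis using 1 2 Vge[OF x0] vm(1) by (intro continuous_intros) auto
    qed
    have "x \<notin> disc_deriv {0..} (speed V)"
    proof (rule not_in_disc_deriv[OF E(1) xE x0 _ cq e(1)])
      show "(speed V has_real_derivative - V' y / (2 * V y * sqrt (V y))) (at y within {0..})" if "y \<ge> 0" "y \<notin> E" for y
        by (rule sd[OF that])
      show "continuous (at y within {0..}) (speed V)" if "y \<ge> 0" "\<bar>y - x\<bar> < e" for y
        by (rule cs[OF that(1) cont[OF that(1) e(2)[OF that]]])
    qed
    then show False using that by simp
  qed
  ultimately show ?thesis unfolding Dd_def by blast
qed

section \<open>Classical solutions\<close>

lemma deriv_on_cong:
  assumes "\<And>y. y \<in> S \<Longrightarrow> f y = g y" "x \<in> S"
  shows "deriv_on S f x = deriv_on S g x"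
proof -
  have "(f has_vector_derivative d) (at x within S) \<longleftrightarrow> (g has_vector_derivative d) (at x within S)" for d
    using assms by (intro has_vector_derivative_cong_ev always_eventually) auto
  then show ?thesis by (simp add: deriv_on_def vector_derivative_def)
qed

lemma C1_quadrant_dx:
  assumes u: "C1_quadrant u" and x: "x \<ge> 0" "t \<ge> 0"
  shows "((\<lambda>x. u (x, t)) has_real_derivative dx u (x, t)) (at x within {0..})"
    and "((\<lambda>t. u (x, t)) has_real_derivative dt u (x, t)) (at t within {0..})"
  using u x halfline_deriv_on(2)[of x "\<lambda>x. u (x, t)"] halfline_deriv_on(2)[of t "\<lambda>t. u (x, t)"]
  by (simp_all add: C1_quadrant_def dx_def dt_def)

lemma C1_data:
  assumes "C_k 1 {0..} u0"
  shows "continuous_on {0..} (deriv_on {0..} u0)" and "x \<ge> 0 \<Longrightarrow> (u0 has_real_derivative deriv_on {0..} u0 x) (at x within {0..})"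
  using assms halfline_deriv_on(2)[of x u0] unfolding C_k_def by (force, auto)

text \<open>The atoms and the speed of \<open>medium\<close> are those constructed from
  \<open>V\<close>, so that statements in \<open>x\<close> and in the travel time can be combined.
  The additional assumption places the points excluded from condition (i) in the countable set
  \<open>E\<close>.\<close>

locale wave = profile "speed V" "disc {0..} (speed V)" E cm cM Ls \<delta> +
    medium "profile.A (speed V) (disc {0..} (speed V)) cm" J "profile.c (speed V) (disc {0..} (speed V)) cm Ls" cm L
  for V :: "real \<Rightarrow> real" and E cm cM Ls \<delta> J L +
  assumes disc_deriv_E: "disc_deriv {0..} (speed V) \<subseteq> E"
begin

abbreviation "Dd \<equiv> disc {0..} (speed V)"

lemma off_jumps_near:
  assumes y: "\<zeta> y \<notin> Dd"
  shows "\<exists>e>0. \<forall>z. \<bar>z - y\<bar> < e \<longrightarrow> \<zeta> z \<notin> Dd"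
proof -
  obtain e where e: "e > 0" "\<And>a. a \<in> Dd \<Longrightarrow> \<bar>a - \<zeta> y\<bar> < e \<Longrightarrow> a = \<zeta> y" using Dd_isolated by blast
  have "\<exists>d>0. \<forall>x'. dist x' y < d \<longrightarrow> dist (\<zeta> x') (\<zeta> y) < e"
    using isCont_\<zeta>[of y] e(1) unfolding continuous_at_eps_delta by blast
  then obtain d where d: "d > 0" "\<And>z. \<bar>z - y\<bar> < d \<Longrightarrow> \<bar>\<zeta> z - \<zeta> y\<bar> < e" by (auto simp: dist_real_def)
  have "\<zeta> z \<notin> Dd" if "\<bar>z - y\<bar> < d" for z
  proof
    assume "\<zeta> z \<in> Dd"
    then have "\<zeta> z = \<zeta> y" using e(2) d(2)[OF that] by blast
    then show False using \<open>\<zeta> z \<in> Dd\<close> y by simp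
  qed
  then show ?thesis using d(1) by blast
qed

lemma c_off_jumps: "\<zeta> y \<notin> Dd \<Longrightarrow> c y = speed V (\<zeta> y)"
  by (simp add: c_def sR_def)

text \<open>The travel time decreases at unit rate along a characteristic, which therefore is unique.\<close>

lemma char_derivative_straighten:
  assumes x: "x > 0" "x \<notin> Dd" and t: "t > 0" and w: "has_char_derivative (speed V) w D (x, t)"
  shows "((\<lambda>s. w (\<zeta> (\<kappa> x - s), t + s)) has_real_derivative D) (at 0)"
proof -
  obtain X \<epsilon> where \<epsilon>: "\<epsilon> > 0" "X 0 = x"
    and X: "\<And>s. \<bar>s\<bar> < \<epsilon> \<Longrightarrow> 0 \<le> t + s \<Longrightarrow> 0 \<le> X s \<and> (X has_real_derivative - speed V (X s)) (at s within {s. \<bar>s\<bar> < \<epsilon> \<and> 0 \<le> t + s})"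
    and wD: "((\<lambda>s. w (X s, t + s)) has_real_derivative D) (at 0 within {s. \<bar>s\<bar> < \<epsilon> \<and> 0 \<le> t + s})"
    using w x(1) unfolding has_char_derivative_def by (force simp: Let_def)
  define e where "e = min \<epsilon> t"
  have e: "e > 0" "e \<le> \<epsilon>" "e \<le> t" using \<epsilon>(1) t by (simp_all add: e_def)
  have at: "at s within {s. \<bar>s\<bar> < \<epsilon> \<and> 0 \<le> t + s} = at s" if "\<bar>s\<bar> < e" for s
    by (rule at_within_open_subset[of _ "{-e<..<e}"]) (use that e in auto)
  have X0: "X s \<ge> 0" and X': "(X has_real_derivative - speed V (X s)) (at s)" if s: "\<bar>s\<bar> < e" for s
    using X[of s] at[OF s] s e by (auto simp: abs_less_iff)
  obtain e1 where e1: "e1 > 0" "\<And>a. a \<in> Dd \<Longrightarrow> \<bar>a - x\<bar> < e1 \<Longrightarrow> a = x" using Dd_isolated by blast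
  have "isCont X 0" using X'[of 0] e(1) by (auto intro: DERIV_isCont)
  moreover have "min e1 x > 0" using e1 x by simp
  ultimately have "\<exists>d>0. \<forall>s. dist s 0 < d \<longrightarrow> dist (X s) (X 0) < min e1 x" unfolding continuous_at_eps_delta by blast
  then obtain d' where d': "d' > 0" "\<And>s. \<bar>s\<bar> < d' \<Longrightarrow> \<bar>X s - x\<bar> < min e1 x" by (auto simp: dist_real_def \<epsilon>(2))
  define d where "d = min d' e"
  have d: "d > 0" "d \<le> e" "d \<le> d'" using d' e by (simp_all add: d_def)
  have Xs: "X s > 0" "X s \<notin> Dd" if s: "\<bar>s\<bar> < d" for s
  proof -
    have *: "\<bar>X s - x\<bar> < e1" "\<bar>X s - x\<bar> < x" using d'(2)[of s] s d by auto
    then show "X s > 0" by linarith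
    show "X s \<notin> Dd" using *(1) e1(2)[of "X s"] x(2) by auto
  qed
  have \<kappa>X: "((\<lambda>s. \<kappa> (X s) + s) has_real_derivative 0) (at s within {-d<..<d})" if s: "s \<in> {-d<..<d}" for s
  proof -
    have s': "\<bar>s\<bar> < d" using s by auto
    have "(\<kappa> has_real_derivative 1 / speed V (X s)) (at (X s))"
      using \<kappa>_deriv[of "X s"] at_pos[of "X s"] Xs[OF s'] by simp
    from DERIV_chain2[OF this X'[of s]] s' d
    have "((\<lambda>s. \<kappa> (X s)) has_real_derivative 1 / speed V (X s) * - speed V (X s)) (at s)" by simp
    moreover have "speed V (X s) > 0" using s_bound[of "X s"] Xs[OF s'] cm by auto
    ultimately have "((\<lambda>s. \<kappa> (X s) + s) has_real_derivative -1 + 1) (at s)" by (intro DERIV_add DERIV_ident) simp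
    then show ?thesis by (auto intro: has_field_derivative_at_within)
  qed
  have "\<exists>k. \<forall>s\<in>{-d<..<d}. \<kappa> (X s) + s = k"
    by (rule has_field_derivative_zero_constant[OF _ \<kappa>X]) auto
  then obtain k where k: "\<And>s. \<bar>s\<bar> < d \<Longrightarrow> \<kappa> (X s) + s = k" by (auto simp: abs_less_iff)
  have Xeq: "X s = \<zeta> (\<kappa> x - s)" if s: "\<bar>s\<bar> < d" for s
  proof -
    have "\<kappa> (X s) = \<kappa> x - s" using k[OF s] k[of 0] d(1) \<epsilon>(2) by simp
    then show ?thesis using \<zeta>_\<kappa>[of "X s"] Xs[OF s] by simp
  qed
  have "((\<lambda>s. w (X s, t + s)) has_real_derivative D) (at 0)" using wD at[of 0] e by simp
  then show ?thesis
    by (rule has_field_derivative_transform_within_open[of _ _ _ "{-d<..<d}"]) (use d Xeq in auto)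
qed

text \<open>Condition (i) holds off a countable set of positions, which is enough for the left
  invariant. The compatibility hypothesis is the fundamental theorem of calculus: the time integral
  of \<open>u\<^sub>t\<close> is an increment of \<open>u\<close>, whose derivative in
  \<open>y\<close> is \<open>c * (u\<^sub>x - u\<^sub>0')\<close>. These two facts imply the
  equation for \<open>r\<close>, and condition (ii) enters in integrated form.\<close>

theorem solution_imp_mild:
  assumes u: "global_C1_solution V f u0 u1 u" and u0: "C_k 1 {0..} u0" and u1: "continuous_on {0..} u1"
  shows "mild_solution f (\<lambda>y. deriv_on {0..} u0 (\<zeta> y)) (\<lambda>y. u1 (\<zeta> y))
    (\<lambda>y t. dx u (\<zeta> y, max 0 t) - deriv_on {0..} u0 (\<zeta> y)) (\<lambda>y t. dt u (\<zeta> y, max 0 t))"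
proof -
  define v0 where "v0 y = deriv_on {0..} u0 (\<zeta> y)" for y
  define v1 where "v1 y = u1 (\<zeta> y)" for y
  define r where "r y t = dx u (\<zeta> y, max 0 t) - v0 y" for y t
  define p where "p y t = dt u (\<zeta> y, max 0 t)" for y t
  have C1: "C1_quadrant u"
    and char: "\<And>x t. x \<ge> 0 \<Longrightarrow> t \<ge> 0 \<Longrightarrow> x \<notin> Dd \<Longrightarrow> x \<notin> disc_deriv {0..} (speed V) \<Longrightarrow>
        has_char_derivative (speed V) (\<lambda>p. dt u p + speed V (fst p) * dx u p)
          (- speed V x * deriv_on {0..} (speed V) x * dx u (x, t)) (x, t)"
    and bdry: "\<And>t. t \<ge> 0 \<Longrightarrow> ((\<lambda>s. f (dt u (0, s))) has_real_derivative dx u (0, t)) (at t within {0..})"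
    and ini: "\<And>x. x \<ge> 0 \<Longrightarrow> u (x, 0) = u0 x" "\<And>x. x \<ge> 0 \<Longrightarrow> dt u (x, 0) = u1 x"
    using u unfolding global_C1_solution_def by auto
  have dxc: "continuous_on quadrant (dx u)" and dtc: "continuous_on quadrant (dt u)" using C1 unfolding C1_quadrant_def by auto
  have v: "continuous_on UNIV v0" "continuous_on UNIV v1"
    unfolding v0_def v1_def using \<zeta>_nonneg
    by (auto intro!: continuous_on_compose2[OF C1_data(1)[OF u0] \<zeta>_cont] continuous_on_compose2[OF u1 \<zeta>_cont])
  have dx0: "dx u (x, 0) = deriv_on {0..} u0 x" if "x \<ge> 0" for x
    unfolding dx_def by (simp, rule deriv_on_cong) (use ini that in auto)
  have quad: "continuous_on S (\<lambda>x. g (\<zeta> (fst x), max 0 (snd x)))" if "continuous_on quadrant g" for g S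
    by (rule continuous_on_compose2[OF that])
       (auto intro!: continuous_intros continuous_on_compose2[OF \<zeta>_cont[of UNIV]] \<zeta>_nonneg)
  have r: "cauc r" "jointly_cont r"
  proof -
    have "continuous_on UNIV (\<lambda>x. r (fst x) (snd x))"
      unfolding r_def by (intro continuous_intros quad dxc continuous_on_compose2[OF v(1)]) auto
    moreover have "r y t = 0" if "t \<le> 0" for y t
    proof -
      have "max 0 t = 0" using that by simp
      then show ?thesis using dx0[OF \<zeta>_nonneg, of y] by (simp only: r_def v0_def diff_self)
    qed
    ultimately show "cauc r" "jointly_cont r" by (auto intro: cauc_continuousI)
  qed
  have pj: "jointly_cont (\<lambda>y t. p y (max 0 t))"
    unfolding jointly_cont_def p_def using quad[OF dtc] by simp
  have p0: "p y 0 = v1 y" for y using ini(2)[OF \<zeta>_nonneg] by (simp add: p_def v1_def)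
  have w: "p y t + c y * r y t + \<beta> v0 y = Fp v0 v1 (y + t) - K1 r y t" if "y \<ge> 0" "t \<ge> 0" for y t
  proof (rule left_invariant[OF r v pj p0 _ _ _ that])
    show "countable (\<kappa> ` E)" using E(1) by simp
    show "A \<subseteq> \<kappa> ` E" using E(2) by (auto simp: A_def)
    fix y t :: real assume y: "y > 0" "t > 0" "y \<notin> \<kappa> ` E"
    define x where "x = \<zeta> y"
    have \<kappa>x: "\<kappa> x = y" and x0: "x > 0" using \<kappa>_\<zeta>[of y] \<zeta>_less[of 0 y] \<zeta>_0 y by (auto simp: x_def)
    have xE: "x \<notin> E" using y(3) \<kappa>x by auto
    then have xd: "x \<notin> Dd" "x \<notin> disc_deriv {0..} (speed V)" using E(2) disc_deriv_E by auto
    obtain m where m: "(speed V has_real_derivative m) (at x within {0..})" using s_deriv[of x] xE x0 by auto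
    \<comment> \<open>In the coordinate \<open>y\<close> the derivative of the speed gains the
      factor \<open>speed V x\<close>, which makes the right-hand side of (i) the derivative of
      \<open>c\<close> in \<open>y\<close>, times \<open>- u\<^sub>x\<close>.\<close>
    have cm: "(c has_real_derivative m * speed V x) (at y within {0..})"
      using c_deriv[of y m] y xd m by (simp add: x_def)
    have "has_char_derivative (speed V) (\<lambda>p. dt u p + speed V (fst p) * dx u p)
          (- speed V x * deriv_on {0..} (speed V) x * dx u (x, t)) (x, t)"
      by (rule char) (use x0 y xd in auto)
    from char_derivative_straighten[OF x0 xd(1) y(2) this]
    have D: "((\<lambda>s. dt u (\<zeta> (y - s), t + s) + speed V (\<zeta> (y - s)) * dx u (\<zeta> (y - s), t + s)) has_real_derivative
        - speed V x * deriv_on {0..} (speed V) x * dx u (x, t)) (at 0)" by (simp add: \<kappa>x)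
    have eqD: "- speed V x * deriv_on {0..} (speed V) x * dx u (x, t) = - (m * speed V x) * (r y t + v0 y)"
      using halfline_deriv_on(1)[OF _ m] x0 y by (simp add: r_def x_def)
    obtain e where e: "e > 0" "\<And>z. \<bar>z - y\<bar> < e \<Longrightarrow> \<zeta> z \<notin> Dd" using off_jumps_near[of y] xd by (auto simp: x_def)
    have "((\<lambda>s. p (y - s) (t + s) + c (y - s) * (r (y - s) (t + s) + v0 (y - s))) has_real_derivative - (m * speed V x) * (r y t + v0 y)) (at 0)"
    proof (rule has_field_derivative_transform_within_open[OF D[unfolded eqD], of "{- min e t<..<min e t}"])
      fix s assume s: "s \<in> {- min e t<..<min e t}"
      have "c (y - s) = speed V (\<zeta> (y - s))" by (rule c_off_jumps, rule e(2)) (use s in auto)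
      moreover have "max 0 (t + s) = t + s" using s by auto
      ultimately show "dt u (\<zeta> (y - s), t + s) + speed V (\<zeta> (y - s)) * dx u (\<zeta> (y - s), t + s) =
          p (y - s) (t + s) + c (y - s) * (r (y - s) (t + s) + v0 (y - s))" by (simp add: p_def r_def)
    qed (use e y in auto)
    with cm show "\<exists>m. (c has_real_derivative m) (at y within {0..}) \<and>
      ((\<lambda>s. p (y - s) (t + s) + c (y - s) * (r (y - s) (t + s) + v0 (y - s))) has_real_derivative - m * (r y t + v0 y)) (at 0)" by blast
  qed
  have P: "((\<lambda>y. integral {0..t} (p y)) has_real_derivative c y * r y t) (at y)" if y: "y > 0" "y \<notin> A" and t: "t \<ge> 0" for y t
  proof -
    have xd: "\<zeta> y \<notin> Dd" using A_iff[of y] y by auto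
    have at: "at y within {0..} = at y" by (rule at_pos[OF y(1)])
    have I: "integral {0..t} (p z) = u (\<zeta> z, t) - u (\<zeta> z, 0)" for z
    proof -
      have "((\<lambda>s. dt u (\<zeta> z, s)) has_integral u (\<zeta> z, t) - u (\<zeta> z, 0)) {0..t}"
      proof (rule fundamental_theorem_of_calculus[OF t])
        fix s assume "s \<in> {0..t}"
        then have "((\<lambda>t. u (\<zeta> z, t)) has_real_derivative dt u (\<zeta> z, s)) (at s within {0..t})"
          by (intro DERIV_subset[OF C1_quadrant_dx(2)[OF C1 \<zeta>_nonneg]]) auto
        then show "((\<lambda>t. u (\<zeta> z, t)) has_vector_derivative dt u (\<zeta> z, s)) (at s within {0..t})"
          by (simp add: has_real_derivative_iff_has_vector_derivative)
      qed
      then have "(p z has_integral u (\<zeta> z, t) - u (\<zeta> z, 0)) {0..t}"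
        by (rule has_integral_eq[rotated]) (simp add: p_def)
      then show ?thesis by (rule integral_unique)
    qed
    have ch: "((\<lambda>z. u (\<zeta> z, \<tau>)) has_real_derivative dx u (\<zeta> y, \<tau>) * speed V (\<zeta> y)) (at y)" if "\<tau> \<ge> 0" for \<tau>
    proof -
      have "(((\<lambda>x. u (x, \<tau>)) \<circ> \<zeta>) has_real_derivative dx u (\<zeta> y, \<tau>) * speed V (\<zeta> y)) (at y within {0..})"
        by (rule DERIV_image_chain[OF DERIV_subset[OF C1_quadrant_dx(1)[OF C1 \<zeta>_nonneg that]] \<zeta>_deriv])
           (use y xd \<zeta>_nonneg in auto)
      then show ?thesis unfolding at by (simp add: comp_def)
    qed
    have "((\<lambda>z. u (\<zeta> z, t) - u (\<zeta> z, 0)) has_real_derivative dx u (\<zeta> y, t) * speed V (\<zeta> y) - dx u (\<zeta> y, 0) * speed V (\<zeta> y)) (at y)"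
      by (intro DERIV_diff ch t order_refl)
    moreover have "dx u (\<zeta> y, t) * speed V (\<zeta> y) - dx u (\<zeta> y, 0) * speed V (\<zeta> y) = c y * r y t"
      using c_off_jumps[OF xd] dx0[OF \<zeta>_nonneg] t by (simp add: r_def v0_def algebra_simps)
    ultimately show ?thesis by (simp add: I)
  qed
  have eq: "(c y + cl y) * r y t = (Hf v0 v1 y t - 2 * (p 0 (max 0 (t - y)) - v1 0)) - K1 r y t + K2 r y t - K1 r 0 (t - y)" if "y \<ge> 0" for y t
    by (rule equation_from_left_invariant[OF r v pj p0 w P that])
  have bd: "f (p 0 t) = f (v1 0) + v0 0 * t + tint r 0 t" if t: "t \<ge> 0" for t
  proof -
    have "((\<lambda>s. dx u (0, s)) has_integral f (dt u (0, t)) - f (dt u (0, 0))) {0..t}"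
    proof (rule fundamental_theorem_of_calculus[OF t])
      fix s assume "s \<in> {0..t}"
      then have "((\<lambda>s. f (dt u (0, s))) has_real_derivative dx u (0, s)) (at s within {0..t})"
        by (intro DERIV_subset[OF bdry]) auto
      then show "((\<lambda>s. f (dt u (0, s))) has_vector_derivative dx u (0, s)) (at s within {0..t})"
        by (simp add: has_real_derivative_iff_has_vector_derivative)
    qed
    then have 1: "((\<lambda>s. r 0 s + v0 0) has_integral f (dt u (0, t)) - f (dt u (0, 0))) {0..t}"
      by (rule has_integral_eq[rotated]) (simp add: r_def \<zeta>_0)
    have "((\<lambda>s. (r 0 s + v0 0) - v0 0) has_integral (f (dt u (0, t)) - f (dt u (0, 0))) - v0 0 * t) {0..t}"
      by (rule has_integral_diff[OF 1]) (use has_integral_const_real[of "v0 0" 0 t] t in \<open>simp add: mult.commute\<close>)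
    then have "integral {0..t} (r 0) = (f (dt u (0, t)) - f (dt u (0, 0))) - v0 0 * t" by (simp add: integral_unique)
    then show ?thesis using t p0[of 0] by (simp add: tint_def p_def \<zeta>_0)
  qed
  have "mild_solution f v0 v1 r p" unfolding mild_solution_def using r w eq bd by blast
  then show ?thesis unfolding v0_def v1_def r_def p_def .
qed

end

section \<open>From mild to classical solutions\<close>

lemma integral_deriv_halfline:
  fixes g :: "real \<Rightarrow> real"
  assumes g: "continuous_on {0..} g" and t: "t \<ge> 0"
  shows "((\<lambda>t. integral {0..t} g) has_real_derivative g t) (at t within {0..})"
proof -
  have "((\<lambda>t. integral {0..t} g) has_real_derivative g t) (at t within {0..t+1})"
    by (rule integral_has_real_derivative[OF continuous_on_subset[OF g]]) (use t in auto)
  moreover have "at t within {0..t+1} = at t within {0..}"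
    by (rule at_within_nhd[of _ "{t-1<..<t+1}"]) auto
  ultimately show ?thesis by simp
qed

text \<open>With a fixed interval of integration, joint continuity in the upper limit and a
  parameter is a statement about parameter integrals.\<close>

lemma integral_rescale:
  fixes g :: "real \<Rightarrow> real"
  assumes g: "continuous_on {0..} g" and t: "t \<ge> 0"
  shows "integral {0..t} g = t * integral {0..1} (\<lambda>s. g (t * s))"
proof -
  have "((\<lambda>s. t * g (t * s)) has_integral integral {0..t * 1} g - integral {0..t * 0} g) {0..1}"
  proof (rule fundamental_theorem_of_calculus)
    fix s :: real assume s: "s \<in> {0..1}"
    have "(((\<lambda>t. integral {0..t} g) \<circ> (\<lambda>s. t * s)) has_real_derivative g (t * s) * t) (at s within {0..1})"
      by (rule DERIV_image_chain[OF DERIV_subset[OF integral_deriv_halfline[OF g]]])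
         (use s t in \<open>auto intro!: derivative_eq_intros\<close>)
    then show "((\<lambda>s. integral {0..t * s} g) has_vector_derivative t * g (t * s)) (at s within {0..1})"
      by (simp add: has_real_derivative_iff_has_vector_derivative comp_def mult.commute)
  qed simp
  from integral_unique[OF this] show ?thesis by simp
qed

context wave
begin

text \<open>\<open>u\<close> arises by integrating \<open>p\<close> in time, so its time derivative
  is immediate. Its space derivative is found off the jumps from the compatibility of
  \<open>p\<close> and \<open>r\<close>, and at the jumps because the expression obtained is
  continuous. Condition (i) is read off the left invariant, which along a characteristic is a
  constant plus two Stieltjes integrals.\<close>

theorem mild_imp_solution:
  assumes u0: "C_k 1 {0..} u0" and u1: "continuous_on {0..} u1"
    and m: "mild_solution f (\<lambda>y. deriv_on {0..} u0 (\<zeta> y)) (\<lambda>y. u1 (\<zeta> y)) r p"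
  shows "global_C1_solution V f u0 u1 (\<lambda>z. u0 (fst z) + integral {0..snd z} (p (\<kappa> (fst z))))"
proof -
  define v0 where "v0 y = deriv_on {0..} u0 (\<zeta> y)" for y
  define v1 where "v1 y = u1 (\<zeta> y)" for y
  define u where "u z = u0 (fst z) + integral {0..snd z} (p (\<kappa> (fst z)))" for z :: "real \<times> real"
  have m: "mild_solution f v0 v1 r p" using m unfolding v0_def v1_def .
  have v: "continuous_on UNIV v0" "continuous_on UNIV v1"
    unfolding v0_def v1_def using \<zeta>_nonneg
    by (auto intro!: continuous_on_compose2[OF C1_data(1)[OF u0] \<zeta>_cont] continuous_on_compose2[OF u1 \<zeta>_cont])
  note r = mildD(1,2)[OF m]
  have pj: "jointly_cont (\<lambda>y t. p y (max 0 t))" by (rule mild_p_cont[OF v r mildD(3)[OF m]])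
  have pc: "continuous_on {0..} (p y)" if "y \<ge> 0" for y
  proof -
    have "continuous_on {0..} (\<lambda>t. p y (max 0 t))"
      by (rule jointly_cont_compose[OF pj, of _ "\<lambda>_. y" "\<lambda>t. t"]) (auto intro!: continuous_intros that)
    then show ?thesis by (rule continuous_on_eq) auto
  qed
  have u_t: "((\<lambda>t. u (x, t)) has_real_derivative p (\<kappa> x) t) (at t within {0..})" if "x \<ge> 0" "t \<ge> 0" for x t
    using DERIV_add[OF DERIV_const[of "u0 x"] integral_deriv_halfline[OF pc[OF \<kappa>_nonneg[OF that(1)]] that(2)]] by (simp add: u_def)
  have I_cont: "continuous_on quadrant (\<lambda>z. integral {0..snd z} (p (\<kappa> (fst z))))"
  proof -
    have "continuous_on quadrant (\<lambda>z. snd z * integral (cbox 0 1) (\<lambda>s. p (\<kappa> (fst z)) (max 0 (snd z * s))))"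
    proof (intro continuous_intros integral_continuous_on_param)
      show "continuous_on (quadrant \<times> cbox 0 1) (\<lambda>(z, s). p (\<kappa> (fst z)) (max 0 (snd z * s)))"
        unfolding case_prod_beta
        by (rule jointly_cont_compose[OF pj]) (auto intro!: continuous_intros continuous_on_compose2[OF \<kappa>_cont] \<kappa>_nonneg)
    qed
    then show ?thesis
    proof (rule continuous_on_eq)
      fix z :: "real \<times> real" assume z: "z \<in> quadrant"
      have "integral {0..1} (\<lambda>s. p (\<kappa> (fst z)) (max 0 (snd z * s))) = integral {0..1} (\<lambda>s. p (\<kappa> (fst z)) (snd z * s))"
        by (rule integral_cong) (use z in auto)
      then show "snd z * integral (cbox 0 1) (\<lambda>s. p (\<kappa> (fst z)) (max 0 (snd z * s))) = integral {0..snd z} (p (\<kappa> (fst z)))"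
        using integral_rescale[OF pc[OF \<kappa>_nonneg], of "fst z" "snd z"] z by auto
    qed
  qed
  have u0c: "continuous_on {0..} u0"
    using C1_data(2)[OF u0] by (auto simp: continuous_on_eq_continuous_within intro: DERIV_continuous)
  have u_cont: "continuous_on quadrant u" unfolding u_def
    by (intro continuous_intros I_cont continuous_on_compose2[OF u0c]) auto
  have rc: "continuous_on S (\<lambda>z. deriv_on {0..} u0 (fst z) + r (\<kappa> (fst z)) (snd z))" if "S \<subseteq> quadrant" for S
    using that by (intro continuous_intros continuous_on_compose2[OF C1_data(1)[OF u0]] jointly_cont_compose[OF r(2)] continuous_on_compose2[OF \<kappa>_cont]) (auto intro!: \<kappa>_nonneg dest!: subsetD)
  have u_x: "((\<lambda>x. u (x, t)) has_real_derivative deriv_on {0..} u0 x + r (\<kappa> x) t) (at x within {0..})" if x: "x \<ge> 0" and t: "t \<ge> 0" for x t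
  proof (rule derivative_off_countable[OF _ _ _ _ x])
    show "countable Dd" using E countable_subset by blast
    have line: "continuous_on {0..} (\<lambda>x. (x, t))" by (intro continuous_intros)
    show "continuous_on {0..} (\<lambda>x. u (x, t))"
      by (rule continuous_on_compose2[OF u_cont line]) (use t in auto)
    show "continuous_on {0..} (\<lambda>x. deriv_on {0..} u0 x + r (\<kappa> x) t)"
      using continuous_on_compose2[OF rc[OF order_refl] line] t by auto
    fix x assume x: "x > 0" "x \<notin> Dd"
    have y: "\<kappa> x > 0" using \<kappa>_less[of 0 x] \<kappa>_0 x by simp
    have yA: "\<kappa> x \<notin> A" using A_iff[of "\<kappa> x"] y \<zeta>_\<kappa>[of x] x by simp
    have "((\<lambda>y. integral {0..t} (p y)) has_real_derivative c (\<kappa> x) * r (\<kappa> x) t) (at (\<kappa> x))"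
      by (rule mild_P_deriv[OF m v y yA t])
    moreover have "(\<kappa> has_real_derivative 1 / speed V x) (at x)" using \<kappa>_deriv[of x] at_pos[of x] x by simp
    ultimately have "((\<lambda>x. integral {0..t} (p (\<kappa> x))) has_real_derivative c (\<kappa> x) * r (\<kappa> x) t * (1 / speed V x)) (at x)"
      by (rule DERIV_chain2)
    moreover have "c (\<kappa> x) = speed V x" "speed V x > 0"
      using c_off_jumps[of "\<kappa> x"] \<zeta>_\<kappa>[of x] x s_bound[of x] cm by auto
    moreover have "(u0 has_real_derivative deriv_on {0..} u0 x) (at x)" using C1_data(2)[OF u0, of x] at_pos[of x] x by simp
    ultimately have "((\<lambda>x. u0 x + integral {0..t} (p (\<kappa> x))) has_real_derivative deriv_on {0..} u0 x + r (\<kappa> x) t) (at x)"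
      by (intro DERIV_add) auto
    then show "((\<lambda>x. u (x, t)) has_real_derivative deriv_on {0..} u0 x + r (\<kappa> x) t) (at x)" by (simp add: u_def)
  qed
  have dtu: "dt u (x, t) = p (\<kappa> x) t" if "x \<ge> 0" "t \<ge> 0" for x t
    unfolding dt_def using halfline_deriv_on(1)[OF that(2) u_t[OF that]] by simp
  have dxu: "dx u (x, t) = deriv_on {0..} u0 x + r (\<kappa> x) t" if "x \<ge> 0" "t \<ge> 0" for x t
    unfolding dx_def using halfline_deriv_on(1)[OF that(1) u_x[OF that]] by simp
  have C1: "C1_quadrant u" unfolding C1_quadrant_def
  proof (intro conjI allI impI)
    show "(\<lambda>y. u (y, t)) differentiable (at x within {0..})" "(\<lambda>s. u (x, s)) differentiable (at t within {0..})"
      if "x \<ge> 0" "t \<ge> 0" for x t using u_x[OF that] u_t[OF that] real_differentiable_def by blast+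
    show "continuous_on quadrant u" by (rule u_cont)
    show "continuous_on quadrant (dx u)" by (rule continuous_on_eq[OF rc[OF order_refl]]) (use dxu in auto)
    have "continuous_on quadrant (\<lambda>z. p (\<kappa> (fst z)) (max 0 (snd z)))"
      by (rule jointly_cont_compose[OF pj]) (auto intro!: continuous_intros continuous_on_compose2[OF \<kappa>_cont] \<kappa>_nonneg)
    then show "continuous_on quadrant (dt u)" by (rule continuous_on_eq) (use dtu in auto)
  qed
  have char: "has_char_derivative (speed V) (\<lambda>p. dt u p + speed V (fst p) * dx u p)
        (- speed V x * deriv_on {0..} (speed V) x * dx u (x, t)) (x, t)"
    if x: "x \<ge> 0" and t: "t \<ge> 0" and xd: "x \<notin> Dd" "x \<notin> disc_deriv {0..} (speed V)" for x t
  proof -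
    define y where "y = \<kappa> x"
    have y: "y \<ge> 0" "\<zeta> y = x" using \<kappa>_nonneg[OF x] \<zeta>_\<kappa>[OF x] by (simp_all add: y_def)
    have yA: "y \<notin> A" using A_iff[OF y(1)] y(2) xd by simp
    define m' where "m' = deriv_on {0..} (speed V) x * speed V x"
    have "(speed V has_real_derivative deriv_on {0..} (speed V) x) (at x within {0..})"
      using xd(2) x by (intro halfline_deriv_on(2)) (auto simp: disc_deriv_def)
    then have cm': "(c has_real_derivative m') (at y within {0..})"
      using c_deriv[OF y(1)] y(2) xd(1) by (simp add: m'_def)
    obtain e where e: "e > 0" "\<And>z. \<bar>z - y\<bar> < e \<Longrightarrow> \<zeta> z \<notin> Dd" using off_jumps_near[of y] y xd by auto
    \<comment> \<open>For \<open>x > 0\<close> the curve must not leave the domain, hence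
      \<open>\<epsilon> \<le> y\<close>. At \<open>x = 0\<close> only parameters
      \<open>s \<le> 0\<close> occur, and for these \<open>y - s\<close> is nonnegative
      anyway.\<close>
    define \<epsilon> where "\<epsilon> = (if x = 0 then e else min e y)"
    have y0: "x \<noteq> 0 \<Longrightarrow> y > 0" using \<kappa>_less[of 0 x] \<kappa>_0 x by (simp add: y_def)
    have \<epsilon>: "\<epsilon> > 0" "\<epsilon> \<le> e" "x \<noteq> 0 \<Longrightarrow> \<epsilon> \<le> y" using e(1) y0 by (auto simp: \<epsilon>_def)
    define S where "S = {s. \<bar>s\<bar> < \<epsilon> \<and> 0 \<le> t + s \<and> (x = 0 \<longrightarrow> s \<le> 0)}"
    have S: "y - s \<ge> 0" "\<zeta> (y - s) \<notin> Dd" "t + s \<ge> 0" if "s \<in> S" for s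
    proof -
      have s: "\<bar>s\<bar> < \<epsilon>" "0 \<le> t + s" "x = 0 \<Longrightarrow> s \<le> 0" using that by (auto simp: S_def)
      show "y - s \<ge> 0" using s(1,3) \<epsilon>(3) y(1) by (cases "x = 0") auto
      show "\<zeta> (y - s) \<notin> Dd" by (rule e(2)) (use s \<epsilon> in auto)
      show "t + s \<ge> 0" by fact
    qed
    have sub: "(\<lambda>s. y - s) ` S \<subseteq> {0..}" using S(1) by auto
    have lin: "((\<lambda>s. y - s) has_real_derivative -1) (at s within S)" for s by (auto intro!: derivative_eq_intros)
    \<comment> \<open>The values of \<open>r\<close> on the characteristic through
      \<open>(y, t)\<close>, continued constantly to negative positions.\<close>
    define F where "F z = r (max 0 z) (y + t - max 0 z)" for z
    note KF = K1_characteristic[OF r, of _ "y + t", folded F_def[abs_def]]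
    have "((\<lambda>z. Fp v0 v1 (y + t) - K1 r 0 (y + t) + (intJ F z + intJ v0 z)) has_real_derivative 0 - 0 + (m' * F y + m' * v0 y)) (at y within {0..})"
      by (intro DERIV_add DERIV_diff DERIV_const intJ_deriv KF(2)[OF y(1)] v y yA cm')
    then have "((\<lambda>z. Fp v0 v1 (y + t) - K1 r 0 (y + t) + (intJ F z + intJ v0 z)) has_real_derivative 0 - 0 + (m' * F y + m' * v0 y)) (at (y - 0) within (\<lambda>s. y - s) ` S)"
      using DERIV_subset[OF _ sub] by simp
    from DERIV_image_chain[OF this lin]
    have D: "((\<lambda>s. Fp v0 v1 (y + t) - K1 r 0 (y + t) + (intJ F (y - s) + intJ v0 (y - s))) has_real_derivative - (m' * (F y + v0 y))) (at 0 within S)"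
      by (simp add: comp_def algebra_simps)
    have "m' * (F y + v0 y) = speed V x * deriv_on {0..} (speed V) x * dx u (x, t)"
      using dxu[OF x t] y(1) y(2) by (simp add: m'_def F_def v0_def flip: y_def)
    with D have D: "((\<lambda>s. Fp v0 v1 (y + t) - K1 r 0 (y + t) + (intJ F (y - s) + intJ v0 (y - s))) has_real_derivative
        - speed V x * deriv_on {0..} (speed V) x * dx u (x, t)) (at 0 within S)" by simp
    have 0: "0 \<in> S" using \<epsilon> t by (simp add: S_def)
    have W: "((\<lambda>s. dt u (\<zeta> (y - s), t + s) + speed V (\<zeta> (y - s)) * dx u (\<zeta> (y - s), t + s)) has_real_derivative
        - speed V x * deriv_on {0..} (speed V) x * dx u (x, t)) (at 0 within S)"
    proof (rule has_field_derivative_transform_within[OF D zero_less_one 0])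
      fix s assume s: "s \<in> S"
      define z where "z = y - s"
      have z: "z \<ge> 0" "\<zeta> z \<notin> Dd" "t + s \<ge> 0" "t + s = y + t - z" using S[OF s] by (simp_all add: z_def)
      have "dt u (\<zeta> z, t + s) = p z (t + s)" "dx u (\<zeta> z, t + s) = v0 z + r z (t + s)"
        using dtu[OF \<zeta>_nonneg z(3)] dxu[OF \<zeta>_nonneg z(3)] \<kappa>_\<zeta>[OF z(1)] by (simp_all add: v0_def)
      moreover have "p z (t + s) + c z * r z (t + s) + \<beta> v0 z = Fp v0 v1 (y + t) - K1 r z (t + s)"
        using mildD(3)[OF m z(1,3)] by (simp add: z_def)
      moreover have "K1 r z (t + s) = K1 r 0 (y + t) - intJ F z" unfolding z(4) by (rule KF(1)[OF z(1)])
      ultimately have "Fp v0 v1 (y + t) - K1 r 0 (y + t) + (intJ F z + intJ v0 z) =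
          dt u (\<zeta> z, t + s) + speed V (\<zeta> z) * dx u (\<zeta> z, t + s)"
        using c_off_jumps[OF z(2)] by (simp add: \<beta>_def algebra_simps)
      then show "Fp v0 v1 (y + t) - K1 r 0 (y + t) + (intJ F (y - s) + intJ v0 (y - s)) =
          dt u (\<zeta> (y - s), t + s) + speed V (\<zeta> (y - s)) * dx u (\<zeta> (y - s), t + s)" by (simp add: z_def)
    qed
    have X: "((\<lambda>s. \<zeta> (y - s)) has_real_derivative - speed V (\<zeta> (y - s))) (at s within S)" if s: "s \<in> S" for s
    proof -
      have "((\<zeta> \<circ> (\<lambda>s. y - s)) has_real_derivative speed V (\<zeta> (y - s)) * -1) (at s within S)"
        by (rule DERIV_image_chain[OF DERIV_subset[OF \<zeta>_deriv[OF S(1,2)[OF s]] sub] lin])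
      then show ?thesis by (simp add: comp_def)
    qed
    \<comment> \<open>The characteristic is the straight line \<open>y - s\<close> of the travel
      time coordinate, mapped back by \<zeta>.\<close>
    show ?thesis unfolding has_char_derivative_def prod.case Let_def
      by (intro exI[of _ "\<lambda>s. \<zeta> (y - s)"] exI[of _ \<epsilon>], fold S_def)
         (use \<epsilon>(1) y(2) X W \<zeta>_nonneg in auto)
  qed
  have bdry: "((\<lambda>s. f (dt u (0, s))) has_real_derivative dx u (0, t)) (at t within {0..})" if t: "t \<ge> 0" for t
  proof -
    have "((\<lambda>t. f (v1 0) + v0 0 * t + tint r 0 t) has_real_derivative 0 + v0 0 * 1 + r 0 t) (at t within {0..})"
      by (intro DERIV_add DERIV_const DERIV_cmult DERIV_ident has_field_derivative_at_within[OF tint_deriv[OF r(1) order_refl]])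
    then have "((\<lambda>t. f (v1 0) + v0 0 * t + tint r 0 t) has_real_derivative dx u (0, t)) (at t within {0..})"
      using dxu[OF order_refl t] by (simp add: \<kappa>_0 v0_def \<zeta>_0)
    then show ?thesis
      by (rule has_field_derivative_transform_within[OF _ zero_less_one])
         (use t dtu[OF order_refl] mildD(5)[OF m] in \<open>auto simp: \<kappa>_0\<close>)
  qed
  have ini: "u (x, 0) = u0 x" "dt u (x, 0) = u1 x" if "x \<ge> 0" for x
    using dtu[OF that order_refl] mild_initial(1)[OF m \<kappa>_nonneg[OF that]] \<zeta>_\<kappa>[OF that] by (simp_all add: u_def v1_def)
  have "global_C1_solution V f u0 u1 u" unfolding global_C1_solution_def
    using C1 char bdry ini by auto
  then show ?thesis unfolding u_def .
qed

end

section \<open>Existence, convergence and uniqueness\<close>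

lemma increasing_homeomorphism_inverse:
  assumes "increasing_homeomorphism f"
  shows "\<exists>g. mono g \<and> continuous_on UNIV g \<and> continuous_on UNIV f \<and> (\<forall>x. g (f x) = x) \<and> (\<forall>x. f (g x) = x)"
proof -
  obtain g where f: "strict_mono f" and g: "homeomorphism UNIV UNIV f g"
    using assms unfolding increasing_homeomorphism_def by blast
  have fg: "f (g x) = x" and gf: "g (f x) = x" for x using g by (auto simp: homeomorphism_def)
  have "mono g"
  proof (rule monoI)
    fix x y :: real assume "x \<le> y"
    then have "f (g x) \<le> f (g y)" by (simp add: fg)
    then show "g x \<le> g y" using strict_mono_less_eq[OF f] by blast
  qed
  then show ?thesis using g fg gf by (auto simp: homeomorphism_def)
qed

context wave
begin

lemma solution_exists:
  assumes u0: "C_k 1 {0..} u0" and u1: "continuous_on {0..} u1" and f: "increasing_homeomorphism f"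
  shows "\<exists>u. global_C1_solution V f u0 u1 u"
proof -
  obtain g where g: "mono g" "continuous_on UNIV g" "\<And>x. f (g x) = x" "\<And>x. g (f x) = x"
    using increasing_homeomorphism_inverse[OF f] by blast
  have v: "continuous_on UNIV (\<lambda>y. deriv_on {0..} u0 (\<zeta> y))" "continuous_on UNIV (\<lambda>y. u1 (\<zeta> y))"
    using \<zeta>_nonneg by (auto intro!: continuous_on_compose2[OF C1_data(1)[OF u0] \<zeta>_cont] continuous_on_compose2[OF u1 \<zeta>_cont])
  obtain r p where "mild_solution f (\<lambda>y. deriv_on {0..} u0 (\<zeta> y)) (\<lambda>y. u1 (\<zeta> y)) r p"
    using mild_exists[OF g v] by blast
  from mild_imp_solution[OF u0 u1 this] show ?thesis by blast
qed

text \<open>Stability of mild solutions is uniform on triangles, and the triangle of size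
  \<open>\<kappa> X + T\<close> contains the rectangle over \<open>{0..X}\<close>.
  \<open>u\<^sub>x\<close> differs from \<open>r\<close> by \<open>u\<^sub>0'\<close>, whose
  convergence is assumed; \<open>u\<close> itself is controlled by its initial values and a mean
  value estimate with \<open>u\<^sub>t\<close>.\<close>

theorem solutions_converge:
  assumes f: "increasing_homeomorphism f"
    and u0: "C_k 1 {0..} u0" and u1: "continuous_on {0..} u1"
    and u0n: "\<And>n. C_k 1 {0..} (u0n n)" and u1n: "\<And>n. continuous_on {0..} (u1n n)"
    and c0: "loc_uniform_limit {0..} u0n u0"
    and c0': "loc_uniform_limit {0..} (\<lambda>n. deriv_on {0..} (u0n n)) (deriv_on {0..} u0)"
    and c1: "loc_uniform_limit {0..} u1n u1"
    and un: "\<And>n. global_C1_solution V f (u0n n) (u1n n) (un n)" and u: "global_C1_solution V f u0 u1 u"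
    and T: "T > 0"
  shows "loc_uniform_limit ({0..} \<times> {0..T}) un u"
    and "loc_uniform_limit ({0..} \<times> {0..T}) (\<lambda>n. dt (un n)) (dt u)"
    and "loc_uniform_limit ({0..} \<times> {0..T}) (\<lambda>n. dx (un n)) (dx u)"
proof -
  obtain g where g: "mono g" "continuous_on UNIV g" "\<And>x. g (f x) = x" and fc: "continuous_on UNIV f"
    using increasing_homeomorphism_inverse[OF f] by blast
  have C1: "C1_quadrant u" "\<And>n. C1_quadrant (un n)" using u un by (auto simp: global_C1_solution_def)
  have ini: "u (x, 0) = u0 x" "un n (x, 0) = u0n n x" if "x \<ge> 0" for x n
    using u un that by (auto simp: global_C1_solution_def)
  have lim: "eventually (\<lambda>n. \<forall>x\<in>{0..X}. dist (Fn n x) (F x) < e) sequentially"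
    if "loc_uniform_limit {0..} Fn F" "e > 0" for Fn F and X e :: real
  proof -
    have "compact {0..X} \<and> {0..X} \<subseteq> {0..}" by auto
    then have "uniform_limit {0..X} Fn F sequentially" using that(1) unfolding loc_uniform_limit_def by blast
    then show ?thesis using that(2) by (rule uniform_limitD)
  qed
  have main: "eventually (\<lambda>n. \<forall>x\<in>{0..X}. \<forall>t\<in>{0..T}. \<bar>un n (x, t) - u (x, t)\<bar> < e \<and>
      \<bar>dt (un n) (x, t) - dt u (x, t)\<bar> < e \<and> \<bar>dx (un n) (x, t) - dx u (x, t)\<bar> < e) sequentially"
    if X: "X \<ge> 0" and e: "e > 0" for X e
  proof -
    define R where "R = \<kappa> X + T"
    \<comment> \<open>Leaves room for two errors of size \<eta> in \<open>u\<^sub>x\<close>, and in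
      \<open>u\<close> for one at time 0 and one of size \<open>\<eta> * T\<close> from the
      integration of \<open>u\<^sub>t\<close>.\<close>
    define \<eta> where "\<eta> = e / (3 * (1 + T))"
    have R: "R \<ge> 0" and \<eta>: "\<eta> > 0" using \<kappa>_nonneg[OF X] T e by (simp_all add: R_def \<eta>_def)
    have "\<eta> * (3 * (1 + T)) = e" unfolding \<eta>_def by (rule nonzero_eq_divide_eq[THEN iffD1, OF _ refl]) (use T in simp)
    then have "3 * \<eta> + 3 * (\<eta> * T) = e" by (simp add: algebra_simps)
    then have \<eta>e: "2 * \<eta> < e" "\<eta> + \<eta> * T < e" using \<eta> T mult_pos_pos[OF \<eta> T] by linarith+
    have "\<forall>\<^sub>F n in sequentially. \<forall>y t. 0 \<le> y \<longrightarrow> 0 \<le> t \<longrightarrow> y + t \<le> R \<longrightarrow>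
        \<bar>(dx u (\<zeta> y, max 0 t) - deriv_on {0..} u0 (\<zeta> y)) - (dx (un n) (\<zeta> y, max 0 t) - deriv_on {0..} (u0n n) (\<zeta> y))\<bar> \<le> \<eta> \<and>
        \<bar>dt u (\<zeta> y, max 0 t) - dt (un n) (\<zeta> y, max 0 t)\<bar> \<le> \<eta>"
    proof (rule mild_stability[OF g fc R solution_imp_mild[OF u u0 u1] solution_imp_mild[OF un u0n u1n] _ _ _ _ _ \<eta>])
      show "continuous_on UNIV (\<lambda>y. deriv_on {0..} u0 (\<zeta> y))" "continuous_on UNIV (\<lambda>y. u1 (\<zeta> y))"
        "continuous_on UNIV (\<lambda>y. deriv_on {0..} (u0n n) (\<zeta> y))" "continuous_on UNIV (\<lambda>y. u1n n (\<zeta> y))" for n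
        using \<zeta>_nonneg by (auto intro!: continuous_on_compose2[OF C1_data(1)[OF u0] \<zeta>_cont] continuous_on_compose2[OF u1 \<zeta>_cont]
          continuous_on_compose2[OF C1_data(1)[OF u0n] \<zeta>_cont] continuous_on_compose2[OF u1n \<zeta>_cont])
      fix d :: real assume d: "d > 0"
      show "\<forall>\<^sub>F n in sequentially. \<forall>z. 0 \<le> z \<longrightarrow> z \<le> R \<longrightarrow> \<bar>deriv_on {0..} u0 (\<zeta> z) - deriv_on {0..} (u0n n) (\<zeta> z)\<bar> \<le> d \<and>
          \<bar>u1 (\<zeta> z) - u1n n (\<zeta> z)\<bar> \<le> d"
        using lim[OF c0' d, of "\<zeta> R"] lim[OF c1 d, of "\<zeta> R"]
      proof eventually_elim
        case (elim n)
        have "\<zeta> z \<in> {0..\<zeta> R}" if "0 \<le> z" "z \<le> R" for z using \<zeta>_lip(1)[OF that] \<zeta>_nonneg by simp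
        then show ?case using elim by (auto simp: dist_real_def abs_minus_commute intro: less_imp_le)
      qed
    qed
    then show ?thesis using lim[OF c0 \<eta>, of X] lim[OF c0' \<eta>, of X]
    proof eventually_elim
      case (elim n)
      have r: "\<bar>(dx u (x, t) - deriv_on {0..} u0 x) - (dx (un n) (x, t) - deriv_on {0..} (u0n n) x)\<bar> \<le> \<eta>"
        and p: "\<bar>dt u (x, t) - dt (un n) (x, t)\<bar> \<le> \<eta>" if xt: "x \<in> {0..X}" "t \<in> {0..T}" for x t
      proof -
        have "\<kappa> x \<le> \<kappa> X" using \<kappa>_less[of x X] xt by (cases "x = X") auto
        then have "0 \<le> \<kappa> x" "0 \<le> t" "\<kappa> x + t \<le> R" using \<kappa>_nonneg[of x] xt by (auto simp: R_def)
        then show "\<bar>(dx u (x, t) - deriv_on {0..} u0 x) - (dx (un n) (x, t) - deriv_on {0..} (u0n n) x)\<bar> \<le> \<eta>"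
          "\<bar>dt u (x, t) - dt (un n) (x, t)\<bar> \<le> \<eta>"
          using elim(1)[rule_format, of "\<kappa> x" t] \<zeta>_\<kappa>[of x] xt by auto
      qed
      show ?case
      proof (intro ballI conjI)
        fix x t assume xt: "x \<in> {0..X}" "t \<in> {0..T}"
        have dx0: "\<bar>deriv_on {0..} (u0n n) x - deriv_on {0..} u0 x\<bar> < \<eta>" "\<bar>u0n n x - u0 x\<bar> < \<eta>"
          using elim(2,3) xt by (auto simp: dist_real_def)
        show "\<bar>dx (un n) (x, t) - dx u (x, t)\<bar> < e" using r[OF xt] dx0(1) \<eta>e(1) by linarith
        show "\<bar>dt (un n) (x, t) - dt u (x, t)\<bar> < e" using p[OF xt] \<eta>e(1) \<eta> by linarith
        have "norm ((un n (x, t) - u (x, t)) - (un n (x, 0) - u (x, 0))) \<le> \<eta> * norm (t - 0)"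
        proof (rule field_differentiable_bound[of "{0..t}" _ "\<lambda>s. dt (un n) (x, s) - dt u (x, s)"])
          fix s assume s: "s \<in> {0..t}"
          show "((\<lambda>t. un n (x, t) - u (x, t)) has_real_derivative dt (un n) (x, s) - dt u (x, s)) (at s within {0..t})"
            by (intro DERIV_diff DERIV_subset[OF C1_quadrant_dx(2)[OF C1(1)]] DERIV_subset[OF C1_quadrant_dx(2)[OF C1(2)]])
               (use s xt in auto)
          show "norm (dt (un n) (x, s) - dt u (x, s)) \<le> \<eta>" using p[of x s] s xt by (auto simp: abs_minus_commute)
        qed (use xt in auto)
        moreover have "\<eta> * norm (t - 0) \<le> \<eta> * T" using xt \<eta> by (intro mult_left_mono) auto
        ultimately show "\<bar>un n (x, t) - u (x, t)\<bar> < e"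
          using ini(1)[of x] ini(2)[of x n] xt dx0(2) \<eta>e(2) by auto
      qed
    qed
  qed
  have box: "\<exists>X\<ge>0. K \<subseteq> {0..X} \<times> {0..T}" if K: "compact K \<and> K \<subseteq> {0..} \<times> {0..T}" for K :: "(real \<times> real) set"
  proof -
    have "bounded (fst ` K)" using K by (intro compact_imp_bounded compact_continuous_image continuous_intros) auto
    then obtain X where "\<forall>x\<in>fst ` K. norm x \<le> X" unfolding bounded_iff by blast
    then have "K \<subseteq> {0..max 0 X} \<times> {0..T}" using K by force
    then show ?thesis by (intro exI[of _ "max 0 X"]) auto
  qed
  have conv: "loc_uniform_limit ({0..} \<times> {0..T}) Fn F"
    if "\<And>X e. X \<ge> 0 \<Longrightarrow> e > 0 \<Longrightarrow> eventually (\<lambda>n. \<forall>x\<in>{0..X}. \<forall>t\<in>{0..T}. \<bar>Fn n (x, t) - F (x, t)\<bar> < e) sequentially" for Fn and F :: "real \<times> real \<Rightarrow> real"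
    unfolding loc_uniform_limit_def
  proof (intro allI impI uniform_limitI)
    fix K :: "(real \<times> real) set" and e :: real assume K: "compact K \<and> K \<subseteq> {0..} \<times> {0..T}" and e: "e > 0"
    obtain X where X: "X \<ge> 0" "K \<subseteq> {0..X} \<times> {0..T}" using box[OF K] by blast
    show "\<forall>\<^sub>F n in sequentially. \<forall>z\<in>K. dist (Fn n z) (F z) < e"
      using that[OF X(1) e] by eventually_elim (use X(2) in \<open>auto simp: dist_real_def\<close>)
  qed
  show "loc_uniform_limit ({0..} \<times> {0..T}) un u"
    by (rule conv) (use main in \<open>force elim: eventually_mono\<close>)
  show "loc_uniform_limit ({0..} \<times> {0..T}) (\<lambda>n. dt (un n)) (dt u)"
    by (rule conv) (use main in \<open>force elim: eventually_mono\<close>)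
  show "loc_uniform_limit ({0..} \<times> {0..T}) (\<lambda>n. dx (un n)) (dx u)"
    by (rule conv) (use main in \<open>force elim: eventually_mono\<close>)
qed

lemma solution_unique:
  assumes f: "increasing_homeomorphism f" and u0: "C_k 1 {0..} u0" and u1: "continuous_on {0..} u1"
    and u: "global_C1_solution V f u0 u1 u" and v: "global_C1_solution V f u0 u1 v" and z: "z \<in> quadrant"
  shows "v z = u z"
proof -
  have const: "loc_uniform_limit S (\<lambda>n. g) g" for S and g :: "real \<Rightarrow> real"
    by (auto simp: loc_uniform_limit_def intro: uniform_limit_const)
  have "loc_uniform_limit ({0..} \<times> {0..snd z + 1}) (\<lambda>n. v) u"
    by (rule solutions_converge(1)[OF f u0 u1 u0 u1 const const const v u]) (use z in auto)
  moreover have "compact {z} \<and> {z} \<subseteq> {0..} \<times> {0..snd z + 1}" using z by (cases z) auto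
  ultimately have "uniform_limit {z} (\<lambda>n. v) u sequentially" unfolding loc_uniform_limit_def by blast
  then have "(\<lambda>n. v z) \<longlonglongrightarrow> u z" by (rule tendsto_uniform_limitI) simp
  then show ?thesis using LIMSEQ_const_iff by blast
qed

end

theorem theorem1p1:
  fixes V f u0 u1 :: "real \<Rightarrow> real"
  assumes A0: "C_k 1 {0..} u0" "continuous_on {0..} u1"
    and A12: "admissible_potential V"
    and A3: "increasing_homeomorphism f"
  shows "(\<exists>u. global_C1_solution V f u0 u1 u \<and>
            (\<forall>v. global_C1_solution V f u0 u1 v \<longrightarrow> (\<forall>p\<in>quadrant. v p = u p))) \<and>
         (\<forall>(u0n :: nat \<Rightarrow> real \<Rightarrow> real) (u1n :: nat \<Rightarrow> real \<Rightarrow> real)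
            (un :: nat \<Rightarrow> real \<times> real \<Rightarrow> real) (u :: real \<times> real \<Rightarrow> real).
            (\<forall>n. C_k 1 {0..} (u0n n) \<and> continuous_on {0..} (u1n n)) \<longrightarrow>
            loc_uniform_limit {0..} u0n u0 \<longrightarrow>
            loc_uniform_limit {0..} (\<lambda>n. deriv_on {0..} (u0n n)) (deriv_on {0..} u0) \<longrightarrow>
            loc_uniform_limit {0..} u1n u1 \<longrightarrow>
            (\<forall>n. global_C1_solution V f (u0n n) (u1n n) (un n)) \<longrightarrow>
            global_C1_solution V f u0 u1 u \<longrightarrow>
            (\<forall>T>0.
               loc_uniform_limit ({0..} \<times> {0..T}) un u \<and>
               loc_uniform_limit ({0..} \<times> {0..T}) (\<lambda>n. dt (un n)) (dt u) \<and>
               loc_uniform_limit ({0..} \<times> {0..T}) (\<lambda>n. dx (un n)) (dx u)))"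
proof -
  obtain E cm cM Ls \<delta> where P: "profile (speed V) (disc {0..} (speed V)) E cm cM Ls \<delta>"
    and E: "disc_deriv {0..} (speed V) \<subseteq> E"
    using admissible_potential_profile[OF A12] by blast
  obtain J L where M: "medium (profile.A (speed V) (disc {0..} (speed V)) cm) J (profile.c (speed V) (disc {0..} (speed V)) cm Ls) cm L"
    using profile.medium_exists[OF P] by blast
  interpret wave V E cm cM Ls \<delta> J L
    using P M E by (intro wave.intro wave_axioms.intro)
  show ?thesis
  proof (intro conjI allI impI)
    obtain u where u: "global_C1_solution V f u0 u1 u" using solution_exists[OF A0 A3] by blast
    then show "\<exists>u. global_C1_solution V f u0 u1 u \<and>
        (\<forall>v. global_C1_solution V f u0 u1 v \<longrightarrow> (\<forall>p\<in>quadrant. v p = u p))"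
      using solution_unique[OF A3 A0 u] by blast
  next
    fix u0n u1n :: "nat \<Rightarrow> real \<Rightarrow> real" and un :: "nat \<Rightarrow> real \<times> real \<Rightarrow> real" and u :: "real \<times> real \<Rightarrow> real" and T :: real
    assume data: "\<forall>n. C_k 1 {0..} (u0n n) \<and> continuous_on {0..} (u1n n)"
      and lim: "loc_uniform_limit {0..} u0n u0" "loc_uniform_limit {0..} (\<lambda>n. deriv_on {0..} (u0n n)) (deriv_on {0..} u0)"
        "loc_uniform_limit {0..} u1n u1"
      and un: "\<forall>n. global_C1_solution V f (u0n n) (u1n n) (un n)" and u: "global_C1_solution V f u0 u1 u" and T: "T > 0"
    note conv = solutions_converge[OF A3 A0 _ _ lim _ u T, of un]
    show "loc_uniform_limit ({0..} \<times> {0..T}) un u" by (rule conv(1)) (use data un in auto)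
    show "loc_uniform_limit ({0..} \<times> {0..T}) (\<lambda>n. dt (un n)) (dt u)" by (rule conv(2)) (use data un in auto)
    show "loc_uniform_limit ({0..} \<times> {0..T}) (\<lambda>n. dx (un n)) (dx u)" by (rule conv(3)) (use data un in auto)
  qed
qed

end
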